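(* Let $n\ge 1$, $0<p,q,t\le\infty$, $A>0$, $r\ge 0$, and $\sigma>n/\min(p,q,t)$. Consider sequences $\{f_k\}_{k\in\mathbb{Z}}$ with $f_k\in\mathcal{E}(A2^k)$ for every $k\in\mathbb{Z}$. (1) Suppose $0<p<\infty$, or $p=q=\infty$. Then the following are equivalent: (i) $r\ge |1/p-1/q|$; (ii) there is a constant $C$ (independent of $y$ and of the sequence) such that for all $y\in\mathbb{R}^n$ and all such sequences $$\Big\Vert \big\{\mathfrak{M}^{t}_{\sigma,2^k,y}f_k\big\}_{k\in\mathbb{Z}}\Big\Vert_{L^p(\ell^q)}\le C\,\big(\ln(e+|y|)\big)^{r}\,\big\Vert\{f_k\}_{k\in\mathbb{Z}}\big\Vert_{L^p(\ell^q)}.$$ (2) Suppose $p=\infty$ and $0<q<\infty$. Then the following are equivalent: (i) $r\ge 1/q$; (ii) there is a constant $C$ (independent of $y$ and of the sequence) such that for all $y\in\mathbb{R}^n$ and all such sequences $$\sup_{P\in\mathcal{D}}\Big(\frac{1}{|P|}\int_P\sum_{k:\,2^k\ell(P)\ge1}\big(\mathfrak{M}^t_{\sigma,2^k,y}f_k(x)\big)^q\,dx\Big)^{1/q}\le C\big(\ln(e+|y|)\big)^{r}\sup_{P\in\mathcal{D}}\Big(\frac{1}{|P|}\int_P\sum_{k:\,2^k\ell(P)\ge1}|f_k(x)|^q\,dx\Big)^{1/q}.$$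
   Context: For $r>0$, $\mathcal{E}(r)$ denotes the set of tempered distributions $f$ on $\mathbb{R}^n$ whose Fourier transform is supported in $\{\xi\in\mathbb{R}^n:|\xi|<2r\}$; such $f$ are smooth functions. For $k\in\mathbb{Z}$, $y\in\mathbb{R}^n$, $\sigma>0$ and $0<t<\infty$, the shifted generalized Peetre maximal function is $$\mathfrak{M}^t_{\sigma,2^k,y}f(x):=2^{kn/t}\Big(\int_{\mathbb{R}^n}\frac{|f(x-z)|^t}{(1+|2^kz-y|)^{\sigma t}}\,dz\Big)^{1/t},$$ and for $t=\infty$, $\mathfrak{M}^\infty_{\sigma,2^k,y}f(x):=\sup_{z\in\mathbb{R}^n}\frac{|f(x-z)|}{(1+|2^kz-y|)^{\sigma}}$. For a sequence of functions, $\Vert\{f_k\}_{k\in\mathbb{Z}}\Vert_{L^p(\ell^q)}:=\big\Vert\big(\sum_{k}|f_k|^q\big)^{1/q}\big\Vert_{L^p(\mathbb{R}^n)}$ (usual modification if $q=\infty$). $\mathcal{D}$ is the set of all dyadic cubes in $\mathbb{R}^n$ and $\ell(P)$ is the side length of $P$. The constants $C$ may depend on $n,p,q,t,\sigma,A,r$. *)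

theory Defs
  imports "HOL-Analysis.Analysis"
begin

text \<open>Exponents p, q, t range over (0, infinity]; they are modelled as ennreal values.
  epow x a is x to the power a for a > 0 (it is only used with positive a),
  with infinity to a positive power being infinity.\<close>

definition epow :: "ennreal \<Rightarrow> real \<Rightarrow> ennreal" where
  "epow x a = (if x = \<infinity> then \<infinity> else ennreal (enn2real x powr a))"

definition recip_exp :: "ennreal \<Rightarrow> real" where
  "recip_exp p = (if p = \<infinity> then 0 else 1 / enn2real p)"

definition smooth_fun :: "('a::euclidean_space \<Rightarrow> complex) \<Rightarrow> bool" where
  "smooth_fun g \<longleftrightarrow> (\<exists>D :: 'a list \<Rightarrow> 'a \<Rightarrow> complex. D [] = g \<and>
     (\<forall>vs x. (D vs has_derivative (\<lambda>h. \<Sum>i\<in>Basis. (h \<bullet> i) *\<^sub>R D (i # vs) x)) (at x)))"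

definition fsupport :: "('a::euclidean_space \<Rightarrow> complex) \<Rightarrow> 'a set" where
  "fsupport g = closure {x. g x \<noteq> 0}"

definition test_fun :: "('a::euclidean_space \<Rightarrow> complex) \<Rightarrow> bool" where
  "test_fun g \<longleftrightarrow> smooth_fun g \<and> compact (fsupport g)"

definition fourier :: "('a::euclidean_space \<Rightarrow> complex) \<Rightarrow> 'a \<Rightarrow> complex" where
  "fourier g \<xi> = (\<integral>x. g x * cis (- 2 * pi * (x \<bullet> \<xi>)) \<partial>lborel)"

text \<open>A tempered distribution with compactly supported Fourier transform is (by Paley--Wiener--Schwartz)
  a smooth function of polynomial growth; we represent it by that (continuous) function.
  The class E(r): f continuous, of polynomial growth (hence a tempered distribution via
  integration), and its distributional Fourier transform has support (a closed set) contained
  in the open ball of radius 2r, i.e. it vanishes on the complement of some compact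
  K contained in that ball: for all test functions phi supported outside K,
  <hat f, phi> = <f, hat phi> = 0.\<close>
definition class_E :: "real \<Rightarrow> ('a::euclidean_space \<Rightarrow> complex) set" where
  "class_E r = {f. continuous_on UNIV f \<and>
      (\<exists>C N. \<forall>x. cmod (f x) \<le> C * (1 + norm x) ^ N) \<and>
      (\<exists>K. compact K \<and> K \<subseteq> ball 0 (2 * r) \<and>
         (\<forall>\<phi>. test_fun \<phi> \<and> fsupport \<phi> \<inter> K = {} \<longrightarrow>
              (\<integral>x. f x * fourier \<phi> x \<partial>lborel) = 0))}"

definition peetre :: "ennreal \<Rightarrow> real \<Rightarrow> int \<Rightarrow> 'a::euclidean_space \<Rightarrow> ('a \<Rightarrow> complex) \<Rightarrow> 'a \<Rightarrow> ennreal" where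
  "peetre t \<sigma> k y f x =
    (if t = \<infinity> then
       (SUP z. ennreal (cmod (f (x - z)) / (1 + norm ((2 powr real_of_int k) *\<^sub>R z - y)) powr \<sigma>))
     else
       ennreal (2 powr (real_of_int k * real DIM('a) / enn2real t)) *
       epow (\<integral>\<^sup>+ z. ennreal (cmod (f (x - z)) powr enn2real t /
                 (1 + norm ((2 powr real_of_int k) *\<^sub>R z - y)) powr (\<sigma> * enn2real t)) \<partial>lborel)
            (1 / enn2real t))"

definition lq_norm :: "ennreal \<Rightarrow> (int \<Rightarrow> ennreal) \<Rightarrow> ennreal" where
  "lq_norm q g = (if q = \<infinity> then (SUP k. g k)
     else epow (\<integral>\<^sup>+ k. epow (g k) (enn2real q) \<partial>count_space UNIV) (1 / enn2real q))"

definition Lp_norm :: "ennreal \<Rightarrow> ('a::euclidean_space \<Rightarrow> ennreal) \<Rightarrow> ennreal" where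
  "Lp_norm p F = (if p = \<infinity> then Inf {c. AE x in lborel. F x \<le> c}
     else epow (\<integral>\<^sup>+ x. epow (F x) (enn2real p) \<partial>lborel) (1 / enn2real p))"

definition Lp_lq_norm :: "ennreal \<Rightarrow> ennreal \<Rightarrow> (int \<Rightarrow> 'a::euclidean_space \<Rightarrow> ennreal) \<Rightarrow> ennreal" where
  "Lp_lq_norm p q F = Lp_norm p (\<lambda>x. lq_norm q (\<lambda>k. F k x))"

definition dyadic_cube :: "int \<Rightarrow> ('a::euclidean_space \<Rightarrow> int) \<Rightarrow> 'a set" where
  "dyadic_cube j m = {x. \<forall>i\<in>Basis. 2 powr (- real_of_int j) * real_of_int (m i) \<le> x \<bullet> i \<and>
                                   x \<bullet> i < 2 powr (- real_of_int j) * (real_of_int (m i) + 1)}"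

definition dyadic_cubes :: "'a::euclidean_space set set" where
  "dyadic_cubes = {dyadic_cube j m | j m. True}"

definition side_len :: "'a::euclidean_space set \<Rightarrow> real" where
  "side_len P = (THE s. \<exists>j m. P = dyadic_cube j m \<and> s = 2 powr (- real_of_int j))"

definition dyadic_sup_norm :: "ennreal \<Rightarrow> (int \<Rightarrow> 'a::euclidean_space \<Rightarrow> ennreal) \<Rightarrow> ennreal" where
  "dyadic_sup_norm q F = (SUP P\<in>dyadic_cubes.
      epow (ennreal (1 / measure lborel P) *
            (\<integral>\<^sup>+ x. indicator P x *
               (\<integral>\<^sup>+ k. indicator {k. 2 powr real_of_int k * side_len P \<ge> 1} k *
                         epow (F k x) (enn2real q) \<partial>count_space UNIV) \<partial>lborel))
           (1 / enn2real q))"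

end

theory Submission
  imports Defs "HOL-Probability.Sinc_Integral" "HOL-Probability.Characteristic_Functions"
begin

text \<open>
  Choose s below p, q and t with \<open>\<sigma> s > n\<close>. By a reproducing formula for band-limited functions and an
  absorption argument, the Peetre maximal function at scale k is dominated by the 1/s-th power of the
  average of \<open>|f\<^sub>k|\<^sup>s\<close> against the kernel \<open>2\<^sup>k\<^sup>n (1 + |2\<^sup>k x - y|)\<close> to the power \<open>-\<sigma> s\<close>. So everything
  reduces to vector-valued inequalities for these shifted averages. Taken one at a time they are
  bounded on \<open>L\<^sup>P\<close> uniformly in y, whereas their supremum over k costs \<open>ln (e + |y|)\<close> to the power
  1/P: in the Vitali covering argument a shift by \<open>2\<^sup>-\<^sup>k y\<close> matters only for about \<open>log |y|\<close> scales below that of the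
  selected ball. Interpolating between the two statements settles \<open>p \<le> q\<close>, and testing against a
  power of the result (the adjoint of the shift by y is the shift by -y) settles \<open>q \<le> p\<close>.
  For \<open>p = \<infinity>\<close>, a function averaged over a cube of side \<open>2\<^sup>-\<^sup>j\<close> is seen by the scales \<open>k \<ge> j\<close> through the cubes
  near its translates by \<open>2\<^sup>-\<^sup>k y\<close>, of which again about \<open>log |y|\<close> are different.

  For sharpness let \<open>y = 2\<^sup>N e\<close> and use a band-limited bump at the scales \<open>0 \<le> k < N\<close>. If all bumps sit at
  the origin, the maximal functions live near the distinct points \<open>2\<^sup>N\<^sup>-\<^sup>k e\<close>; if they sit at the points
  \<open>-2\<^sup>N\<^sup>-\<^sup>k e\<close>, the maximal functions all pile up at the origin.
\<close>

section \<open>Powers of extended nonnegative reals\<close>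

text \<open>The power of the logarithm has to come out exactly, so the detour through s must not
  spoil it. Put P = p/s and Q = q/s. In norm the maximal theorem loses the power 1/P of the
  logarithm, while the diagonal case P = Q loses nothing; interpolation leaves 1/P - 1/Q, duality
  leaves 1/Q - 1/P, and the final power 1/s turns these into 1/p - 1/q and 1/q - 1/p, free of s.
  Taking s strictly below p and q makes P and Q exceed 1, as the maximal theorem requires, and
  \<sigma> s > n makes the kernel integrable; the lower bound on \<sigma> is exactly what provides
  such an s.

  One bump may serve at all scales 0 \<le> k < N because the classes E(A 2^k) increase with k, and
  ln (e + |y|) is at most a multiple of N for y = 2^N e. Up to constants both sides are then powers
  of N: spreading compares N^(1/p) with N^(r + 1/q), aligning compares N^(1/q) with N^(r + 1/p) for
  finite p and with N^r for the norm over cubes.\<close>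

lemma epow_ennreal: "0 \<le> x \<Longrightarrow> epow (ennreal x) a = ennreal (x powr a)"
  by (simp add: epow_def)

lemma epow_top [simp]: "epow \<infinity> a = \<infinity>" "epow top a = top"
  by (simp_all add: epow_def)

lemma epow_0 [simp]: "epow 0 a = 0"
  by (simp add: epow_def)

lemma epow_1 [simp]: "epow 1 a = 1"
  by (simp add: epow_def)

lemma epow_one [simp]: "epow x 1 = x"
  by (cases x) (auto simp: epow_def)

lemma epow_eq_0_iff [simp]: "epow x a = 0 \<longleftrightarrow> x = 0"
  by (cases x) (auto simp: epow_def ennreal_eq_0_iff)

lemma epow_eq_top_iff [simp]: "epow x a = top \<longleftrightarrow> x = top"
  by (cases x) (auto simp: epow_def)

lemma epow_mono: "x \<le> y \<Longrightarrow> 0 \<le> a \<Longrightarrow> epow x a \<le> epow y a"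
  by (cases x; cases y) (auto simp: epow_def powr_mono2 ennreal_le_iff2 top_unique)

lemma epow_mult: "epow (x * y) a = epow x a * epow y a"
proof (cases "x = 0 \<or> y = 0 \<or> x = top \<or> y = top")
  case True
  then show ?thesis
    by (auto simp: ennreal_mult_top ennreal_top_mult)
next
  case False
  then obtain r s where "x = ennreal r" "0 \<le> r" "y = ennreal s" "0 \<le> s"
    by (metis ennreal_cases infinity_ennreal_def)
  then show ?thesis
    by (simp add: epow_ennreal powr_mult flip: ennreal_mult)
qed

lemma epow_epow: "epow (epow x a) b = epow x (a * b)"
  by (cases x) (auto simp: epow_ennreal powr_powr)

lemma epow_add: "epow x (a + b) = epow x a * epow x b"
  by (cases x) (auto simp: epow_ennreal powr_add ennreal_mult'')

lemma epow_le_swap: "0 < a \<Longrightarrow> epow x a \<le> y \<longleftrightarrow> x \<le> epow y (1 / a)"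
  using epow_mono[of "epow x a" y "1/a"] epow_mono[of x "epow y (1/a)" a]
  by (auto simp: epow_epow)

lemma epow_SUP: "0 < a \<Longrightarrow> epow (SUP i\<in>I. f i) a = (SUP i\<in>I. epow (f i) a)"
  apply (rule antisym)
   apply (subst epow_le_swap, simp)
   apply (rule SUP_least)
   apply (subst epow_le_swap[symmetric], simp)
   apply (auto intro!: SUP_upper SUP_least epow_mono)
  done

lemma epow_measurable [measurable (raw)]:
  assumes [measurable]: "f \<in> borel_measurable M"
  shows "(\<lambda>x. epow (f x) a) \<in> borel_measurable M"
  unfolding epow_def by measurable

section \<open>Hoelder and Jensen inequalities up to constants\<close>

lemma epow_convex_le:
  assumes "0 < \<theta>" "\<theta> < 1"
  shows "epow x \<theta> * epow y (1 - \<theta>) \<le> x + y"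
proof -
  have "epow x \<theta> * epow y (1 - \<theta>) \<le> epow (max x y) \<theta> * epow (max x y) (1 - \<theta>)"
    using assms by (intro mult_mono epow_mono) auto
  also have "\<dots> = max x y"
    by (simp flip: epow_add)
  also have "\<dots> \<le> x + y"
    by (auto simp: max_def)
  finally show ?thesis .
qed

lemma epow_pos_real:
  assumes "x \<noteq> 0" "x \<noteq> top"
  obtains r where "0 < r" "x = ennreal r"
  using assms by (cases x) (auto simp: less_le)

text \<open>By homogeneity both integrals are normalised to 1, and then the pointwise bound of a
  geometric mean by a sum is integrated; bounding by the sum instead of the convex combination
  produces the factor 2. Normalising is impossible when an integral is 0 or infinite, hence the case
  distinction.\<close>

lemma nn_integral_Hoelder:
  assumes [measurable]: "f \<in> borel_measurable M" "g \<in> borel_measurable M" and "0 < \<theta>" "\<theta> < 1"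
  shows "(\<integral>\<^sup>+x. epow (f x) \<theta> * epow (g x) (1 - \<theta>) \<partial>M)
     \<le> 2 * (epow (\<integral>\<^sup>+x. f x \<partial>M) \<theta> * epow (\<integral>\<^sup>+x. g x \<partial>M) (1 - \<theta>))"
proof -
  define a b where "a = (\<integral>\<^sup>+x. f x \<partial>M)" and "b = (\<integral>\<^sup>+x. g x \<partial>M)"
  consider "a = 0" | "b = 0" | "a \<noteq> 0" "b \<noteq> 0" "a = top \<or> b = top" | "a \<noteq> 0" "a \<noteq> top" "b \<noteq> 0" "b \<noteq> top"
    by blast
  then show ?thesis
  proof cases
    case 1
    then have "AE x in M. f x = 0" by (simp add: a_def nn_integral_0_iff_AE)
    then have "(\<integral>\<^sup>+x. epow (f x) \<theta> * epow (g x) (1 - \<theta>) \<partial>M) = (\<integral>\<^sup>+x. 0 \<partial>M)"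
      by (intro nn_integral_cong_AE) (auto elim!: eventually_mono)
    then show ?thesis by simp
  next
    case 2
    then have "AE x in M. g x = 0" by (simp add: b_def nn_integral_0_iff_AE)
    then have "(\<integral>\<^sup>+x. epow (f x) \<theta> * epow (g x) (1 - \<theta>) \<partial>M) = (\<integral>\<^sup>+x. 0 \<partial>M)"
      by (intro nn_integral_cong_AE) (auto elim!: eventually_mono)
    then show ?thesis by simp
  next
    case 3
    then have "epow a \<theta> * epow b (1 - \<theta>) = top"
      by (auto simp: ennreal_mult_eq_top_iff)
    then show ?thesis by (simp add: a_def b_def ennreal_mult_top)
  next
    case 4
    obtain r where r: "0 < r" "a = ennreal r" using 4 by (blast elim: epow_pos_real)
    obtain s where s: "0 < s" "b = ennreal s" using 4 by (blast elim: epow_pos_real)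
    define c where "c = epow a \<theta> * epow b (1 - \<theta>)"
    have *: "epow x \<theta> * epow y (1 - \<theta>) \<le> c * (ennreal (1/r) * x + ennreal (1/s) * y)" for x y
    proof -
      have 1: "x = a * (ennreal (1/r) * x)" "y = b * (ennreal (1/s) * y)"
        using r s by (simp_all add: mult.assoc[symmetric] flip: ennreal_mult)
      have "epow x \<theta> * epow y (1 - \<theta>) = c * (epow (ennreal (1/r) * x) \<theta> * epow (ennreal (1/s) * y) (1 - \<theta>))"
        by (subst 1(1), subst 1(2)) (simp only: epow_mult c_def mult_ac)
      also have "\<dots> \<le> c * (ennreal (1/r) * x + ennreal (1/s) * y)"
        by (intro mult_left_mono epow_convex_le assms) auto
      finally show ?thesis .
    qed
    have "(\<integral>\<^sup>+x. epow (f x) \<theta> * epow (g x) (1 - \<theta>) \<partial>M) \<le> (\<integral>\<^sup>+x. c * (ennreal (1/r) * f x + ennreal (1/s) * g x) \<partial>M)"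
      by (intro nn_integral_mono *)
    also have "\<dots> = c * (ennreal (1/r) * a + ennreal (1/s) * b)"
      by (simp add: nn_integral_cmult nn_integral_add a_def b_def)
    also have "\<dots> = 2 * c"
      using r s by (simp add: mult.commute flip: ennreal_mult)
    finally show ?thesis by (simp add: c_def a_def b_def)
  qed
qed

text \<open>Hoelder for the factorisation g w = (g^a w)^(1/a) w^(1 - 1/a). The weight is not
  normalised, so the power a - 1 of its mass appears. For a = 1 the Hoelder exponent would be 1,
  outside the range of \<open>nn_integral_Hoelder\<close>.\<close>

lemma nn_integral_Jensen:
  assumes [measurable]: "g \<in> borel_measurable M" "w \<in> borel_measurable M" and a: "1 \<le> a"
  shows "epow (\<integral>\<^sup>+x. g x * w x \<partial>M) a
     \<le> epow 2 a * (epow (\<integral>\<^sup>+x. w x \<partial>M) (a - 1) * (\<integral>\<^sup>+x. epow (g x) a * w x \<partial>M))"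
proof (cases "a = 1")
  case True
  \<comment> \<open>\<open>epow 0 0\<close> is 0, so for a weight of mass 0 the factor with exponent
    a - 1 = 0 does not reduce to 1, and this case is separated.\<close>
  show ?thesis
  proof (cases "(\<integral>\<^sup>+x. w x \<partial>M) = 0")
    case T: True
    then have "AE x in M. w x = 0" by (simp add: nn_integral_0_iff_AE)
    then have "(\<integral>\<^sup>+x. g x * w x \<partial>M) = (\<integral>\<^sup>+x. 0 \<partial>M)"
      by (intro nn_integral_cong_AE) (auto elim!: eventually_mono)
    then show ?thesis by simp
  next
    case F: False
    have "epow (\<integral>\<^sup>+x. w x \<partial>M) 0 \<ge> 1"
      using F by (cases "(\<integral>\<^sup>+x. w x \<partial>M)") (auto simp: epow_ennreal)
    then have "1 * (1 * (\<integral>\<^sup>+x. g x * w x \<partial>M)) \<le> 2 * (epow (\<integral>\<^sup>+x. w x \<partial>M) 0 * (\<integral>\<^sup>+x. g x * w x \<partial>M))"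
      by (intro mult_mono) auto
    with True show ?thesis by simp
  qed
next
  case False
  with a have a1: "1 < a" by simp
  have "(\<integral>\<^sup>+x. g x * w x \<partial>M) = (\<integral>\<^sup>+x. epow (epow (g x) a * w x) (1/a) * epow (w x) (1 - 1/a) \<partial>M)"
  proof (intro nn_integral_cong)
    fix x
    show "g x * w x = epow (epow (g x) a * w x) (1/a) * epow (w x) (1 - 1/a)"
      using a1 epow_add[of "w x" "1/a" "1-1/a"]
      by (simp add: epow_mult epow_epow mult.assoc)
  qed
  also have "\<dots> \<le> 2 * (epow (\<integral>\<^sup>+x. epow (g x) a * w x \<partial>M) (1/a) * epow (\<integral>\<^sup>+x. w x \<partial>M) (1 - 1/a))"
    using a1 by (intro nn_integral_Hoelder) auto
  finally have "epow (\<integral>\<^sup>+x. g x * w x \<partial>M) a \<le> epow (2 * (epow (\<integral>\<^sup>+x. epow (g x) a * w x \<partial>M) (1/a) * epow (\<integral>\<^sup>+x. w x \<partial>M) (1 - 1/a))) a"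
    using a1 by (intro epow_mono) auto
  also have "(1 - 1/a) * a = a - 1" using a1 by (simp add: field_simps)
  then have "epow (2 * (epow (\<integral>\<^sup>+x. epow (g x) a * w x \<partial>M) (1/a) * epow (\<integral>\<^sup>+x. w x \<partial>M) (1 - 1/a))) a
    = epow 2 a * (epow (\<integral>\<^sup>+x. w x \<partial>M) (a - 1) * (\<integral>\<^sup>+x. epow (g x) a * w x \<partial>M))"
    using a1 by (simp add: epow_mult epow_epow mult.commute mult.left_commute)
  finally show ?thesis .
qed

lemma measurable_nn_integral_count_space [measurable (raw)]:
  fixes f :: "'c::countable \<Rightarrow> 'b \<Rightarrow> ennreal"
  assumes [measurable]: "\<And>j. f j \<in> borel_measurable M"
  shows "(\<lambda>x. \<integral>\<^sup>+j. f j x \<partial>count_space UNIV) \<in> borel_measurable M"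
proof -
  interpret sigma_finite_measure "count_space (UNIV :: 'c set)"
    by (rule sigma_finite_measure_count_space)
  have "(\<lambda>p. f (snd p) (fst p)) \<in> borel_measurable (M \<Otimes>\<^sub>M count_space UNIV)"
    by (rule measurable_compose_countable) auto
  then show ?thesis by (intro borel_measurable_nn_integral) (simp add: split_beta')
qed

section \<open>Shifted averages and their maximal function\<close>

lemma ennreal_eq_topI: "(\<And>n. of_nat n \<le> x) \<Longrightarrow> x = (top::ennreal)"
  by (metis top.not_eq_extremum ennreal_Ex_less_of_nat not_le)

lemma ennreal_mult_top_pos: "0 < e \<Longrightarrow> ennreal e * top = top"
  by (simp add: ennreal_mult_top)

lemma nn_integral_lborel_affine:
  fixes f :: "'a::euclidean_space \<Rightarrow> ennreal"
  assumes [measurable]: "f \<in> borel_measurable borel" and "c \<noteq> 0"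
  shows "(\<integral>\<^sup>+x. f x \<partial>lborel) = ennreal (\<bar>c\<bar> ^ DIM('a)) * (\<integral>\<^sup>+x. f (t + c *\<^sub>R x) \<partial>lborel)"
  by (subst lborel_affine[OF assms(2), of t])
     (simp add: nn_integral_density nn_integral_distr nn_integral_cmult)

text \<open>The factor 2^(k n) makes the mass independent of k and y
  (\<open>nn_integral_kern\<close>). The shift y is measured in units of the scale: the kernel is
  centred at 2^-k y.\<close>

definition kern :: "real \<Rightarrow> int \<Rightarrow> 'a::euclidean_space \<Rightarrow> 'a \<Rightarrow> real" where
  "kern L k y z = 2 powr (real_of_int k * real DIM('a)) * (1 + norm ((2 powr real_of_int k) *\<^sub>R z - y)) powr (- L)"

definition shiftavg :: "real \<Rightarrow> int \<Rightarrow> 'a::euclidean_space \<Rightarrow> ('a \<Rightarrow> ennreal) \<Rightarrow> 'a \<Rightarrow> ennreal" where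
  "shiftavg L k y g x = (\<integral>\<^sup>+v. g v * ennreal (kern L k y (x - v)) \<partial>lborel)"

text \<open>An average over the ball of radius 2^-k about x - 2^-k y, normalised by 2^(k n) instead
  of the volume; hence the factor \<open>unit_ball_vol\<close> in \<open>ballavg_const\<close> and
  later.\<close>

definition ballavg :: "int \<Rightarrow> 'a::euclidean_space \<Rightarrow> ('a \<Rightarrow> ennreal) \<Rightarrow> 'a \<Rightarrow> ennreal" where
  "ballavg k y g x = ennreal (2 powr (real_of_int k * real DIM('a))) *
     (\<integral>\<^sup>+v. (if norm (x - (2 powr - real_of_int k) *\<^sub>R y - v) \<le> 2 powr - real_of_int k then g v else 0) \<partial>lborel)"

definition maxop :: "'a::euclidean_space \<Rightarrow> ('a \<Rightarrow> ennreal) \<Rightarrow> 'a \<Rightarrow> ennreal" where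
  "maxop y g x = (SUP k. ballavg k y g x)"

definition logfac :: "'a::euclidean_space \<Rightarrow> real" where
  "logfac y = ln (exp 1 + norm y)"

lemma logfac_ge_1: "1 \<le> logfac y"
proof -
  have "ln (exp 1) \<le> ln (exp 1 + norm y)"
    by (subst ln_le_cancel_iff) (auto intro: add_pos_nonneg)
  then show ?thesis by (simp add: logfac_def)
qed

lemma logfac_mono: "norm x \<le> norm y \<Longrightarrow> logfac x \<le> logfac y"
  unfolding logfac_def by (subst ln_le_cancel_iff) (auto intro: add_pos_nonneg)

lemma logfac_minus [simp]: "logfac (- y) = logfac y"
  by (simp add: logfac_def)

lemma kern_measurable [measurable]: "kern L k y \<in> borel_measurable borel"
  unfolding kern_def by measurable

lemma kern_nonneg [simp]: "0 \<le> kern L k y z"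
  by (simp add: kern_def)

lemma kern_minus: "kern L k y (- z) = kern L k (- y) z"
proof -
  have "norm (2 powr real_of_int k *\<^sub>R (- z) - y) = norm (- (2 powr real_of_int k *\<^sub>R z - (- y)))"
    by simp
  then show ?thesis unfolding kern_def by (simp only: norm_minus_cancel)
qed

lemma shiftavg_measurable [measurable]:
  assumes [measurable]: "g \<in> borel_measurable borel"
  shows "shiftavg L k y g \<in> borel_measurable borel"
  unfolding shiftavg_def by measurable

lemma ballavg_measurable [measurable]:
  assumes [measurable]: "g \<in> borel_measurable borel"
  shows "ballavg k y g \<in> borel_measurable borel"
  unfolding ballavg_def by measurable

lemma maxop_measurable [measurable]:
  assumes [measurable]: "g \<in> borel_measurable borel"
  shows "maxop y g \<in> borel_measurable borel"
  unfolding maxop_def by measurable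

section \<open>Decaying kernels as sums over dyadic balls\<close>

lemma geometric_nn_integral:
  assumes "0 < (\<beta>::real)"
  shows "(\<integral>\<^sup>+j. ennreal (2 powr (- real j * \<beta>)) \<partial>count_space UNIV) = ennreal (1 / (1 - 2 powr - \<beta>))"
proof -
  have *: "2 powr (- real j * \<beta>) = (2 powr - \<beta>) ^ j" for j
    by (simp add: powr_powr powr_realpow[symmetric] mult.commute)
  have "2 powr - \<beta> < 1" using assms by (simp add: powr_less_one)
  then have "(\<lambda>j. (2 powr - \<beta>) ^ j) sums (1 / (1 - 2 powr - \<beta>))"
    by (intro geometric_sums) simp
  then show ?thesis
    unfolding * nn_integral_count_space_nat
    by (subst suminf_ennreal2) (auto simp: sums_iff)
qed

text \<open>A single term of the sum suffices: the least j with \<open>norm w \<le> 2 ^ j\<close>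
  satisfies 2^j \<le> 2 (1 + norm w). This replaces a kernel with tails by a superposition of balls,
  to which covering arguments apply.\<close>

lemma decay_le_dyadic:
  fixes w :: "'a::euclidean_space"
  assumes "0 < L"
  shows "ennreal ((1 + norm w) powr - L) \<le> ennreal (2 powr L) *
    (\<integral>\<^sup>+j. ennreal (2 powr (- real j * L)) * (if norm w \<le> 2 ^ j then 1 else 0) \<partial>count_space (UNIV::nat set))"
proof -
  have ex: "\<exists>j. norm w \<le> 2 ^ j"
    using real_arch_pow[of 2 "norm w"] by (auto intro: less_imp_le)
  define j where "j = (LEAST j. norm w \<le> 2 ^ j)"
  have j: "norm w \<le> 2 ^ j" using ex unfolding j_def by (rule LeastI_ex)
  have "2 ^ j \<le> 2 * (1 + norm w)"
  proof (cases j)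
    case (Suc i)
    then have "i < (LEAST j. norm w \<le> 2 ^ j)" by (simp add: j_def)
    then have "\<not> norm w \<le> 2 ^ i" by (rule not_less_Least)
    then show ?thesis using Suc by simp
  qed simp
  then have "(1 + norm w) powr - L \<le> (2 ^ j / 2) powr - L"
    using assms by (intro powr_mono2') (auto intro: add_pos_nonneg)
  also have "\<dots> = 2 powr L * 2 powr (- real j * L)"
    by (simp add: powr_divide powr_realpow[symmetric] powr_powr powr_minus_divide field_simps)
  finally have "ennreal ((1 + norm w) powr - L) \<le> ennreal (2 powr L) * (ennreal (2 powr (- real j * L)) * (if norm w \<le> 2 ^ j then 1 else 0))"
    using j by (simp flip: ennreal_mult)
  also have "\<dots> \<le> ennreal (2 powr L) *
    (\<integral>\<^sup>+j. ennreal (2 powr (- real j * L)) * (if norm w \<le> 2 ^ j then 1 else 0) \<partial>count_space (UNIV::nat set))"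
    by (intro mult_left_mono nn_integral_ge_point) auto
  finally show ?thesis .
qed

text \<open>Dilating the ball of scale k by 2^j yields the ball of scale k - j, and in units of the
  new scale the same displacement 2^-k y reads 2^-j y. The volume 2^(j n) gained by the larger ball
  leaves the weight 2^(-j (L - n)), summable for L > n.\<close>

lemma shiftavg_le_ballavg:
  fixes y :: "'a::euclidean_space"
  assumes [measurable]: "g \<in> borel_measurable borel" and "0 < L"
  shows "shiftavg L k y g x \<le> ennreal (2 powr L) *
    (\<integral>\<^sup>+j. ennreal (2 powr (- real j * (L - DIM('a)))) * ballavg (k - int j) ((2 powr - real j) *\<^sub>R y) g x \<partial>count_space UNIV)"
proof -
  let ?w = "\<lambda>v. (2 powr real_of_int k) *\<^sub>R (x - v) - y"
  let ?c = "2 powr (real_of_int k * real DIM('a))"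
  have "shiftavg L k y g x \<le> (\<integral>\<^sup>+v. ennreal (2 powr L) * (\<integral>\<^sup>+j. g v * (ennreal ?c *
     (ennreal (2 powr (- real j * L)) * (if norm (?w v) \<le> 2 ^ j then 1 else 0))) \<partial>count_space UNIV) \<partial>lborel)"
    unfolding shiftavg_def
  proof (intro nn_integral_mono)
    fix v
    have "g v * ennreal (kern L k y (x - v)) = g v * (ennreal ?c * ennreal ((1 + norm (?w v)) powr - L))"
      by (simp add: kern_def ennreal_mult)
    also have "\<dots> \<le> g v * (ennreal ?c * (ennreal (2 powr L) *
       (\<integral>\<^sup>+j. ennreal (2 powr (- real j * L)) * (if norm (?w v) \<le> 2 ^ j then 1 else 0) \<partial>count_space UNIV)))"
      using assms by (intro mult_left_mono decay_le_dyadic) auto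
    also have "\<dots> = ennreal (2 powr L) * (\<integral>\<^sup>+j. g v * (ennreal ?c *
     (ennreal (2 powr (- real j * L)) * (if norm (?w v) \<le> 2 ^ j then 1 else 0))) \<partial>count_space UNIV)"
    proof -
      have "(\<integral>\<^sup>+j. g v * (ennreal ?c * X j) \<partial>count_space UNIV) = g v * ennreal ?c * (\<integral>\<^sup>+j. X j \<partial>count_space UNIV)" for X :: "nat \<Rightarrow> ennreal"
        by (subst nn_integral_cmult[symmetric]) (auto simp: mult.assoc)
      note this[of "\<lambda>j. ennreal (2 powr (- real j * L)) * (if norm (?w v) \<le> 2 ^ j then 1 else 0)"]
      then show ?thesis by (simp only: mult_ac)
    qed
    finally show "g v * ennreal (kern L k y (x - v)) \<le> \<dots>" .
  qed
  also have "\<dots> = ennreal (2 powr L) * (\<integral>\<^sup>+j. (\<integral>\<^sup>+v. g v * (ennreal ?c *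
     (ennreal (2 powr (- real j * L)) * (if norm (?w v) \<le> 2 ^ j then 1 else 0))) \<partial>lborel) \<partial>count_space UNIV)"
    by (subst nn_integral_cmult) (auto simp: nn_integral_count_space_nn_integral)
  also have "\<dots> = ennreal (2 powr L) *
    (\<integral>\<^sup>+j. ennreal (2 powr (- real j * (L - DIM('a)))) * ballavg (k - int j) ((2 powr - real j) *\<^sub>R y) g x \<partial>count_space UNIV)"
  proof (intro arg_cong2[where f="(*)"] nn_integral_cong refl)
    fix j
    have iff: "norm (?w v) \<le> 2 ^ j \<longleftrightarrow>
       norm (x - (2 powr - real_of_int (k - int j)) *\<^sub>R (2 powr - real j) *\<^sub>R y - v) \<le> 2 powr - real_of_int (k - int j)" for v
    proof -
      have "?w v = (2 powr real_of_int k) *\<^sub>R (x - (2 powr - real_of_int (k - int j)) *\<^sub>R (2 powr - real j) *\<^sub>R y - v)"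
        by (simp add: algebra_simps flip: powr_add)
      then have "norm (?w v) = 2 powr real_of_int k * norm (x - (2 powr - real_of_int (k - int j)) *\<^sub>R (2 powr - real j) *\<^sub>R y - v)"
        by (simp only: norm_scaleR) simp
      moreover have "(2::real) ^ j = 2 powr real_of_int k * 2 powr - real_of_int (k - int j)"
        by (simp add: powr_realpow[symmetric] flip: powr_add)
      ultimately show ?thesis by simp
    qed
    have c: "ennreal ?c * ennreal (2 powr (- real j * L)) =
        ennreal (2 powr (- real j * (L - DIM('a)))) * ennreal (2 powr (real_of_int (k - int j) * real DIM('a)))"
      by (simp add: algebra_simps flip: ennreal_mult powr_add)
    have "(\<integral>\<^sup>+v. g v * (ennreal ?c * (ennreal (2 powr (- real j * L)) * (if norm (?w v) \<le> 2 ^ j then 1 else 0))) \<partial>lborel)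
      = (\<integral>\<^sup>+v. (ennreal ?c * ennreal (2 powr (- real j * L))) * (if norm (x - (2 powr - real_of_int (k - int j)) *\<^sub>R (2 powr - real j) *\<^sub>R y - v) \<le> 2 powr - real_of_int (k - int j) then g v else 0) \<partial>lborel)"
      by (intro nn_integral_cong) (simp add: iff mult_ac)
    also have "\<dots> = (ennreal ?c * ennreal (2 powr (- real j * L))) * (\<integral>\<^sup>+v. (if norm (x - (2 powr - real_of_int (k - int j)) *\<^sub>R (2 powr - real j) *\<^sub>R y - v) \<le> 2 powr - real_of_int (k - int j) then g v else 0) \<partial>lborel)"
      by (rule nn_integral_cmult) measurable
    also have "\<dots> = ennreal (2 powr (- real j * (L - DIM('a)))) * ballavg (k - int j) ((2 powr - real j) *\<^sub>R y) g x"
      unfolding c ballavg_def by (simp add: mult.assoc)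
    finally show "(\<integral>\<^sup>+v. g v * (ennreal ?c * (ennreal (2 powr (- real j * L)) * (if norm (?w v) \<le> 2 ^ j then 1 else 0))) \<partial>lborel)
       = ennreal (2 powr (- real j * (L - DIM('a)))) * ballavg (k - int j) ((2 powr - real j) *\<^sub>R y) g x" .
  qed
  finally show ?thesis .
qed

lemma nn_integral_cball_indicator:
  fixes c :: "'a::euclidean_space"
  assumes "0 \<le> \<rho>"
  shows "(\<integral>\<^sup>+v. (if norm (c - v) \<le> \<rho> then b else 0) \<partial>lborel) = b * ennreal (unit_ball_vol (real DIM('a)) * \<rho> ^ DIM('a))"
proof -
  have "(\<integral>\<^sup>+v. (if norm (c - v) \<le> \<rho> then b else 0) \<partial>lborel) = (\<integral>\<^sup>+v. b * indicator (cball c \<rho>) v \<partial>lborel)"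
    by (intro nn_integral_cong) (auto simp: indicator_def dist_norm)
  also have "\<dots> = b * emeasure lborel (cball c \<rho>)"
    by (rule nn_integral_cmult_indicator) simp
  finally show ?thesis using assms by (simp add: emeasure_cball)
qed

lemma ballavg_const:
  "ballavg k (y::'a::euclidean_space) (\<lambda>_. b) x = b * ennreal (unit_ball_vol (real DIM('a)))"
proof -
  have "2 powr (real_of_int k * real DIM('a)) * (2 powr - real_of_int k) ^ DIM('a) = (1::real)"
    by (simp add: powr_realpow[symmetric] powr_powr flip: powr_add)
  then have "ennreal (2 powr (real_of_int k * real DIM('a))) * ennreal (unit_ball_vol (real DIM('a)) * (2 powr - real_of_int k) ^ DIM('a))
     = ennreal (unit_ball_vol (real DIM('a)))"
    by (simp add: mult.left_commute flip: ennreal_mult)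
  then show ?thesis
    unfolding ballavg_def by (subst nn_integral_cball_indicator) (auto simp: mult.left_commute)
qed

definition kmass :: "'a::euclidean_space itself \<Rightarrow> real \<Rightarrow> ennreal" where
  "kmass _ L = (\<integral>\<^sup>+w. ennreal ((1 + norm (w::'a)) powr - L) \<partial>lborel)"

lemma nn_integral_kern:
  fixes y :: "'a::euclidean_space"
  shows "(\<integral>\<^sup>+v. ennreal (kern L k y (x - v)) \<partial>lborel) = kmass TYPE('a) L"
proof -
  have "(\<integral>\<^sup>+v. ennreal (kern L k y (x - v)) \<partial>lborel) = ennreal (\<bar>- (2 powr - real_of_int k)\<bar> ^ DIM('a)) *
    (\<integral>\<^sup>+w. ennreal (kern L k y (x - ((x - (2 powr - real_of_int k) *\<^sub>R y) + (- (2 powr - real_of_int k)) *\<^sub>R w))) \<partial>lborel)"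
    by (rule nn_integral_lborel_affine) auto
  also have "\<dots> = (\<integral>\<^sup>+w. ennreal (\<bar>- (2 powr - real_of_int k)\<bar> ^ DIM('a)) *
    ennreal (kern L k y (x - ((x - (2 powr - real_of_int k) *\<^sub>R y) + (- (2 powr - real_of_int k)) *\<^sub>R w))) \<partial>lborel)"
    by (subst nn_integral_cmult) auto
  also have "\<dots> = kmass TYPE('a) L"
    unfolding kmass_def
  proof (intro nn_integral_cong)
    fix w :: 'a
    have 1: "(2 powr real_of_int k) *\<^sub>R (x - ((x - (2 powr - real_of_int k) *\<^sub>R y) + (- (2 powr - real_of_int k)) *\<^sub>R w)) - y = w"
      by (simp add: algebra_simps flip: powr_add)
    have 2: "(2 powr - real_of_int k) ^ DIM('a) * 2 powr (real_of_int k * real DIM('a)) = (1::real)"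
      by (simp add: powr_realpow[symmetric] powr_powr flip: powr_add)
    show "ennreal (\<bar>- (2 powr - real_of_int k)\<bar> ^ DIM('a)) *
       ennreal (kern L k y (x - ((x - (2 powr - real_of_int k) *\<^sub>R y) + (- (2 powr - real_of_int k)) *\<^sub>R w)))
       = ennreal ((1 + norm w) powr - L)"
      unfolding kern_def 1 using 2 by (simp add: mult.assoc[symmetric] flip: ennreal_mult)
  qed
  finally show ?thesis .
qed

text \<open>Applied to the constant function 1, the decomposition into balls bounds the mass by a
  geometric series, convergent because L > n.\<close>

lemma kmass_finite:
  assumes "real DIM('a) < L"
  shows "kmass TYPE('a::euclidean_space) L < \<infinity>"
proof -
  have L: "0 < L" using assms DIM_positive[where 'a='a] by linarith
  have "kmass TYPE('a) L = shiftavg L 0 (0::'a) (\<lambda>_. 1) 0"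
    unfolding shiftavg_def by (simp add: nn_integral_kern[of L 0 "0::'a" 0, simplified, symmetric])
  also have "\<dots> \<le> ennreal (2 powr L) * (\<integral>\<^sup>+j. ennreal (2 powr (- real j * (L - DIM('a)))) * (1 * ennreal (unit_ball_vol (real DIM('a)))) \<partial>count_space UNIV)"
    using shiftavg_le_ballavg[OF _ L, of "\<lambda>_. 1" 0 "0::'a" 0] by (simp add: ballavg_const)
  also have "\<dots> < \<infinity>"
    using assms by (subst nn_integral_multc) (auto simp: geometric_nn_integral[of "L - real DIM('a)", simplified] ennreal_mult_less_top)
  finally show ?thesis .
qed

lemma shiftavg_adjoint:
  fixes y :: "'a::euclidean_space"
  assumes [measurable]: "g \<in> borel_measurable borel" "h \<in> borel_measurable borel"
  shows "(\<integral>\<^sup>+x. shiftavg L k y g x * h x \<partial>lborel) = (\<integral>\<^sup>+x. g x * shiftavg L k (- y) h x \<partial>lborel)"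
proof -
  have "(\<integral>\<^sup>+x. shiftavg L k y g x * h x \<partial>lborel) = (\<integral>\<^sup>+x. \<integral>\<^sup>+v. g v * ennreal (kern L k y (x - v)) * h x \<partial>lborel \<partial>lborel)"
    unfolding shiftavg_def by (subst nn_integral_multc) auto
  also have "\<dots> = (\<integral>\<^sup>+v. \<integral>\<^sup>+x. g v * ennreal (kern L k y (x - v)) * h x \<partial>lborel \<partial>lborel)"
    by (rule lborel_pair.Fubini') measurable
  also have "\<dots> = (\<integral>\<^sup>+v. g v * (\<integral>\<^sup>+x. h x * ennreal (kern L k (- y) (v - x)) \<partial>lborel) \<partial>lborel)"
  proof (intro nn_integral_cong)
    fix v
    have "kern L k y (x - v) = kern L k (- y) (v - x)" for x
      using kern_minus[of L k y "v - x"] by simp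
    then show "(\<integral>\<^sup>+x. g v * ennreal (kern L k y (x - v)) * h x \<partial>lborel) = g v * (\<integral>\<^sup>+x. h x * ennreal (kern L k (- y) (v - x)) \<partial>lborel)"
      by (subst nn_integral_cmult[symmetric]) (auto simp: mult_ac)
  qed
  finally show ?thesis by (simp add: shiftavg_def)
qed

section \<open>The weak type estimate for displaced balls\<close>

lemma ballavg_le_maxop: "ballavg k y g x \<le> maxop y g x"
  unfolding maxop_def by (rule SUP_upper) simp

lemma ballavg_mono: "(\<And>v. g v \<le> h v) \<Longrightarrow> ballavg k y g x \<le> ballavg k y h x"
  unfolding ballavg_def by (intro mult_left_mono nn_integral_mono) auto

lemma ballavg_add:
  assumes [measurable]: "g \<in> borel_measurable borel" "h \<in> borel_measurable borel"
  shows "ballavg k y (\<lambda>v. g v + h v) x = ballavg k y g x + ballavg k y h x"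
proof -
  have "(\<integral>\<^sup>+v. (if norm (x - (2 powr - real_of_int k) *\<^sub>R y - v) \<le> 2 powr - real_of_int k then g v + h v else 0) \<partial>lborel)
    = (\<integral>\<^sup>+v. (if norm (x - (2 powr - real_of_int k) *\<^sub>R y - v) \<le> 2 powr - real_of_int k then g v else 0) +
       (if norm (x - (2 powr - real_of_int k) *\<^sub>R y - v) \<le> 2 powr - real_of_int k then h v else 0) \<partial>lborel)"
    by (intro nn_integral_cong) auto
  then show ?thesis
    unfolding ballavg_def by (simp add: nn_integral_add distrib_left)
qed

lemma emeasure_UN_countable_le:
  assumes "countable C" and [measurable]: "\<And>j. j \<in> C \<Longrightarrow> U j \<in> sets M"
  shows "emeasure M (\<Union>j\<in>C. U j) \<le> (\<integral>\<^sup>+j. emeasure M (U j) \<partial>count_space C)"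
proof -
  have [measurable]: "(\<Union>j\<in>C. U j) \<in> sets M" using assms by (intro sets.countable_UN') auto
  have "emeasure M (\<Union>j\<in>C. U j) = (\<integral>\<^sup>+x. indicator (\<Union>j\<in>C. U j) x \<partial>M)"
    by simp
  also have "\<dots> \<le> (\<integral>\<^sup>+x. (\<integral>\<^sup>+j. indicator (U j) x \<partial>count_space C) \<partial>M)"
  proof (intro nn_integral_mono)
    fix x
    show "indicator (\<Union>j\<in>C. U j) x \<le> (\<integral>\<^sup>+j. indicator (U j) x \<partial>count_space C :: ennreal)"
    proof (cases "\<exists>j\<in>C. x \<in> U j")
      case True
      then obtain j where j: "j \<in> C" "x \<in> U j" by blast
      then have "indicator (\<Union>j\<in>C. U j) x = (indicator (U j) x :: ennreal)" by (auto simp: indicator_def)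
      also have "\<dots> \<le> (\<integral>\<^sup>+j. indicator (U j) x \<partial>count_space C)"
        using j by (intro nn_integral_ge_point) auto
      finally show ?thesis .
    qed auto
  qed
  also have "\<dots> = (\<integral>\<^sup>+j. (\<integral>\<^sup>+x. indicator (U j) x \<partial>M) \<partial>count_space C)"
    using assms by (intro nn_integral_count_space_nn_integral) auto
  also have "\<dots> = (\<integral>\<^sup>+j. emeasure M (U j) \<partial>count_space C)"
    by (intro nn_integral_cong) auto
  finally show ?thesis .
qed

lemma nn_integral_disjoint_le:
  assumes "countable C" and [measurable]: "\<And>j. j \<in> C \<Longrightarrow> U j \<in> sets M" and [measurable]: "g \<in> borel_measurable M"
    and disj: "\<And>i j x. i \<in> C \<Longrightarrow> j \<in> C \<Longrightarrow> x \<in> U i \<Longrightarrow> x \<in> U j \<Longrightarrow> i = j"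
  shows "(\<integral>\<^sup>+j. (\<integral>\<^sup>+x. g x * indicator (U j) x \<partial>M) \<partial>count_space C) \<le> (\<integral>\<^sup>+x. g x \<partial>M)"
proof -
  have "(\<integral>\<^sup>+j. (\<integral>\<^sup>+x. g x * indicator (U j) x \<partial>M) \<partial>count_space C) = (\<integral>\<^sup>+x. (\<integral>\<^sup>+j. g x * indicator (U j) x \<partial>count_space C) \<partial>M)"
    using assms by (intro nn_integral_count_space_nn_integral[symmetric]) auto
  also have "\<dots> \<le> (\<integral>\<^sup>+x. g x \<partial>M)"
  proof (intro nn_integral_mono)
    fix x
    have eq: "(\<integral>\<^sup>+j. g x * indicator (U j) x \<partial>count_space C) = g x * (\<integral>\<^sup>+j. indicator {j\<in>C. x \<in> U j} j \<partial>count_space C)"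
      by (subst nn_integral_cmult[symmetric]) (auto intro!: nn_integral_cong simp: indicator_def)
    have "(\<integral>\<^sup>+j. indicator {j\<in>C. x \<in> U j} j \<partial>count_space C) = emeasure (count_space C) {j\<in>C. x \<in> U j}"
      by (subst nn_integral_indicator) auto
    also have "\<dots> \<le> 1"
    proof (cases "{j\<in>C. x \<in> U j} = {}")
      case True
      then show ?thesis by (simp only: emeasure_empty) simp
    next
      case False
      then obtain i where "{j\<in>C. x \<in> U j} = {i}" using disj by blast
      then show ?thesis by (subst emeasure_count_space) auto
    qed
    finally have "g x * (\<integral>\<^sup>+j. indicator {j\<in>C. x \<in> U j} j \<partial>count_space C) \<le> g x * 1"
      by (intro mult_left_mono) auto
    with eq show "(\<integral>\<^sup>+j. g x * indicator (U j) x \<partial>count_space C) \<le> g x"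
      by simp
  qed
  finally show ?thesis .
qed

text \<open>Vitali selection for the displaced balls \<open>cball (x - 2\<^sup>-\<^sup>k y) 2\<^sup>-\<^sup>k\<close>. A point x whose ball meets a
  selected one is found by displacing back; up to the radius of the selected ball, only about
  \<open>log |y|\<close> displacements differ.\<close>
lemma maxop_weak:
  fixes y :: "'a::euclidean_space"
  assumes [measurable]: "g \<in> borel_measurable borel" and lam: "0 < l"
  shows "emeasure lborel {x. ennreal l < maxop y g x} \<le>
     ennreal (7 * 6 ^ DIM('a) * unit_ball_vol (real DIM('a)) * logfac y / l) * (\<integral>\<^sup>+x. g x \<partial>lborel)"
proof (cases "(\<integral>\<^sup>+x. g x \<partial>lborel) = \<infinity>")
  case True
  have "7 * 6 ^ DIM('a) * unit_ball_vol (real DIM('a)) * logfac y / l > 0"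
    using lam logfac_ge_1[of y] by (intro divide_pos_pos mult_pos_pos) auto
  then have "ennreal (7 * 6 ^ DIM('a) * unit_ball_vol (real DIM('a)) * logfac y / l) * \<infinity> = \<infinity>"
    unfolding infinity_ennreal_def by (rule ennreal_mult_top_pos)
  then show ?thesis using True by simp
next
  case False
  let ?n = "DIM('a)" and ?V = "unit_ball_vol (real DIM('a))"
  obtain I where I: "(\<integral>\<^sup>+x. g x \<partial>lborel) = ennreal I" "0 \<le> I"
    using False by (cases "(\<integral>\<^sup>+x. g x \<partial>lborel)") auto
  \<comment> \<open>The balls to be selected sit at the displaced centres \<open>a\<close>, while
    the set to be covered consists of the points x; the index keeps both x and k so that a ball can
    be traced back to its point.\<close>
  define K where "K = {(x, k). ennreal l < ballavg k y g x}"
  define a where "a = (\<lambda>(x, k). x - (2 powr - real_of_int k) *\<^sub>R y)"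
  define \<rho> where "\<rho> = (\<lambda>(x::'a, k). 2 powr - real_of_int k)"
  have \<rho>_pos: "0 < \<rho> i" for i by (auto simp: \<rho>_def split: prod.split)
  have avg: "ennreal (l * \<rho> i ^ ?n) \<le> (\<integral>\<^sup>+v. g v * indicator (cball (a i) (\<rho> i)) v \<partial>lborel)" if "i \<in> K" for i
  proof -
    obtain x k where i: "i = (x, k)" by (cases i)
    have eq: "\<rho> i ^ ?n * 2 powr (real_of_int k * real ?n) = 1"
      by (simp add: \<rho>_def i powr_realpow[symmetric] powr_powr flip: powr_add)
    have "ennreal (l * \<rho> i ^ ?n) = ennreal (\<rho> i ^ ?n) * ennreal l"
      using lam \<rho>_pos[of i] by (simp add: mult.commute flip: ennreal_mult)
    also have "\<dots> \<le> ennreal (\<rho> i ^ ?n) * ballavg k y g x"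
      using that by (intro mult_left_mono) (auto simp: K_def i)
    also have "\<dots> = ennreal (\<rho> i ^ ?n * 2 powr (real_of_int k * real ?n)) * (\<integral>\<^sup>+v. (if norm (x - (2 powr - real_of_int k) *\<^sub>R y - v) \<le> 2 powr - real_of_int k then g v else 0) \<partial>lborel)"
      unfolding ballavg_def using \<rho>_pos[of i] by (simp add: ennreal_mult mult.assoc)
    also have "\<dots> = (\<integral>\<^sup>+v. g v * indicator (cball (a i) (\<rho> i)) v \<partial>lborel)"
      unfolding eq by (auto simp: a_def \<rho>_def i indicator_def dist_norm intro!: nn_integral_cong)
    finally show ?thesis .
  qed
  \<comment> \<open>Vitali's lemma asks for bounded radii: a large average of a function of integral
    I forces \<rho>^n \<le> I / l, and \<rho> \<le> \<rho>^n once \<rho> > 1.\<close>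
  have "0 < \<rho> i \<and> \<rho> i \<le> max 1 (I / l)" if "i \<in> K" for i
  proof -
    have "ennreal (l * \<rho> i ^ ?n) \<le> (\<integral>\<^sup>+v. g v * indicator (cball (a i) (\<rho> i)) v \<partial>lborel)"
      by (rule avg) fact
    also have "\<dots> \<le> (\<integral>\<^sup>+v. g v \<partial>lborel)"
      by (intro nn_integral_mono) (auto simp: indicator_def)
    finally have "l * \<rho> i ^ ?n \<le> I" using I by simp
    then have *: "\<rho> i ^ ?n \<le> I / l" using lam by (simp add: field_simps)
    have "\<rho> i \<le> max 1 (I / l)"
    proof (cases "\<rho> i \<le> 1")
      case F: False
      then have "\<rho> i ^ 1 \<le> \<rho> i ^ ?n" by (intro power_increasing) (auto simp: Suc_leI)
      with * show ?thesis by auto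
    qed auto
    with \<rho>_pos show ?thesis by auto
  qed
  then obtain C where C: "countable C" "C \<subseteq> K"
     "pairwise (\<lambda>i j. disjnt (cball (a i) (\<rho> i)) (cball (a j) (\<rho> j))) C"
     "\<And>i. i \<in> K \<Longrightarrow> \<exists>j. j \<in> C \<and> \<not> disjnt (cball (a i) (\<rho> i)) (cball (a j) (\<rho> j)) \<and>
                        cball (a i) (\<rho> i) \<subseteq> ball (a j) (5 * \<rho> j)"
    by (rule Vitali_covering_lemma_cballs_balls[of K \<rho> "max 1 (I / l)" a]) blast+
  \<comment> \<open>When the scale of the ball of x exceeds that of the selected ball by more than
    M, the displacement of x is at most one radius of the selected ball and needs no ball of its
    own.\<close>
  define M where "M = \<lceil>log 2 (1 + norm y)\<rceil>"
  have log0: "0 \<le> log 2 (1 + norm y)" by (subst zero_le_log_cancel_iff) (auto intro: add_pos_nonneg)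
  then have M0: "0 \<le> M" unfolding M_def by simp
  \<comment> \<open>The index m is the difference of the two scales. It is at least -2, since a ball
    contained in the fivefold selected ball has radius below 2^3 times the selected one. The radius
    6 is 5 for the distance of the centres plus 1 for a displacement of at most one radius.\<close>
  define U where "U = (\<lambda>j. cball (a j) (6 * \<rho> j) \<union> (\<Union>m\<in>{-2..M}. cball (a j + (2 powr - real_of_int m * \<rho> j) *\<^sub>R y) (6 * \<rho> j)))"
  have Um [measurable]: "U j \<in> sets lborel" for j
    unfolding U_def by (intro sets.Un sets.finite_UN) auto
  have sub: "{x. ennreal l < maxop y g x} \<subseteq> (\<Union>j\<in>C. U j)"
  proof
    fix x assume "x \<in> {x. ennreal l < maxop y g x}"
    then obtain k where "ennreal l < ballavg k y g x" by (auto simp: maxop_def less_SUP_iff)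
    then have "(x, k) \<in> K" by (simp add: K_def)
    then obtain j where j: "j \<in> C" "cball (a (x,k)) (\<rho> (x,k)) \<subseteq> ball (a j) (5 * \<rho> j)"
      using C(4) by blast
    obtain x' k' where j': "j = (x', k')" by (cases j)
    have d: "dist (a (x,k)) (a j) + \<rho> (x,k) < 5 * \<rho> j"
      using j(2) \<rho>_pos[of "(x,k)"] by (auto simp: cball_subset_ball_iff)
    then have d1: "norm (a (x,k) - a j) \<le> 5 * \<rho> j" "\<rho> (x,k) < 8 * \<rho> j"
      using \<rho>_pos[of "(x,k)"] \<rho>_pos[of j] by (auto simp: dist_norm intro: less_imp_le) (smt (verit) zero_le_dist dist_norm)+
    from d1(2) have "2 powr (- real_of_int k) < 2 powr (3 - real_of_int k')"
      by (simp add: \<rho>_def j' powr_diff powr_minus field_simps)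
    then have m2: "- 2 \<le> k - k'" by (simp add: powr_less_cancel_iff)
    have x: "x - a j = (a (x,k) - a j) + (2 powr - real_of_int k) *\<^sub>R y" by (simp add: a_def)
    show "x \<in> (\<Union>j\<in>C. U j)"
    proof (cases "k - k' \<le> M")
      case True
      have "2 powr - real_of_int k = 2 powr - real_of_int (k - k') * \<rho> j"
        by (simp add: \<rho>_def j' flip: powr_add)
      then have "x - (a j + (2 powr - real_of_int (k - k') * \<rho> j) *\<^sub>R y) = a (x,k) - a j" using x by (simp add: algebra_simps)
      note eq = this
      have "norm (x - (a j + (2 powr - real_of_int (k - k') * \<rho> j) *\<^sub>R y)) \<le> 6 * \<rho> j"
        unfolding eq using d1 \<rho>_pos[of j] by linarith
      then have "x \<in> cball (a j + (2 powr - real_of_int (k - k') * \<rho> j) *\<^sub>R y) (6 * \<rho> j)"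
        unfolding mem_cball dist_norm by (subst norm_minus_commute)
      then show ?thesis using True m2 j(1) unfolding U_def by force
    next
      case F: False
      have "log 2 (1 + norm y) \<le> real_of_int (k - k')" using F unfolding M_def by linarith
      then have "1 + norm y \<le> 2 powr real_of_int (k - k')"
        by (subst (asm) log_le_iff) (auto intro: add_pos_nonneg)
      then have "norm y \<le> 2 powr real_of_int (k - k')" by simp
      then have "2 powr - real_of_int k * norm y \<le> 2 powr - real_of_int k * 2 powr real_of_int (k - k')"
        by (intro mult_left_mono) auto
      also have "\<dots> = \<rho> j" by (simp add: \<rho>_def j' flip: powr_add)
      finally have "norm (x - a j) \<le> 5 * \<rho> j + \<rho> j"
        unfolding x by (intro norm_triangle_mono d1) auto
      then have "x \<in> cball (a j) (6 * \<rho> j)" by (simp add: dist_norm norm_minus_commute)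
      then show ?thesis using j(1) unfolding U_def by auto
    qed
  qed
  have Ubound: "emeasure lborel (U j) \<le> ennreal (7 * 6 ^ ?n * ?V * logfac y * \<rho> j ^ ?n)" for j
  proof -
    have e: "emeasure lborel (cball c (6 * \<rho> j)) = ennreal (?V * (6 * \<rho> j) ^ ?n)" for c :: 'a
      using \<rho>_pos[of j] by (subst emeasure_cball) auto
    have "emeasure lborel (U j) \<le> emeasure lborel (cball (a j) (6 * \<rho> j)) + (\<Sum>m\<in>{-2..M}. emeasure lborel (cball (a j + (2 powr - real_of_int m * \<rho> j) *\<^sub>R y) (6 * \<rho> j)))"
      unfolding U_def by (intro order_trans[OF emeasure_subadditive] add_left_mono emeasure_subadditive_finite) auto
    also have "\<dots> = ennreal (real_of_int (M + 4) * (?V * (6 * \<rho> j) ^ ?n))"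
    proof -
      have "of_nat (nat (M + 3)) = ennreal (real_of_int (M + 3))" using M0 by (simp add: ennreal_of_nat_eq_real_of_nat)
      then show ?thesis
        unfolding e using M0 \<rho>_pos[of j] by (simp add: algebra_simps flip: ennreal_mult ennreal_plus)
    qed
    \<comment> \<open>There are \<open>M + 3\<close> displaced balls and one in place;
      \<open>M \<le> 2 * logfac y + 1\<close> because ln 2 \<ge> 1/2, and the remaining 5 is
      absorbed by \<open>1 \<le> logfac y\<close>.\<close>
    also have "\<dots> \<le> ennreal (7 * logfac y * (?V * (6 * \<rho> j) ^ ?n))"
    proof (intro ennreal_leI mult_right_mono)
      have "1 / 2 \<le> ln (2::real)" using ln2_ge_two_thirds by simp
      have "log 2 (1 + norm y) = ln (1 + norm y) / ln 2" by (simp add: log_def)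
      also have "\<dots> \<le> ln (1 + norm y) / (1/2)"
        using \<open>1 / 2 \<le> ln 2\<close> by (intro divide_left_mono) auto
      also have "ln (1 + norm y) \<le> logfac y"
        unfolding logfac_def by (subst ln_le_cancel_iff) (auto intro: add_pos_nonneg)
      finally have "log 2 (1 + norm y) \<le> 2 * logfac y" by simp
      moreover have "real_of_int M \<le> log 2 (1 + norm y) + 1" unfolding M_def by linarith
      ultimately show "real_of_int (M + 4) \<le> 7 * logfac y" using logfac_ge_1[of y] by simp
    qed (use \<rho>_pos[of j] in auto)
    finally show ?thesis by (simp add: power_mult_distrib mult_ac)
  qed
  have [measurable]: "{x. ennreal l < maxop y g x} \<in> sets lborel" by measurable
  have cball_m: "cball (a j) (\<rho> j) \<in> sets lborel" for j by simp
  have "emeasure lborel {x. ennreal l < maxop y g x} \<le> emeasure lborel (\<Union>j\<in>C. U j)"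
    by (rule emeasure_mono[OF sub sets.countable_UN''[OF C(1) Um]])
  also have "\<dots> \<le> (\<integral>\<^sup>+j. emeasure lborel (U j) \<partial>count_space C)"
    using C(1) by (intro emeasure_UN_countable_le Um)
  also have "\<dots> \<le> (\<integral>\<^sup>+j. ennreal (7 * 6 ^ ?n * ?V * logfac y / l) * (\<integral>\<^sup>+v. g v * indicator (cball (a j) (\<rho> j)) v \<partial>lborel) \<partial>count_space C)"
  proof (intro nn_integral_mono)
    fix j assume "j \<in> space (count_space C)"
    then have "j \<in> K" using C by auto
    have "7 * 6 ^ ?n * ?V * logfac y * \<rho> j ^ ?n = (7 * 6 ^ ?n * ?V * logfac y / l) * (l * \<rho> j ^ ?n)"
      using lam by simp
    then have "ennreal (7 * 6 ^ ?n * ?V * logfac y * \<rho> j ^ ?n) = ennreal (7 * 6 ^ ?n * ?V * logfac y / l) * ennreal (l * \<rho> j ^ ?n)"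
      using lam \<rho>_pos[of j] logfac_ge_1[of y] by (simp flip: ennreal_mult)
    with Ubound[of j] have "emeasure lborel (U j) \<le> ennreal (7 * 6 ^ ?n * ?V * logfac y / l) * ennreal (l * \<rho> j ^ ?n)"
      by simp
    also have "\<dots> \<le> ennreal (7 * 6 ^ ?n * ?V * logfac y / l) * (\<integral>\<^sup>+v. g v * indicator (cball (a j) (\<rho> j)) v \<partial>lborel)"
      by (intro mult_left_mono avg \<open>j \<in> K\<close>) auto
    finally show "emeasure lborel (U j) \<le> \<dots>" .
  qed
  also have "\<dots> = ennreal (7 * 6 ^ ?n * ?V * logfac y / l) * (\<integral>\<^sup>+j. (\<integral>\<^sup>+v. g v * indicator (cball (a j) (\<rho> j)) v \<partial>lborel) \<partial>count_space C)"
    by (rule nn_integral_cmult) auto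
  also have "\<dots> \<le> ennreal (7 * 6 ^ ?n * ?V * logfac y / l) * (\<integral>\<^sup>+v. g v \<partial>lborel)"
  proof (intro mult_left_mono nn_integral_disjoint_le C cball_m)
    fix i j x assume "i \<in> C" "j \<in> C" "x \<in> cball (a i) (\<rho> i)" "x \<in> cball (a j) (\<rho> j)"
    then show "i = j" using C(3) unfolding pairwise_def disjnt_def by blast
  qed auto
  finally show ?thesis .
qed

section \<open>From the weak type estimate to powers above 1\<close>

lemma epow_le_dyadic_sum:
  assumes a: "0 < a"
  shows "epow x a \<le> (\<integral>\<^sup>+i. ennreal (2 powr (real_of_int (i + 1) * a)) * (if ennreal (2 powr real_of_int i) < x then 1 else 0) \<partial>count_space (UNIV::int set))"
    (is "_ \<le> ?S")
proof -
  have ge: "ennreal (2 powr (real_of_int (i + 1) * a)) * (if ennreal (2 powr real_of_int i) < x then 1 else 0) \<le> ?S" for i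
    by (rule nn_integral_ge_point) simp
  consider "x = 0" | "x = top" | r where "0 < r" "x = ennreal r"
    by (metis epow_pos_real)
  then show ?thesis
  proof cases
    case 2
    have "of_nat n \<le> ?S" for n
    proof -
      define i where "i = \<lceil>log 2 (1 + real n) / a\<rceil>"
      have "log 2 (1 + real n) / a \<le> real_of_int i" unfolding i_def by linarith
      then have "log 2 (1 + real n) \<le> real_of_int i * a" using a by (simp add: field_simps)
      also have "\<dots> \<le> real_of_int (i + 1) * a" using a by (intro mult_right_mono) auto
      finally have "1 + real n \<le> 2 powr (real_of_int (i + 1) * a)" by (subst (asm) log_le_iff) auto
      then have "of_nat n \<le> ennreal (2 powr (real_of_int (i + 1) * a))"
        by (simp add: ennreal_of_nat_eq_real_of_nat)
      also have "\<dots> \<le> ?S" using ge[of i] 2 by (simp add: ennreal_less_top)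
      finally show ?thesis .
    qed
    then have "?S = top" by (rule ennreal_eq_topI)
    then show ?thesis by simp
  next
    case (3 r)
    define i where "i = \<lceil>log 2 r\<rceil> - 1"
    have "real_of_int i < log 2 r" "log 2 r \<le> real_of_int (i + 1)" unfolding i_def by linarith+
    then have i: "2 powr real_of_int i < r" "r \<le> 2 powr real_of_int (i + 1)"
      using 3 by (simp_all add: less_log_iff log_le_iff)
    have "epow x a \<le> ennreal ((2 powr real_of_int (i + 1)) powr a)"
      using 3 i a by (simp add: epow_ennreal powr_mono2)
    also have "\<dots> = ennreal (2 powr (real_of_int (i + 1) * a))" by (simp add: powr_powr)
    also have "\<dots> \<le> ?S" using ge[of i] 3 i by (simp add: ennreal_less_iff)
    finally show ?thesis .
  qed simp
qed

text \<open>The counterpart of \<open>epow_le_dyadic_sum\<close>: the geometric sum is controlled by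
  its largest term, about x^b. Together the two form a dyadic layer-cake formula. One is used with
  exponent a before the weak type estimate, the other with a - 1 after it, since the estimate
  contributes 1 / 2^i.\<close>

lemma geometric_int_below:
  assumes b: "0 < b"
  shows "(\<integral>\<^sup>+i. ennreal (2 powr (real_of_int i * b)) * (if ennreal (2 powr real_of_int i) < x then 1 else 0) \<partial>count_space (UNIV::int set))
    \<le> ennreal (2 powr b / (1 - 2 powr - b)) * epow x b" (is "?S \<le> _")
proof -
  have b1: "2 powr - b < (1::real)" using b by (simp add: powr_less_one)
  consider "x = 0" | "x = top" | r where "0 < r" "x = ennreal r"
    by (metis epow_pos_real)
  then show ?thesis
  proof cases
    case 2
    have "ennreal (2 powr b / (1 - 2 powr - b)) \<noteq> 0" using b1 by (simp add: ennreal_eq_0_iff not_le)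
    then have "ennreal (2 powr b / (1 - 2 powr - b)) * epow x b = top" using 2 by (simp add: ennreal_mult_eq_top_iff)
    then show ?thesis by simp
  next
    case (3 r)
    define i where "i = \<lceil>log 2 r\<rceil>"
    have "?S \<le> (\<integral>\<^sup>+j. ennreal (2 powr (real_of_int j * b)) * indicator {..i} j \<partial>count_space UNIV)"
    proof (intro nn_integral_mono mult_left_mono)
      fix j
      have "j \<le> i" if "2 powr real_of_int j < r"
      proof -
        have "real_of_int j < log 2 r" using 3 that by (simp add: less_log_iff)
        then show ?thesis unfolding i_def by linarith
      qed
      then show "(if ennreal (2 powr real_of_int j) < x then 1 else 0) \<le> (indicator {..i} j :: ennreal)"
        using 3 by (auto simp: ennreal_less_iff indicator_def)
    qed auto
    also have "\<dots> = (\<integral>\<^sup>+j. ennreal (2 powr (real_of_int j * b)) \<partial>count_space {..i})"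
      by (subst nn_integral_count_space_indicator) auto
    also have "\<dots> = (\<integral>\<^sup>+n. ennreal (2 powr (real_of_int (i - int n) * b)) \<partial>count_space UNIV)"
    proof -
      have "bij_betw (\<lambda>n. i - int n) UNIV {..i}"
        by (rule bij_betwI[of _ _ _ "\<lambda>j. nat (i - j)"]) auto
      from nn_integral_bij_count_space[OF this, of "\<lambda>j. ennreal (2 powr (real_of_int j * b))"]
      show ?thesis by simp
    qed
    also have "\<dots> = (\<integral>\<^sup>+n. ennreal (2 powr (real_of_int i * b)) * ennreal (2 powr (- real n * b)) \<partial>count_space UNIV)"
      by (intro nn_integral_cong) (simp add: algebra_simps flip: ennreal_mult powr_add)
    also have "\<dots> = ennreal (2 powr (real_of_int i * b)) * ennreal (1 / (1 - 2 powr - b))"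
      by (subst nn_integral_cmult, simp, subst geometric_nn_integral[OF b], simp)
    also have "\<dots> \<le> ennreal ((2 * r) powr b) * ennreal (1 / (1 - 2 powr - b))"
    proof (intro mult_right_mono ennreal_leI)
      have "real_of_int i \<le> log 2 r + 1" unfolding i_def by linarith
      also have "\<dots> = log 2 (2 * r)" using 3 by (simp add: log_mult)
      finally have "2 powr real_of_int i \<le> 2 * r" using 3 by (simp add: le_log_iff)
      then have "(2 powr real_of_int i) powr b \<le> (2 * r) powr b" using b by (intro powr_mono2) auto
      then show "2 powr (real_of_int i * b) \<le> (2 * r) powr b" by (simp add: powr_powr)
    qed auto
    also have "\<dots> = ennreal (2 powr b / (1 - 2 powr - b)) * epow x b"
      using 3 b1 by (simp add: epow_ennreal powr_mult flip: ennreal_mult)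
    finally show ?thesis .
  qed simp
qed

text \<open>The part of g not exceeding b contributes at most b times the volume of the unit ball.
  This is the bound on L^\<infinity>, with a constant free of y, in the form needed for
  interpolation.\<close>

lemma maxop_truncate:
  fixes y :: "'a::euclidean_space"
  assumes [measurable]: "g \<in> borel_measurable borel"
  shows "maxop y g x \<le> maxop y (\<lambda>v. if b < g v then g v else 0) x + b * ennreal (unit_ball_vol (real DIM('a)))"
  unfolding maxop_def
proof (rule SUP_least)
  fix k
  have "ballavg k y g x \<le> ballavg k y (\<lambda>v. (if b < g v then g v else 0) + b) x"
    by (intro ballavg_mono) (auto simp: not_less)
  also have "\<dots> = ballavg k y (\<lambda>v. if b < g v then g v else 0) x + b * ennreal (unit_ball_vol (real DIM('a)))"
    by (subst ballavg_add) (auto simp: ballavg_const)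
  also have "\<dots> \<le> (SUP k. ballavg k y (\<lambda>v. if b < g v then g v else 0) x) + b * ennreal (unit_ball_vol (real DIM('a)))"
    by (intro add_right_mono SUP_upper) simp
  finally show "ballavg k y g x \<le> \<dots>" .
qed

text \<open>Marcinkiewicz interpolation between the weak type estimate and the bound on
  L^\<infinity>. Only the former carries the logarithm, and it enters linearly; in norm this is the
  power 1/a of the logarithm.\<close>

lemma maxop_strong:
  assumes a: "1 < a"
  shows "\<exists>C>0. \<forall>(y::'a::euclidean_space) g. g \<in> borel_measurable borel \<longrightarrow>
     (\<integral>\<^sup>+x. epow (maxop y g x) a \<partial>lborel) \<le> ennreal (C * logfac y) * (\<integral>\<^sup>+x. epow (g x) a \<partial>lborel)"
proof -
  let ?V = "unit_ball_vol (real DIM('a))"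
  define W where "W = 7 * 6 ^ DIM('a) * ?V"
  define B where "B = 2 powr (a - 1) / (1 - 2 powr - (a - 1))"
  define C where "C = 2 * W * 2 powr a * B * (2 * ?V) powr (a - 1)"
  have V: "0 < ?V" by simp
  have V0: "?V \<noteq> 0" using V by linarith
  have W: "0 < W" by (simp add: W_def)
  have "2 powr - (a - 1) < (1::real)" using a by (simp add: powr_less_one)
  then have B: "0 < B" by (simp add: B_def)
  have C: "0 < C" unfolding C_def using V V0 W B by (intro mult_pos_pos) auto
  show ?thesis
  proof (intro exI[of _ C] conjI C allI impI)
    fix y :: 'a and g :: "'a \<Rightarrow> ennreal"
    assume [measurable]: "g \<in> borel_measurable borel"
    let ?i = "\<lambda>i. 2 powr real_of_int i"
    let ?W = "2 * W * logfac y * 2 powr a"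
    have level: "emeasure lborel {x. ennreal (?i i) < maxop y g x} \<le>
        ennreal (2 * W * logfac y / ?i i) * (\<integral>\<^sup>+v. (if ennreal (?i i) < ennreal (2 * ?V) * g v then g v else 0) \<partial>lborel)" for i
    proof -
      \<comment> \<open>The threshold is chosen so that the discarded part of g contributes at most
        half of the level 2^i; the retained part must then exceed the other half.\<close>
      define h where "h = (\<lambda>v. if ennreal (?i i / (2 * ?V)) < g v then g v else 0)"
      have [measurable]: "h \<in> borel_measurable borel" unfolding h_def by measurable
      have "{x. ennreal (?i i) < maxop y g x} \<subseteq> {x. ennreal (?i i / 2) < maxop y h x}"
      proof safe
        fix x assume *: "ennreal (?i i) < maxop y g x"
        show "ennreal (?i i / 2) < maxop y h x"
        proof (rule ccontr)
          assume "\<not> ennreal (?i i / 2) < maxop y h x"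
          then have "maxop y h x \<le> ennreal (?i i / 2)" by simp
          have "maxop y g x \<le> maxop y h x + ennreal (?i i / (2 * ?V)) * ennreal ?V"
            unfolding h_def by (rule maxop_truncate) measurable
          also have "\<dots> \<le> ennreal (?i i / 2) + ennreal (?i i / (2 * ?V)) * ennreal ?V"
            by (intro add_right_mono) fact
          also have "\<dots> = ennreal (?i i)" using V V0 by (simp flip: ennreal_mult ennreal_plus)
          finally show False using * by simp
        qed
      qed
      then have "emeasure lborel {x. ennreal (?i i) < maxop y g x} \<le> emeasure lborel {x. ennreal (?i i / 2) < maxop y h x}"
        by (intro emeasure_mono) measurable
      also have "\<dots> \<le> ennreal (7 * 6 ^ DIM('a) * ?V * logfac y / (?i i / 2)) * (\<integral>\<^sup>+x. h x \<partial>lborel)"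
        by (rule maxop_weak) auto
      also have "7 * 6 ^ DIM('a) * ?V * logfac y / (?i i / 2) = 2 * W * logfac y / ?i i"
        by (simp add: W_def)
      also have "ennreal (?i i / (2 * ?V)) < z \<longleftrightarrow> ennreal (?i i) < ennreal (2 * ?V) * z" for z
        using V V0 by (cases z) (auto simp: ennreal_less_iff field_simps ennreal_mult_top ennreal_top_mult simp flip: ennreal_mult)
      then have "(\<integral>\<^sup>+x. h x \<partial>lborel) = (\<integral>\<^sup>+v. (if ennreal (?i i) < ennreal (2 * ?V) * g v then g v else 0) \<partial>lborel)"
        by (simp add: h_def)
      finally show ?thesis .
    qed
    have "(\<integral>\<^sup>+x. epow (maxop y g x) a \<partial>lborel) \<le>
      (\<integral>\<^sup>+x. (\<integral>\<^sup>+i. ennreal (2 powr (real_of_int (i + 1) * a)) * (if ennreal (?i i) < maxop y g x then 1 else 0) \<partial>count_space (UNIV::int set)) \<partial>lborel)"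
      using a by (intro nn_integral_mono epow_le_dyadic_sum) auto
    also have "\<dots> = (\<integral>\<^sup>+i. (\<integral>\<^sup>+x. ennreal (2 powr (real_of_int (i + 1) * a)) * (if ennreal (?i i) < maxop y g x then 1 else 0) \<partial>lborel) \<partial>count_space (UNIV::int set))"
      by (intro nn_integral_count_space_nn_integral) auto
    also have "\<dots> \<le> (\<integral>\<^sup>+i. (\<integral>\<^sup>+v. ennreal ?W * (g v * (ennreal (2 powr (real_of_int i * (a - 1))) * (if ennreal (?i i) < ennreal (2 * ?V) * g v then 1 else 0))) \<partial>lborel) \<partial>count_space (UNIV::int set))"
    proof (rule nn_integral_mono)
      fix i :: int
      have "(\<integral>\<^sup>+x. ennreal (2 powr (real_of_int (i + 1) * a)) * (if ennreal (?i i) < maxop y g x then 1 else 0) \<partial>lborel)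
        = (\<integral>\<^sup>+x. ennreal (2 powr (real_of_int (i + 1) * a)) * indicator {x. ennreal (?i i) < maxop y g x} x \<partial>lborel)"
        by (intro nn_integral_cong) (auto simp: indicator_def)
      also have "\<dots> = ennreal (2 powr (real_of_int (i + 1) * a)) * emeasure lborel {x. ennreal (?i i) < maxop y g x}"
        by (subst nn_integral_cmult_indicator) auto
      also have "\<dots> \<le> ennreal (2 powr (real_of_int (i + 1) * a)) * (ennreal (2 * W * logfac y / ?i i) * (\<integral>\<^sup>+v. (if ennreal (?i i) < ennreal (2 * ?V) * g v then g v else 0) \<partial>lborel))"
        by (intro mult_left_mono level) auto
      also have "\<dots> = (ennreal ?W * ennreal (2 powr (real_of_int i * (a - 1)))) * (\<integral>\<^sup>+v. (if ennreal (?i i) < ennreal (2 * ?V) * g v then g v else 0) \<partial>lborel)"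
      proof -
        have "2 powr (real_of_int (i + 1) * a) * (2 * W * logfac y / ?i i) = ?W * 2 powr (real_of_int i * (a - 1))"
          by (simp add: algebra_simps powr_add powr_diff)
        then show ?thesis
          using W logfac_ge_1[of y] by (simp add: mult.assoc[symmetric] flip: ennreal_mult)
      qed
      also have "\<dots> = (\<integral>\<^sup>+v. (ennreal ?W * ennreal (2 powr (real_of_int i * (a - 1)))) * (if ennreal (?i i) < ennreal (2 * ?V) * g v then g v else 0) \<partial>lborel)"
        by (rule nn_integral_cmult[symmetric]) measurable
      also have "\<dots> = (\<integral>\<^sup>+v. ennreal ?W * (g v * (ennreal (2 powr (real_of_int i * (a - 1))) * (if ennreal (?i i) < ennreal (2 * ?V) * g v then 1 else 0))) \<partial>lborel)"
        by (intro nn_integral_cong) (simp add: mult_ac)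
      finally show "(\<integral>\<^sup>+x. ennreal (2 powr (real_of_int (i + 1) * a)) * (if ennreal (?i i) < maxop y g x then 1 else 0) \<partial>lborel) \<le> \<dots>" .
    qed
    also have "\<dots> = (\<integral>\<^sup>+v. (\<integral>\<^sup>+i. ennreal ?W * (g v * (ennreal (2 powr (real_of_int i * (a - 1))) * (if ennreal (?i i) < ennreal (2 * ?V) * g v then 1 else 0))) \<partial>count_space (UNIV::int set)) \<partial>lborel)"
      by (intro nn_integral_count_space_nn_integral[symmetric]) auto
    also have "\<dots> \<le> (\<integral>\<^sup>+v. ennreal ?W * ennreal (B * (2 * ?V) powr (a - 1)) * epow (g v) a \<partial>lborel)"
    proof (intro nn_integral_mono)
      fix v
      have "(\<integral>\<^sup>+i. ennreal ?W * (g v * (ennreal (2 powr (real_of_int i * (a - 1))) * (if ennreal (?i i) < ennreal (2 * ?V) * g v then 1 else 0))) \<partial>count_space (UNIV::int set))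
         = ennreal ?W * (g v * (\<integral>\<^sup>+i. ennreal (2 powr (real_of_int i * (a - 1))) * (if ennreal (?i i) < ennreal (2 * ?V) * g v then 1 else 0) \<partial>count_space (UNIV::int set)))"
        by (subst nn_integral_cmult, simp, subst nn_integral_cmult, simp_all)
      also have "\<dots> \<le> ennreal ?W * (g v * (ennreal B * epow (ennreal (2 * ?V) * g v) (a - 1)))"
        unfolding B_def using a by (intro mult_left_mono geometric_int_below) auto
      also have "\<dots> = ennreal ?W * ennreal (B * (2 * ?V) powr (a - 1)) * (epow (g v) 1 * epow (g v) (a - 1))"
      proof -
        have "epow (ennreal (2 * ?V) * g v) (a - 1) = ennreal ((2 * ?V) powr (a - 1)) * epow (g v) (a - 1)"
          by (subst epow_mult, subst epow_ennreal) auto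
        moreover have "ennreal (B * (2 * ?V) powr (a - 1)) = ennreal B * ennreal ((2 * ?V) powr (a - 1))"
          using B by (intro ennreal_mult) auto
        ultimately show ?thesis by (simp only: epow_one mult_ac)
      qed
      also have "epow (g v) 1 * epow (g v) (a - 1) = epow (g v) a"
        by (simp only: epow_add[symmetric]) simp
      finally show "(\<integral>\<^sup>+i. ennreal ?W * (g v * (ennreal (2 powr (real_of_int i * (a - 1))) * (if ennreal (?i i) < ennreal (2 * ?V) * g v then 1 else 0))) \<partial>count_space (UNIV::int set))
         \<le> ennreal ?W * ennreal (B * (2 * ?V) powr (a - 1)) * epow (g v) a" .
    qed
    also have "\<dots> = ennreal (C * logfac y) * (\<integral>\<^sup>+x. epow (g x) a \<partial>lborel)"
    proof -
      have "ennreal ?W * ennreal (B * (2 * ?V) powr (a - 1)) = ennreal (C * logfac y)"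
        using W B V logfac_ge_1[of y] by (simp add: C_def mult_ac flip: ennreal_mult)
      then show ?thesis by (subst nn_integral_cmult) auto
    qed
    finally show "(\<integral>\<^sup>+x. epow (maxop y g x) a \<partial>lborel) \<le> ennreal (C * logfac y) * (\<integral>\<^sup>+x. epow (g x) a \<partial>lborel)" .
  qed
qed

text \<open>The dilations j are summed by Jensen's inequality against the weights 2^(-j (L - n)).
  For each j the supremum over k is at most \<open>maxop\<close> with the shorter shift 2^-j y,
  whose logarithm is no larger.\<close>

lemma shiftavg_maximal:
  assumes a: "1 < a" and L: "real DIM('a) < L"
  shows "\<exists>C>0. \<forall>(y::'a::euclidean_space) g. g \<in> borel_measurable borel \<longrightarrow>
     (\<integral>\<^sup>+x. epow (SUP k. shiftavg L k y g x) a \<partial>lborel) \<le> ennreal (C * logfac y) * (\<integral>\<^sup>+x. epow (g x) a \<partial>lborel)"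
proof -
  obtain C0 where C0: "0 < C0" and strong: "\<And>(y::'a) g. g \<in> borel_measurable borel \<Longrightarrow>
     (\<integral>\<^sup>+x. epow (maxop y g x) a \<partial>lborel) \<le> ennreal (C0 * logfac y) * (\<integral>\<^sup>+x. epow (g x) a \<partial>lborel)"
    using maxop_strong[OF a, where 'a='a] by blast
  let ?b = "L - DIM('a)"
  have L0: "0 < L" using L DIM_positive[where 'a='a] by linarith
  define S where "S = 1 / (1 - 2 powr - ?b)"
  have "2 powr - ?b < (1::real)" using L by (simp add: powr_less_one)
  then have S: "0 < S" by (simp add: S_def)
  have geom: "(\<integral>\<^sup>+j. ennreal (2 powr (- real j * ?b)) \<partial>count_space UNIV) = ennreal S"
    unfolding S_def using L by (intro geometric_nn_integral) simp
  define C where "C = (2 powr L) powr a * (2 powr a * S powr (a - 1)) * (C0 * S)"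
  have C: "0 < C" using C0 S by (simp add: C_def)
  show ?thesis
  proof (intro exI[of _ C] conjI C allI impI)
    fix y :: 'a and g :: "'a \<Rightarrow> ennreal"
    assume [measurable]: "g \<in> borel_measurable borel"
    let ?y = "\<lambda>j::nat. (2 powr - real j) *\<^sub>R y"
    let ?c = "\<lambda>j::nat. ennreal (2 powr (- real j * ?b))"
    let ?K = "ennreal ((2 powr L) powr a * (2 powr a * S powr (a - 1)))"
    have pt: "epow (SUP k. shiftavg L k y g x) a \<le> ?K * (\<integral>\<^sup>+j. ?c j * epow (maxop (?y j) g x) a \<partial>count_space UNIV)" for x
    proof -
      have "(SUP k. shiftavg L k y g x) \<le> ennreal (2 powr L) * (\<integral>\<^sup>+j. ?c j * maxop (?y j) g x \<partial>count_space UNIV)"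
      proof (rule SUP_least)
        fix k
        have "shiftavg L k y g x \<le> ennreal (2 powr L) * (\<integral>\<^sup>+j. ?c j * ballavg (k - int j) (?y j) g x \<partial>count_space UNIV)"
          using L0 by (intro shiftavg_le_ballavg) auto
        also have "\<dots> \<le> ennreal (2 powr L) * (\<integral>\<^sup>+j. ?c j * maxop (?y j) g x \<partial>count_space UNIV)"
          by (intro mult_left_mono nn_integral_mono ballavg_le_maxop) auto
        finally show "shiftavg L k y g x \<le> \<dots>" .
      qed
      then have "epow (SUP k. shiftavg L k y g x) a \<le> epow (ennreal (2 powr L) * (\<integral>\<^sup>+j. maxop (?y j) g x * ?c j \<partial>count_space UNIV)) a"
        using a by (intro epow_mono) (auto simp: mult.commute)
      also have "\<dots> = ennreal ((2 powr L) powr a) * epow (\<integral>\<^sup>+j. maxop (?y j) g x * ?c j \<partial>count_space UNIV) a"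
        by (simp add: epow_mult epow_ennreal)
      also have "\<dots> \<le> ennreal ((2 powr L) powr a) * (epow 2 a * (epow (\<integral>\<^sup>+j. ?c j \<partial>count_space UNIV) (a - 1) * (\<integral>\<^sup>+j. epow (maxop (?y j) g x) a * ?c j \<partial>count_space UNIV)))"
        using a by (intro mult_left_mono nn_integral_Jensen) auto
      also have "\<dots> = ?K * (\<integral>\<^sup>+j. ?c j * epow (maxop (?y j) g x) a \<partial>count_space UNIV)"
      proof -
        have comm: "(\<integral>\<^sup>+j. epow (maxop (?y j) g x) a * ?c j \<partial>count_space UNIV) = (\<integral>\<^sup>+j. ?c j * epow (maxop (?y j) g x) a \<partial>count_space UNIV)"
          by (intro nn_integral_cong mult.commute)
        show ?thesis unfolding geom comm using S epow_ennreal[of 2 a] by (simp add: epow_ennreal ennreal_mult mult.assoc)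
      qed
      finally show ?thesis .
    qed
    have "(\<integral>\<^sup>+x. epow (SUP k. shiftavg L k y g x) a \<partial>lborel) \<le> (\<integral>\<^sup>+x. ?K * (\<integral>\<^sup>+j. ?c j * epow (maxop (?y j) g x) a \<partial>count_space UNIV) \<partial>lborel)"
      by (intro nn_integral_mono pt)
    also have "\<dots> = ?K * (\<integral>\<^sup>+j. ?c j * (\<integral>\<^sup>+x. epow (maxop (?y j) g x) a \<partial>lborel) \<partial>count_space UNIV)"
      by (subst nn_integral_cmult) (auto simp: nn_integral_count_space_nn_integral nn_integral_cmult)
    also have "\<dots> \<le> ?K * (\<integral>\<^sup>+j. ?c j * (ennreal (C0 * logfac y) * (\<integral>\<^sup>+x. epow (g x) a \<partial>lborel)) \<partial>count_space UNIV)"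
    proof (intro mult_left_mono nn_integral_mono)
      fix j :: nat
      have "(\<integral>\<^sup>+x. epow (maxop (?y j) g x) a \<partial>lborel) \<le> ennreal (C0 * logfac (?y j)) * (\<integral>\<^sup>+x. epow (g x) a \<partial>lborel)"
        by (intro strong) measurable
      also have "\<dots> \<le> ennreal (C0 * logfac y) * (\<integral>\<^sup>+x. epow (g x) a \<partial>lborel)"
      proof (intro mult_right_mono ennreal_leI mult_left_mono logfac_mono)
        have "2 powr - real j \<le> (2::real) powr 0" by (intro powr_mono) auto
        then show "norm (?y j) \<le> norm y" by (simp add: mult_left_le_one_le)
      qed (use C0 in auto)
      finally show "(\<integral>\<^sup>+x. epow (maxop (?y j) g x) a \<partial>lborel) \<le> ennreal (C0 * logfac y) * (\<integral>\<^sup>+x. epow (g x) a \<partial>lborel)" .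
    qed auto
    also have "\<dots> = ?K * (ennreal S * (ennreal (C0 * logfac y) * (\<integral>\<^sup>+x. epow (g x) a \<partial>lborel)))"
      unfolding geom[symmetric] by (subst nn_integral_multc) auto
    also have "\<dots> = ennreal (C * logfac y) * (\<integral>\<^sup>+x. epow (g x) a \<partial>lborel)"
      using S C0 logfac_ge_1[of y] by (simp add: C_def ennreal_mult mult_ac)
    finally show "(\<integral>\<^sup>+x. epow (SUP k. shiftavg L k y g x) a \<partial>lborel) \<le> ennreal (C * logfac y) * (\<integral>\<^sup>+x. epow (g x) a \<partial>lborel)" .
  qed
qed

section \<open>Vector-valued inequalities\<close>

lemma shiftavg_mono: "(\<And>v. g v \<le> h v) \<Longrightarrow> shiftavg L k y g x \<le> shiftavg L k y h x"
  unfolding shiftavg_def by (intro nn_integral_mono mult_right_mono) auto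

lemma shiftavg_const: "shiftavg L k (y::'a::euclidean_space) (\<lambda>_. c) x = c * kmass TYPE('a) L"
  unfolding shiftavg_def by (subst nn_integral_cmult) (auto simp: nn_integral_kern)

lemma shiftavg_sum:
  assumes [measurable]: "\<And>k::int. g k \<in> borel_measurable borel"
  shows "shiftavg L j y (\<lambda>v. \<integral>\<^sup>+k. g k v \<partial>count_space UNIV) x = (\<integral>\<^sup>+k. shiftavg L j y (g k) x \<partial>count_space UNIV)"
proof -
  have "shiftavg L j y (\<lambda>v. \<integral>\<^sup>+k. g k v \<partial>count_space UNIV) x = (\<integral>\<^sup>+v. (\<integral>\<^sup>+k. g k v * ennreal (kern L j y (x - v)) \<partial>count_space UNIV) \<partial>lborel)"
    unfolding shiftavg_def by (intro nn_integral_cong) (simp add: nn_integral_multc)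
  also have "\<dots> = (\<integral>\<^sup>+k. shiftavg L j y (g k) x \<partial>count_space UNIV)"
    unfolding shiftavg_def by (intro nn_integral_count_space_nn_integral) auto
  finally show ?thesis .
qed

lemma nn_integral_shiftavg:
  fixes y :: "'a::euclidean_space"
  assumes [measurable]: "g \<in> borel_measurable borel"
  shows "(\<integral>\<^sup>+x. shiftavg L k y g x \<partial>lborel) = kmass TYPE('a) L * (\<integral>\<^sup>+x. g x \<partial>lborel)"
  using shiftavg_adjoint[OF assms, of "\<lambda>_. 1" L k y]
  by (simp add: shiftavg_const nn_integral_multc mult.commute)

lemma shiftavg_Jensen:
  fixes y :: "'a::euclidean_space"
  assumes [measurable]: "g \<in> borel_measurable borel" and a: "1 \<le> a"
  shows "epow (shiftavg L k y g x) a \<le> epow 2 a * (epow (kmass TYPE('a) L) (a - 1) * shiftavg L k y (\<lambda>v. epow (g v) a) x)"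
  unfolding shiftavg_def nn_integral_kern[of L k y x, symmetric] using a by (intro nn_integral_Jensen) auto

lemma shiftavg_Hoelder:
  fixes y :: "'a::euclidean_space"
  assumes [measurable]: "g \<in> borel_measurable borel" "h \<in> borel_measurable borel" and "0 < \<theta>" "\<theta> < 1"
  shows "shiftavg L k y (\<lambda>v. epow (g v) \<theta> * epow (h v) (1 - \<theta>)) x \<le> 2 * (epow (shiftavg L k y g x) \<theta> * epow (shiftavg L k y h x) (1 - \<theta>))"
proof -
  have "shiftavg L k y (\<lambda>v. epow (g v) \<theta> * epow (h v) (1 - \<theta>)) x =
    (\<integral>\<^sup>+v. epow (g v * ennreal (kern L k y (x - v))) \<theta> * epow (h v * ennreal (kern L k y (x - v))) (1 - \<theta>) \<partial>lborel)"
    unfolding shiftavg_def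
  proof (intro nn_integral_cong)
    fix v
    have "ennreal (kern L k y (x - v)) = epow (ennreal (kern L k y (x - v))) \<theta> * epow (ennreal (kern L k y (x - v))) (1 - \<theta>)"
      by (simp flip: epow_add)
    then show "epow (g v) \<theta> * epow (h v) (1 - \<theta>) * ennreal (kern L k y (x - v)) =
       epow (g v * ennreal (kern L k y (x - v))) \<theta> * epow (h v * ennreal (kern L k y (x - v))) (1 - \<theta>)"
      by (simp only: epow_mult mult_ac)
  qed
  also have "\<dots> \<le> 2 * (epow (shiftavg L k y g x) \<theta> * epow (shiftavg L k y h x) (1 - \<theta>))"
    unfolding shiftavg_def using assms by (intro nn_integral_Hoelder) auto
  finally show ?thesis .
qed

lemma kmass_real:
  assumes L: "real DIM('a::euclidean_space) < L"
  obtains m where "0 < m" "kmass TYPE('a) L = ennreal m"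
proof -
  have "kmass TYPE('a) L \<noteq> 0"
  proof
    assume "kmass TYPE('a) L = 0"
    then have "AE w in lborel. ennreal ((1 + norm (w::'a)) powr - L) = 0"
      unfolding kmass_def by (subst (asm) nn_integral_0_iff_AE) auto
    then have "AE w in lborel. (w::'a) \<in> {}"
    proof (rule AE_mp, intro AE_I2 impI)
      fix w :: 'a assume "ennreal ((1 + norm w) powr - L) = 0"
      moreover have "0 < (1 + norm w) powr - L" by (simp add: add_pos_nonneg add_nonneg_eq_0_iff)
      ultimately show "w \<in> {}" by (simp add: ennreal_eq_0_iff)
    qed
    then show False by (simp add: AE_iff_null null_sets_def emeasure_lborel_UNIV)
  qed
  moreover have "kmass TYPE('a) L \<noteq> top" using kmass_finite[OF L] by simp
  ultimately show ?thesis using epow_pos_real that by metis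
qed

text \<open>Jensen against a kernel of fixed mass; integration over x then forgets the shift, so
  neither k nor y enters the constant.\<close>

lemma shiftavg_Lp:
  assumes L: "real DIM('a::euclidean_space) < L" and a: "1 \<le> a"
  shows "\<exists>C>0. \<forall>(y::'a) k g. g \<in> borel_measurable borel \<longrightarrow>
     (\<integral>\<^sup>+x. epow (shiftavg L k y g x) a \<partial>lborel) \<le> ennreal C * (\<integral>\<^sup>+x. epow (g x) a \<partial>lborel)"
proof -
  obtain m where m: "0 < m" "kmass TYPE('a) L = ennreal m" using kmass_real[OF L] .
  define C where "C = 2 powr a * m powr (a - 1) * m"
  show ?thesis
  proof (intro exI[of _ C] conjI allI impI)
    show "0 < C" using m by (simp add: C_def)
    fix y :: 'a and k and g :: "'a \<Rightarrow> ennreal" assume [measurable]: "g \<in> borel_measurable borel"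
    have "(\<integral>\<^sup>+x. epow (shiftavg L k y g x) a \<partial>lborel) \<le> (\<integral>\<^sup>+x. epow 2 a * (epow (kmass TYPE('a) L) (a - 1) * shiftavg L k y (\<lambda>v. epow (g v) a) x) \<partial>lborel)"
      by (intro nn_integral_mono shiftavg_Jensen a) auto
    also have "\<dots> = epow 2 a * (epow (kmass TYPE('a) L) (a - 1) * (kmass TYPE('a) L * (\<integral>\<^sup>+x. epow (g x) a \<partial>lborel)))"
      by (subst nn_integral_cmult, simp, subst nn_integral_cmult, simp) (simp add: nn_integral_shiftavg)
    also have "\<dots> = ennreal C * (\<integral>\<^sup>+x. epow (g x) a \<partial>lborel)"
      using m epow_ennreal[of 2 a] by (simp add: C_def epow_ennreal ennreal_mult mult_ac)
    finally show "(\<integral>\<^sup>+x. epow (shiftavg L k y g x) a \<partial>lborel) \<le> ennreal C * (\<integral>\<^sup>+x. epow (g x) a \<partial>lborel)" .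
  qed
qed

section \<open>Mixed norms over all scales\<close>

lemma epow_ge_point: "0 < a \<Longrightarrow> g k \<le> epow (\<integral>\<^sup>+k. epow (g k) a \<partial>count_space UNIV) (1 / a)"
  by (subst epow_le_swap[symmetric]) (auto intro: nn_integral_ge_point)

text \<open>An explicit Calderon factorisation of l^Q between l^P and l^\<infinity>. G plays the
  constant l^\<infinity> factor, and \<theta> is determined by (1 - \<theta>) Q = P, which for
  finite positive G makes the P-th powers of h sum to G^(Q - \<theta> Q) = G^P. Where G is infinite,
  h is set to infinity and both bounds are trivial.\<close>

lemma Hoelder_factor:
  fixes g :: "int \<Rightarrow> ennreal"
  assumes PQ: "0 < P" "P < Q" and \<theta>: "\<theta> = 1 - P / Q"
    and G: "G = epow (\<integral>\<^sup>+k. epow (g k) Q \<partial>count_space UNIV) (1 / Q)"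
    and h: "h = (\<lambda>k. if G = top then top else epow (epow (g k) Q / epow G (\<theta> * Q)) (1 / P))"
  shows "g k \<le> epow (h k) (1 - \<theta>) * epow G \<theta>"
    and "(\<integral>\<^sup>+k. epow (h k) P \<partial>count_space UNIV) \<le> epow G P"
proof -
  have gG: "g k \<le> G" for k unfolding G using PQ by (intro epow_ge_point) auto
  have exps: "(1 - \<theta>) / P = 1 / Q" "Q - \<theta> * Q = P" using PQ by (auto simp: \<theta> field_simps)
  consider "G = top" | "G = 0" | r where "0 < r" "G = ennreal r" by (metis epow_pos_real)
  then have "g k \<le> epow (h k) (1 - \<theta>) * epow G \<theta> \<and> (\<integral>\<^sup>+k. epow (h k) P \<partial>count_space UNIV) \<le> epow G P"
  proof cases
    case 1
    then show ?thesis by (simp add: h)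
  next
    case 2
    then have "g k = 0" for k using gG[of k] by simp
    then show ?thesis using 2 by (simp add: h)
  next
    case (3 r)
    have hP: "epow (h k) P = epow (g k) Q * ennreal (r powr (- \<theta> * Q))" for k
      using 3 PQ by (simp add: h epow_epow epow_ennreal divide_ennreal_def inverse_ennreal powr_minus)
    have "g k < top" using gG[of k] 3 by (simp add: le_less_trans)
    then obtain u where u: "0 \<le> u" "g k = ennreal u" by (cases "g k") auto
    have hk: "h k = ennreal ((u powr Q / r powr (\<theta> * Q)) powr (1/P))"
      using 3 u by (simp add: h epow_ennreal divide_ennreal)
    have "((u powr Q / r powr (\<theta> * Q)) powr (1/P)) powr (1 - \<theta>) = (u powr Q / r powr (\<theta> * Q)) powr ((1 - \<theta>) / P)"
      by (simp add: powr_powr)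
    also have "\<dots> = u / r powr \<theta>"
      unfolding exps using u 3 PQ by (simp add: powr_divide powr_powr)
    finally have "epow (h k) (1 - \<theta>) * epow G \<theta> = ennreal (u / r powr \<theta>) * ennreal (r powr \<theta>)"
      using 3 by (simp add: hk epow_ennreal)
    also have "\<dots> = g k" using 3 u by (simp flip: ennreal_mult)
    finally have A: "g k \<le> epow (h k) (1 - \<theta>) * epow G \<theta>" by simp
    have "(\<integral>\<^sup>+k. epow (h k) P \<partial>count_space UNIV) = epow G Q * ennreal (r powr (- \<theta> * Q))"
      unfolding hP G using PQ by (simp add: nn_integral_multc epow_epow)
    also have "\<dots> = epow G P"
      using 3 exps by (simp add: epow_ennreal flip: ennreal_mult powr_add)
    finally show ?thesis using A by simp
  qed
  then show "g k \<le> epow (h k) (1 - \<theta>) * epow G \<theta>"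
    and "(\<integral>\<^sup>+k. epow (h k) P \<partial>count_space UNIV) \<le> epow G P" by auto
qed

text \<open>Factor \<open>g\<^sub>k\<close> into powers of \<open>h\<^sub>k\<close> and G, where G is the \<open>\<ell>\<^sup>Q\<close> norm of the sequence and the P-th powers
  of the \<open>h\<^sub>k\<close> sum to at most that of G: each \<open>h\<^sub>k\<close> needs only the scalar bound, and the maximal theorem
  enters through the factor G alone.\<close>
lemma vector_shiftavg_lt:
  assumes L: "real DIM('a::euclidean_space) < L" and PQ: "1 < P" "P < Q"
  shows "\<exists>C>0. \<forall>(y::'a) g. (\<forall>k::int. g k \<in> borel_measurable borel) \<longrightarrow>
     (\<integral>\<^sup>+x. epow (\<integral>\<^sup>+k. epow (shiftavg L k y (g k) x) Q \<partial>count_space UNIV) (P / Q) \<partial>lborel)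
       \<le> ennreal (C * logfac y powr (1 - P / Q)) * (\<integral>\<^sup>+x. epow (\<integral>\<^sup>+k. epow (g k x) Q \<partial>count_space UNIV) (P / Q) \<partial>lborel)"
proof -
  obtain C1 where C1: "0 < C1" and mx: "\<And>(y::'a) g. g \<in> borel_measurable borel \<Longrightarrow>
     (\<integral>\<^sup>+x. epow (SUP k. shiftavg L k y g x) P \<partial>lborel) \<le> ennreal (C1 * logfac y) * (\<integral>\<^sup>+x. epow (g x) P \<partial>lborel)"
    using shiftavg_maximal[OF PQ(1) L] by blast
  obtain C2 where C2: "0 < C2" and lp: "\<And>(y::'a) k g. g \<in> borel_measurable borel \<Longrightarrow>
     (\<integral>\<^sup>+x. epow (shiftavg L k y g x) P \<partial>lborel) \<le> ennreal C2 * (\<integral>\<^sup>+x. epow (g x) P \<partial>lborel)"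
    using shiftavg_Lp[OF L, of P] PQ by auto
  define \<theta> where "\<theta> = 1 - P / Q"
  have \<theta>: "0 < \<theta>" "\<theta> < 1" "0 < 1 - \<theta>" "1 - \<theta> < 1" using PQ by (auto simp: \<theta>_def field_simps)
  have ex: "(1 - \<theta>) * Q = P" "P / Q = 1 - \<theta>" using PQ by (auto simp: \<theta>_def)
  define C where "C = 2 powr P * 2 * C1 powr \<theta> * C2 powr (1 - \<theta>)"
  show ?thesis
  proof (intro exI[of _ C] conjI allI impI)
    show "0 < C" using C1 C2 by (simp add: C_def)
    fix y :: 'a and g :: "int \<Rightarrow> 'a \<Rightarrow> ennreal" assume m: "\<forall>k. g k \<in> borel_measurable borel"
    then have [measurable]: "g k \<in> borel_measurable borel" for k by blast
    define G where "G x = epow (\<integral>\<^sup>+k. epow (g k x) Q \<partial>count_space UNIV) (1 / Q)" for x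
    define h where "h k x = (if G x = top then top else epow (epow (g k x) Q / epow (G x) (\<theta> * Q)) (1 / P))" for k x
    have [measurable]: "G \<in> borel_measurable borel" unfolding G_def by measurable
    have [measurable]: "h k \<in> borel_measurable borel" for k unfolding h_def by measurable
    have f1: "g k x \<le> epow (h k x) (1 - \<theta>) * epow (G x) \<theta>" for k x
      using PQ by (intro Hoelder_factor(1)[where P=P and Q=Q and g="\<lambda>k. g k x" and h="\<lambda>k. h k x"]) (auto simp: \<theta>_def G_def h_def)
    have f2: "(\<integral>\<^sup>+k. epow (h k x) P \<partial>count_space UNIV) \<le> epow (G x) P" for x
      using PQ by (intro Hoelder_factor(2)[where Q=Q and g="\<lambda>k. g k x"]) (auto simp: \<theta>_def G_def h_def)
    define M where "M x = (SUP k. shiftavg L k y G x)" for x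
    define D where "D x = (\<integral>\<^sup>+k. epow (shiftavg L k y (h k) x) P \<partial>count_space UNIV)" for x
    have [measurable]: "M \<in> borel_measurable borel" unfolding M_def by measurable
    have [measurable]: "D \<in> borel_measurable borel" unfolding D_def by measurable
    \<comment> \<open>Hoelder with respect to the kernel separates the two factors. Replacing the
      average of G by its supremum over all scales makes that factor independent of k, so that only
      the averages of h remain under the sum.\<close>
    have trm: "epow (shiftavg L k y (g k) x) Q \<le> epow 2 Q * epow (M x) (\<theta> * Q) * epow (shiftavg L k y (h k) x) P" for k x
    proof -
      have "shiftavg L k y (g k) x \<le> shiftavg L k y (\<lambda>v. epow (h k v) (1 - \<theta>) * epow (G v) (1 - (1 - \<theta>))) x"
        using f1 by (intro shiftavg_mono) simp
      also have "\<dots> \<le> 2 * (epow (shiftavg L k y (h k) x) (1 - \<theta>) * epow (shiftavg L k y G x) (1 - (1 - \<theta>)))"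
        by (intro shiftavg_Hoelder \<theta>) measurable
      also have "\<dots> \<le> 2 * (epow (shiftavg L k y (h k) x) (1 - \<theta>) * epow (M x) \<theta>)"
        using \<theta> unfolding M_def by (intro mult_left_mono) (auto intro!: epow_mono SUP_upper)
      finally have "epow (shiftavg L k y (g k) x) Q \<le> epow (2 * (epow (shiftavg L k y (h k) x) (1 - \<theta>) * epow (M x) \<theta>)) Q"
        using PQ by (intro epow_mono) auto
      also have "\<dots> = epow 2 Q * epow (M x) (\<theta> * Q) * epow (shiftavg L k y (h k) x) P"
        by (simp only: epow_mult epow_epow ex(1)) (simp only: mult_ac)
      finally show ?thesis .
    qed
    have pt: "epow (\<integral>\<^sup>+k. epow (shiftavg L k y (g k) x) Q \<partial>count_space UNIV) (P / Q) \<le> epow 2 P * (epow (epow (M x) P) \<theta> * epow (D x) (1 - \<theta>))" for x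
    proof -
      have "(\<integral>\<^sup>+k. epow (shiftavg L k y (g k) x) Q \<partial>count_space UNIV) \<le> epow 2 Q * epow (M x) (\<theta> * Q) * D x"
        unfolding D_def by (subst nn_integral_cmult[symmetric], simp, intro nn_integral_mono trm)
      then have "epow (\<integral>\<^sup>+k. epow (shiftavg L k y (g k) x) Q \<partial>count_space UNIV) (P / Q) \<le> epow (epow 2 Q * epow (M x) (\<theta> * Q) * D x) (P / Q)"
        using PQ by (intro epow_mono) auto
      also have "\<dots> = epow 2 P * (epow (epow (M x) P) \<theta> * epow (D x) (1 - \<theta>))"
      proof -
        have "Q * (P / Q) = P" "\<theta> * Q * (P / Q) = P * \<theta>" using PQ by auto
        then show ?thesis by (simp only: epow_mult epow_epow ex(2)[symmetric] mult.assoc)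
      qed
      finally show ?thesis .
    qed
    have E: "0 < logfac y" using logfac_ge_1[of y] by linarith
    define X where "X = (\<integral>\<^sup>+x. epow (G x) P \<partial>lborel)"
    have MX: "(\<integral>\<^sup>+x. epow (M x) P \<partial>lborel) \<le> ennreal (C1 * logfac y) * X"
      unfolding M_def X_def by (intro mx) measurable
    have "(\<integral>\<^sup>+x. D x \<partial>lborel) = (\<integral>\<^sup>+k. \<integral>\<^sup>+x. epow (shiftavg L k y (h k) x) P \<partial>lborel \<partial>count_space UNIV)"
      unfolding D_def by (intro nn_integral_count_space_nn_integral) auto
    also have "\<dots> \<le> (\<integral>\<^sup>+k. ennreal C2 * (\<integral>\<^sup>+x. epow (h k x) P \<partial>lborel) \<partial>count_space UNIV)"
      by (intro nn_integral_mono lp) measurable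
    also have "\<dots> = ennreal C2 * (\<integral>\<^sup>+k. \<integral>\<^sup>+x. epow (h k x) P \<partial>lborel \<partial>count_space UNIV)"
      by (intro nn_integral_cmult) auto
    also have "(\<integral>\<^sup>+k. \<integral>\<^sup>+x. epow (h k x) P \<partial>lborel \<partial>count_space UNIV) = (\<integral>\<^sup>+x. \<integral>\<^sup>+k. epow (h k x) P \<partial>count_space UNIV \<partial>lborel)"
      by (intro nn_integral_count_space_nn_integral[symmetric]) auto
    also have "ennreal C2 * \<dots> \<le> ennreal C2 * X"
      unfolding X_def by (intro mult_left_mono nn_integral_mono f2) auto
    finally have DX: "(\<integral>\<^sup>+x. D x \<partial>lborel) \<le> ennreal C2 * X" .
    \<comment> \<open>Hoelder in x with the same \<theta>: M pays the logarithm to the power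
      \<theta>, while D was handled scale by scale without loss.\<close>
    have "(\<integral>\<^sup>+x. epow (\<integral>\<^sup>+k. epow (shiftavg L k y (g k) x) Q \<partial>count_space UNIV) (P / Q) \<partial>lborel) \<le>
      (\<integral>\<^sup>+x. epow 2 P * (epow (epow (M x) P) \<theta> * epow (D x) (1 - \<theta>)) \<partial>lborel)"
      by (intro nn_integral_mono pt)
    also have "\<dots> = epow 2 P * (\<integral>\<^sup>+x. epow (epow (M x) P) \<theta> * epow (D x) (1 - \<theta>) \<partial>lborel)"
      by (intro nn_integral_cmult) measurable
    also have "\<dots> \<le> epow 2 P * (2 * (epow (\<integral>\<^sup>+x. epow (M x) P \<partial>lborel) \<theta> * epow (\<integral>\<^sup>+x. D x \<partial>lborel) (1 - \<theta>)))"
      by (intro mult_left_mono nn_integral_Hoelder \<theta>) auto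
    also have "\<dots> \<le> epow 2 P * (2 * (epow (ennreal (C1 * logfac y) * X) \<theta> * epow (ennreal C2 * X) (1 - \<theta>)))"
      using \<theta> by (intro mult_left_mono mult_mono epow_mono MX DX) auto
    also have "\<dots> = (epow 2 P * 2 * ennreal ((C1 * logfac y) powr \<theta>) * ennreal (C2 powr (1 - \<theta>))) * (epow X \<theta> * epow X (1 - \<theta>))"
      using C1 C2 E by (simp add: epow_mult epow_ennreal mult_ac flip: ennreal_mult)
    also have "epow X \<theta> * epow X (1 - \<theta>) = X" by (simp flip: epow_add)
    also have "epow 2 P * 2 * ennreal ((C1 * logfac y) powr \<theta>) * ennreal (C2 powr (1 - \<theta>)) = ennreal (C * logfac y powr \<theta>)"
    proof -
      have "epow 2 P * 2 = ennreal (2 powr P * 2)" using epow_ennreal[of 2 P] by (simp add: ennreal_mult)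
      then show ?thesis using C1 C2 E by (simp add: C_def powr_mult mult_ac flip: ennreal_mult)
    qed
    also have "X = (\<integral>\<^sup>+x. epow (\<integral>\<^sup>+k. epow (g k x) Q \<partial>count_space UNIV) (P / Q) \<partial>lborel)"
      unfolding X_def G_def by (simp add: epow_epow)
    finally show "(\<integral>\<^sup>+x. epow (\<integral>\<^sup>+k. epow (shiftavg L k y (g k) x) Q \<partial>count_space UNIV) (P / Q) \<partial>lborel)
       \<le> ennreal (C * logfac y powr (1 - P / Q)) * (\<integral>\<^sup>+x. epow (\<integral>\<^sup>+k. epow (g k x) Q \<partial>count_space UNIV) (P / Q) \<partial>lborel)"
      by (simp only: \<theta>_def)
  qed
qed

text \<open>The endpoint Q = \<infinity>: replacing every \<open>g k\<close> by the supremum of all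
  of them changes nothing on the right-hand side and leaves the scalar maximal theorem.\<close>

lemma vector_shiftavg_sup:
  assumes L: "real DIM('a::euclidean_space) < L" and P: "1 < P"
  shows "\<exists>C>0. \<forall>(y::'a) g. (\<forall>k::int. g k \<in> borel_measurable borel) \<longrightarrow>
     (\<integral>\<^sup>+x. epow (SUP k. shiftavg L k y (g k) x) P \<partial>lborel)
       \<le> ennreal (C * logfac y) * (\<integral>\<^sup>+x. epow (SUP k. g k x) P \<partial>lborel)"
proof -
  obtain C1 where C1: "0 < C1" and mx: "\<And>(y::'a) g. g \<in> borel_measurable borel \<Longrightarrow>
     (\<integral>\<^sup>+x. epow (SUP k. shiftavg L k y g x) P \<partial>lborel) \<le> ennreal (C1 * logfac y) * (\<integral>\<^sup>+x. epow (g x) P \<partial>lborel)"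
    using shiftavg_maximal[OF P L] by blast
  show ?thesis
  proof (intro exI[of _ C1] conjI C1 allI impI)
    fix y :: 'a and g :: "int \<Rightarrow> 'a \<Rightarrow> ennreal" assume m: "\<forall>k. g k \<in> borel_measurable borel"
    then have [measurable]: "g k \<in> borel_measurable borel" for k by blast
    have "(\<integral>\<^sup>+x. epow (SUP k. shiftavg L k y (g k) x) P \<partial>lborel) \<le> (\<integral>\<^sup>+x. epow (SUP k. shiftavg L k y (\<lambda>v. SUP k. g k v) x) P \<partial>lborel)"
      using P by (intro nn_integral_mono epow_mono SUP_mono' shiftavg_mono SUP_upper) auto
    also have "\<dots> \<le> ennreal (C1 * logfac y) * (\<integral>\<^sup>+x. epow (SUP k. g k x) P \<partial>lborel)"
      by (intro mx) measurable
    finally show "(\<integral>\<^sup>+x. epow (SUP k. shiftavg L k y (g k) x) P \<partial>lborel)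
       \<le> ennreal (C1 * logfac y) * (\<integral>\<^sup>+x. epow (SUP k. g k x) P \<partial>lborel)" .
  qed
qed

text \<open>Truncation in height and in space keeps the tested integral finite, so that it can be
  cancelled in the duality argument. Where H is infinite, the truncated powers m^u are
  unbounded.\<close>

lemma epow_le_SUP_truncated:
  fixes x :: "'a::euclidean_space"
  assumes u: "1 \<le> u"
  shows "epow H u \<le> (SUP m::nat. epow (min H (of_nat m)) u * indicator (cball 0 (real m)) x)" (is "_ \<le> ?S")
proof -
  have ge: "epow (min H (of_nat m)) u \<le> ?S" if "norm x \<le> real m" for m
    using that by (intro SUP_upper2[of m]) auto
  obtain m0 where m0: "norm x \<le> real m0" using real_arch_simple by blast
  show ?thesis
  proof (cases "H = top")
    case True
    have "of_nat n \<le> ?S" for n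
    proof -
      define m where "m = max (max n m0) 1"
      have "real n \<le> real m powr 1" by (simp add: m_def)
      also have "\<dots> \<le> real m powr u" using u by (intro powr_mono) (auto simp: m_def)
      finally have "of_nat n \<le> epow (of_nat m) u"
        by (simp add: ennreal_of_nat_eq_real_of_nat epow_ennreal)
      also have "\<dots> \<le> ?S" using ge[of m] m0 True by (simp add: m_def)
      finally show ?thesis .
    qed
    then have "?S = top" by (rule ennreal_eq_topI)
    then show ?thesis by (metis top_greatest)
  next
    case False
    then obtain n where n: "H < of_nat n" using ennreal_Ex_less_of_nat[of H] by (auto simp: less_top)
    have "H \<le> of_nat (max n m0)"
    proof -
      have "of_nat n \<le> (of_nat (max n m0) :: ennreal)" by (intro of_nat_mono) simp
      with n show ?thesis by (meson less_imp_le less_le_trans)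
    qed
    then have "min H (of_nat (max n m0)) = H" by (simp add: min_def)
    then show ?thesis using ge[of "max n m0"] m0 by simp
  qed
qed

text \<open>Duality: test the sum of the averages against its own truncated power and move the averages to
  the test function, where the maximal theorem applies with the conjugate exponent.\<close>
lemma vector_shiftavg_gt:
  assumes L: "real DIM('a::euclidean_space) < L" and u: "1 < u"
  shows "\<exists>C>0. \<forall>(y::'a) h. (\<forall>k::int. h k \<in> borel_measurable borel) \<longrightarrow>
     (\<integral>\<^sup>+x. epow (\<integral>\<^sup>+k. shiftavg L k y (h k) x \<partial>count_space UNIV) u \<partial>lborel)
       \<le> ennreal (C * logfac y powr (u - 1)) * (\<integral>\<^sup>+x. epow (\<integral>\<^sup>+k. h k x \<partial>count_space UNIV) u \<partial>lborel)"
proof -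
  define u' where "u' = u / (u - 1)"
  have u': "1 < u'" "u' * (1 - 1 / u) = 1" "(u - 1) * u' = u" using u by (auto simp: u'_def field_simps)
  obtain C1 where C1: "0 < C1" and mx: "\<And>(y::'a) g. g \<in> borel_measurable borel \<Longrightarrow>
     (\<integral>\<^sup>+x. epow (SUP k. shiftavg L k y g x) u' \<partial>lborel) \<le> ennreal (C1 * logfac y) * (\<integral>\<^sup>+x. epow (g x) u' \<partial>lborel)"
    using shiftavg_maximal[OF u'(1) L] by blast
  define C where "C = 2 powr u * C1 powr (u - 1)"
  show ?thesis
  proof (intro exI[of _ C] conjI allI impI)
    show "0 < C" using C1 by (simp add: C_def)
    fix y :: 'a and h :: "int \<Rightarrow> 'a \<Rightarrow> ennreal" assume m: "\<forall>k. h k \<in> borel_measurable borel"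
    then have [measurable]: "h k \<in> borel_measurable borel" for k by blast
    have E: "0 < logfac y" using logfac_ge_1[of y] by linarith
    have [measurable]: "cball (0::'a) (real m) \<in> sets borel" for m by simp
    define H where "H x = (\<integral>\<^sup>+k. shiftavg L k y (h k) x \<partial>count_space UNIV)" for x
    define G where "G x = (\<integral>\<^sup>+k. h k x \<partial>count_space UNIV)" for x
    have [measurable]: "G \<in> borel_measurable borel" unfolding G_def by measurable
    have [measurable]: "H \<in> borel_measurable borel" unfolding H_def by measurable
    define X where "X = (\<integral>\<^sup>+x. epow (G x) u \<partial>lborel)"
    define F where "F m x = epow (min (H x) (of_nat m)) u * indicator (cball 0 (real m)) x" for m x
    have [measurable]: "F m \<in> borel_measurable borel" for m unfolding F_def by measurable
    have J: "(\<integral>\<^sup>+x. F m x \<partial>lborel) \<le> ennreal (C * logfac y powr (u - 1)) * X" for m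
    proof -
      define J where "J = (\<integral>\<^sup>+x. F m x \<partial>lborel)"
      \<comment> \<open>The dual function of the truncated H: its power u' is \<open>F m\<close>
        again, so J itself reappears after Hoelder's inequality, with a power below 1, and can be
        absorbed.\<close>
      define w where "w x = epow (min (H x) (of_nat m)) (u - 1) * indicator (cball 0 (real m)) x" for x
      have [measurable]: "w \<in> borel_measurable borel" unfolding w_def by measurable
      have wF: "epow (w x) u' = F m x" for x
        by (auto simp: w_def F_def epow_mult epow_epow u' indicator_def)
      have "F m x \<le> H x * w x" for x
      proof -
        have "epow (min (H x) (of_nat m)) u = epow (min (H x) (of_nat m)) 1 * epow (min (H x) (of_nat m)) (u - 1)"
          by (simp only: epow_add[symmetric]) simp
        also have "\<dots> \<le> H x * epow (min (H x) (of_nat m)) (u - 1)"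
          by (intro mult_right_mono) auto
        finally show ?thesis unfolding F_def w_def by (auto simp: indicator_def)
      qed
      then have "J \<le> (\<integral>\<^sup>+x. H x * w x \<partial>lborel)"
        unfolding J_def by (intro nn_integral_mono)
      also have "\<dots> = (\<integral>\<^sup>+k. \<integral>\<^sup>+x. shiftavg L k y (h k) x * w x \<partial>lborel \<partial>count_space UNIV)"
        unfolding H_def by (subst nn_integral_count_space_nn_integral[symmetric]) (auto simp: nn_integral_multc)
      also have "\<dots> = (\<integral>\<^sup>+k. \<integral>\<^sup>+x. h k x * shiftavg L k (- y) w x \<partial>lborel \<partial>count_space UNIV)"
        by (intro nn_integral_cong shiftavg_adjoint) auto
      also have "\<dots> \<le> (\<integral>\<^sup>+k. \<integral>\<^sup>+x. h k x * (SUP k. shiftavg L k (- y) w x) \<partial>lborel \<partial>count_space UNIV)"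
        by (intro nn_integral_mono mult_left_mono SUP_upper) auto
      also have "\<dots> = (\<integral>\<^sup>+x. G x * (SUP k. shiftavg L k (- y) w x) \<partial>lborel)"
        unfolding G_def by (subst nn_integral_count_space_nn_integral[symmetric]) (auto simp: nn_integral_multc)
      also have "\<dots> = (\<integral>\<^sup>+x. epow (epow (G x) u) (1/u) * epow (epow (SUP k. shiftavg L k (- y) w x) u') (1 - 1/u) \<partial>lborel)"
        using u u' by (simp only: epow_epow) simp
      also have "\<dots> \<le> 2 * (epow X (1/u) * epow (\<integral>\<^sup>+x. epow (SUP k. shiftavg L k (- y) w x) u' \<partial>lborel) (1 - 1/u))"
        unfolding X_def using u by (intro nn_integral_Hoelder) auto
      also have "\<dots> \<le> 2 * (epow X (1/u) * epow (ennreal (C1 * logfac y) * J) (1 - 1/u))"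
      proof (intro mult_left_mono epow_mono)
        have "(\<integral>\<^sup>+x. epow (SUP k. shiftavg L k (- y) w x) u' \<partial>lborel) \<le> ennreal (C1 * logfac (- y)) * (\<integral>\<^sup>+x. epow (w x) u' \<partial>lborel)"
          by (intro mx) measurable
        then show "(\<integral>\<^sup>+x. epow (SUP k. shiftavg L k (- y) w x) u' \<partial>lborel) \<le> ennreal (C1 * logfac y) * J"
          by (simp add: wF J_def)
      qed (use u in auto)
      finally have "epow J u \<le> epow (2 * (epow X (1/u) * epow (ennreal (C1 * logfac y) * J) (1 - 1/u))) u"
        using u by (intro epow_mono) auto
      also have "(1 - 1/u) * u = u - 1" using u by (simp add: field_simps)
      then have "epow (2 * (epow X (1/u) * epow (ennreal (C1 * logfac y) * J) (1 - 1/u))) u = epow J (u - 1) * (epow 2 u * ennreal ((C1 * logfac y) powr (u - 1)) * X)"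
        using u C1 E by (simp add: epow_mult epow_epow epow_ennreal powr_powr mult_ac)
      also have "epow 2 u * ennreal ((C1 * logfac y) powr (u - 1)) = ennreal (C * logfac y powr (u - 1))"
        using C1 E epow_ennreal[of 2 u] by (simp add: C_def powr_mult mult_ac flip: ennreal_mult)
      finally have *: "epow J (u - 1) * J \<le> epow J (u - 1) * (ennreal (C * logfac y powr (u - 1)) * X)"
        using epow_add[of J "u - 1" 1] by simp
      \<comment> \<open>Cancelling J^(u - 1) needs it to be finite, which the truncation guarantees;
        for J = 0 the claim is trivial.\<close>
      have "J < top"
      proof -
        have "J \<le> (\<integral>\<^sup>+x. epow (of_nat m) u * indicator (cball (0::'a) (real m)) x \<partial>lborel)"
          unfolding J_def F_def using u by (intro nn_integral_mono mult_right_mono epow_mono) auto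
        also have "\<dots> = epow (of_nat m) u * emeasure lborel (cball (0::'a) (real m))"
          by (intro nn_integral_cmult_indicator) auto
        also have "\<dots> < top"
          using emeasure_lborel_cball_finite[of "0::'a" "real m"]
          by (subst ennreal_mult_less_top) (auto simp: less_top[symmetric])
        finally show ?thesis .
      qed
      then have "J = 0 \<or> epow J (u - 1) \<noteq> 0 \<and> epow J (u - 1) \<noteq> top" by auto
      with * show ?thesis unfolding J_def[symmetric]
        by (auto simp: ennreal_mult_le_mult_iff)
    qed
    have "(\<integral>\<^sup>+x. epow (H x) u \<partial>lborel) \<le> (\<integral>\<^sup>+x. (SUP m. F m x) \<partial>lborel)"
      unfolding F_def using u by (intro nn_integral_mono epow_le_SUP_truncated) auto
    also have "\<dots> = (SUP m. \<integral>\<^sup>+x. F m x \<partial>lborel)"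
    proof (intro nn_integral_monotone_convergence_SUP)
      show "incseq F"
        unfolding incseq_def le_fun_def F_def using u
        by (auto intro!: mult_mono epow_mono min.mono simp: indicator_def)
    qed auto
    also have "\<dots> \<le> ennreal (C * logfac y powr (u - 1)) * X"
      by (intro SUP_least J)
    finally show "(\<integral>\<^sup>+x. epow (\<integral>\<^sup>+k. shiftavg L k y (h k) x \<partial>count_space UNIV) u \<partial>lborel)
       \<le> ennreal (C * logfac y powr (u - 1)) * (\<integral>\<^sup>+x. epow (\<integral>\<^sup>+k. h k x \<partial>count_space UNIV) u \<partial>lborel)"
      by (simp add: H_def X_def G_def)
  qed
qed

section \<open>Averages over dyadic cubes\<close>

text \<open>The dyadic cube of side 2^-j that contains x. Written with floors, membership is visibly
  symmetric in the two points and measurable in the pair, as the use of Fubini in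
  \<open>shiftavg_cells\<close> requires.\<close>

definition cell :: "int \<Rightarrow> 'a::euclidean_space \<Rightarrow> 'a set" where
  "cell j x = {v. \<forall>i\<in>Basis. \<lfloor>2 powr real_of_int j * (v \<bullet> i)\<rfloor> = \<lfloor>2 powr real_of_int j * (x \<bullet> i)\<rfloor>}"

lemma mem_dyadic_cube:
  "v \<in> dyadic_cube j m \<longleftrightarrow> (\<forall>i\<in>Basis. \<lfloor>2 powr real_of_int j * (v \<bullet> i)\<rfloor> = m i)"
proof -
  have "2 powr - real_of_int j * a \<le> b \<longleftrightarrow> a \<le> 2 powr real_of_int j * b"
       "b < 2 powr - real_of_int j * a \<longleftrightarrow> 2 powr real_of_int j * b < a" for a b :: real
    by (auto simp: powr_minus field_simps)
  then show ?thesis by (simp add: dyadic_cube_def floor_eq_iff)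
qed

lemma dyadic_cube_eq_cell: "x \<in> dyadic_cube j m \<Longrightarrow> dyadic_cube j m = cell j x"
  by (auto simp: cell_def mem_dyadic_cube set_eq_iff)

lemma cell_eq_dyadic_cube: "cell j x = dyadic_cube j (\<lambda>i. \<lfloor>2 powr real_of_int j * (x \<bullet> i)\<rfloor>)"
  by (auto simp: cell_def mem_dyadic_cube set_eq_iff)

lemma mem_cell_sym: "v \<in> cell j x \<longleftrightarrow> x \<in> cell j v"
  by (auto simp: cell_def)

lemma dyadic_cube_measurable [measurable]: "dyadic_cube j m \<in> sets borel"
  unfolding dyadic_cube_def by measurable

lemma cell_measurable [measurable]: "cell j x \<in> sets borel"
  unfolding cell_eq_dyadic_cube by measurable

lemma emeasure_dyadic_cube:
  "emeasure lborel (dyadic_cube j m :: 'a::euclidean_space set) = ennreal (2 powr - (real_of_int j * real DIM('a)))"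
proof -
  let ?a = "\<Sum>i\<in>Basis. (2 powr - real_of_int j * real_of_int (m i)) *\<^sub>R i :: 'a"
  let ?b = "\<Sum>i\<in>Basis. (2 powr - real_of_int j * (real_of_int (m i) + 1)) *\<^sub>R i :: 'a"
  have c: "?a \<bullet> i = 2 powr - real_of_int j * real_of_int (m i)" "?b \<bullet> i = 2 powr - real_of_int j * (real_of_int (m i) + 1)"
    if "i \<in> Basis" for i using that by (simp_all add: inner_sum_left_Basis)
  have le: "?a \<bullet> i \<le> ?b \<bullet> i" if "i \<in> Basis" for i
    unfolding c[OF that] by (intro mult_left_mono) auto
  have "(\<Prod>i\<in>Basis. (?b - ?a) \<bullet> i) = (\<Prod>i\<in>(Basis::'a set). 2 powr - real_of_int j)"
  proof (intro prod.cong refl)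
    fix i :: 'a assume "i \<in> Basis"
    then show "(?b - ?a) \<bullet> i = 2 powr - real_of_int j"
      by (simp only: inner_diff_left c) (simp add: algebra_simps)
  qed
  also have "\<dots> = 2 powr - (real_of_int j * real DIM('a))"
    by (simp add: powr_realpow[symmetric] powr_powr)
  finally have p: "(\<Prod>i\<in>Basis. (?b - ?a) \<bullet> i) = 2 powr - (real_of_int j * real DIM('a))" .
  have 1: "box ?a ?b \<subseteq> dyadic_cube j m"
    by (auto simp: box_def dyadic_cube_def c intro: less_imp_le)
  have 2: "dyadic_cube j m \<subseteq> cbox ?a ?b"
    by (auto simp: cbox_def dyadic_cube_def c intro: less_imp_le)
  show ?thesis
  proof (rule antisym)
    have "emeasure lborel (dyadic_cube j m) \<le> emeasure lborel (cbox ?a ?b)"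
      by (intro emeasure_mono 2) auto
    also have "\<dots> = ennreal (2 powr - (real_of_int j * real DIM('a)))"
      using emeasure_lborel_cbox[OF le] p by simp
    finally show "emeasure lborel (dyadic_cube j m :: 'a set) \<le> ennreal (2 powr - (real_of_int j * real DIM('a)))" .
    have "ennreal (2 powr - (real_of_int j * real DIM('a))) = emeasure lborel (box ?a ?b)"
      using emeasure_lborel_box[OF le] p by simp
    also have "\<dots> \<le> emeasure lborel (dyadic_cube j m)"
      by (intro emeasure_mono 1) auto
    finally show "ennreal (2 powr - (real_of_int j * real DIM('a))) \<le> emeasure lborel (dyadic_cube j m :: 'a set)" .
  qed
qed

lemma emeasure_cell: "emeasure lborel (cell j x :: 'a::euclidean_space set) = ennreal (2 powr - (real_of_int j * real DIM('a)))"
  unfolding cell_eq_dyadic_cube by (rule emeasure_dyadic_cube)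

lemma measure_dyadic_cube:
  "measure lborel (dyadic_cube j m :: 'a::euclidean_space set) = 2 powr - (real_of_int j * real DIM('a))"
  by (simp add: measure_def emeasure_dyadic_cube)

text \<open>The volume of a cube determines j, which makes the description in
  \<open>side_len\<close> unique.\<close>

lemma side_len_dyadic_cube: "side_len (dyadic_cube j m :: 'a::euclidean_space set) = 2 powr - real_of_int j"
  unfolding side_len_def
proof (rule the_equality)
  show "\<exists>j' m'. (dyadic_cube j m :: 'a set) = dyadic_cube j' m' \<and> 2 powr - real_of_int j = 2 powr - real_of_int j'"
    by blast
  fix s assume "\<exists>j' m'. (dyadic_cube j m :: 'a set) = dyadic_cube j' m' \<and> s = 2 powr - real_of_int j'"
  then obtain j' m' where *: "(dyadic_cube j m :: 'a set) = dyadic_cube j' m'" "s = 2 powr - real_of_int j'" by blast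
  then have "2 powr - (real_of_int j * real DIM('a)) = (2::real) powr - (real_of_int j' * real DIM('a))"
    using measure_dyadic_cube[where 'a='a and j=j and m=m] measure_dyadic_cube[where 'a='a and j=j' and m=m'] by simp
  then have "j = j'" by (simp add: powr_inj)
  with * show "s = 2 powr - real_of_int j" by simp
qed

lemma norm_cell_diff:
  fixes x :: "'a::euclidean_space"
  assumes "v \<in> cell j x"
  shows "norm ((2 powr real_of_int j) *\<^sub>R (v - x)) \<le> real DIM('a)"
proof -
  have "norm ((2 powr real_of_int j) *\<^sub>R (v - x)) \<le> (\<Sum>i\<in>Basis. \<bar>(2 powr real_of_int j) *\<^sub>R (v - x) \<bullet> i\<bar>)"
    by (rule norm_le_l1)
  also have "\<dots> \<le> (\<Sum>i\<in>(Basis::'a set). 1)"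
  proof (intro sum_mono)
    fix i :: 'a assume "i \<in> Basis"
    then have "\<lfloor>2 powr real_of_int j * (v \<bullet> i)\<rfloor> = \<lfloor>2 powr real_of_int j * (x \<bullet> i)\<rfloor>"
      using assms by (auto simp: cell_def)
    then have "\<bar>2 powr real_of_int j * (v \<bullet> i) - 2 powr real_of_int j * (x \<bullet> i)\<bar> \<le> 1" by linarith
    then show "\<bar>(2 powr real_of_int j) *\<^sub>R (v - x) \<bullet> i\<bar> \<le> 1"
      by (simp add: inner_diff_left right_diff_distrib)
  qed
  finally show ?thesis by simp
qed

section \<open>Kernels averaged over cells\<close>

lemma powr_neg_comparable:
  fixes a b d L :: real
  assumes "0 \<le> a" "0 \<le> b" "a \<le> b + d" "0 \<le> d" "0 \<le> L"
  shows "(1 + b) powr - L \<le> (1 + d) powr L * (1 + a) powr - L"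
proof -
  have "1 + a \<le> (1 + d) * (1 + b)"
  proof -
    have "(1 + d) * (1 + b) = 1 + b + d + b * d" by (simp add: algebra_simps)
    moreover have "0 \<le> b * d" using assms by simp
    ultimately show ?thesis using assms(3) by linarith
  qed
  then have "((1 + d) * (1 + b)) powr - L \<le> (1 + a) powr - L" using assms by (intro powr_mono2') auto
  then have "(1 + d) powr L * ((1 + d) * (1 + b)) powr - L \<le> (1 + d) powr L * (1 + a) powr - L"
    by (intro mult_left_mono) auto
  moreover have "(1 + d) powr L * ((1 + d) * (1 + b)) powr - L = (1 + b) powr - L"
    using assms by (simp add: powr_mult mult.assoc[symmetric] flip: powr_add)
  ultimately show ?thesis by simp
qed

text \<open>Serves to move the argument within one cell and to drop a shift of norm at most 1,
  either at the cost of a constant.\<close>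

lemma kern_comparable:
  fixes y :: "'a::euclidean_space"
  assumes "norm ((2 powr real_of_int j) *\<^sub>R z - y - ((2 powr real_of_int j) *\<^sub>R z' - y')) \<le> d" "0 \<le> L"
  shows "kern L j y z \<le> (1 + d) powr L * kern L j y' z'"
proof -
  let ?a = "(2 powr real_of_int j) *\<^sub>R z - y" and ?b = "(2 powr real_of_int j) *\<^sub>R z' - y'"
  have d: "0 \<le> d" using assms(1) norm_ge_zero order_trans by blast
  have "norm ?b \<le> norm ?a + d"
    using assms(1) norm_triangle_ineq3[of ?b ?a] by (simp add: norm_minus_commute)
  then have "(1 + norm ?a) powr - L \<le> (1 + d) powr L * (1 + norm ?b) powr - L"
    using d assms by (intro powr_neg_comparable) auto
  then show ?thesis by (simp add: kern_def mult.left_commute)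
qed

text \<open>Since 2^(j n) times the measure of a cell is 1, an average over the cell of v may be
  inserted into the integral over v. On a cell the kernel is constant up to a factor, so exchanging
  the integrals leaves the cell averages of h, bounded by N, against the mass of the kernel.\<close>

lemma shiftavg_cells:
  fixes y c :: "'a::euclidean_space"
  assumes L: "0 \<le> L" and [measurable]: "h \<in> borel_measurable borel"
    and N: "\<And>x. ennreal (2 powr (real_of_int j * real DIM('a))) * (\<integral>\<^sup>+v. h v * indicator (cell j x) v \<partial>lborel) \<le> N"
  shows "shiftavg L j y h c \<le> ennreal ((1 + real DIM('a)) powr L) * kmass TYPE('a) L * N"
proof -
  let ?s = "ennreal (2 powr (real_of_int j * real DIM('a)))"
  let ?D = "ennreal ((1 + real DIM('a)) powr L)"
  have ind: "indicator (cell j v) x = (indicator (cell j x) v :: ennreal)" for v x :: 'a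
    using mem_cell_sym[of v j x] by (auto simp: indicator_def)
  have [measurable]: "Measurable.pred (borel \<Otimes>\<^sub>M borel) (\<lambda>p. fst p \<in> cell j (snd p :: 'a))"
    unfolding cell_def mem_Collect_eq by measurable
  have [measurable]: "Measurable.pred (borel \<Otimes>\<^sub>M borel) (\<lambda>p. snd p \<in> cell j (fst p :: 'a))"
    unfolding cell_def mem_Collect_eq by measurable
  have [measurable]: "(\<lambda>p. indicator (cell j (snd p :: 'a)) (fst p) :: ennreal) \<in> borel_measurable (borel \<Otimes>\<^sub>M borel)"
    unfolding indicator_def of_bool_def by measurable
  have [measurable]: "(\<lambda>p. indicator (cell j (fst p :: 'a)) (snd p) :: ennreal) \<in> borel_measurable (borel \<Otimes>\<^sub>M borel)"
    unfolding indicator_def of_bool_def by measurable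
  have one: "?s * (\<integral>\<^sup>+x. indicator (cell j v) x \<partial>lborel) = 1" for v :: 'a
    by (simp add: emeasure_cell flip: ennreal_mult powr_add)
  have "shiftavg L j y h c = (\<integral>\<^sup>+v. h v * ennreal (kern L j y (c - v)) * (?s * (\<integral>\<^sup>+x. indicator (cell j v) x \<partial>lborel)) \<partial>lborel)"
    unfolding one by (simp add: shiftavg_def)
  also have "\<dots> = (\<integral>\<^sup>+v. (\<integral>\<^sup>+x. h v * ennreal (kern L j y (c - v)) * ?s * indicator (cell j v) x \<partial>lborel) \<partial>lborel)"
    by (intro nn_integral_cong) (simp add: nn_integral_cmult mult.assoc)
  also have "\<dots> = (\<integral>\<^sup>+x. (\<integral>\<^sup>+v. h v * ennreal (kern L j y (c - v)) * ?s * indicator (cell j v) x \<partial>lborel) \<partial>lborel)"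
    by (rule lborel_pair.Fubini') measurable
  also have "\<dots> \<le> (\<integral>\<^sup>+x. ?D * (ennreal (kern L j y (c - x)) * N) \<partial>lborel)"
  proof (rule nn_integral_mono)
    fix x :: 'a
    have "(\<integral>\<^sup>+v. h v * ennreal (kern L j y (c - v)) * ?s * indicator (cell j v) x \<partial>lborel)
      \<le> (\<integral>\<^sup>+v. (?D * ennreal (kern L j y (c - x)) * ?s) * (h v * indicator (cell j x) v) \<partial>lborel)"
    proof (rule nn_integral_mono)
      fix v :: 'a
      show "h v * ennreal (kern L j y (c - v)) * ?s * indicator (cell j v) x \<le> (?D * ennreal (kern L j y (c - x)) * ?s) * (h v * indicator (cell j x) v)"
      proof (cases "v \<in> cell j x")
        case True
        have "kern L j y (c - v) \<le> (1 + real DIM('a)) powr L * kern L j y (c - x)"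
        proof (rule kern_comparable[OF _ L])
          have "(2 powr real_of_int j) *\<^sub>R (c - v) - y - ((2 powr real_of_int j) *\<^sub>R (c - x) - y) = - ((2 powr real_of_int j) *\<^sub>R (v - x))"
            by (simp add: algebra_simps)
          then show "norm ((2 powr real_of_int j) *\<^sub>R (c - v) - y - ((2 powr real_of_int j) *\<^sub>R (c - x) - y)) \<le> real DIM('a)"
            using norm_cell_diff[OF True] by (simp only: norm_minus_cancel)
        qed
        then have "ennreal (kern L j y (c - v)) \<le> ?D * ennreal (kern L j y (c - x))"
          by (simp flip: ennreal_mult)
        then have "(h v * ?s * indicator (cell j x) v) * ennreal (kern L j y (c - v)) \<le> (h v * ?s * indicator (cell j x) v) * (?D * ennreal (kern L j y (c - x)))"
          by (intro mult_left_mono) auto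
        then show ?thesis unfolding ind[of v x] by (simp only: mult_ac)
      next
        case False
        then show ?thesis unfolding ind[of v x] by simp
      qed
    qed
    also have "\<dots> = (?D * ennreal (kern L j y (c - x)) * ?s) * (\<integral>\<^sup>+v. h v * indicator (cell j x) v \<partial>lborel)"
      by (rule nn_integral_cmult) measurable
    also have "\<dots> = ?D * (ennreal (kern L j y (c - x)) * (?s * (\<integral>\<^sup>+v. h v * indicator (cell j x) v \<partial>lborel)))"
      by (simp only: mult_ac)
    also have "\<dots> \<le> ?D * (ennreal (kern L j y (c - x)) * N)"
      by (intro mult_left_mono N) auto
    finally show "(\<integral>\<^sup>+v. h v * ennreal (kern L j y (c - v)) * ?s * indicator (cell j v) x \<partial>lborel) \<le> ?D * (ennreal (kern L j y (c - x)) * N)" .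
  qed
  also have "\<dots> = ?D * (kmass TYPE('a) L * N)"
    by (subst nn_integral_cmult, simp, subst nn_integral_multc) (auto simp: nn_integral_kern)
  finally show ?thesis by (simp add: mult.assoc)
qed

text \<open>A kernel of scale $2^{-k}$, averaged over a cube of larger side $2^{-j}$, is dominated by the
  kernel of scale $2^{-j}$ with the same physical displacement $2^{-k} y = 2^{-j} (2^{j-k} y)$.\<close>
lemma kern_average_cell:
  fixes x0 y v :: "'a::euclidean_space"
  assumes L: "real DIM('a) < L" and jk: "j \<le> k"
  shows "(\<integral>\<^sup>+x. ennreal (kern L k y (x - v)) * indicator (cell j x0) x \<partial>lborel) \<le>
     ennreal (2 powr - (real_of_int j * real DIM('a))) *
     ((kmass TYPE('a) L * ennreal ((1 + 2 * real DIM('a)) powr L) + ennreal (4 powr L)) *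
      ennreal (kern L j ((2 powr real_of_int (j - k)) *\<^sub>R y) (x0 - v)))"
proof -
  let ?n = "real DIM('a)"
  have n1: "1 \<le> ?n" using DIM_positive[where 'a='a] by linarith
  have L0: "0 < L" using L n1 by linarith
  let ?w = "\<lambda>x. (2 powr real_of_int j) *\<^sub>R (x - v) - (2 powr real_of_int (j - k)) *\<^sub>R y"
  let ?a = "norm (?w x0)"
  let ?s = "2 powr (real_of_int j * ?n)"
  let ?R = "ennreal (2 powr - (real_of_int j * ?n)) *
     ((kmass TYPE('a) L * ennreal ((1 + 2 * ?n) powr L) + ennreal (4 powr L)) *
      ennreal (kern L j ((2 powr real_of_int (j - k)) *\<^sub>R y) (x0 - v)))"
  have K: "ennreal (2 powr - (real_of_int j * ?n)) * ennreal (kern L j ((2 powr real_of_int (j - k)) *\<^sub>R y) (x0 - v)) = ennreal ((1 + ?a) powr - L)"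
    by (simp add: kern_def mult.assoc[symmetric] flip: ennreal_mult powr_add)
  have R: "?R = kmass TYPE('a) L * ennreal ((1 + 2 * ?n) powr L) * ennreal ((1 + ?a) powr - L) + ennreal (4 powr L) * ennreal ((1 + ?a) powr - L)"
    unfolding K[symmetric] by (simp only: distrib_left distrib_right mult_ac)
  \<comment> \<open>If \<open>x0 - v\<close> is within 2 n of the displaced centre, in units of the
    side 2^-j, the target kernel is bounded below and the whole mass of the finer kernel is
    affordable. Otherwise the finer kernel is small on the whole cell.\<close>
  show ?thesis
  proof (cases "?a \<le> 2 * ?n")
    case True
    have "(\<integral>\<^sup>+x. ennreal (kern L k y (x - v)) * indicator (cell j x0) x \<partial>lborel) \<le> (\<integral>\<^sup>+x. ennreal (kern L k y (x - v)) \<partial>lborel)"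
      by (intro nn_integral_mono) (auto simp: indicator_def)
    also have "\<dots> = (\<integral>\<^sup>+x. ennreal (kern L k (- y) (v - x)) \<partial>lborel)"
      by (intro nn_integral_cong) (metis kern_minus minus_diff_eq)
    also have "\<dots> = kmass TYPE('a) L" by (rule nn_integral_kern)
    also have "\<dots> \<le> kmass TYPE('a) L * (ennreal ((1 + 2 * ?n) powr L) * ennreal ((1 + ?a) powr - L))"
    proof -
      have "1 = (1 + ?a) powr L * (1 + ?a) powr - L" by (simp add: add_nonneg_eq_0_iff flip: powr_add)
      also have "\<dots> \<le> (1 + 2 * ?n) powr L * (1 + ?a) powr - L"
        using True L0 by (intro mult_right_mono powr_mono2) auto
      finally have "ennreal 1 \<le> ennreal ((1 + 2 * ?n) powr L) * ennreal ((1 + ?a) powr - L)"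
        unfolding ennreal_mult[symmetric, OF powr_ge_zero powr_ge_zero] by (rule ennreal_leI)
      then show ?thesis using mult_left_mono[of 1 _ "kmass TYPE('a) L"] by fastforce
    qed
    also have "\<dots> \<le> ?R" unfolding R by (simp add: mult.assoc)
    finally show ?thesis .
  next
    case F: False
    have pt: "kern L k y (x - v) \<le> 2 powr (real_of_int j * ?n) * 4 powr L * (1 + ?a) powr - L" if x: "x \<in> cell j x0" for x
    proof -
      have wx: "norm (?w x) \<ge> ?a - ?n"
      proof -
        have "?w x = ?w x0 + (2 powr real_of_int j) *\<^sub>R (x - x0)" by (simp add: algebra_simps)
        note eq = this
        show ?thesis unfolding eq using norm_cell_diff[OF x] norm_diff_ineq[of "?w x0" "(2 powr real_of_int j) *\<^sub>R (x - x0)"] by linarith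
      qed
      have "(2 powr real_of_int k) *\<^sub>R (x - v) - y = (2 powr real_of_int (k - j)) *\<^sub>R ?w x"
        by (simp add: algebra_simps flip: powr_add)
      then have "norm ((2 powr real_of_int k) *\<^sub>R (x - v) - y) = 2 powr real_of_int (k - j) * norm (?w x)"
        by (simp only: norm_scaleR) simp
      also have "\<dots> \<ge> 2 powr real_of_int (k - j) * ((1 + ?a) / 4)"
      proof (intro mult_left_mono)
        \<comment> \<open>From \<open>?a\<close> > 2 n \<ge> 2: the distance \<open>?a - ?n\<close>
          exceeds half of \<open>?a\<close>, which is at least \<open>(1 + ?a) / 4\<close>.\<close>
        show "(1 + ?a) / 4 \<le> norm (?w x)" using wx F n1 by argo
      qed simp
      finally have ge: "2 powr real_of_int (k - j) * ((1 + ?a) / 4) \<le> 1 + norm ((2 powr real_of_int k) *\<^sub>R (x - v) - y)" by simp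
      have "kern L k y (x - v) \<le> 2 powr (real_of_int k * ?n) * (2 powr real_of_int (k - j) * ((1 + ?a) / 4)) powr - L"
        unfolding kern_def using ge L0 by (intro mult_left_mono powr_mono2') (auto intro!: mult_pos_pos add_pos_nonneg)
      also have "\<dots> = (2 powr (real_of_int k * ?n) * 2 powr (real_of_int (k - j) * - L)) * (4 powr L * (1 + ?a) powr - L)"
      proof -
        have "(2 powr e * (b / 4)) powr - L = 2 powr (e * - L) * (b powr - L / 4 powr - L)" if "0 \<le> b" for e b :: real
          using that by (simp add: powr_mult powr_divide powr_powr)
        from this[of "1 + ?a" "real_of_int (k - j)"]
        have "(2 powr real_of_int (k - j) * ((1 + ?a) / 4)) powr - L = 2 powr (real_of_int (k - j) * - L) * ((1 + ?a) powr - L / 4 powr - L)"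
          by simp
        then show ?thesis by (simp add: powr_minus field_simps)
      qed
      \<comment> \<open>Passing from scale k to scale j costs the factor 2^((k - j) (n - L)), at
        most 1 because L > n and j \<le> k.\<close>
      also have "2 powr (real_of_int k * ?n) * 2 powr (real_of_int (k - j) * - L) \<le> 2 powr (real_of_int j * ?n)"
      proof -
        have "real_of_int (k - j) * ?n \<le> real_of_int (k - j) * L" using L jk by (intro mult_left_mono) auto
        then have "real_of_int k * ?n + real_of_int (k - j) * - L \<le> real_of_int j * ?n" by (simp add: algebra_simps)
        then show ?thesis by (simp flip: powr_add)
      qed
      then have "(2 powr (real_of_int k * ?n) * 2 powr (real_of_int (k - j) * - L)) * (4 powr L * (1 + ?a) powr - L) \<le> 2 powr (real_of_int j * ?n) * (4 powr L * (1 + ?a) powr - L)"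
        by (intro mult_right_mono) auto
      finally show ?thesis by (simp add: mult.assoc)
    qed
    have "(\<integral>\<^sup>+x. ennreal (kern L k y (x - v)) * indicator (cell j x0) x \<partial>lborel) \<le>
       (\<integral>\<^sup>+x. ennreal (2 powr (real_of_int j * ?n) * 4 powr L * (1 + ?a) powr - L) * indicator (cell j x0) x \<partial>lborel)"
      using pt by (intro nn_integral_mono) (auto simp: indicator_def intro!: ennreal_leI)
    also have "\<dots> = ennreal (2 powr (real_of_int j * ?n) * 4 powr L * (1 + ?a) powr - L) * ennreal (2 powr - (real_of_int j * ?n))"
      by (simp add: nn_integral_cmult_indicator emeasure_cell)
    also have "\<dots> = ennreal (4 powr L) * ennreal ((1 + ?a) powr - L)"
      by (simp add: mult_ac flip: ennreal_mult powr_add)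
    also have "\<dots> \<le> ?R" unfolding R by simp
    finally show ?thesis .
  qed
qed

lemma dyadic_shiftavg_sum:
  assumes L: "real DIM('a::euclidean_space) < L"
  shows "\<exists>C>0. \<forall>(y::'a) (h::int \<Rightarrow> 'a \<Rightarrow> ennreal) j N x0. (\<forall>k. h k \<in> borel_measurable borel) \<longrightarrow>
     (\<forall>x. ennreal (2 powr (real_of_int j * real DIM('a))) *
        (\<integral>\<^sup>+v. (\<integral>\<^sup>+k. indicator {j..} k * h k v \<partial>count_space UNIV) * indicator (cell j x) v \<partial>lborel) \<le> N) \<longrightarrow>
     ennreal (2 powr (real_of_int j * real DIM('a))) *
        (\<integral>\<^sup>+x. (\<integral>\<^sup>+k. indicator {j..} k * shiftavg L k y (h k) x \<partial>count_space UNIV) * indicator (cell j x0) x \<partial>lborel)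
       \<le> ennreal (C * logfac y) * N"
proof -
  let ?n = "real DIM('a)"
  have n1: "1 \<le> ?n" using DIM_positive[where 'a='a] by linarith
  have L0: "0 < L" using L n1 by linarith
  obtain m where m: "0 < m" "kmass TYPE('a) L = ennreal m" using kmass_real[OF L] .
  define C0 where "C0 = m * (1 + 2 * ?n) powr L + 4 powr L"
  define C1 where "C1 = (1 + ?n) powr L * m"
  have C0: "0 < C0" unfolding C0_def using m by (intro add_nonneg_pos) auto
  have C1: "0 < C1" unfolding C1_def using m n1 by auto
  define C where "C = C0 * ((3 + 2 powr L) * C1)"
  show ?thesis
  proof (intro exI[of _ C] conjI allI impI)
    show "0 < C" unfolding C_def using C0 C1 by (intro mult_pos_pos add_pos_pos) auto
    fix y :: 'a and h :: "int \<Rightarrow> 'a \<Rightarrow> ennreal" and j :: int and N and x0 :: 'a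
    assume "\<forall>k. h k \<in> borel_measurable borel"
    then have [measurable]: "h k \<in> borel_measurable borel" for k by blast
    let ?s = "ennreal (2 powr (real_of_int j * ?n))"
    assume N: "\<forall>x. ?s * (\<integral>\<^sup>+v. (\<integral>\<^sup>+k. indicator {j..} k * h k v \<partial>count_space UNIV) * indicator (cell j x) v \<partial>lborel) \<le> N"
    have cells: "shiftavg L j y' g c \<le> ennreal C1 * N"
      if [measurable]: "g \<in> borel_measurable borel" and le: "\<And>v. g v \<le> (\<integral>\<^sup>+k. indicator {j..} k * h k v \<partial>count_space UNIV)" for g and y' c :: 'a
    proof -
      have "shiftavg L j y' g c \<le> ennreal ((1 + ?n) powr L) * kmass TYPE('a) L * N"
      proof (rule shiftavg_cells)
        fix x :: 'a
        have "?s * (\<integral>\<^sup>+v. g v * indicator (cell j x) v \<partial>lborel) \<le> ?s * (\<integral>\<^sup>+v. (\<integral>\<^sup>+k. indicator {j..} k * h k v \<partial>count_space UNIV) * indicator (cell j x) v \<partial>lborel)"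
          by (intro mult_left_mono nn_integral_mono mult_right_mono le) auto
        also have "\<dots> \<le> N" using N by blast
        finally show "?s * (\<integral>\<^sup>+v. g v * indicator (cell j x) v \<partial>lborel) \<le> N" .
      qed (use L0 in auto)
      then show ?thesis using m by (simp add: C1_def ennreal_mult)
    qed
    let ?y = "\<lambda>k. (2 powr real_of_int (j - k)) *\<^sub>R y"
    define S where "S k = shiftavg L j (?y k) (h k) x0" for k
    have one: "?s * (\<integral>\<^sup>+x. shiftavg L k y (h k) x * indicator (cell j x0) x \<partial>lborel) \<le> ennreal C0 * S k" if jk: "j \<le> k" for k
    proof -
      have "(\<integral>\<^sup>+x. shiftavg L k y (h k) x * indicator (cell j x0) x \<partial>lborel) = (\<integral>\<^sup>+v. h k v * shiftavg L k (- y) (indicator (cell j x0)) v \<partial>lborel)"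
        by (intro shiftavg_adjoint) auto
      also have "\<dots> = (\<integral>\<^sup>+v. h k v * (\<integral>\<^sup>+x. ennreal (kern L k y (x - v)) * indicator (cell j x0) x \<partial>lborel) \<partial>lborel)"
        unfolding shiftavg_def
      proof (rule nn_integral_cong)
        fix v :: 'a
        have "kern L k (- y) (v - x) = kern L k y (x - v)" for x by (metis kern_minus minus_diff_eq)
        then show "h k v * (\<integral>\<^sup>+x. indicator (cell j x0) x * ennreal (kern L k (- y) (v - x)) \<partial>lborel) =
           h k v * (\<integral>\<^sup>+x. ennreal (kern L k y (x - v)) * indicator (cell j x0) x \<partial>lborel)"
          by (simp add: mult.commute)
      qed
      also have "\<dots> \<le> (\<integral>\<^sup>+v. h k v * (ennreal (2 powr - (real_of_int j * ?n)) * (ennreal C0 * ennreal (kern L j (?y k) (x0 - v)))) \<partial>lborel)"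
      proof (intro nn_integral_mono mult_left_mono)
        fix v :: 'a
        have "kmass TYPE('a) L * ennreal ((1 + 2 * ?n) powr L) + ennreal (4 powr L) = ennreal C0"
          using m by (simp add: C0_def ennreal_mult)
        then show "(\<integral>\<^sup>+x. ennreal (kern L k y (x - v)) * indicator (cell j x0) x \<partial>lborel) \<le> ennreal (2 powr - (real_of_int j * ?n)) * (ennreal C0 * ennreal (kern L j (?y k) (x0 - v)))"
          using kern_average_cell[OF L jk, of y v x0] by simp
      qed auto
      also have "\<dots> = (\<integral>\<^sup>+v. ennreal (2 powr - (real_of_int j * ?n)) * ennreal C0 * (h k v * ennreal (kern L j (?y k) (x0 - v))) \<partial>lborel)"
        by (intro nn_integral_cong) (simp only: mult_ac)
      also have "\<dots> = ennreal (2 powr - (real_of_int j * ?n)) * ennreal C0 * S k"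
        unfolding S_def shiftavg_def by (rule nn_integral_cmult) measurable
      finally have "?s * (\<integral>\<^sup>+x. shiftavg L k y (h k) x * indicator (cell j x0) x \<partial>lborel) \<le> ?s * (ennreal (2 powr - (real_of_int j * ?n)) * ennreal C0 * S k)"
        by (intro mult_left_mono) auto
      also have "?s * (ennreal (2 powr - (real_of_int j * ?n)) * ennreal C0 * S k) = (?s * ennreal (2 powr - (real_of_int j * ?n))) * (ennreal C0 * S k)"
        by (simp only: mult_ac)
      also have "?s * ennreal (2 powr - (real_of_int j * ?n)) = 1" by (simp flip: ennreal_mult powr_add)
      finally show ?thesis by simp
    qed
    have E: "1 \<le> logfac y" by (rule logfac_ge_1)
    define M where "M = \<lceil>log 2 (1 + norm y)\<rceil>"
    have log0: "0 \<le> log 2 (1 + norm y)" by (subst zero_le_log_cancel_iff) (auto intro: add_pos_nonneg)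
    have M0: "0 \<le> M" using log0 unfolding M_def by simp
    have ME: "real_of_int M \<le> 3 * logfac y"
    proof -
      have "1 / 2 \<le> ln (2::real)" using ln2_ge_two_thirds by simp
      have "log 2 (1 + norm y) = ln (1 + norm y) / ln 2" by (simp add: log_def)
      also have "\<dots> \<le> ln (1 + norm y) / (1/2)"
        using \<open>1 / 2 \<le> ln 2\<close> by (intro divide_left_mono) auto
      also have "ln (1 + norm y) \<le> logfac y"
        unfolding logfac_def by (subst ln_le_cancel_iff) (auto intro: add_pos_nonneg)
      finally have "log 2 (1 + norm y) \<le> 2 * logfac y" by simp
      moreover have "real_of_int M \<le> log 2 (1 + norm y) + 1" unfolding M_def by linarith
      ultimately show ?thesis using E by simp
    qed
    have each: "S k \<le> ennreal C1 * N" if "j \<le> k" for k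
      unfolding S_def
    proof (rule cells)
      fix v
      show "h k v \<le> (\<integral>\<^sup>+k. indicator {j..} k * h k v \<partial>count_space UNIV)"
        using nn_integral_ge_point[of k UNIV "\<lambda>k. indicator {j..} k * h k v"] that by simp
    qed simp
    have far: "(\<integral>\<^sup>+k. indicator {j + M..} k * S k \<partial>count_space UNIV) \<le> ennreal (2 powr L * C1) * N"
    proof -
      have "(\<integral>\<^sup>+k. indicator {j + M..} k * S k \<partial>count_space UNIV) \<le> (\<integral>\<^sup>+k. ennreal (2 powr L) * shiftavg L j 0 (\<lambda>v. indicator {j + M..} k * h k v) x0 \<partial>count_space UNIV)"
      proof (rule nn_integral_mono)
        fix k
        show "indicator {j + M..} k * S k \<le> ennreal (2 powr L) * shiftavg L j 0 (\<lambda>v. indicator {j + M..} k * h k v) x0"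
        proof (cases "j + M \<le> k")
          case True
          have "log 2 (1 + norm y) \<le> real_of_int (k - j)" using True unfolding M_def by linarith
          then have "1 + norm y \<le> 2 powr real_of_int (k - j)"
            by (subst (asm) log_le_iff) (auto intro: add_pos_nonneg)
          then have "norm y \<le> 2 powr real_of_int (k - j)" by simp
          then have "2 powr real_of_int (j - k) * norm y \<le> 2 powr real_of_int (j - k) * 2 powr real_of_int (k - j)"
            by (intro mult_left_mono) auto
          also have "\<dots> = 1" by (simp flip: powr_add)
          finally have y1: "norm (?y k) \<le> 1" by simp
          have "kern L j (?y k) z \<le> 2 powr L * kern L j 0 z" for z
          proof -
            have "kern L j (?y k) z \<le> (1 + 1) powr L * kern L j 0 z"
              using y1 L0 by (intro kern_comparable) auto
            then show ?thesis by simp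
          qed
          then have "S k \<le> (\<integral>\<^sup>+v. ennreal (2 powr L) * (h k v * ennreal (kern L j 0 (x0 - v))) \<partial>lborel)"
            unfolding S_def shiftavg_def
            by (intro nn_integral_mono) (auto simp: mult.left_commute ennreal_mult[symmetric] intro!: mult_left_mono ennreal_leI)
          also have "\<dots> = ennreal (2 powr L) * shiftavg L j 0 (h k) x0"
            unfolding shiftavg_def by (rule nn_integral_cmult) measurable
          finally show ?thesis using True by simp
        qed simp
      qed
      also have "\<dots> = ennreal (2 powr L) * shiftavg L j 0 (\<lambda>v. \<integral>\<^sup>+k. indicator {j + M..} k * h k v \<partial>count_space UNIV) x0"
        by (subst shiftavg_sum) (auto simp: nn_integral_cmult)
      also have "\<dots> \<le> ennreal (2 powr L) * (ennreal C1 * N)"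
      proof (intro mult_left_mono cells)
        show "(\<integral>\<^sup>+k. indicator {j + M..} k * h k v \<partial>count_space UNIV) \<le> (\<integral>\<^sup>+k. indicator {j..} k * h k v \<partial>count_space UNIV)" for v
          using M0 by (intro nn_integral_mono mult_right_mono) (auto simp: indicator_def)
      qed auto
      finally show ?thesis using C1 by (simp add: ennreal_mult mult.assoc)
    qed
    have near: "(\<integral>\<^sup>+k. indicator {j..<j + M} k * S k \<partial>count_space UNIV) \<le> ennreal (3 * logfac y * C1) * N"
    proof -
      have "(\<integral>\<^sup>+k. indicator {j..<j + M} k * S k \<partial>count_space UNIV) \<le> (\<integral>\<^sup>+k. (ennreal C1 * N) * indicator {j..<j + M} k \<partial>count_space UNIV)"
        using each by (intro nn_integral_mono) (auto simp: indicator_def)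
      also have "\<dots> = (ennreal C1 * N) * ennreal (real_of_int M)"
        using M0 by (subst nn_integral_cmult_indicator) (auto simp: ennreal_of_nat_eq_real_of_nat)
      also have "\<dots> \<le> (ennreal C1 * N) * ennreal (3 * logfac y)"
        by (intro mult_left_mono ennreal_leI ME) auto
      also have "\<dots> = ennreal (3 * logfac y * C1) * N"
        using C1 E by (simp add: ennreal_mult mult_ac)
      finally show ?thesis .
    qed
    have "?s * (\<integral>\<^sup>+x. (\<integral>\<^sup>+k. indicator {j..} k * shiftavg L k y (h k) x \<partial>count_space UNIV) * indicator (cell j x0) x \<partial>lborel)
      = ?s * (\<integral>\<^sup>+x. (\<integral>\<^sup>+k. indicator {j..} k * (shiftavg L k y (h k) x * indicator (cell j x0) x) \<partial>count_space UNIV) \<partial>lborel)"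
      by (simp add: nn_integral_multc[symmetric] mult.assoc)
    also have "\<dots> = ?s * (\<integral>\<^sup>+k. indicator {j..} k * (\<integral>\<^sup>+x. shiftavg L k y (h k) x * indicator (cell j x0) x \<partial>lborel) \<partial>count_space UNIV)"
      by (subst nn_integral_count_space_nn_integral) (auto simp: nn_integral_cmult)
    also have "\<dots> = (\<integral>\<^sup>+k. indicator {j..} k * (?s * (\<integral>\<^sup>+x. shiftavg L k y (h k) x * indicator (cell j x0) x \<partial>lborel)) \<partial>count_space UNIV)"
      by (subst nn_integral_cmult[symmetric]) (auto simp: mult.left_commute)
    also have "\<dots> \<le> (\<integral>\<^sup>+k. ennreal C0 * (indicator {j..<j + M} k * S k + indicator {j + M..} k * S k) \<partial>count_space UNIV)"
    proof (rule nn_integral_mono)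
      fix k
      show "indicator {j..} k * (?s * (\<integral>\<^sup>+x. shiftavg L k y (h k) x * indicator (cell j x0) x \<partial>lborel)) \<le> ennreal C0 * (indicator {j..<j + M} k * S k + indicator {j + M..} k * S k)"
        using one[of k] by (cases "j \<le> k"; cases "k < j + M") (auto simp: indicator_def)
    qed
    also have "\<dots> = ennreal C0 * ((\<integral>\<^sup>+k. indicator {j..<j + M} k * S k \<partial>count_space UNIV) + (\<integral>\<^sup>+k. indicator {j + M..} k * S k \<partial>count_space UNIV))"
      by (simp add: nn_integral_cmult nn_integral_add)
    also have "\<dots> \<le> ennreal C0 * (ennreal (3 * logfac y * C1) * N + ennreal (2 powr L * C1) * N)"
      by (intro mult_left_mono add_mono near far) auto
    also have "\<dots> = ennreal (C0 * (3 * logfac y * C1 + 2 powr L * C1)) * N"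
      using C0 C1 E by (simp add: ennreal_mult distrib_right mult.assoc)
    also have "\<dots> \<le> ennreal (C * logfac y) * N"
    proof (intro mult_right_mono ennreal_leI)
      have "2 powr L * C1 * 1 \<le> 2 powr L * C1 * logfac y" using E C1 by (intro mult_left_mono) auto
      then have "C0 * (3 * logfac y * C1 + 2 powr L * C1) \<le> C0 * (3 * logfac y * C1 + 2 powr L * C1 * logfac y)"
        using C0 by (intro mult_left_mono) auto
      then show "C0 * (3 * logfac y * C1 + 2 powr L * C1) \<le> C * logfac y"
        by (simp add: C_def algebra_simps)
    qed auto
    finally show "?s * (\<integral>\<^sup>+x. (\<integral>\<^sup>+k. indicator {j..} k * shiftavg L k y (h k) x \<partial>count_space UNIV) * indicator (cell j x0) x \<partial>lborel) \<le> ennreal (C * logfac y) * N" .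
  qed
qed

section \<open>Smooth functions and the Fourier transform on the line\<close>

text \<open>Recursion on the order keeps the closure rules for products, inverses and affine
  substitutions plain inductions. Continuity of the derivatives comes from \<open>smooth1\<close>,
  which asks for every order.\<close>

fun Ck :: "nat \<Rightarrow> (real \<Rightarrow> complex) \<Rightarrow> bool" where
  "Ck 0 h = True"
| "Ck (Suc n) h = (\<exists>h'. (\<forall>x. (h has_vector_derivative h' x) (at x)) \<and> Ck n h')"

lemma Ck_SucI: "(\<And>x. (h has_vector_derivative h' x) (at x)) \<Longrightarrow> Ck n h' \<Longrightarrow> Ck (Suc n) h"
  by (simp, blast)

definition smooth1 :: "(real \<Rightarrow> complex) \<Rightarrow> bool" where
  "smooth1 h \<longleftrightarrow> (\<forall>n. Ck n h)"

definition dd :: "(real \<Rightarrow> complex) \<Rightarrow> real \<Rightarrow> complex" where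
  "dd h x = vector_derivative h (at x)"

lemma smooth1_dd:
  assumes "smooth1 h"
  shows "(h has_vector_derivative dd h x) (at x)" "smooth1 (dd h)"
proof -
  have *: "(\<forall>x. (h has_vector_derivative dd h x) (at x)) \<and> Ck n (dd h)" for n
  proof -
    have "Ck (Suc n) h" using assms by (auto simp: smooth1_def simp del: Ck.simps)
    then obtain h' where h': "\<And>x. (h has_vector_derivative h' x) (at x)" "Ck n h'" by auto
    have "dd h x = h' x" for x unfolding dd_def by (rule vector_derivative_at) (rule h')
    then have "dd h = h'" by (rule ext)
    with h' show ?thesis by simp
  qed
  then show "(h has_vector_derivative dd h x) (at x)" "smooth1 (dd h)"
    by (auto simp: smooth1_def)
qed

lemma Ck_mono: "Ck (Suc n) h \<Longrightarrow> Ck n h"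
  by (induction n arbitrary: h) auto

lemma Ck_add: "Ck n f \<Longrightarrow> Ck n g \<Longrightarrow> Ck n (\<lambda>x. f x + g x)"
proof (induction n arbitrary: f g)
  case (Suc n)
  then obtain f' g' where "\<And>x. (f has_vector_derivative f' x) (at x)" "Ck n f'"
    "\<And>x. (g has_vector_derivative g' x) (at x)" "Ck n g'" by auto
  with Suc.IH[of f' g'] show ?case
    by (auto intro!: exI[of _ "\<lambda>x. f' x + g' x"] has_vector_derivative_add)
qed simp

lemma Ck_mult: "Ck n f \<Longrightarrow> Ck n g \<Longrightarrow> Ck n (\<lambda>x. f x * g x)"
proof (induction n arbitrary: f g)
  case (Suc n)
  then obtain f' g' where fg: "\<And>x. (f has_vector_derivative f' x) (at x)" "Ck n f'"
    "\<And>x. (g has_vector_derivative g' x) (at x)" "Ck n g'" by auto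
  have "Ck n (\<lambda>x. f x * g' x + f' x * g x)"
    using Suc fg by (intro Ck_add Suc.IH) (auto dest: Ck_mono simp del: Ck.simps)
  moreover have "((\<lambda>x. f x * g x) has_vector_derivative (f x * g' x + f' x * g x)) (at x)" for x
    by (intro has_vector_derivative_mult fg)
  ultimately show ?case by (intro Ck_SucI)
qed simp

lemma Ck_const: "Ck n (\<lambda>x. c)"
proof (induction n arbitrary: c)
  case (Suc n)
  then show ?case by (auto intro!: exI[of _ "\<lambda>x. 0"] has_vector_derivative_const)
qed simp

lemma Ck_affine: "Ck n f \<Longrightarrow> Ck n (\<lambda>x. f (a * x + b))"
proof (induction n arbitrary: f)
  case (Suc n)
  then obtain f' where f: "\<And>x. (f has_vector_derivative f' x) (at x)" "Ck n f'" by auto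
  have d: "((\<lambda>x. f (a * x + b)) has_vector_derivative (of_real a * f' (a * x + b))) (at x)" for x
  proof -
    have "((\<lambda>x. a * x + b) has_real_derivative a) (at x)"
      by (auto intro!: derivative_eq_intros)
    then have "((f \<circ> (\<lambda>x. a * x + b)) has_vector_derivative (a *\<^sub>R f' (a * x + b))) (at x)"
      by (intro vector_diff_chain_at f) (simp add: has_real_derivative_iff_has_vector_derivative)
    then show ?thesis by (simp add: o_def scaleR_conv_of_real)
  qed
  have "Ck n (\<lambda>x. of_real a * f' (a * x + b))"
    by (intro Ck_mult Ck_const Suc.IH f)
  with d show ?case by (rule Ck_SucI)
qed simp

lemma cis_has_vector_derivative:
  "((\<lambda>x. cis (c * x)) has_vector_derivative (\<i> * of_real c * cis (c * x))) (at x)"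
proof -
  have "((\<lambda>x. exp (\<i> * of_real c * of_real x)) has_vector_derivative (exp (\<i> * of_real c * of_real x) * (\<i> * of_real c))) (at x)"
    by (rule has_vector_derivative_real_field) (auto intro!: derivative_eq_intros)
  then show ?thesis by (simp add: cis_conv_exp mult_ac)
qed

lemma Ck_cis: "Ck n (\<lambda>x. k * cis (c * x))"
proof (induction n arbitrary: k)
  case (Suc n)
  have "((\<lambda>x. k * cis (c * x)) has_vector_derivative (k * (\<i> * of_real c * cis (c * x)))) (at x)" for x
    by (intro has_vector_derivative_mult_right cis_has_vector_derivative)
  moreover have "Ck n (\<lambda>x. (k * (\<i> * of_real c)) * cis (c * x))" by (rule Suc.IH)
  ultimately show ?case by (intro Ck_SucI[where h'="\<lambda>x. (k * (\<i> * of_real c)) * cis (c * x)"]) (simp_all add: mult.assoc)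
qed simp

lemma Ck_inverse: "Ck n f \<Longrightarrow> (\<And>x. f x \<noteq> 0) \<Longrightarrow> Ck n (\<lambda>x. inverse (f x))"
proof (induction n)
  case (Suc n)
  then obtain f' where f: "\<And>x. (f has_vector_derivative f' x) (at x)" "Ck n f'" by auto
  have inv: "Ck n (\<lambda>x. inverse (f x))" using Suc by (auto dest: Ck_mono simp del: Ck.simps)
  have "((\<lambda>x. inverse (f x)) has_vector_derivative (- 1 * (inverse (f x) * f' x * inverse (f x)))) (at x)" for x
  proof -
    have "((\<lambda>x. inverse (f x)) has_derivative (\<lambda>h. - (inverse (f x) * (h *\<^sub>R f' x) * inverse (f x)))) (at x)"
      using Suc.prems(2) f(1)[of x] by (intro Deriv.has_derivative_inverse) (auto simp: has_vector_derivative_def)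
    then show ?thesis by (simp add: has_vector_derivative_def scaleR_conv_of_real mult_ac)
  qed
  moreover have "Ck n (\<lambda>x. - 1 * (inverse (f x) * f' x * inverse (f x)))"
    by (intro Ck_mult Ck_const inv f)
  ultimately show ?case by (intro Ck_SucI)
qed simp

lemma smooth1_mult: "smooth1 f \<Longrightarrow> smooth1 g \<Longrightarrow> smooth1 (\<lambda>x. f x * g x)"
  by (simp add: smooth1_def Ck_mult)

lemma smooth1_affine: "smooth1 f \<Longrightarrow> smooth1 (\<lambda>x. f (a * x + b))"
  by (simp add: smooth1_def Ck_affine)

lemma smooth1_cis: "smooth1 (\<lambda>x. cis (c * x))"
  using Ck_cis[of _ 1 c] by (simp add: smooth1_def)

lemma smooth1_continuous_on: "smooth1 h \<Longrightarrow> continuous_on A h"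
  by (meson smooth1_dd(1) continuous_at_imp_continuous_on has_vector_derivative_continuous)

text \<open>All derivatives of $e^{-1/x}$ are polynomials in $1/x$ times $e^{-1/x}$.\<close>
definition flatexp :: "real poly \<Rightarrow> real \<Rightarrow> real" where
  "flatexp p x = (if 0 < x then poly p (1 / x) * exp (- 1 / x) else 0)"

text \<open>This is the difference quotient at 0. In the variable 1/x it is a polynomial divided by
  an exponential.\<close>

lemma flatexp_tendsto_0: "((\<lambda>x. flatexp p x / x) \<longlongrightarrow> 0) (at 0)"
proof -
  have lim: "((\<lambda>x. poly (pCons 0 p) x / exp x) \<longlongrightarrow> 0) at_top" for p :: "real poly"
  proof (induction p)
    case 0
    then show ?case by simp
  next
    case (pCons a p)
    have 1: "((\<lambda>x::real. x ^ k / exp x) \<longlongrightarrow> 0) at_top" for k by (rule tendsto_power_div_exp_0)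
    have "((\<lambda>x. poly q x / exp x) \<longlongrightarrow> 0) at_top" for q :: "real poly"
    proof -
      have "((\<lambda>x. \<Sum>i\<le>degree q. coeff q i * (x ^ i / exp x)) \<longlongrightarrow> (\<Sum>i\<le>degree q. coeff q i * 0)) at_top"
        by (intro tendsto_sum tendsto_mult tendsto_const 1)
      then show ?thesis by (simp add: poly_altdef sum_divide_distrib)
    qed
    then show ?case .
  qed
  have r: "((\<lambda>x. flatexp p x / x) \<longlongrightarrow> 0) (at_right 0)"
  proof -
    have "((\<lambda>x. poly (pCons 0 p) (inverse x) / exp (inverse x)) \<longlongrightarrow> 0) (at_right 0)"
      by (rule filterlim_compose[OF lim filterlim_inverse_at_top_right])
    moreover have "\<forall>\<^sub>F x in at_right 0. poly (pCons 0 p) (inverse x) / exp (inverse x) = flatexp p x / x"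
      using eventually_at_right_less[of 0]
      by eventually_elim (simp add: flatexp_def exp_minus divide_inverse mult_ac)
    ultimately show ?thesis by (rule Lim_transform_eventually)
  qed
  have l: "((\<lambda>x. flatexp p x / x) \<longlongrightarrow> 0) (at_left 0)"
  proof -
    have "\<forall>\<^sub>F x in at_left 0. 0 = flatexp p x / x"
      unfolding eventually_at_filter by (auto simp: flatexp_def intro!: always_eventually)
    from Lim_transform_eventually[OF tendsto_const this] show ?thesis .
  qed
  from l r show ?thesis by (simp add: filterlim_at_split)
qed

text \<open>By the chain rule the derivative of p(1/x) exp(-1/x) is (p - p')(1/x) exp(-1/x) / x^2,
  again of the same form; the factor 1/x^2 is the monomial of degree 2.\<close>

lemma flatexp_deriv: "(flatexp p has_real_derivative flatexp (monom 1 2 * (p - pderiv p)) x) (at x)"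
proof -
  consider "0 < x" | "x < 0" | "x = 0" by linarith
  then show ?thesis
  proof cases
    case 1
    have "((\<lambda>x. poly p (1 / x) * exp (- 1 / x)) has_real_derivative flatexp (monom 1 2 * (p - pderiv p)) x) (at x)"
      using 1 by (auto intro!: derivative_eq_intros DERIV_chain'[of "\<lambda>x. 1 / x", OF _ poly_DERIV]
        simp: flatexp_def poly_monom field_simps power2_eq_square)
    then show ?thesis
      using eventually_nhds_in_open[of "{0<..}" x] 1
      by (subst DERIV_cong_ev[OF refl _ refl]) (auto elim!: eventually_mono simp: flatexp_def)
  next
    case 2
    have "\<forall>\<^sub>F y in nhds x. flatexp p y = 0"
      using eventually_nhds_in_open[of "{..<0}" x] 2 by (auto elim!: eventually_mono simp: flatexp_def)
    from iffD2[OF DERIV_cong_ev[OF refl this refl], of 0]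
    have "(flatexp p has_real_derivative 0) (at x)" by simp
    then show ?thesis using 2 by (simp add: flatexp_def[of "_ * _"])
  next
    case 3
    have "((\<lambda>h. (flatexp p (0 + h) - flatexp p 0) / h) \<longlongrightarrow> 0) (at 0)"
      using flatexp_tendsto_0[of p] by (simp add: flatexp_def)
    then show ?thesis using 3 by (simp add: DERIV_def flatexp_def)
  qed
qed

lemma Ck_flatexp: "Ck n (\<lambda>x. of_real (flatexp p x))"
proof (induction n arbitrary: p)
  case (Suc n)
  have "((\<lambda>x. of_real (flatexp p x)) has_vector_derivative complex_of_real (flatexp (monom 1 2 * (p - pderiv p)) x)) (at x)" for x
    using flatexp_deriv[of p x] by (intro has_vector_derivative_of_real) (simp add: has_real_derivative_iff_has_vector_derivative)
  then show ?case by (rule Ck_SucI) (rule Suc.IH)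
qed simp

section \<open>Smooth cut-off functions\<close>

definition cstep :: "real \<Rightarrow> real" where
  "cstep x = flatexp 1 x * inverse (flatexp 1 x + flatexp 1 (1 - x))"

lemma flatexp_1_nonneg: "0 \<le> flatexp 1 x" and flatexp_1_pos: "0 < x \<Longrightarrow> 0 < flatexp 1 x" and flatexp_1_0: "x \<le> 0 \<Longrightarrow> flatexp 1 x = 0"
  by (auto simp: flatexp_def)

lemma cstep_denom: "0 < flatexp 1 x + flatexp 1 (1 - x)"
  using flatexp_1_nonneg[of x] flatexp_1_nonneg[of "1 - x"] flatexp_1_pos[of x] flatexp_1_pos[of "1 - x"] by linarith

lemma smooth1_cstep: "smooth1 (\<lambda>x. of_real (cstep x))"
proof -
  have "Ck n (\<lambda>x. of_real (flatexp 1 x) * inverse (of_real (flatexp 1 x) + of_real (flatexp 1 (- 1 * x + 1))))" for n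
  proof (intro Ck_mult Ck_inverse Ck_add Ck_flatexp)
    show "Ck n (\<lambda>x. of_real (flatexp 1 (- 1 * x + 1)))"
      by (rule Ck_affine[OF Ck_flatexp])
    fix x :: real
    show "complex_of_real (flatexp 1 x) + complex_of_real (flatexp 1 (- 1 * x + 1)) \<noteq> 0"
      using cstep_denom[of x] by (simp flip: of_real_add)
  qed
  then show ?thesis by (simp add: smooth1_def cstep_def)
qed

lemma cstep_simps: "x \<le> 0 \<Longrightarrow> cstep x = 0" "1 \<le> x \<Longrightarrow> cstep x = 1" "0 \<le> cstep x"
  using cstep_denom[of x] flatexp_1_nonneg[of x] by (auto simp: cstep_def flatexp_1_0)

text \<open>Equal to 1 on [-2, 2], which contains each coordinate of a frequency in the ball of
  radius 2 belonging to \<open>class_E 1\<close>, and equal to 0 outside [-3, 3].\<close>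

definition cut :: "real \<Rightarrow> complex" where
  "cut x = of_real (cstep (3 - x) * cstep (3 + x))"

lemma smooth1_cut: "smooth1 cut"
proof -
  have "smooth1 (\<lambda>x. of_real (cstep (- 1 * x + 3)) * of_real (cstep (1 * x + 3)))"
    by (intro smooth1_mult smooth1_affine[OF smooth1_cstep])
  then show ?thesis by (simp add: cut_def[abs_def] add.commute)
qed

lemma cut_eq_1: "\<bar>x\<bar> \<le> 2 \<Longrightarrow> cut x = 1"
  by (simp add: cut_def cstep_simps abs_le_iff)

lemma cut_eq_0: "3 \<le> \<bar>x\<bar> \<Longrightarrow> cut x = 0"
  by (auto simp: cut_def cstep_simps abs_if split: if_splits)

section \<open>Fourier transforms of compactly supported smooth functions\<close>

definition csupp :: "(real \<Rightarrow> complex) \<Rightarrow> bool" where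
  "csupp h \<longleftrightarrow> (\<exists>R. \<forall>x. R < \<bar>x\<bar> \<longrightarrow> h x = 0)"

lemma csupp_mult: "csupp h \<Longrightarrow> csupp (\<lambda>x. h x * g x)"
  by (auto simp: csupp_def)

lemma csupp_dd:
  assumes "csupp h"
  shows "csupp (dd h)"
proof -
  obtain R where R: "\<And>x. R < \<bar>x\<bar> \<Longrightarrow> h x = 0" using assms by (auto simp: csupp_def)
  have "dd h x = 0" if "R < \<bar>x\<bar>" for x
  proof -
    have "open {x::real. R < \<bar>x\<bar>}" by (intro open_Collect_less continuous_intros)
    then have "\<forall>\<^sub>F y in nhds x. h y = 0"
      using eventually_nhds_in_open[of "{x. R < \<bar>x\<bar>}" x] that by (auto elim!: eventually_mono intro: R)
    then have "(h has_vector_derivative 0) (at x)"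
      using that by (subst has_vector_derivative_cong_ev[where g="\<lambda>_. 0"]) (auto simp: R)
    then show ?thesis by (simp add: dd_def vector_derivative_at)
  qed
  then show ?thesis by (auto simp: csupp_def)
qed

lemma csupp_indicator:
  assumes "csupp h" obtains R where "0 < R" "\<And>x. R \<le> \<bar>x\<bar> \<Longrightarrow> h x = 0" "h = (\<lambda>x. indicator {- R..R} x *\<^sub>R h x)"
proof -
  obtain R where R: "\<And>x. R < \<bar>x\<bar> \<Longrightarrow> h x = 0" using assms by (auto simp: csupp_def)
  show ?thesis
    by (rule that[of "\<bar>R\<bar> + 1"]) (auto simp: fun_eq_iff indicator_def intro!: R)
qed

lemma csupp_integrable:
  assumes "csupp h" "continuous_on UNIV h"
  shows "integrable lborel h"
proof -
  obtain R where R: "h = (\<lambda>x. indicator {- R..R} x *\<^sub>R h x)" using csupp_indicator[OF assms(1)] by metis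
  have "integrable lborel (\<lambda>x. indicator {- R..R} x *\<^sub>R h x)"
    by (rule borel_integrable_compact) (auto intro: continuous_on_subset[OF assms(2)])
  then show ?thesis using R by metis
qed

text \<open>The integrations by parts in \<open>F1_dd\<close> and \<open>integral_sinc_Si\<close>
  are instances with the derivative of a product.\<close>

lemma integral_deriv_csupp:
  assumes "csupp h" "\<And>x. (h has_vector_derivative h' x) (at x)" "continuous_on UNIV h'"
  shows "(\<integral>x. h' x \<partial>lborel) = 0"
proof -
  obtain R where R: "0 < R" "\<And>x. R \<le> \<bar>x\<bar> \<Longrightarrow> h x = 0" using csupp_indicator[OF assms(1)] by metis
  have z: "h' x = 0" if "R < \<bar>x\<bar>" for x
  proof -
    have "open {x::real. R < \<bar>x\<bar>}" by (intro open_Collect_less continuous_intros)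
    then have "\<forall>\<^sub>F y in nhds x. h y = 0"
      using eventually_nhds_in_open[of "{x. R < \<bar>x\<bar>}" x] that by (auto elim!: eventually_mono intro: R)
    then have "(h has_vector_derivative 0) (at x)"
      using that by (subst has_vector_derivative_cong_ev[where g="\<lambda>_. 0"]) (auto simp: R)
    with assms(2)[of x] show ?thesis using vector_derivative_unique_at by blast
  qed
  have "(\<integral>x. h' x \<partial>lborel) = (\<integral>x. indicator {- R..R} x *\<^sub>R h' x \<partial>lborel)"
    by (intro Bochner_Integration.integral_cong) (auto simp: indicator_def intro!: z)
  also have "\<dots> = h R - h (- R)"
    using R assms by (intro integral_FTC_Icc) (auto intro: has_vector_derivative_at_within continuous_on_subset)
  also have "\<dots> = 0" using R by simp
  finally show ?thesis .
qed

definition F1 :: "(real \<Rightarrow> complex) \<Rightarrow> real \<Rightarrow> complex" where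
  "F1 h w = (\<integral>x. h x * cis (- 2 * pi * (x * w)) \<partial>lborel)"

lemma F1_integrand:
  assumes "smooth1 h" "csupp h"
  shows "integrable lborel (\<lambda>x. h x * cis (- 2 * pi * (x * w)))"
proof (rule csupp_integrable)
  show "csupp (\<lambda>x. h x * cis (- 2 * pi * (x * w)))" using assms by (intro csupp_mult)
  show "continuous_on UNIV (\<lambda>x. h x * cis (- 2 * pi * (x * w)))"
    by (intro continuous_intros smooth1_continuous_on assms continuous_on_cis)
qed

lemma F1_dd:
  assumes h: "smooth1 h" "csupp h"
  shows "F1 (dd h) w = 2 * pi * \<i> * w * F1 h w"
proof -
  let ?c = "- 2 * pi * w"
  have e: "cis (- 2 * pi * (x * w)) = cis (?c * x)" for x by (simp add: mult_ac)
  have "(\<integral>x. h x * (\<i> * of_real ?c * cis (?c * x)) + dd h x * cis (?c * x) \<partial>lborel) = 0"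
  proof (rule integral_deriv_csupp)
    show "csupp (\<lambda>x. h x * cis (?c * x))" using h by (intro csupp_mult)
    show "((\<lambda>x. h x * cis (?c * x)) has_vector_derivative h x * (\<i> * of_real ?c * cis (?c * x)) + dd h x * cis (?c * x)) (at x)" for x
      by (intro has_vector_derivative_mult smooth1_dd h cis_has_vector_derivative)
    show "continuous_on UNIV (\<lambda>x. h x * (\<i> * of_real ?c * cis (?c * x)) + dd h x * cis (?c * x))"
      by (intro continuous_intros smooth1_continuous_on smooth1_dd h continuous_on_cis)
  qed
  moreover have "integrable lborel (\<lambda>x. dd h x * cis (?c * x))"
    using F1_integrand[OF smooth1_dd(2)[OF h(1)] csupp_dd[OF h(2)], of w] by (simp only: e)
  moreover have i: "integrable lborel (\<lambda>x. h x * cis (?c * x))"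
    using F1_integrand[OF h, of w] by (simp only: e)
  have "integrable lborel (\<lambda>x. \<i> * of_real ?c * (h x * cis (?c * x)))"
    by (intro integrable_mult_right i)
  then have "integrable lborel (\<lambda>x. h x * (\<i> * of_real ?c * cis (?c * x)))" by (simp add: mult_ac)
  ultimately have "(\<integral>x. h x * (\<i> * of_real ?c * cis (?c * x)) \<partial>lborel) + (\<integral>x. dd h x * cis (?c * x) \<partial>lborel) = 0"
    by simp
  moreover have "(\<integral>x. h x * (\<i> * of_real ?c * cis (?c * x)) \<partial>lborel) = \<i> * of_real ?c * (\<integral>x. h x * cis (?c * x) \<partial>lborel)"
    by (subst integral_mult_right_zero[symmetric]) (simp add: mult_ac)
  ultimately show ?thesis unfolding F1_def e by (simp add: mult_ac add_eq_0_iff)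
qed

lemma F1_bound: "smooth1 h \<Longrightarrow> csupp h \<Longrightarrow> cmod (F1 h w) \<le> (\<integral>x. cmod (h x) \<partial>lborel)"
  unfolding F1_def by (rule order_trans[OF integral_norm_bound]) (simp add: norm_mult)

text \<open>Each derivative of h buys one power of w; the factor 2 pi gained in \<open>F1_dd\<close>
  is at least 1 and may be dropped.\<close>

lemma F1_decay_power:
  "smooth1 h \<Longrightarrow> csupp h \<Longrightarrow> \<exists>C. \<forall>w. \<bar>w\<bar> ^ N * cmod (F1 h w) \<le> C"
proof (induction N arbitrary: h)
  case 0
  then show ?case using F1_bound by auto
next
  case (Suc N)
  then obtain C where C: "\<And>w. \<bar>w\<bar> ^ N * cmod (F1 (dd h) w) \<le> C"
    using Suc.IH[of "dd h"] smooth1_dd csupp_dd by blast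
  have "\<bar>w\<bar> ^ Suc N * cmod (F1 h w) \<le> C" for w
  proof -
    have "\<bar>w\<bar> ^ N * cmod (F1 (dd h) w) = 2 * pi * (\<bar>w\<bar> ^ Suc N * cmod (F1 h w))"
      using Suc.prems by (simp add: F1_dd norm_mult)
    moreover have "1 * (\<bar>w\<bar> ^ Suc N * cmod (F1 h w)) \<le> 2 * pi * (\<bar>w\<bar> ^ Suc N * cmod (F1 h w))"
      using pi_ge_two by (intro mult_right_mono) auto
    ultimately show ?thesis using C[of w] by linarith
  qed
  then show ?case by blast
qed

lemma F1_decay:
  assumes "smooth1 h" "csupp h"
  shows "\<exists>C>0. \<forall>w. (1 + \<bar>w\<bar>) ^ N * cmod (F1 h w) \<le> C"
proof -
  obtain C0 where C0: "\<And>w. cmod (F1 h w) \<le> C0" using F1_decay_power[OF assms, of 0] by auto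
  obtain C1 where C1: "\<And>w. \<bar>w\<bar> ^ N * cmod (F1 h w) \<le> C1" using F1_decay_power[OF assms, of N] by auto
  have "(1 + \<bar>w\<bar>) ^ N * cmod (F1 h w) \<le> 2 ^ N * (C0 + C1)" for w
  proof -
    have "(1 + \<bar>w\<bar>) ^ N \<le> (2 * max 1 \<bar>w\<bar>) ^ N" by (intro power_mono) auto
    also have "\<dots> \<le> 2 ^ N * (1 + \<bar>w\<bar> ^ N)" by (auto simp: power_mult_distrib max_def)
    finally have "(1 + \<bar>w\<bar>) ^ N * cmod (F1 h w) \<le> 2 ^ N * (1 + \<bar>w\<bar> ^ N) * cmod (F1 h w)"
      by (intro mult_right_mono) auto
    also have "\<dots> = 2 ^ N * (cmod (F1 h w) + \<bar>w\<bar> ^ N * cmod (F1 h w))" by (simp add: algebra_simps)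
    also have "\<dots> \<le> 2 ^ N * (C0 + C1)" by (intro mult_left_mono add_mono C0 C1) auto
    finally show ?thesis .
  qed
  then have "\<forall>w. (1 + \<bar>w\<bar>) ^ N * cmod (F1 h w) \<le> max 1 (2 ^ N * (C0 + C1))" by (meson max.coboundedI2)
  then show ?thesis by (intro exI[of _ "max 1 (2 ^ N * (C0 + C1))"]) auto
qed

lemma F1_measurable:
  assumes "smooth1 h"
  shows "F1 h \<in> borel_measurable borel"
proof -
  have [measurable]: "h \<in> borel_measurable borel"
    using smooth1_continuous_on[OF assms] by (rule borel_measurable_continuous_onI)
  have [measurable]: "cis \<in> borel_measurable borel"
    by (intro borel_measurable_continuous_onI continuous_on_cis continuous_intros)
  show ?thesis unfolding F1_def by measurable
qed

text \<open>Supplies the continuity of the bump. The difference of two characters is at most the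
  difference of their phases, and compact support makes |x| h(x) integrable.\<close>

lemma F1_Lipschitz:
  assumes "smooth1 h" "csupp h"
  shows "\<exists>C. \<forall>w w'. cmod (F1 h w - F1 h w') \<le> C * \<bar>w - w'\<bar>"
proof -
  have lip: "cmod (cis a - cis b) \<le> \<bar>a - b\<bar>" for a b
  proof -
    have "cis a - cis b = cis b * (cis (a - b) - 1)" by (simp add: algebra_simps cis_mult)
    then have "cmod (cis a - cis b) = cmod (cis (a - b) - 1)" by (simp add: norm_mult)
    also have "\<dots> \<le> \<bar>a - b\<bar>" using iexp_approx1[of "a - b" 0] by (simp add: cis_conv_exp)
    finally show ?thesis .
  qed
  let ?g = "\<lambda>x. h x * of_real \<bar>x\<bar>"
  have "integrable lborel ?g"
    using assms by (intro csupp_integrable csupp_mult continuous_intros smooth1_continuous_on)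
  then have ig: "integrable lborel (\<lambda>x. 2 * pi * cmod (?g x))" by (intro integrable_mult_right integrable_norm)
  have "cmod (F1 h w - F1 h w') \<le> (\<integral>x. 2 * pi * cmod (?g x) \<partial>lborel) * \<bar>w - w'\<bar>" for w w'
  proof -
    have eq: "F1 h w - F1 h w' = (\<integral>x. h x * cis (- 2 * pi * (x * w)) - h x * cis (- 2 * pi * (x * w')) \<partial>lborel)"
      unfolding F1_def by (intro Bochner_Integration.integral_diff[symmetric] F1_integrand assms)
    have "cmod (F1 h w - F1 h w') \<le> (\<integral>x. cmod (h x * cis (- 2 * pi * (x * w)) - h x * cis (- 2 * pi * (x * w'))) \<partial>lborel)"
      unfolding eq by (rule integral_norm_bound)
    also have "\<dots> \<le> (\<integral>x. 2 * pi * cmod (?g x) * \<bar>w - w'\<bar> \<partial>lborel)"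
    proof (rule integral_mono)
      show "integrable lborel (\<lambda>x. cmod (h x * cis (- 2 * pi * (x * w)) - h x * cis (- 2 * pi * (x * w'))))"
        by (intro integrable_norm Bochner_Integration.integrable_diff F1_integrand assms)
      show "integrable lborel (\<lambda>x. 2 * pi * cmod (?g x) * \<bar>w - w'\<bar>)"
        by (intro integrable_mult_left ig)
      fix x :: real
      have "cmod (h x * cis (- 2 * pi * (x * w)) - h x * cis (- 2 * pi * (x * w'))) = cmod (h x) * cmod (cis (- 2 * pi * (x * w)) - cis (- 2 * pi * (x * w')))"
        by (simp add: right_diff_distrib[symmetric] norm_mult)
      also have "\<dots> \<le> cmod (h x) * \<bar>- 2 * pi * (x * w) - (- 2 * pi * (x * w'))\<bar>"
        by (intro mult_left_mono lip) auto
      also have "\<dots> = 2 * pi * cmod (?g x) * \<bar>w - w'\<bar>"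
      proof -
        have eq: "- 2 * pi * (x * w) - (- 2 * pi * (x * w')) = - 2 * pi * x * (w - w')" by (simp add: algebra_simps)
        show ?thesis unfolding eq by (simp add: abs_mult norm_mult)
      qed
      finally show "cmod (h x * cis (- 2 * pi * (x * w)) - h x * cis (- 2 * pi * (x * w'))) \<le> 2 * pi * cmod (?g x) * \<bar>w - w'\<bar>" .
    qed
    also have "\<dots> = (\<integral>x. 2 * pi * cmod (?g x) \<partial>lborel) * \<bar>w - w'\<bar>" by simp
    finally show ?thesis .
  qed
  then show ?thesis by blast
qed

lemma integrable_decay:
  assumes "real DIM('a::euclidean_space) < L"
  shows "integrable lborel (\<lambda>w::'a. (1 + norm w) powr - L)"
proof (rule integrableI_nonneg)
  show "(\<integral>\<^sup>+w. ennreal ((1 + norm (w::'a)) powr - L) \<partial>lborel) < \<infinity>"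
    using kmass_finite[OF assms] by (simp add: kmass_def)
qed auto

lemma cis_measurable [measurable]: "cis \<in> borel_measurable borel"
  by (intro borel_measurable_continuous_onI continuous_on_cis continuous_intros)

lemma F1_integrable:
  assumes "smooth1 h" "csupp h"
  shows "integrable lborel (F1 h)"
proof -
  obtain C where C: "\<And>w. (1 + \<bar>w\<bar>) ^ 2 * cmod (F1 h w) \<le> C" using F1_decay[OF assms, of 2] by blast
  have [measurable]: "F1 h \<in> borel_measurable borel" by (rule F1_measurable) fact
  show ?thesis
  proof (rule Bochner_Integration.integrable_bound)
    show "integrable lborel (\<lambda>w::real. C * (1 + norm w) powr - 2)"
      by (intro integrable_mult_right integrable_decay) simp
    show "AE w in lborel. norm (F1 h w) \<le> norm (C * (1 + norm w) powr - 2)"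
    proof (intro AE_I2)
      fix w :: real
      have "norm (F1 h w) \<le> C / (1 + \<bar>w\<bar>) ^ 2"
        using C[of w] by (simp add: field_simps pos_le_divide_eq add_pos_nonneg)
      also have "\<dots> = C * (1 + norm w) powr - 2"
        by (simp add: powr_minus_divide powr_numeral)
      finally show "norm (F1 h w) \<le> norm (C * (1 + norm w) powr - 2)" by simp
    qed
  qed simp
qed

section \<open>Fourier inversion through the Dirichlet integral\<close>

lemma integral_cis_sinc:
  assumes T: "0 < T"
  shows "(\<integral>w. indicator {- T..T} w *\<^sub>R cis (- 2 * pi * (w * a)) \<partial>lborel) = of_real (2 * T * sinc (2 * pi * T * a))"
proof (cases "a = 0")
  case True
  have "(\<integral>w. indicator {- T..T} w *\<^sub>R (1::complex) \<partial>lborel) = of_real (2 * T)"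
    using T by (simp add: scaleR_conv_of_real)
  then show ?thesis using True by (simp add: scaleR_conv_of_real)
next
  case False
  let ?c = "- 2 * pi * a"
  let ?G = "\<lambda>w. (\<i> / of_real (2 * pi * a)) * cis (?c * w)"
  have e: "cis (- 2 * pi * (w * a)) = cis (?c * w)" for w by (simp add: mult_ac)
  have "(\<integral>w. indicator {- T..T} w *\<^sub>R cis (?c * w) \<partial>lborel) = ?G T - ?G (- T)"
  proof (rule integral_FTC_Icc)
    fix w
    have "(?G has_vector_derivative (\<i> / of_real (2 * pi * a)) * (\<i> * of_real ?c * cis (?c * w))) (at w)"
      by (intro has_vector_derivative_mult_right cis_has_vector_derivative)
    moreover have "(\<i> / of_real (2 * pi * a)) * (\<i> * of_real ?c * cis (?c * w)) = cis (?c * w)"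
      using False by (simp add: field_simps)
    ultimately show "(?G has_vector_derivative cis (?c * w)) (at w within {- T..T})"
      by (metis has_vector_derivative_at_within)
  qed (use T in \<open>auto intro!: continuous_on_cis continuous_intros\<close>)
  also have "\<dots> = of_real (2 * T * sinc (2 * pi * T * a))"
    using T False by (simp add: complex_eq_iff mult_ac)
  finally show ?thesis unfolding e .
qed

text \<open>The Dirichlet kernel has no integrable majorant uniform in T, but its primitive
  \<open>Si\<close> is bounded. Moving the derivative onto h therefore prepares the limit of large T
  for dominated convergence.\<close>

lemma integral_sinc_Si:
  assumes h: "smooth1 h" "csupp h"
  shows "(\<integral>x. h x * of_real (2 * T * sinc (2 * pi * T * (x - x0))) \<partial>lborel) =
    - (\<integral>x. dd h x * of_real (Si (2 * pi * T * (x - x0)) / pi) \<partial>lborel)"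
proof -
  let ?S = "\<lambda>x. complex_of_real (Si (2 * pi * T * (x - x0)) / pi)"
  let ?s = "\<lambda>x. complex_of_real (2 * T * sinc (2 * pi * T * (x - x0)))"
  have dS: "(?S has_vector_derivative ?s x) (at x)" for x
  proof -
    have "((\<lambda>x. Si (2 * pi * T * (x - x0)) / pi) has_real_derivative 2 * T * sinc (2 * pi * T * (x - x0))) (at x)"
      by (auto intro!: derivative_eq_intros DERIV_chain2[OF DERIV_Si])
    then show ?thesis
      by (intro has_vector_derivative_of_real) (simp add: has_real_derivative_iff_has_vector_derivative)
  qed
  have cS: "continuous_on UNIV ?S" using dS
    by (meson continuous_at_imp_continuous_on has_vector_derivative_continuous)
  have cs: "continuous_on UNIV ?s" by (intro continuous_intros)
  have "(\<integral>x. h x * ?s x + dd h x * ?S x \<partial>lborel) = 0"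
  proof (rule integral_deriv_csupp)
    show "csupp (\<lambda>x. h x * ?S x)" using h by (intro csupp_mult)
    show "((\<lambda>x. h x * ?S x) has_vector_derivative h x * ?s x + dd h x * ?S x) (at x)" for x
      by (intro has_vector_derivative_mult smooth1_dd h dS)
    show "continuous_on UNIV (\<lambda>x. h x * ?s x + dd h x * ?S x)"
      by (intro continuous_on_add continuous_on_mult cS cs smooth1_continuous_on smooth1_dd h)
  qed
  moreover have "integrable lborel (\<lambda>x. h x * ?s x)"
    by (intro csupp_integrable csupp_mult continuous_on_mult cs smooth1_continuous_on h)
  moreover have "integrable lborel (\<lambda>x. dd h x * ?S x)"
    by (intro csupp_integrable csupp_mult csupp_dd continuous_on_mult cS smooth1_continuous_on smooth1_dd h)
  ultimately have "(\<integral>x. h x * ?s x \<partial>lborel) + (\<integral>x. dd h x * ?S x \<partial>lborel) = 0"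
    by simp
  then show ?thesis by (simp add: add_eq_0_iff)
qed

lemma Si_tendsto_sgn: "((\<lambda>T. Si (2 * pi * T * a)) \<longlongrightarrow> pi / 2 * sgn a) at_top"
proof -
  have pos: "((\<lambda>T. Si (2 * pi * T * a)) \<longlongrightarrow> pi / 2) at_top" if "0 < a" for a
  proof (rule filterlim_compose[OF Si_at_top])
    have "LIM T at_top. (2 * pi * a) * T :> at_top"
      using that by (intro filterlim_tendsto_pos_mult_at_top[OF tendsto_const] filterlim_ident) auto
    then show "LIM T at_top. 2 * pi * T * a :> at_top" by (simp add: mult_ac)
  qed
  consider "0 < a" | "a = 0" | "a < 0" by linarith
  then show ?thesis
  proof cases
    case 1
    then show ?thesis using pos by simp
  next
    case 2
    have "Si 0 = 0" using Si_neg[of 0] by simp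
    with 2 show ?thesis by simp
  next
    case 3
    have "((\<lambda>T. - Si (2 * pi * T * (- a))) \<longlongrightarrow> - (pi / 2)) at_top"
      using 3 by (intro tendsto_minus pos) auto
    moreover have "\<forall>\<^sub>F T in at_top. - Si (2 * pi * T * (- a)) = Si (2 * pi * T * a)"
      using eventually_ge_at_top[of 0]
    proof eventually_elim
      case (elim T)
      have "0 \<le> 2 * pi * T * (- a)" using 3 elim by (intro mult_nonneg_nonneg) auto
      from Si_neg[OF this] show ?case by simp
    qed
    ultimately show ?thesis using 3 by (auto intro: Lim_transform_eventually)
  qed
qed

text \<open>In effect, the derivative of the sign function is twice the Dirac mass.\<close>

lemma integral_dd_sgn:
  assumes h: "smooth1 h" "csupp h"
  shows "(\<integral>x. dd h x * of_real (sgn (x - x0)) \<partial>lborel) = - 2 * h x0"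
proof -
  obtain R1 where R1: "0 < R1" "\<And>x. R1 \<le> \<bar>x\<bar> \<Longrightarrow> h x = 0" using csupp_indicator[OF h(2)] by metis
  obtain R2 where R2: "0 < R2" "\<And>x. R2 \<le> \<bar>x\<bar> \<Longrightarrow> dd h x = 0" using csupp_indicator[OF csupp_dd[OF h(2)]] by metis
  define R where "R = max R1 R2 + \<bar>x0\<bar>"
  have R: "h R = 0" "h (- R) = 0" "\<And>x. R \<le> \<bar>x\<bar> \<Longrightarrow> dd h x = 0" "x0 \<le> R" "- R \<le> x0"
    using R1 R2 by (auto simp: R_def)
  have c: "continuous_on A (dd h)" for A by (intro smooth1_continuous_on smooth1_dd h)
  have 1: "(\<integral>x. indicator {x0..R} x *\<^sub>R dd h x \<partial>lborel) = h R - h x0"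
    using R c by (intro integral_FTC_Icc) (auto intro: has_vector_derivative_at_within[OF smooth1_dd(1)[OF h(1)]])
  have 2: "(\<integral>x. indicator {- R..x0} x *\<^sub>R dd h x \<partial>lborel) = h x0 - h (- R)"
    using R c by (intro integral_FTC_Icc) (auto intro: has_vector_derivative_at_within[OF smooth1_dd(1)[OF h(1)]])
  have i: "integrable lborel (\<lambda>x. indicator {x0..R} x *\<^sub>R dd h x)" "integrable lborel (\<lambda>x. indicator {- R..x0} x *\<^sub>R dd h x)"
    by (intro borel_integrable_compact c compact_Icc)+
  have "dd h x * of_real (sgn (x - x0)) = indicator {x0..R} x *\<^sub>R dd h x - indicator {- R..x0} x *\<^sub>R dd h x" for x
    using R(3)[of x] R(4,5) by (auto simp: indicator_def sgn_if)
  then have "(\<integral>x. dd h x * of_real (sgn (x - x0)) \<partial>lborel) = (\<integral>x. indicator {x0..R} x *\<^sub>R dd h x \<partial>lborel) - (\<integral>x. indicator {- R..x0} x *\<^sub>R dd h x \<partial>lborel)"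
    using i by (simp only:) (rule Bochner_Integration.integral_diff)
  then show ?thesis unfolding 1 2 using R by simp
qed

text \<open>The truncated integral \<open>K T\<close> has two limits. Directly it tends to the full
  integral, because \<open>F1 h\<close> is integrable; by Fubini it is an integral of h against the
  Dirichlet kernel, which after integration by parts involves \<open>Si\<close> and tends to the
  integral against the sign function, that is, to \<open>h x0\<close>.\<close>

lemma F1_inversion:
  assumes h: "smooth1 h" "csupp h"
  shows "(\<integral>w. F1 h w * cis (2 * pi * (w * x0)) \<partial>lborel) = h x0"
proof -
  have [measurable]: "F1 h \<in> borel_measurable borel" by (rule F1_measurable) fact
  have [measurable]: "h \<in> borel_measurable borel" "dd h \<in> borel_measurable borel"
    using h smooth1_dd by (auto intro!: borel_measurable_continuous_onI smooth1_continuous_on)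
  define K where "K T = (\<integral>w. indicator {- T..T} w *\<^sub>R (F1 h w * cis (2 * pi * (w * x0))) \<partial>lborel)" for T
  have lim1: "(K \<longlongrightarrow> (\<integral>w. F1 h w * cis (2 * pi * (w * x0)) \<partial>lborel)) at_top"
    unfolding K_def
  proof (rule integral_dominated_convergence_at_top[where w="\<lambda>w. cmod (F1 h w)"])
    show "integrable lborel (\<lambda>w. cmod (F1 h w))" by (intro integrable_norm F1_integrable h)
    show "AE w in lborel. ((\<lambda>T. indicator {- T..T} w *\<^sub>R (F1 h w * cis (2 * pi * (w * x0)))) \<longlongrightarrow> F1 h w * cis (2 * pi * (w * x0))) at_top"
    proof (intro AE_I2)
      fix w :: real
      have "\<forall>\<^sub>F T in at_top. F1 h w * cis (2 * pi * (w * x0)) = indicator {- T..T} w *\<^sub>R (F1 h w * cis (2 * pi * (w * x0)))"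
        using eventually_ge_at_top[of "\<bar>w\<bar>"] by eventually_elim (auto simp: indicator_def abs_le_iff)
      then show "((\<lambda>T. indicator {- T..T} w *\<^sub>R (F1 h w * cis (2 * pi * (w * x0)))) \<longlongrightarrow> F1 h w * cis (2 * pi * (w * x0))) at_top"
        by (rule Lim_transform_eventually[OF tendsto_const])
    qed
    show "\<forall>\<^sub>F T in at_top. AE w in lborel. norm (indicator {- T..T} w *\<^sub>R (F1 h w * cis (2 * pi * (w * x0)))) \<le> cmod (F1 h w)"
      by (intro always_eventually allI AE_I2) (auto simp: indicator_def norm_mult)
  qed measurable
  have KT: "K T = - (\<integral>x. dd h x * of_real (Si (2 * pi * T * (x - x0)) / pi) \<partial>lborel)" if T: "0 < T" for T
  proof -
    let ?f = "\<lambda>x w. indicator {- T..T} w *\<^sub>R (h x * cis (- 2 * pi * (w * (x - x0))))"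
    \<comment> \<open>The truncation to [-T, T] makes the double integral absolutely convergent, so
      that Fubini applies.\<close>
    have int: "integrable (lborel \<Otimes>\<^sub>M lborel) (case_prod ?f)"
    proof (rule lborel_pair.Fubini_integrable)
      show "integrable lborel (\<lambda>x. \<integral>w. norm (case_prod ?f (x, w)) \<partial>lborel)"
      proof -
        have "(\<integral>w. norm (case_prod ?f (x, w)) \<partial>lborel) = 2 * T * cmod (h x)" for x
          using T by (simp add: norm_mult)
        moreover have "integrable lborel (\<lambda>x. 2 * T * cmod (h x))"
          by (intro integrable_mult_right integrable_norm csupp_integrable h smooth1_continuous_on)
        ultimately show ?thesis by simp
      qed
      show "AE x in lborel. integrable lborel (\<lambda>w. case_prod ?f (x, w))"
        by (intro AE_I2, simp only: case_prod_conv) (intro borel_integrable_compact continuous_intros continuous_on_cis compact_Icc)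
    qed measurable
    have "K T = (\<integral>w. (\<integral>x. ?f x w \<partial>lborel) \<partial>lborel)"
      unfolding K_def F1_def
    proof (intro Bochner_Integration.integral_cong refl)
      fix w :: real
      have "cis (- 2 * pi * (w * (x - x0))) = cis (- 2 * pi * (x * w)) * cis (2 * pi * (w * x0))" for x
        by (simp add: cis_mult algebra_simps)
      then have "?f x w = (h x * cis (- 2 * pi * (x * w))) * (indicator {- T..T} w *\<^sub>R cis (2 * pi * (w * x0)))" for x
        by (simp only:) (simp add: scaleR_conv_of_real mult_ac)
      then have "(\<integral>x. ?f x w \<partial>lborel) = (\<integral>x. h x * cis (- 2 * pi * (x * w)) \<partial>lborel) * (indicator {- T..T} w *\<^sub>R cis (2 * pi * (w * x0)))"
        by (simp only: integral_mult_left_zero)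
      then show "indicator {- T..T} w *\<^sub>R ((\<integral>x. h x * cis (- 2 * pi * (x * w)) \<partial>lborel) * cis (2 * pi * (w * x0))) = (\<integral>x. ?f x w \<partial>lborel)"
        by (auto simp: mult_scaleR_right dest: sym)
    qed
    also have "\<dots> = (\<integral>x. (\<integral>w. ?f x w \<partial>lborel) \<partial>lborel)"
      by (rule lborel_pair.Fubini_integral[OF int])
    also have "\<dots> = (\<integral>x. h x * of_real (2 * T * sinc (2 * pi * T * (x - x0))) \<partial>lborel)"
    proof (intro Bochner_Integration.integral_cong refl)
      fix x :: real
      have "(\<integral>w. ?f x w \<partial>lborel) = (\<integral>w. h x * (indicator {- T..T} w *\<^sub>R cis (- 2 * pi * (w * (x - x0)))) \<partial>lborel)"
        by (simp add: mult_scaleR_right)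
      also have "\<dots> = h x * (\<integral>w. indicator {- T..T} w *\<^sub>R cis (- 2 * pi * (w * (x - x0))) \<partial>lborel)"
        by (rule integral_mult_right_zero)
      finally show "(\<integral>w. ?f x w \<partial>lborel) = h x * of_real (2 * T * sinc (2 * pi * T * (x - x0)))"
        unfolding integral_cis_sinc[OF T] .
    qed
    also have "\<dots> = - (\<integral>x. dd h x * of_real (Si (2 * pi * T * (x - x0)) / pi) \<partial>lborel)"
      by (rule integral_sinc_Si[OF h])
    finally show ?thesis .
  qed
  obtain B where B: "\<And>T. \<bar>Si T\<bar> \<le> B" using bounded_Si by blast
  have "((\<lambda>T. \<integral>x. dd h x * of_real (Si (2 * pi * T * (x - x0)) / pi) \<partial>lborel) \<longlongrightarrow> (\<integral>x. dd h x * of_real (sgn (x - x0) / 2) \<partial>lborel)) at_top"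
  proof (rule integral_dominated_convergence_at_top[where w="\<lambda>x. cmod (dd h x) * (B / pi)"])
    show "integrable lborel (\<lambda>x. cmod (dd h x) * (B / pi))"
      by (intro integrable_mult_left integrable_norm csupp_integrable csupp_dd smooth1_continuous_on smooth1_dd h)
    show "AE x in lborel. ((\<lambda>T. dd h x * of_real (Si (2 * pi * T * (x - x0)) / pi)) \<longlongrightarrow> dd h x * of_real (sgn (x - x0) / 2)) at_top"
    proof (intro AE_I2 tendsto_mult tendsto_const tendsto_of_real)
      fix x :: real
      have "((\<lambda>T. Si (2 * pi * T * (x - x0)) / pi) \<longlongrightarrow> (pi / 2 * sgn (x - x0)) / pi) at_top"
        by (intro tendsto_divide Si_tendsto_sgn tendsto_const) simp
      then show "((\<lambda>T. Si (2 * pi * T * (x - x0)) / pi) \<longlongrightarrow> sgn (x - x0) / 2) at_top" by simp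
    qed
    show "\<forall>\<^sub>F T in at_top. AE x in lborel. norm (dd h x * of_real (Si (2 * pi * T * (x - x0)) / pi)) \<le> cmod (dd h x) * (B / pi)"
    proof (intro always_eventually allI AE_I2)
      fix T x
      have "norm (dd h x * of_real (Si (2 * pi * T * (x - x0)) / pi)) = cmod (dd h x) * (\<bar>Si (2 * pi * T * (x - x0))\<bar> / pi)"
        by (simp only: norm_mult norm_of_real) simp
      also have "\<dots> \<le> cmod (dd h x) * (B / pi)"
        by (intro mult_left_mono divide_right_mono B) auto
      finally show "norm (dd h x * of_real (Si (2 * pi * T * (x - x0)) / pi)) \<le> cmod (dd h x) * (B / pi)" .
    qed
  qed measurable
  then have "((\<lambda>T. - (\<integral>x. dd h x * of_real (Si (2 * pi * T * (x - x0)) / pi) \<partial>lborel)) \<longlongrightarrow> - (\<integral>x. dd h x * of_real (sgn (x - x0) / 2) \<partial>lborel)) at_top"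
    by (rule tendsto_minus)
  moreover have "- (\<integral>x. dd h x * of_real (sgn (x - x0) / 2) \<partial>lborel) = h x0"
    using integral_dd_sgn[OF h, of x0] by simp
  ultimately have "((\<lambda>T. - (\<integral>x. dd h x * of_real (Si (2 * pi * T * (x - x0)) / pi) \<partial>lborel)) \<longlongrightarrow> h x0) at_top" by simp
  moreover have "\<forall>\<^sub>F T in at_top. - (\<integral>x. dd h x * of_real (Si (2 * pi * T * (x - x0)) / pi) \<partial>lborel) = K T"
    using eventually_gt_at_top[of 0] by eventually_elim (simp add: KT)
  ultimately have "(K \<longlongrightarrow> h x0) at_top" by (rule Lim_transform_eventually)
  from tendsto_unique[OF _ lim1 this] show ?thesis by simp
qed

section \<open>Band-limited functions\<close>

definition pf :: "('a::euclidean_space \<Rightarrow> real \<Rightarrow> complex) \<Rightarrow> 'a \<Rightarrow> complex" where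
  "pf h x = (\<Prod>i\<in>Basis. h i (x \<bullet> i))"

lemma pf_integral:
  fixes h :: "'a::euclidean_space \<Rightarrow> real \<Rightarrow> complex"
  assumes "\<And>i. i \<in> Basis \<Longrightarrow> integrable lborel (h i)"
  shows "integrable lborel (pf h)" "(\<integral>x. pf h x \<partial>lborel) = (\<Prod>i\<in>Basis. \<integral>t. h i t \<partial>lborel)"
proof -
  interpret product_sigma_finite "\<lambda>_::'a. lborel :: real measure"
    by (rule product_sigma_finite.intro) (rule sigma_finite_lborel)
  have [measurable]: "h i \<in> borel_measurable borel" if "i \<in> Basis" for i
    using borel_measurable_integrable[OF assms[OF that]] by simp
  have m: "pf h \<in> borel_measurable borel" unfolding pf_def by measurable
  let ?T = "\<lambda>f. \<Sum>b\<in>Basis. f b *\<^sub>R (b::'a)"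
  have T: "?T \<in> measurable (\<Pi>\<^sub>M b\<in>Basis. lborel) borel" by measurable
  have e: "pf h (?T f) = (\<Prod>i\<in>Basis. h i (f i))" for f
    unfolding pf_def by (intro prod.cong refl) (simp add: inner_sum_left_Basis)
  have i: "integrable (\<Pi>\<^sub>M b\<in>Basis. lborel) (\<lambda>f. \<Prod>i\<in>(Basis::'a set). h i (f i))"
    using assms by (intro product_integrable_prod) auto
  show "integrable lborel (pf h)"
    unfolding lborel_eq[where 'a='a] using i m T by (subst integrable_distr_eq) (auto simp: e)
  show "(\<integral>x. pf h x \<partial>lborel) = (\<Prod>i\<in>Basis. \<integral>t. h i t \<partial>lborel)"
    unfolding lborel_eq[where 'a='a] using m T assms
    by (subst integral_distr) (auto simp: e product_integral_prod)
qed

lemma cis_sum: "finite A \<Longrightarrow> cis (\<Sum>i\<in>A. f i) = (\<Prod>i\<in>A. cis (f i))"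
  by (induction A rule: finite_induct) (auto simp: cis_mult[symmetric])

lemma pf_cis: "pf h x * cis (- 2 * pi * (x \<bullet> \<xi>)) = pf (\<lambda>i t. h i t * cis (- 2 * pi * (t * (\<xi> \<bullet> i)))) x"
proof -
  have "- 2 * pi * (x \<bullet> \<xi>) = (\<Sum>i\<in>Basis. - 2 * pi * ((x \<bullet> i) * (\<xi> \<bullet> i)))"
    by (simp only: euclidean_inner[of x \<xi>] sum_distrib_left)
  then show ?thesis
    unfolding pf_def by (simp only: cis_sum[OF finite_Basis] prod.distrib)
qed

lemma fourier_pf:
  assumes "\<And>i. i \<in> Basis \<Longrightarrow> smooth1 (h i)" "\<And>i. i \<in> Basis \<Longrightarrow> csupp (h i)"
  shows "fourier (pf h) \<xi> = pf (\<lambda>i. F1 (h i)) \<xi>"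
    "integrable lborel (\<lambda>x. pf h x * cis (- 2 * pi * (x \<bullet> \<xi>)))"
proof -
  have i: "integrable lborel (\<lambda>t. h i t * cis (- 2 * pi * (t * (\<xi> \<bullet> i))))" if "i \<in> Basis" for i
    using that by (intro F1_integrand assms)
  show "fourier (pf h) \<xi> = pf (\<lambda>i. F1 (h i)) \<xi>"
  proof -
    have "fourier (pf h) \<xi> = (\<integral>x. pf (\<lambda>i t. h i t * cis (- 2 * pi * (t * (\<xi> \<bullet> i)))) x \<partial>lborel)"
      by (simp only: fourier_def pf_cis)
    also have "\<dots> = (\<Prod>i\<in>Basis. \<integral>t. h i t * cis (- 2 * pi * (t * (\<xi> \<bullet> i))) \<partial>lborel)"
      by (rule pf_integral(2)) (rule i)
    finally show ?thesis by (simp only: pf_def F1_def)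
  qed
  show "integrable lborel (\<lambda>x. pf h x * cis (- 2 * pi * (x \<bullet> \<xi>)))"
    unfolding pf_cis by (rule pf_integral(1)) (rule i)
qed

lemma prod_1_plus_ge: "finite A \<Longrightarrow> (\<And>i. i \<in> A \<Longrightarrow> 0 \<le> a i) \<Longrightarrow> 1 + (\<Sum>i\<in>A. a i) \<le> (\<Prod>i\<in>A. 1 + (a i :: real))"
proof (induction A rule: finite_induct)
  case (insert i A)
  have "0 \<le> (\<Sum>i\<in>A. a i)" using insert by (intro sum_nonneg) auto
  then have "1 + (a i + (\<Sum>i\<in>A. a i)) \<le> (1 + a i) * (1 + (\<Sum>i\<in>A. a i))"
    using insert.prems[of i] by (simp add: algebra_simps)
  also have "\<dots> \<le> (1 + a i) * (\<Prod>i\<in>A. 1 + a i)"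
    using insert by (intro mult_left_mono) auto
  finally show ?case using insert by simp
qed simp

text \<open>Since 1 + norm x is at most the product of the 1 + |x_i|, the decay in the single
  coordinates multiplies to decay in the norm.\<close>

lemma pf_F1_decay:
  assumes "\<And>i. i \<in> Basis \<Longrightarrow> smooth1 (h i)" "\<And>i. i \<in> Basis \<Longrightarrow> csupp (h i)"
  shows "\<exists>C>0. \<forall>x::'a::euclidean_space. cmod (pf (\<lambda>i. F1 (h i)) x) \<le> C * (1 + norm x) powr - real N"
proof -
  have "\<forall>i\<in>Basis. \<exists>C>0. \<forall>w. (1 + \<bar>w\<bar>) ^ N * cmod (F1 (h i) w) \<le> C"
    using F1_decay assms by blast
  then obtain C where C: "\<And>i. i \<in> Basis \<Longrightarrow> 0 < C i" "\<And>i w. i \<in> Basis \<Longrightarrow> (1 + \<bar>w\<bar>) ^ N * cmod (F1 (h i) w) \<le> C i"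
    by metis
  define D where "D = (\<Prod>i\<in>(Basis::'a set). C i)"
  have D: "0 < D" unfolding D_def using C by (intro prod_pos) auto
  have "cmod (pf (\<lambda>i. F1 (h i)) x) \<le> D * (1 + norm x) powr - real N" for x :: 'a
  proof -
    have "1 + norm x \<le> 1 + (\<Sum>i\<in>Basis. \<bar>x \<bullet> i\<bar>)" using norm_le_l1[of x] by simp
    also have "\<dots> \<le> (\<Prod>i\<in>Basis. 1 + \<bar>x \<bullet> i\<bar>)" by (intro prod_1_plus_ge) auto
    finally have "(1 + norm x) ^ N \<le> (\<Prod>i\<in>Basis. 1 + \<bar>x \<bullet> i\<bar>) ^ N" by (intro power_mono) auto
    then have "(1 + norm x) ^ N * cmod (pf (\<lambda>i. F1 (h i)) x) \<le> (\<Prod>i\<in>Basis. 1 + \<bar>x \<bullet> i\<bar>) ^ N * cmod (pf (\<lambda>i. F1 (h i)) x)"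
      by (intro mult_right_mono) auto
    also have "\<dots> = (\<Prod>i\<in>Basis. (1 + \<bar>x \<bullet> i\<bar>) ^ N * cmod (F1 (h i) (x \<bullet> i)))"
      by (simp add: pf_def prod_norm[symmetric] prod_power_distrib[symmetric] prod.distrib)
    also have "\<dots> \<le> D" unfolding D_def by (intro prod_mono) (auto intro: C)
    finally have "cmod (pf (\<lambda>i. F1 (h i)) x) \<le> D / (1 + norm x) ^ N"
      by (simp add: pos_le_divide_eq add_pos_nonneg mult.commute)
    also have "\<dots> = D * (1 + norm x) powr - real N"
      by (simp add: powr_minus_divide powr_realpow add_pos_nonneg)
    finally show ?thesis .
  qed
  with D show ?thesis by blast
qed

lemma pf_F1_measurable:
  assumes "\<And>i. i \<in> Basis \<Longrightarrow> smooth1 (h i)"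
  shows "pf (\<lambda>i. F1 (h i)) \<in> borel_measurable borel"
proof -
  have [measurable]: "F1 (h i) \<in> borel_measurable borel" if "i \<in> Basis" for i
    by (intro F1_measurable assms that)
  show ?thesis unfolding pf_def by measurable
qed

lemma smooth_fun_pf:
  fixes h :: "'a::euclidean_space \<Rightarrow> real \<Rightarrow> complex"
  assumes "\<And>i. i \<in> Basis \<Longrightarrow> smooth1 (h i)"
  shows "smooth_fun (pf h)"
proof -
  define N where "N n i = (dd ^^ n) (h i)" for n and i :: 'a
  have sm: "smooth1 (N n i)" if "i \<in> Basis" for n i
    unfolding N_def by (induction n) (auto intro: smooth1_dd assms that)
  have dN: "(N n i has_vector_derivative N (Suc n) i t) (at t)" if "i \<in> Basis" for n i t
    using smooth1_dd(1)[OF sm[OF that]] by (simp add: N_def)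
  \<comment> \<open>\<open>smooth_fun\<close> indexes derivatives by lists of directions. For a
    tensor product the factor in direction i is differentiated as often as i occurs in the list,
    whatever the order.\<close>
  define D where "D vs x = (\<Prod>i\<in>Basis. N (count_list vs i) i (x \<bullet> i))" for vs and x :: 'a
  have "(D vs has_derivative (\<lambda>u. \<Sum>i\<in>Basis. (u \<bullet> i) *\<^sub>R D (i # vs) x)) (at x)" for vs x
  proof -
    have "((\<lambda>x. \<Prod>i\<in>Basis. N (count_list vs i) i (x \<bullet> i)) has_derivative
       (\<lambda>u. \<Sum>i\<in>Basis. ((u \<bullet> i) *\<^sub>R N (Suc (count_list vs i)) i (x \<bullet> i)) * (\<Prod>j\<in>Basis - {i}. N (count_list vs j) j (x \<bullet> j)))) (at x)"
    proof (rule has_derivative_prod)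
      fix i :: 'a assume i: "i \<in> Basis"
      have 1: "((\<lambda>x. x \<bullet> i) has_derivative (\<lambda>u. u \<bullet> i)) (at x)" by (auto intro!: derivative_eq_intros)
      have 2: "(N (count_list vs i) i has_derivative (\<lambda>s. s *\<^sub>R N (Suc (count_list vs i)) i (x \<bullet> i))) (at (x \<bullet> i))"
        using dN[OF i, of "count_list vs i" "x \<bullet> i"] by (simp add: has_vector_derivative_def)
      from has_derivative_compose[OF 1 2]
      show "((\<lambda>x. N (count_list vs i) i (x \<bullet> i)) has_derivative (\<lambda>u. (u \<bullet> i) *\<^sub>R N (Suc (count_list vs i)) i (x \<bullet> i))) (at x)" .
    qed
    moreover have "((u \<bullet> i) *\<^sub>R N (Suc (count_list vs i)) i (x \<bullet> i)) * (\<Prod>j\<in>Basis - {i}. N (count_list vs j) j (x \<bullet> j)) = (u \<bullet> i) *\<^sub>R D (i # vs) x"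
      if "i \<in> Basis" for u i
    proof -
      have "D (i # vs) x = N (count_list (i # vs) i) i (x \<bullet> i) * (\<Prod>j\<in>Basis - {i}. N (count_list (i # vs) j) j (x \<bullet> j))"
        unfolding D_def using that by (intro prod.remove) auto
      also have "(\<Prod>j\<in>Basis - {i}. N (count_list (i # vs) j) j (x \<bullet> j)) = (\<Prod>j\<in>Basis - {i}. N (count_list vs j) j (x \<bullet> j))"
        by (intro prod.cong) auto
      finally show ?thesis by simp
    qed
    then have "(\<lambda>u. \<Sum>i\<in>Basis. ((u \<bullet> i) *\<^sub>R N (Suc (count_list vs i)) i (x \<bullet> i)) * (\<Prod>j\<in>Basis - {i}. N (count_list vs j) j (x \<bullet> j)))
       = (\<lambda>u. \<Sum>i\<in>Basis. (u \<bullet> i) *\<^sub>R D (i # vs) x)"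
      by (intro ext sum.cong refl)
    moreover have "D vs = (\<lambda>x. \<Prod>i\<in>Basis. N (count_list vs i) i (x \<bullet> i))" by (simp add: D_def fun_eq_iff)
    ultimately show ?thesis by (simp only:)
  qed
  moreover have "D [] = pf h" by (simp add: D_def pf_def N_def fun_eq_iff)
  ultimately show ?thesis unfolding smooth_fun_def by blast
qed

lemma smooth_fun_diff:
  assumes "smooth_fun f" "smooth_fun g"
  shows "smooth_fun (\<lambda>x. f x - g x)"
proof -
  obtain D1 where 1: "D1 [] = f" "\<And>vs x. (D1 vs has_derivative (\<lambda>h. \<Sum>i\<in>Basis. (h \<bullet> i) *\<^sub>R D1 (i # vs) x)) (at x)"
    using assms(1) by (auto simp: smooth_fun_def)
  obtain D2 where 2: "D2 [] = g" "\<And>vs x. (D2 vs has_derivative (\<lambda>h. \<Sum>i\<in>Basis. (h \<bullet> i) *\<^sub>R D2 (i # vs) x)) (at x)"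
    using assms(2) by (auto simp: smooth_fun_def)
  have "((\<lambda>x. D1 vs x - D2 vs x) has_derivative (\<lambda>h. \<Sum>i\<in>Basis. (h \<bullet> i) *\<^sub>R (D1 (i # vs) x - D2 (i # vs) x))) (at x)" for vs x
    using has_derivative_diff[OF 1(2)[of vs x] 2(2)[of vs x]] by (simp add: scaleR_diff_right sum_subtractf)
  then show ?thesis
    unfolding smooth_fun_def using 1(1) 2(1) by (intro exI[of _ "\<lambda>vs x. D1 vs x - D2 vs x"]) auto
qed

lemma smooth_fun_continuous: "smooth_fun f \<Longrightarrow> continuous_on UNIV f"
  unfolding smooth_fun_def
  by (auto intro!: continuous_at_imp_continuous_on intro: has_derivative_continuous)

section \<open>The reproducing formula for band-limited functions\<close>

lemma F1_modulate:
  assumes s: "0 < s" and h: "h \<in> borel_measurable borel"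
  shows "F1 (\<lambda>\<xi>. h (\<xi> / s) * cis (2 * pi * (c * \<xi>))) w = of_real s * F1 h (s * (w - c))"
proof -
  have "F1 (\<lambda>\<xi>. h (\<xi> / s) * cis (2 * pi * (c * \<xi>))) w =
    \<bar>s\<bar> *\<^sub>R (\<integral>x. h ((0 + s * x) / s) * cis (2 * pi * (c * (0 + s * x))) * cis (- 2 * pi * ((0 + s * x) * w)) \<partial>lborel)"
    unfolding F1_def using s by (intro lborel_integral_real_affine) auto
  also have "(\<integral>x. h ((0 + s * x) / s) * cis (2 * pi * (c * (0 + s * x))) * cis (- 2 * pi * ((0 + s * x) * w)) \<partial>lborel) = F1 h (s * (w - c))"
    unfolding F1_def
  proof (intro Bochner_Integration.integral_cong refl)
    fix x
    have "cis (2 * pi * (c * (0 + s * x))) * cis (- 2 * pi * ((0 + s * x) * w)) = cis (- 2 * pi * (x * (s * (w - c))))"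
      by (simp add: cis_mult algebra_simps)
    then show "h ((0 + s * x) / s) * cis (2 * pi * (c * (0 + s * x))) * cis (- 2 * pi * ((0 + s * x) * w)) = h x * cis (- 2 * pi * (x * (s * (w - c))))"
      using s by (simp add: mult.assoc)
  qed
  finally show ?thesis using s by (simp add: scaleR_conv_of_real)
qed

lemma lborel_integral_affine:
  fixes f :: "'a::euclidean_space \<Rightarrow> complex"
  assumes [measurable]: "f \<in> borel_measurable borel" and "c \<noteq> 0"
  shows "(\<integral>x. f x \<partial>lborel) = (\<bar>c\<bar> ^ DIM('a)) *\<^sub>R (\<integral>x. f (t + c *\<^sub>R x) \<partial>lborel)"
  by (subst lborel_affine[OF assms(2), of t])
     (simp add: integral_density integral_distr)

text \<open>The Fourier transform of the n-dimensional cut-off. Its rapid decay and its integral 1,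
  which is the value of the cut-off at 0, make its dilates an approximate identity.\<close>

abbreviation bump :: "'a::euclidean_space \<Rightarrow> complex" where
  "bump \<equiv> pf (\<lambda>_. F1 cut)"

lemma csupp_cut: "csupp cut"
  unfolding csupp_def by (intro exI[of _ 3]) (auto intro: cut_eq_0)

lemma bump_measurable [measurable]: "bump \<in> borel_measurable borel"
  by (intro pf_F1_measurable smooth1_cut)

lemma integral_bump: "integrable lborel bump" "(\<integral>x. bump x \<partial>lborel) = 1"
proof -
  have i: "integrable lborel (F1 cut)" by (intro F1_integrable smooth1_cut csupp_cut)
  then show "integrable lborel bump" by (intro pf_integral) auto
  have "(\<integral>w. F1 cut w \<partial>lborel) = 1"
    using F1_inversion[OF smooth1_cut csupp_cut, of 0] by (simp add: cut_eq_1)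
  then show "(\<integral>x. bump x \<partial>lborel) = 1" using i by (subst pf_integral(2)) auto
qed

text \<open>The cut-off at frequency s, modulated so that its Fourier transform is the dilated bump
  centred at x. Pairing f with that transform evaluates a smoothing of f at x.\<close>

definition freqcut :: "real \<Rightarrow> 'a::euclidean_space \<Rightarrow> 'a \<Rightarrow> complex" where
  "freqcut s x = pf (\<lambda>i \<xi>. cut (\<xi> / s) * cis (2 * pi * ((x \<bullet> i) * \<xi>)))"

lemma freqcut_factor:
  assumes "0 < s"
  shows "smooth1 (\<lambda>\<xi>. cut (\<xi> / s) * cis (2 * pi * (c * \<xi>)))" "csupp (\<lambda>\<xi>. cut (\<xi> / s) * cis (2 * pi * (c * \<xi>)))"
proof -
  have "smooth1 (\<lambda>\<xi>. cut (1 / s * \<xi> + 0) * cis ((2 * pi * c) * \<xi>))"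
    by (intro smooth1_mult smooth1_cis smooth1_affine[OF smooth1_cut])
  then show "smooth1 (\<lambda>\<xi>. cut (\<xi> / s) * cis (2 * pi * (c * \<xi>)))" by (simp add: mult.assoc)
  show "csupp (\<lambda>\<xi>. cut (\<xi> / s) * cis (2 * pi * (c * \<xi>)))"
    unfolding csupp_def using assms
    by (intro exI[of _ "3 * s"]) (auto intro!: cut_eq_0 simp: field_simps)
qed

lemma fourier_freqcut:
  fixes x :: "'a::euclidean_space"
  assumes s: "0 < s"
  shows "fourier (freqcut s x) u = of_real (s ^ DIM('a)) * bump (s *\<^sub>R (u - x))"
    "integrable lborel (\<lambda>v. freqcut s x v * cis (- 2 * pi * (v \<bullet> u)))"
proof -
  have c: "cut \<in> borel_measurable borel"
    by (intro borel_measurable_continuous_onI smooth1_continuous_on smooth1_cut)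
  show "fourier (freqcut s x) u = of_real (s ^ DIM('a)) * bump (s *\<^sub>R (u - x))"
    unfolding freqcut_def using s
    by (simp add: fourier_pf(1) freqcut_factor pf_def F1_modulate[OF s c] prod.distrib inner_diff_left)
  show "integrable lborel (\<lambda>v. freqcut s x v * cis (- 2 * pi * (v \<bullet> u)))"
    unfolding freqcut_def using s by (intro fourier_pf(2) freqcut_factor)
qed

lemma freqcut_nonzero:
  fixes x :: "'a::euclidean_space"
  assumes "freqcut s x \<xi> \<noteq> 0" "0 < s" "i \<in> Basis"
  shows "\<bar>\<xi> \<bullet> i\<bar> < 3 * s"
proof (rule ccontr)
  assume "\<not> \<bar>\<xi> \<bullet> i\<bar> < 3 * s"
  then have "cut ((\<xi> \<bullet> i) / s) = 0" using assms(2) by (intro cut_eq_0) (simp add: field_simps)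
  then have "freqcut s x \<xi> = 0" unfolding freqcut_def pf_def using assms(3) by (intro prod_zero) auto
  with assms(1) show False by simp
qed

text \<open>Both cut-offs are 1 where all coordinates are below 2 \<rho> in absolute value, so their
  difference lives outside the ball that contains the spectrum and is an admissible test function in
  \<open>class_E\<close>.\<close>

lemma test_fun_freqcut_diff:
  fixes x :: "'a::euclidean_space"
  assumes s: "0 < \<rho>" "\<rho> \<le> s"
  shows "test_fun (\<lambda>\<xi>. freqcut s x \<xi> - freqcut \<rho> x \<xi>)"
    "fsupport (\<lambda>\<xi>. freqcut s x \<xi> - freqcut \<rho> x \<xi>) \<inter> ball 0 (2 * \<rho>) = {}"
proof -
  have sm: "smooth_fun (\<lambda>\<xi>. freqcut s x \<xi> - freqcut \<rho> x \<xi>)"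
    unfolding freqcut_def using s by (intro smooth_fun_diff smooth_fun_pf freqcut_factor) auto
  have "{\<xi>. freqcut s x \<xi> - freqcut \<rho> x \<xi> \<noteq> 0} \<subseteq> cball 0 (3 * s * real DIM('a))"
  proof
    fix \<xi> assume "\<xi> \<in> {\<xi>. freqcut s x \<xi> - freqcut \<rho> x \<xi> \<noteq> 0}"
    then have "freqcut s x \<xi> \<noteq> 0 \<or> freqcut \<rho> x \<xi> \<noteq> 0" by auto
    then have "\<bar>\<xi> \<bullet> i\<bar> \<le> 3 * s" if "i \<in> Basis" for i
      using freqcut_nonzero[of s x \<xi> i] freqcut_nonzero[of \<rho> x \<xi> i] s that by auto
    then have "(\<Sum>i\<in>Basis. \<bar>\<xi> \<bullet> i\<bar>) \<le> (\<Sum>i\<in>(Basis::'a set). 3 * s)" by (intro sum_mono)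
    with norm_le_l1[of \<xi>] show "\<xi> \<in> cball 0 (3 * s * real DIM('a))" by (simp add: mult.commute)
  qed
  then have "bounded {\<xi>. freqcut s x \<xi> - freqcut \<rho> x \<xi> \<noteq> 0}" using bounded_cball bounded_subset by blast
  then show "test_fun (\<lambda>\<xi>. freqcut s x \<xi> - freqcut \<rho> x \<xi>)"
    using sm by (simp add: test_fun_def fsupport_def compact_closure)
  have "{\<xi>. freqcut s x \<xi> - freqcut \<rho> x \<xi> \<noteq> 0} \<subseteq> (\<Union>i\<in>Basis. {\<xi>. 2 * \<rho> \<le> \<bar>\<xi> \<bullet> i\<bar>})"
  proof (rule ccontr)
    assume "\<not> {\<xi>. freqcut s x \<xi> - freqcut \<rho> x \<xi> \<noteq> 0} \<subseteq> (\<Union>i\<in>Basis. {\<xi>. 2 * \<rho> \<le> \<bar>\<xi> \<bullet> i\<bar>})"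
    then obtain \<xi> where \<xi>: "freqcut s x \<xi> - freqcut \<rho> x \<xi> \<noteq> 0" "\<And>i. i \<in> Basis \<Longrightarrow> \<bar>\<xi> \<bullet> i\<bar> < 2 * \<rho>" by force
    have "freqcut s x \<xi> = freqcut \<rho> x \<xi>"
      unfolding freqcut_def pf_def
    proof (intro prod.cong refl arg_cong2[where f="(*)"])
      fix i :: 'a assume "i \<in> Basis"
      then have "\<bar>\<xi> \<bullet> i\<bar> < 2 * \<rho>" by (rule \<xi>)
      moreover have "2 * \<rho> \<le> 2 * s" using s by simp
      ultimately have "\<bar>(\<xi> \<bullet> i) / s\<bar> \<le> 2" "\<bar>(\<xi> \<bullet> i) / \<rho>\<bar> \<le> 2" using s by (auto simp: pos_divide_le_eq abs_divide)
      then show "cut ((\<xi> \<bullet> i) / s) = cut ((\<xi> \<bullet> i) / \<rho>)" by (simp only: cut_eq_1)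
    qed
    with \<xi> show False by simp
  qed
  moreover have "closed (\<Union>i\<in>Basis. {\<xi>::'a. 2 * \<rho> \<le> \<bar>\<xi> \<bullet> i\<bar>})"
    by (intro closed_UN finite_Basis ballI closed_Collect_le continuous_intros)
  ultimately have "fsupport (\<lambda>\<xi>. freqcut s x \<xi> - freqcut \<rho> x \<xi>) \<subseteq> (\<Union>i\<in>Basis. {\<xi>. 2 * \<rho> \<le> \<bar>\<xi> \<bullet> i\<bar>})"
    unfolding fsupport_def by (rule closure_minimal)
  moreover have "(\<Union>i\<in>Basis. {\<xi>::'a. 2 * \<rho> \<le> \<bar>\<xi> \<bullet> i\<bar>}) \<inter> ball 0 (2 * \<rho>) = {}"
  proof -
    have False if "i \<in> Basis" "2 * \<rho> \<le> \<bar>\<xi> \<bullet> i\<bar>" "\<xi> \<in> ball 0 (2 * \<rho>)" for i \<xi> :: 'a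
      using that Basis_le_norm[of i \<xi>] by simp
    then show ?thesis by blast
  qed
  ultimately show "fsupport (\<lambda>\<xi>. freqcut s x \<xi> - freqcut \<rho> x \<xi>) \<inter> ball 0 (2 * \<rho>) = {}" by blast
qed

text \<open>The smoothing \<open>J s\<close> of f at x is the same for all s \<ge> \<rho>, because
  the difference of two cut-offs is a test function supported off the spectrum. As s grows the bumps
  concentrate and \<open>J s\<close> tends to f x; hence already \<open>J \<rho>\<close> equals f x.
  Only the pairing in \<open>class_E\<close> is used, never a transform of f itself.\<close>

lemma class_E_reproducing:
  fixes f :: "'a::euclidean_space \<Rightarrow> complex"
  assumes f: "f \<in> class_E \<rho>" and rho: "0 < \<rho>"
  shows "f x = (\<integral>v. f (x + (1 / \<rho>) *\<^sub>R v) * bump v \<partial>lborel)"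
proof -
  have cont: "continuous_on UNIV f" using f by (simp add: class_E_def)
  then have [measurable]: "f \<in> borel_measurable borel" by (rule borel_measurable_continuous_onI)
  obtain C0 M where C0: "\<And>x. cmod (f x) \<le> C0 * (1 + norm x) ^ M" using f unfolding class_E_def by blast
  define C where "C = \<bar>C0\<bar>"
  have C: "0 \<le> C" "\<And>x. cmod (f x) \<le> C * (1 + norm x) ^ M"
  proof -
    show "cmod (f x) \<le> C * (1 + norm x) ^ M" for x
      unfolding C_def by (rule order_trans[OF C0]) (intro mult_right_mono, auto)
  qed (simp add: C_def)
  obtain K where K: "K \<subseteq> ball 0 (2 * \<rho>)" "\<And>\<phi>. test_fun \<phi> \<Longrightarrow> fsupport \<phi> \<inter> K = {} \<Longrightarrow> (\<integral>x. f x * fourier \<phi> x \<partial>lborel) = 0"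
    using f unfolding class_E_def by blast
  \<comment> \<open>M powers of decay compensate the growth of f, the other n + 1 make the product
    integrable.\<close>
  define N where "N = M + DIM('a) + 1"
  have split: "(1 + norm v) powr - real N = (1 + norm v) powr - real (DIM('a) + 1) / (1 + norm v) ^ M" for v :: 'a
  proof -
    have "(1 + norm v) powr - real N = (1 + norm v) powr (- real (DIM('a) + 1) - real M)" by (simp add: N_def algebra_simps)
    also have "\<dots> = (1 + norm v) powr - real (DIM('a) + 1) / (1 + norm v) powr real M" by (rule powr_diff)
    also have "(1 + norm v) powr real M = (1 + norm v) ^ M" by (intro powr_realpow add_pos_nonneg) auto
    finally show ?thesis .
  qed
  have intd: "integrable lborel (\<lambda>v::'a. D * (1 + norm v) powr - real (DIM('a) + 1))" for D
    by (intro integrable_mult_right integrable_decay) simp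
  have prod_bound: "norm (a * b) \<le> (D * B) * (1 + norm v) powr - real (DIM('a) + 1)"
    if a: "norm a \<le> D * (1 + norm v) ^ M" and b: "norm b \<le> B * (1 + norm v) powr - real N" and "0 \<le> D" for a b :: complex and D B and v :: 'a
  proof -
    have p: "0 < (1 + norm v) ^ M" by (intro zero_less_power add_pos_nonneg) auto
    have "norm (a * b) \<le> (D * (1 + norm v) ^ M) * (B * (1 + norm v) powr - real N)"
      unfolding norm_mult using that by (intro mult_mono) auto
    also have "\<dots> = (D * B) * (1 + norm v) powr - real (DIM('a) + 1)"
      unfolding split using p by simp
    finally show ?thesis .
  qed
  have int: "integrable lborel (\<lambda>u. f u * fourier (freqcut s x) u)" if s: "0 < s" for s
  proof -
    let ?h = "\<lambda>i \<xi>. cut (\<xi> / s) * cis (2 * pi * ((x \<bullet> i) * \<xi>))"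
    have e: "fourier (freqcut s x) = pf (\<lambda>i. F1 (?h i))"
      unfolding freqcut_def using s by (intro ext fourier_pf(1) freqcut_factor)
    obtain B where B: "\<And>u. cmod (pf (\<lambda>i. F1 (?h i)) u) \<le> B * (1 + norm u) powr - real N"
      using pf_F1_decay[of ?h N] freqcut_factor[OF s] by blast
    have [measurable]: "pf (\<lambda>i. F1 (?h i)) \<in> borel_measurable borel"
      by (intro pf_F1_measurable freqcut_factor s)
    show ?thesis
      unfolding e
    proof (rule Bochner_Integration.integrable_bound[OF intd[of "C * B"]])
      show "AE u in lborel. norm (f u * pf (\<lambda>i. F1 (?h i)) u) \<le> norm (C * B * (1 + norm u) powr - real (DIM('a) + 1))"
      proof (intro AE_I2)
        fix u
        have "norm (f u * pf (\<lambda>i. F1 (?h i)) u) \<le> C * B * (1 + norm u) powr - real (DIM('a) + 1)"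
          by (rule prod_bound[OF C(2) B C(1)])
        then show "norm (f u * pf (\<lambda>i. F1 (?h i)) u) \<le> norm (C * B * (1 + norm u) powr - real (DIM('a) + 1))"
          by (rule order_trans) (simp only: real_norm_def abs_ge_self)
      qed
    qed simp
  qed
  define J where "J s = (\<integral>v. f (x + (1 / s) *\<^sub>R v) * bump v \<partial>lborel)" for s
  have J: "(\<integral>u. f u * fourier (freqcut s x) u \<partial>lborel) = J s" if s: "0 < s" for s
  proof -
    have "(\<integral>u. f u * fourier (freqcut s x) u \<partial>lborel) = (\<integral>u. f u * (of_real (s ^ DIM('a)) * bump (s *\<^sub>R (u - x))) \<partial>lborel)"
      by (simp add: fourier_freqcut[OF s])
    also have "\<dots> = (\<bar>1 / s\<bar> ^ DIM('a)) *\<^sub>R (\<integral>v. f (x + (1 / s) *\<^sub>R v) * (of_real (s ^ DIM('a)) * bump (s *\<^sub>R ((x + (1 / s) *\<^sub>R v) - x))) \<partial>lborel)"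
      using s by (intro lborel_integral_affine) auto
    also have "(\<integral>v. f (x + (1 / s) *\<^sub>R v) * (of_real (s ^ DIM('a)) * bump (s *\<^sub>R ((x + (1 / s) *\<^sub>R v) - x))) \<partial>lborel)
      = (\<integral>v. of_real (s ^ DIM('a)) * (f (x + (1 / s) *\<^sub>R v) * bump v) \<partial>lborel)"
      using s by (intro Bochner_Integration.integral_cong refl) (simp add: mult_ac)
    also have "\<dots> = of_real (s ^ DIM('a)) * J s" unfolding J_def by (rule integral_mult_right_zero)
    finally show ?thesis using s by (simp add: scaleR_conv_of_real power_one_over field_simps)
  qed
  have Jconst: "J s = J \<rho>" if s: "\<rho> \<le> s" for s
  proof -
    have s0: "0 < s" using s rho by linarith
    have "fourier (\<lambda>\<xi>. freqcut s x \<xi> - freqcut \<rho> x \<xi>) u = fourier (freqcut s x) u - fourier (freqcut \<rho> x) u" for u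
      using fourier_freqcut(2)[OF s0, of x u] fourier_freqcut(2)[OF rho, of x u]
      unfolding fourier_def by (simp add: left_diff_distrib)
    moreover have "(\<integral>u. f u * fourier (\<lambda>\<xi>. freqcut s x \<xi> - freqcut \<rho> x \<xi>) u \<partial>lborel) = 0"
      using test_fun_freqcut_diff[OF rho s, of x] K(1) by (intro K(2)) auto
    ultimately have "(\<integral>u. f u * fourier (freqcut s x) u - f u * fourier (freqcut \<rho> x) u \<partial>lborel) = 0"
      by (simp add: right_diff_distrib)
    then have "(\<integral>u. f u * fourier (freqcut s x) u \<partial>lborel) - (\<integral>u. f u * fourier (freqcut \<rho> x) u \<partial>lborel) = 0"
      using int[OF s0] int[OF rho] by simp
    then show ?thesis unfolding J[OF s0] J[OF rho] by simp
  qed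
  \<comment> \<open>The majorant must be uniform in s: 1 + norm (x + v / s) \<le> c (1 + norm v)
    holds for all s \<ge> \<rho>.\<close>
  define c where "c = 1 + norm x + 1 / \<rho>"
  obtain B where B: "\<And>u::'a. cmod (bump u) \<le> B * (1 + norm u) powr - real N"
    using pf_F1_decay[of "\<lambda>_. cut" N] smooth1_cut csupp_cut by blast
  have "(\<lambda>m. J (\<rho> * real (Suc m))) \<longlonglongrightarrow> (\<integral>v. f x * bump (v::'a) \<partial>lborel)"
    unfolding J_def
  proof (rule Bochner_Integration.integral_dominated_convergence[where w="\<lambda>v. C * c ^ M * B * (1 + norm v) powr - real (DIM('a) + 1)"])
    show "integrable lborel (\<lambda>v::'a. C * c ^ M * B * (1 + norm v) powr - real (DIM('a) + 1))" by (rule intd)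
    show "AE v in lborel. (\<lambda>m. f (x + (1 / (\<rho> * real (Suc m))) *\<^sub>R v) * bump v) \<longlonglongrightarrow> f x * bump v"
    proof (intro AE_I2 tendsto_mult tendsto_const)
      fix v :: 'a
      have "(\<lambda>m. inverse (real (Suc m))) \<longlonglongrightarrow> 0" by (rule LIMSEQ_inverse_real_of_nat)
      then have "(\<lambda>m. (1 / \<rho>) * inverse (real (Suc m))) \<longlonglongrightarrow> (1 / \<rho>) * 0" by (intro tendsto_mult tendsto_const)
      moreover have "(1 / \<rho>) * inverse (real (Suc m)) = 1 / (\<rho> * real (Suc m))" for m by (simp add: field_simps)
      ultimately have "(\<lambda>m. 1 / (\<rho> * real (Suc m))) \<longlonglongrightarrow> 0" by simp
      then have "(\<lambda>m. x + (1 / (\<rho> * real (Suc m))) *\<^sub>R v) \<longlonglongrightarrow> x + 0 *\<^sub>R v"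
        by (intro tendsto_add tendsto_const tendsto_scaleR)
      then have l: "(\<lambda>m. x + (1 / (\<rho> * real (Suc m))) *\<^sub>R v) \<longlonglongrightarrow> x" by simp
      have "isCont f x" using cont by (simp add: continuous_on_eq_continuous_at)
      from isCont_tendsto_compose[OF this l]
      show "(\<lambda>m. f (x + (1 / (\<rho> * real (Suc m))) *\<^sub>R v)) \<longlonglongrightarrow> f x" .
    qed
    show "AE v in lborel. norm (f (x + (1 / (\<rho> * real (Suc m))) *\<^sub>R v) * bump v) \<le> C * c ^ M * B * (1 + norm v) powr - real (DIM('a) + 1)" for m
    proof (intro AE_I2 prod_bound[OF _ B])
      fix v :: 'a
      have "1 / (\<rho> * real (Suc m)) \<le> 1 / \<rho>" using rho by (intro divide_left_mono) auto
      then have le: "1 / (\<rho> * real (Suc m)) * norm v \<le> 1 / \<rho> * norm v" by (intro mult_right_mono) auto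
      have "norm (x + (1 / (\<rho> * real (Suc m))) *\<^sub>R v) \<le> norm x + 1 / (\<rho> * real (Suc m)) * norm v"
        using rho by (intro order_trans[OF norm_triangle_ineq]) simp
      then have "1 + norm (x + (1 / (\<rho> * real (Suc m))) *\<^sub>R v) \<le> 1 + norm x + 1 / \<rho> * norm v" using le by linarith
      also have "\<dots> \<le> c * (1 + norm v)"
      proof -
        have "0 \<le> norm x * norm v" "0 \<le> 1 / \<rho>" using rho by auto
        then show ?thesis unfolding c_def by (simp add: distrib_left distrib_right)
      qed
      finally have "(1 + norm (x + (1 / (\<rho> * real (Suc m))) *\<^sub>R v)) ^ M \<le> (c * (1 + norm v)) ^ M"
        by (intro power_mono) auto
      then have "C * (1 + norm (x + (1 / (\<rho> * real (Suc m))) *\<^sub>R v)) ^ M \<le> C * (c * (1 + norm v)) ^ M"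
        using C by (intro mult_left_mono)
      with C(2) show "norm (f (x + (1 / (\<rho> * real (Suc m))) *\<^sub>R v)) \<le> C * c ^ M * (1 + norm v) ^ M"
        by (smt (verit) power_mult_distrib mult.assoc)
      show "0 \<le> C * c ^ M" using C rho by (auto simp: c_def)
    qed
  qed measurable
  moreover have "J (\<rho> * real (Suc m)) = J \<rho>" for m
    using rho by (intro Jconst) (simp add: mult_le_cancel_left1)
  ultimately have "(\<lambda>m. J \<rho>) \<longlonglongrightarrow> (\<integral>v. f x * bump (v::'a) \<partial>lborel)" by simp
  then have "J \<rho> = (\<integral>v. f x * bump (v::'a) \<partial>lborel)" by (simp add: LIMSEQ_const_iff)
  also have "\<dots> = f x" by (simp add: integral_bump)
  finally show ?thesis by (simp add: J_def)
qed

lemma class_E_pointwise: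
  "\<exists>C>0. \<forall>\<rho>>0. \<forall>f\<in>(class_E \<rho> :: ('a::euclidean_space \<Rightarrow> complex) set). \<forall>x.
     ennreal (cmod (f x)) \<le> ennreal C * (\<integral>\<^sup>+v. ennreal (cmod (f (x + (1 / \<rho>) *\<^sub>R v)) * (1 + norm v) powr - real N) \<partial>lborel)"
proof -
  obtain C where C: "0 < C" "\<And>u::'a. cmod (bump u) \<le> C * (1 + norm u) powr - real N"
    using pf_F1_decay[of "\<lambda>_. cut" N] smooth1_cut csupp_cut by blast
  show ?thesis
  proof (intro exI[of _ C] conjI C allI impI ballI)
    fix \<rho> :: real and f :: "'a \<Rightarrow> complex" and x :: 'a assume rho: "0 < \<rho>" and f: "f \<in> class_E \<rho>"
    have cont: "continuous_on UNIV f" using f by (simp add: class_E_def)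
    then have [measurable]: "f \<in> borel_measurable borel" by (rule borel_measurable_continuous_onI)
    have "ennreal (cmod (f x)) \<le> (\<integral>\<^sup>+v. ennreal (norm (f (x + (1 / \<rho>) *\<^sub>R v) * bump v)) \<partial>lborel)"
    proof (cases "integrable lborel (\<lambda>v. f (x + (1 / \<rho>) *\<^sub>R v) * bump v)")
      case True
      then show ?thesis
        unfolding class_E_reproducing[OF f rho, of x] by (rule integral_norm_bound_ennreal)
    next
      \<comment> \<open>The integral of a non-integrable function is 0 by convention, so here the
        reproducing formula itself gives f x = 0.\<close>
      case False
      then have "f x = 0" by (subst class_E_reproducing[OF f rho]) (rule not_integrable_integral_eq)
      then show ?thesis by simp
    qed
    also have "\<dots> \<le> (\<integral>\<^sup>+v. ennreal C * ennreal (cmod (f (x + (1 / \<rho>) *\<^sub>R v)) * (1 + norm v) powr - real N) \<partial>lborel)"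
    proof (intro nn_integral_mono)
      fix v :: 'a
      have "norm (f (x + (1 / \<rho>) *\<^sub>R v) * bump v) \<le> cmod (f (x + (1 / \<rho>) *\<^sub>R v)) * (C * (1 + norm v) powr - real N)"
        unfolding norm_mult by (intro mult_left_mono C) auto
      then show "ennreal (norm (f (x + (1 / \<rho>) *\<^sub>R v) * bump v)) \<le> ennreal C * ennreal (cmod (f (x + (1 / \<rho>) *\<^sub>R v)) * (1 + norm v) powr - real N)"
        using C by (simp add: mult_ac flip: ennreal_mult)
    qed
    also have "\<dots> = ennreal C * (\<integral>\<^sup>+v. ennreal (cmod (f (x + (1 / \<rho>) *\<^sub>R v)) * (1 + norm v) powr - real N) \<partial>lborel)"
      by (rule nn_integral_cmult) measurable
    finally show "ennreal (cmod (f x)) \<le> ennreal C * (\<integral>\<^sup>+v. ennreal (cmod (f (x + (1 / \<rho>) *\<^sub>R v)) * (1 + norm v) powr - real N) \<partial>lborel)" .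
  qed
qed

section \<open>Bumps as members of the band-limited classes\<close>

lemma F1_cut_continuous: "continuous_on UNIV (F1 cut)"
proof -
  obtain C where C: "\<And>w w'. cmod (F1 cut w - F1 cut w') \<le> C * \<bar>w - w'\<bar>"
    using F1_Lipschitz[OF smooth1_cut csupp_cut] by blast
  have "(max 0 C)-lipschitz_on UNIV (F1 cut)"
    by (rule lipschitz_onI) (auto simp: dist_norm intro!: order_trans[OF C] mult_right_mono)
  then show ?thesis by (rule lipschitz_on_continuous_on)
qed

lemma bump_continuous: "continuous_on UNIV (bump :: 'a::euclidean_space \<Rightarrow> complex)"
  unfolding pf_def by (intro continuous_intros continuous_on_compose2[OF F1_cut_continuous]) auto

text \<open>At frequency zero the transform is the integral of a nonnegative function that equals 1
  on an interval.\<close>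

lemma bump_0: "bump (0 :: 'a::euclidean_space) \<noteq> 0"
proof -
  have "F1 cut 0 \<noteq> 0"
  proof
    assume "F1 cut 0 = 0"
    let ?g = "\<lambda>x. cstep (3 - x) * cstep (3 + x)"
    have g0: "0 \<le> ?g x" for x by (simp add: cstep_simps)
    have i: "integrable lborel (\<lambda>x. of_real (?g x) :: complex)"
      using csupp_integrable[OF csupp_cut smooth1_continuous_on[OF smooth1_cut]] by (simp add: cut_def[abs_def])
    then have ir: "integrable lborel ?g" by (simp only: complex_of_real_integrable_eq)
    have "F1 cut 0 = of_real (\<integral>x. ?g x \<partial>lborel)"
      unfolding F1_def cut_def by (simp flip: of_real_mult)
    with \<open>F1 cut 0 = 0\<close> have "(\<integral>x. ?g x \<partial>lborel) = 0" by simp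
    then have "AE x in lborel. ?g x = 0"
      using integral_nonneg_eq_0_iff_AE[OF ir] g0 by simp
    then have "AE x in lborel. x \<notin> {- 1..1::real}"
      by (rule AE_mp) (auto intro!: AE_I2 simp: cstep_simps)
    then have "{- 1..1::real} \<in> null_sets lborel" by (subst AE_iff_null_sets) auto
    then have "emeasure lborel {- 1..1::real} = 0" by (rule null_setsD1)
    then show False by (subst (asm) emeasure_lborel_Icc) auto
  qed
  then show ?thesis by (simp add: pf_def)
qed

text \<open>Fubini moves the Fourier transform from the test function onto $f$.\<close>
lemma class_E_I:
  fixes f :: "'a::euclidean_space \<Rightarrow> complex"
  assumes cont: "continuous_on UNIV f" and bound: "\<And>x. cmod (f x) \<le> C" and int: "integrable lborel f"
    and K: "compact K" "K \<subseteq> ball 0 (2 * \<rho>)" and vanish: "\<And>\<xi>. \<xi> \<notin> K \<Longrightarrow> fourier f \<xi> = 0"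
  shows "f \<in> class_E \<rho>"
  unfolding class_E_def
proof (intro CollectI conjI exI[of _ K] K cont allI impI)
  show "\<exists>C N. \<forall>x. cmod (f x) \<le> C * (1 + norm x) ^ N"
    by (intro exI[of _ C] exI[of _ 0]) (simp add: bound)
  fix \<phi> :: "'a \<Rightarrow> complex" assume \<phi>: "test_fun \<phi> \<and> fsupport \<phi> \<inter> K = {}"
  then have c\<phi>: "continuous_on UNIV \<phi>" and cs: "compact (fsupport \<phi>)"
    by (auto simp: test_fun_def smooth_fun_continuous)
  have [measurable]: "\<phi> \<in> borel_measurable borel" "f \<in> borel_measurable borel"
    using c\<phi> cont by (auto intro: borel_measurable_continuous_onI)
  have in_supp: "\<xi> \<in> fsupport \<phi>" if "\<phi> \<xi> \<noteq> 0" for \<xi>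
    using that closure_subset[of "{x. \<phi> x \<noteq> 0}"] by (auto simp: fsupport_def)
  have "integrable lborel (\<lambda>\<xi>. indicator (fsupport \<phi>) \<xi> *\<^sub>R \<phi> \<xi>)"
    by (rule borel_integrable_compact[OF cs]) (auto intro: continuous_on_subset[OF c\<phi>])
  also have "(\<lambda>\<xi>. indicator (fsupport \<phi>) \<xi> *\<^sub>R \<phi> \<xi>) = \<phi>"
    using in_supp by (auto simp: fun_eq_iff indicator_def)
  finally have i\<phi>: "integrable lborel \<phi>" .
  let ?F = "\<lambda>x \<xi>. f x * (\<phi> \<xi> * cis (- 2 * pi * (\<xi> \<bullet> x)))"
  have iF: "integrable (lborel \<Otimes>\<^sub>M lborel) (case_prod ?F)"
  proof (rule lborel_pair.Fubini_integrable)
    show "integrable lborel (\<lambda>x. \<integral>\<xi>. norm (case_prod ?F (x, \<xi>)) \<partial>lborel)"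
      using int by (simp add: norm_mult)
    show "AE x in lborel. integrable lborel (\<lambda>\<xi>. case_prod ?F (x, \<xi>))"
    proof (intro AE_I2)
      fix x :: 'a
      have "integrable lborel (\<lambda>\<xi>. \<phi> \<xi> * cis (- 2 * pi * (\<xi> \<bullet> x)))"
        by (rule Bochner_Integration.integrable_bound[OF i\<phi>]) (auto simp: norm_mult)
      then show "integrable lborel (\<lambda>\<xi>. case_prod ?F (x, \<xi>))" by simp
    qed
  qed measurable
  have "(\<integral>x. f x * fourier \<phi> x \<partial>lborel) = (\<integral>x. (\<integral>\<xi>. ?F x \<xi> \<partial>lborel) \<partial>lborel)"
    by (simp add: fourier_def)
  also have "\<dots> = (\<integral>\<xi>. (\<integral>x. ?F x \<xi> \<partial>lborel) \<partial>lborel)"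
    by (rule lborel_pair.Fubini_integral[OF iF, symmetric])
  also have "\<dots> = (\<integral>\<xi>. \<phi> \<xi> * fourier f \<xi> \<partial>lborel)"
  proof (intro Bochner_Integration.integral_cong refl)
    fix \<xi>
    have "(\<integral>x. ?F x \<xi> \<partial>lborel) = (\<integral>x. \<phi> \<xi> * (f x * cis (- 2 * pi * (x \<bullet> \<xi>))) \<partial>lborel)"
      by (simp add: mult_ac inner_commute)
    also have "\<dots> = \<phi> \<xi> * fourier f \<xi>"
      unfolding fourier_def by (rule integral_mult_right_zero)
    finally show "(\<integral>x. ?F x \<xi> \<partial>lborel) = \<phi> \<xi> * fourier f \<xi>" .
  qed
  also have "\<phi> \<xi> * fourier f \<xi> = 0" for \<xi>
    using in_supp[of \<xi>] vanish[of \<xi>] \<phi> by auto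
  then have "(\<lambda>\<xi>. \<phi> \<xi> * fourier f \<xi>) = (\<lambda>_. 0)" by (rule ext)
  then have "(\<integral>\<xi>. \<phi> \<xi> * fourier f \<xi> \<partial>lborel) = 0" by (simp only:) simp
  finally show "(\<integral>x. f x * fourier \<phi> x \<partial>lborel) = 0" .
qed

lemma class_E_mono: "\<rho> \<le> \<rho>' \<Longrightarrow> class_E \<rho> \<subseteq> class_E \<rho>'"
  unfolding class_E_def by (auto intro!: exI subset_trans[OF _ subset_ball])

lemma class_E_zero: "(\<lambda>_. 0) \<in> class_E \<rho>"
  unfolding class_E_def by (intro CollectI conjI exI[of _ 0] exI[of _ "{}"]) auto

lemma class_E_measurable: "f \<in> class_E \<rho> \<Longrightarrow> f \<in> borel_measurable borel"
  by (auto simp: class_E_def intro: borel_measurable_continuous_onI)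

text \<open>Up to modulation and a constant, the transform of the dilated bump is the cut-off at
  frequency a again, by inversion in each coordinate. It lives in the cube of half side 3 a, which
  fits into the ball of radius 2 \<rho> because 3 a n < 2 \<rho>.\<close>

lemma bump_in_class_E:
  fixes c :: "'a::euclidean_space"
  assumes a: "0 < a" "3 * a * real DIM('a) < 2 * \<rho>"
  shows "(\<lambda>x. bump (a *\<^sub>R (x + c))) \<in> class_E \<rho>"
proof -
  obtain B where B: "0 < B" "\<And>u::'a. cmod (bump u) \<le> B * (1 + norm u) powr - real (DIM('a) + 1)"
    using pf_F1_decay[of "\<lambda>_. cut" "DIM('a) + 1"] smooth1_cut csupp_cut by blast
  let ?f = "\<lambda>x. bump (a *\<^sub>R (x + c))"
  let ?g = "\<lambda>(i::'a) t. F1 cut (a * (t + c \<bullet> i))"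
  have f_pf: "?f = pf ?g" by (simp add: pf_def fun_eq_iff inner_add_left)
  have ig: "integrable lborel (?g i)" for i
  proof -
    have "integrable lborel (\<lambda>t. F1 cut (a * (c \<bullet> i) + a * t))"
      using a F1_integrable[OF smooth1_cut csupp_cut] by (intro lborel_integrable_real_affine) auto
    then show ?thesis by (simp add: algebra_simps)
  qed
  have [measurable]: "F1 cut \<in> borel_measurable borel" by (intro F1_measurable smooth1_cut)
  show ?thesis
  proof (rule class_E_I)
    show "continuous_on UNIV ?f"
      by (intro continuous_on_compose2[OF bump_continuous] continuous_intros) auto
    show "cmod (?f x) \<le> B" for x
    proof -
      have "(1 + norm (a *\<^sub>R (x + c))) powr - real (DIM('a) + 1) \<le> (1 + norm (a *\<^sub>R (x + c))) powr 0"
        by (intro powr_mono) auto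
      also have "\<dots> \<le> 1" by simp
      finally have "B * (1 + norm (a *\<^sub>R (x + c))) powr - real (DIM('a) + 1) \<le> B * 1"
        using B by (intro mult_left_mono) auto
      with B(2)[of "a *\<^sub>R (x + c)"] show ?thesis by linarith
    qed
    show "integrable lborel ?f" unfolding f_pf by (intro pf_integral ig)
    show "compact (cbox ((- 3 * a) *\<^sub>R One) ((3 * a) *\<^sub>R One :: 'a))" by simp
    show "cbox ((- 3 * a) *\<^sub>R One) ((3 * a) *\<^sub>R One :: 'a) \<subseteq> ball 0 (2 * \<rho>)"
    proof
      fix \<xi> :: 'a assume "\<xi> \<in> cbox ((- 3 * a) *\<^sub>R One) ((3 * a) *\<^sub>R One :: 'a)"
      then have "\<bar>\<xi> \<bullet> i\<bar> \<le> 3 * a" if "i \<in> Basis" for i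
        using that by (fastforce simp: mem_box abs_le_iff)
      then have "(\<Sum>i\<in>Basis. \<bar>\<xi> \<bullet> i\<bar>) \<le> (\<Sum>i\<in>(Basis::'a set). 3 * a)" by (intro sum_mono)
      with norm_le_l1[of \<xi>] a show "\<xi> \<in> ball 0 (2 * \<rho>)" by (simp add: mult.commute)
    qed
    fix \<xi> :: 'a assume "\<xi> \<notin> cbox ((- 3 * a) *\<^sub>R One) ((3 * a) *\<^sub>R One)"
    then obtain i where i: "i \<in> Basis" "3 * a < \<bar>\<xi> \<bullet> i\<bar>" by (fastforce simp: mem_box)
    have "fourier ?f \<xi> = (\<integral>x. pf (\<lambda>i t. ?g i t * cis (- 2 * pi * (t * (\<xi> \<bullet> i)))) x \<partial>lborel)"
      unfolding fourier_def f_pf pf_cis ..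
    also have "\<dots> = (\<Prod>i\<in>Basis. \<integral>t. ?g i t * cis (- 2 * pi * (t * (\<xi> \<bullet> i))) \<partial>lborel)"
      by (rule pf_integral(2), rule Bochner_Integration.integrable_bound[OF ig]) (auto simp: norm_mult)
    \<comment> \<open>The factor of the coordinate i vanishes: inversion returns the cut-off at -
      (\<xi> \<bullet> i) / a, which exceeds 3 in absolute value.\<close>
    also have "\<dots> = 0"
    proof (rule prod_zero[OF finite_Basis], rule bexI[OF _ i(1)])
      have "(\<integral>t. ?g i t * cis (- 2 * pi * (t * (\<xi> \<bullet> i))) \<partial>lborel) =
        \<bar>1 / a\<bar> *\<^sub>R (\<integral>w. ?g i (- (c \<bullet> i) + (1 / a) * w) * cis (- 2 * pi * ((- (c \<bullet> i) + (1 / a) * w) * (\<xi> \<bullet> i))) \<partial>lborel)"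
        using a by (intro lborel_integral_real_affine) auto
      also have "(\<integral>w. ?g i (- (c \<bullet> i) + (1 / a) * w) * cis (- 2 * pi * ((- (c \<bullet> i) + (1 / a) * w) * (\<xi> \<bullet> i))) \<partial>lborel)
        = (\<integral>w. cis (2 * pi * (c \<bullet> i) * (\<xi> \<bullet> i)) * (F1 cut w * cis (2 * pi * (w * (- (\<xi> \<bullet> i) / a)))) \<partial>lborel)"
      proof (intro Bochner_Integration.integral_cong refl)
        fix w :: real
        have "cis (- 2 * pi * ((- (c \<bullet> i) + (1 / a) * w) * (\<xi> \<bullet> i))) = cis (2 * pi * (c \<bullet> i) * (\<xi> \<bullet> i)) * cis (2 * pi * (w * (- (\<xi> \<bullet> i) / a)))"
          unfolding cis_mult using a by (intro arg_cong[where f=cis]) (simp add: field_simps)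
        moreover have "?g i (- (c \<bullet> i) + (1 / a) * w) = F1 cut w" using a by simp
        ultimately show "?g i (- (c \<bullet> i) + (1 / a) * w) * cis (- 2 * pi * ((- (c \<bullet> i) + (1 / a) * w) * (\<xi> \<bullet> i)))
          = cis (2 * pi * (c \<bullet> i) * (\<xi> \<bullet> i)) * (F1 cut w * cis (2 * pi * (w * (- (\<xi> \<bullet> i) / a))))"
          by (simp only: mult_ac)
      qed
      also have "\<dots> = cis (2 * pi * (c \<bullet> i) * (\<xi> \<bullet> i)) * cut (- (\<xi> \<bullet> i) / a)"
        by (simp only: integral_mult_right_zero F1_inversion[OF smooth1_cut csupp_cut])
      also have "cut (- (\<xi> \<bullet> i) / a) = 0"
        using i a by (intro cut_eq_0) (simp add: field_simps)
      finally show "(\<integral>t. ?g i t * cis (- 2 * pi * (t * (\<xi> \<bullet> i))) \<partial>lborel) = 0" by simp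
    qed
    finally show "fourier ?f \<xi> = 0" .
  qed
qed

section \<open>The Peetre maximal function\<close>

text \<open>A form of Peetre's inequality, by which weights are moved from one centre to
  another.\<close>

lemma powr_submult:
  fixes a b c :: "'a::real_normed_vector"
  assumes "0 \<le> \<sigma>"
  shows "(1 + norm (a - c)) powr - \<sigma> \<le> (1 + norm (b - c)) powr - \<sigma> * (1 + norm (a - b)) powr \<sigma>"
proof -
  have "norm (b - c) \<le> norm (a - c) + norm (a - b)"
    using norm_triangle_ineq[of "a - c" "b - a"] by (simp add: norm_minus_commute)
  then show ?thesis
    using powr_neg_comparable[of "norm (b - c)" "norm (a - c)" "norm (a - b)" \<sigma>] assms by (simp add: mult.commute)
qed

text \<open>Multiplying the local estimate by the weight gives F \<le> C (F convolved with
  \<kappa>), where \<kappa> is bounded and integrable. For s \<ge> 1 Jensen's inequality finishes;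
  for s < 1 a power of the supremum of F has to be absorbed, and this is what the boundedness
  hypothesis is for.\<close>

lemma peetre_core_finite:
  assumes s: "0 < s" and \<sigma>: "0 \<le> \<sigma>" and N: "\<sigma> + real DIM('a::euclidean_space) + 1 \<le> N" and C: "0 < C"
  obtains D where "1 \<le> D" "\<forall>(u::'a \<Rightarrow> real) y w. u \<in> borel_measurable borel \<longrightarrow> (\<forall>w. 0 \<le> u w) \<longrightarrow>
     (\<forall>w. ennreal (u w) \<le> ennreal C * (\<integral>\<^sup>+v. ennreal (u v * (1 + norm (w - v)) powr - N) \<partial>lborel)) \<longrightarrow>
     (\<exists>B. \<forall>w. u w * (1 + norm (w - y)) powr - \<sigma> \<le> B) \<longrightarrow>
     epow (ennreal (u w * (1 + norm (w - y)) powr - \<sigma>)) s \<le>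
        ennreal D * (\<integral>\<^sup>+v. epow (ennreal (u v * (1 + norm (v - y)) powr - \<sigma>)) s \<partial>lborel)"
proof -
  let ?n = "real DIM('a)"
  obtain m where m: "0 < m" "kmass TYPE('a) (?n + 1) = ennreal m" using kmass_real[of "?n + 1", where 'a='a] by auto
  define D where "D = max 1 (if 1 \<le> s then C powr s * (2 powr s * m powr (s - 1)) else C)"
  show thesis
  proof (rule that[of D], goal_cases)
    show "1 \<le> D" by (simp add: D_def)
  next
    case 2
    show ?case
    proof (intro allI impI)
      fix u :: "'a \<Rightarrow> real" and y w :: 'a
      assume [measurable]: "u \<in> borel_measurable borel" and u0: "\<forall>w. 0 \<le> u w"
        and loc: "\<forall>w. ennreal (u w) \<le> ennreal C * (\<integral>\<^sup>+v. ennreal (u v * (1 + norm (w - v)) powr - N) \<partial>lborel)"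
        and B: "\<exists>B. \<forall>w. u w * (1 + norm (w - y)) powr - \<sigma> \<le> B"
      define F where "F w = ennreal (u w * (1 + norm (w - y)) powr - \<sigma>)" for w
      define I where "I = (\<integral>\<^sup>+v. epow (F v) s \<partial>lborel)"
      define \<kappa> where "\<kappa> z = ennreal ((1 + norm z) powr - (?n + 1))" for z :: 'a
      have [measurable]: "F \<in> borel_measurable borel" "\<kappa> \<in> borel_measurable borel" unfolding F_def \<kappa>_def by measurable
      have \<kappa>1: "\<kappa> z \<le> 1" for z
      proof -
        have "(1 + norm z) powr - (?n + 1) \<le> (1 + norm z) powr 0" by (intro powr_mono) auto
        also have "\<dots> \<le> 1" by simp
        finally show ?thesis unfolding \<kappa>_def using ennreal_leI by fastforce
      qed
      have F: "F w \<le> ennreal C * (\<integral>\<^sup>+v. F v * \<kappa> (w - v) \<partial>lborel)" for w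
      proof -
        have "F w = ennreal (u w) * ennreal ((1 + norm (w - y)) powr - \<sigma>)"
          using u0 by (simp add: F_def ennreal_mult)
        also have "\<dots> \<le> (ennreal C * (\<integral>\<^sup>+v. ennreal (u v * (1 + norm (w - v)) powr - N) \<partial>lborel)) * ennreal ((1 + norm (w - y)) powr - \<sigma>)"
          using loc by (intro mult_right_mono) auto
        also have "\<dots> = ennreal C * (\<integral>\<^sup>+v. ennreal (u v * (1 + norm (w - v)) powr - N) * ennreal ((1 + norm (w - y)) powr - \<sigma>) \<partial>lborel)"
          by (simp add: nn_integral_multc mult.assoc)
        also have "\<dots> \<le> ennreal C * (\<integral>\<^sup>+v. F v * \<kappa> (w - v) \<partial>lborel)"
        proof (intro mult_left_mono nn_integral_mono)
          fix v :: 'a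
          have "(1 + norm (w - v)) powr - N * (1 + norm (w - y)) powr - \<sigma> \<le> (1 + norm (w - v)) powr - N * ((1 + norm (v - y)) powr - \<sigma> * (1 + norm (w - v)) powr \<sigma>)"
            using \<sigma> by (intro mult_left_mono powr_submult) auto
          also have "\<dots> = (1 + norm (v - y)) powr - \<sigma> * (1 + norm (w - v)) powr (\<sigma> - N)"
            by (simp add: powr_diff powr_minus field_simps)
          \<comment> \<open>The exponent N pays \<sigma> for moving the weight from w to v and keeps
            n + 1 for integrability.\<close>
          also have "\<dots> \<le> (1 + norm (v - y)) powr - \<sigma> * (1 + norm (w - v)) powr - (?n + 1)"
            using N by (intro mult_left_mono powr_mono) auto
          finally have "u v * ((1 + norm (w - v)) powr - N * (1 + norm (w - y)) powr - \<sigma>) \<le> u v * ((1 + norm (v - y)) powr - \<sigma> * (1 + norm (w - v)) powr - (?n + 1))"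
            using u0 by (intro mult_left_mono) auto
          then show "ennreal (u v * (1 + norm (w - v)) powr - N) * ennreal ((1 + norm (w - y)) powr - \<sigma>) \<le> F v * \<kappa> (w - v)"
            unfolding F_def \<kappa>_def using u0 by (simp add: mult.assoc flip: ennreal_mult)
        qed auto
        finally show ?thesis .
      qed
      have "epow (F w) s \<le> ennreal D * I"
      proof (cases "1 \<le> s")
        case True
        have k: "(\<integral>\<^sup>+v. \<kappa> (w - v) \<partial>lborel) = ennreal m"
          using nn_integral_kern[of "?n + 1" 0 "0::'a" w] m by (simp add: kern_def \<kappa>_def)
        have "epow (F w) s \<le> epow (ennreal C * (\<integral>\<^sup>+v. F v * \<kappa> (w - v) \<partial>lborel)) s"
          using s by (intro epow_mono F) auto
        also have "\<dots> = ennreal (C powr s) * epow (\<integral>\<^sup>+v. F v * \<kappa> (w - v) \<partial>lborel) s"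
          using C by (simp add: epow_mult epow_ennreal)
        also have "\<dots> \<le> ennreal (C powr s) * (epow 2 s * (epow (\<integral>\<^sup>+v. \<kappa> (w - v) \<partial>lborel) (s - 1) * (\<integral>\<^sup>+v. epow (F v) s * \<kappa> (w - v) \<partial>lborel)))"
          using True by (intro mult_left_mono nn_integral_Jensen) auto
        also have "\<dots> \<le> ennreal (C powr s) * (epow 2 s * (epow (\<integral>\<^sup>+v. \<kappa> (w - v) \<partial>lborel) (s - 1) * (\<integral>\<^sup>+v. epow (F v) s * 1 \<partial>lborel)))"
          by (intro mult_left_mono nn_integral_mono \<kappa>1) auto
        also have "\<dots> = ennreal (C powr s * (2 powr s * m powr (s - 1))) * I"
          unfolding k I_def using m C epow_ennreal[of 2 s] by (simp add: epow_ennreal ennreal_mult mult.assoc)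
        also have "\<dots> \<le> ennreal D * I"
          using True by (intro mult_right_mono ennreal_leI) (auto simp: D_def)
        finally show ?thesis .
      next
        case False
        \<comment> \<open>Splitting F as F^(1 - s) F^s and bounding the first factor by the supremum
          yields S \<le> C S^(1 - s) I. The power S^(1 - s) cancels because S is finite.\<close>
        define S where "S = (SUP w. F w)"
        obtain b where b: "\<And>w. u w * (1 + norm (w - y)) powr - \<sigma> \<le> b" using B by blast
        have "S \<le> ennreal b" unfolding S_def F_def by (intro SUP_least ennreal_leI b)
        then have "S < top" by (rule le_less_trans) simp
        then have Sfin: "S \<noteq> top" by (simp only: less_top)
        have FS: "F w \<le> S" for w unfolding S_def by (intro SUP_upper) simp
        have SI: "S \<le> ennreal C * (epow S (1 - s) * I)"
          unfolding S_def
        proof (rule SUP_least)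
          fix w
          have "F w \<le> ennreal C * (\<integral>\<^sup>+v. F v * \<kappa> (w - v) \<partial>lborel)" by (rule F)
          also have "\<dots> \<le> ennreal C * (\<integral>\<^sup>+v. epow S (1 - s) * epow (F v) s \<partial>lborel)"
          proof (intro mult_left_mono nn_integral_mono)
            fix v
            have "F v * \<kappa> (w - v) \<le> F v * 1" by (intro mult_left_mono \<kappa>1) auto
            also have "\<dots> = epow (F v) (1 - s) * epow (F v) s" by (simp flip: epow_add)
            also have "\<dots> \<le> epow S (1 - s) * epow (F v) s"
              using False by (intro mult_right_mono epow_mono FS) auto
            finally show "F v * \<kappa> (w - v) \<le> epow S (1 - s) * epow (F v) s" .
          qed auto
          also have "\<dots> = ennreal C * (epow S (1 - s) * I)"
            unfolding I_def by (simp add: nn_integral_cmult)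
          finally show "F w \<le> ennreal C * (epow (SUP w. F w) (1 - s) * I)" unfolding S_def .
        qed
        have "epow S s \<le> ennreal C * I"
        proof (cases "S = 0")
          case True then show ?thesis by simp
        next
          case S0: False
          have "epow S (1 - s) * epow S s \<le> epow S (1 - s) * (ennreal C * I)"
            using SI by (simp add: mult.left_commute flip: epow_add)
          then show ?thesis using S0 Sfin by (subst (asm) ennreal_mult_le_mult_iff) auto
        qed
        moreover have "epow (F w) s \<le> epow S s" using s by (intro epow_mono FS) auto
        moreover have "ennreal C * I \<le> ennreal D * I"
          using False by (intro mult_right_mono ennreal_leI) (auto simp: D_def)
        ultimately show ?thesis by order
      qed
      then show "epow (ennreal (u w * (1 + norm (w - y)) powr - \<sigma>)) s \<le>
          ennreal D * (\<integral>\<^sup>+v. epow (ennreal (u v * (1 + norm (v - y)) powr - \<sigma>)) s \<partial>lborel)"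
        by (simp only: F_def I_def)
    qed
  qed
qed

text \<open>The a priori finiteness needed for the absorption argument comes from a first application with
  a decay exponent exceeding the growth of u, where the constants may still depend on u.\<close>
lemma peetre_core:
  assumes s: "0 < s" and \<sigma>: "0 \<le> \<sigma>" and C: "\<And>N. 0 < C N"
  obtains D where "1 \<le> D" "\<forall>(u::'a::euclidean_space \<Rightarrow> real) y w. u \<in> borel_measurable borel \<longrightarrow> (\<forall>w. 0 \<le> u w) \<longrightarrow>
     (\<forall>N w. ennreal (u w) \<le> ennreal (C N) * (\<integral>\<^sup>+v. ennreal (u v * (1 + norm (w - v)) powr - real N) \<partial>lborel)) \<longrightarrow>
     (\<exists>G M. \<forall>w. u w \<le> G * (1 + norm w) ^ M) \<longrightarrow>
     epow (ennreal (u w * (1 + norm (w - y)) powr - \<sigma>)) s \<le>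
        ennreal D * (\<integral>\<^sup>+v. epow (ennreal (u v * (1 + norm (v - y)) powr - \<sigma>)) s \<partial>lborel)"
proof -
  obtain N :: nat where N: "\<sigma> + real DIM('a) + 1 \<le> real N" using real_arch_simple by blast
  obtain D where D: "1 \<le> D" and fin0: "\<forall>(u::'a \<Rightarrow> real) y w. u \<in> borel_measurable borel \<longrightarrow> (\<forall>w. 0 \<le> u w) \<longrightarrow>
     (\<forall>w. ennreal (u w) \<le> ennreal (C N) * (\<integral>\<^sup>+v. ennreal (u v * (1 + norm (w - v)) powr - real N) \<partial>lborel)) \<longrightarrow>
     (\<exists>B. \<forall>w. u w * (1 + norm (w - y)) powr - \<sigma> \<le> B) \<longrightarrow>
     epow (ennreal (u w * (1 + norm (w - y)) powr - \<sigma>)) s \<le>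
        ennreal D * (\<integral>\<^sup>+v. epow (ennreal (u v * (1 + norm (v - y)) powr - \<sigma>)) s \<partial>lborel)"
    by (rule peetre_core_finite[OF s \<sigma> N C[of N]])
  note fin = fin0[THEN spec, THEN spec, THEN spec, THEN mp, THEN mp, THEN mp, THEN mp]
  show thesis
  proof (rule that[OF D], intro allI impI)
    fix u :: "'a \<Rightarrow> real" and y w :: 'a
    assume m[measurable]: "u \<in> borel_measurable borel" and u0: "\<forall>w. 0 \<le> u w"
      and loc: "\<forall>N w. ennreal (u w) \<le> ennreal (C N) * (\<integral>\<^sup>+v. ennreal (u v * (1 + norm (w - v)) powr - real N) \<partial>lborel)"
      and growth: "\<exists>G M. \<forall>w. u w \<le> G * (1 + norm w) ^ M"
    \<comment> \<open>The weighted integral with the final exponent \<sigma>. If it is infinite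
      there is nothing to prove; if it is finite, it bounds the weighted u, which is the a priori
      information still missing.\<close>
    define I where "I = (\<integral>\<^sup>+v. epow (ennreal (u v * (1 + norm (v - y)) powr - \<sigma>)) s \<partial>lborel)"
    show "epow (ennreal (u w * (1 + norm (w - y)) powr - \<sigma>)) s \<le>
        ennreal D * (\<integral>\<^sup>+v. epow (ennreal (u v * (1 + norm (v - y)) powr - \<sigma>)) s \<partial>lborel)"
    proof (cases "I = top")
      case True
      have "ennreal D * I = top" using D unfolding True by (intro ennreal_mult_top_pos) simp
      then show ?thesis by (simp add: I_def)
    next
      case I: False
      obtain G0 M where G0: "\<And>w. u w \<le> G0 * (1 + norm w) ^ M" using growth by blast
      define G where "G = \<bar>G0\<bar>"
      have G: "0 \<le> G" "\<And>w. u w \<le> G * (1 + norm w) ^ M"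
      proof -
        show "u w \<le> G * (1 + norm w) ^ M" for w
          unfolding G_def by (rule order_trans[OF G0]) (intro mult_right_mono, auto)
      qed (simp add: G_def)
      define \<sigma>' where "\<sigma>' = max \<sigma> (real M)"
      have \<sigma>': "0 \<le> \<sigma>'" "\<sigma> \<le> \<sigma>'" "real M \<le> \<sigma>'" using \<sigma> by (auto simp: \<sigma>'_def)
      obtain N' :: nat where N': "\<sigma>' + real DIM('a) + 1 \<le> real N'" using real_arch_simple by blast
      obtain D' where D': "1 \<le> D'" and fin'0: "\<forall>(u::'a \<Rightarrow> real) y w. u \<in> borel_measurable borel \<longrightarrow> (\<forall>w. 0 \<le> u w) \<longrightarrow>
         (\<forall>w. ennreal (u w) \<le> ennreal (C N') * (\<integral>\<^sup>+v. ennreal (u v * (1 + norm (w - v)) powr - real N') \<partial>lborel)) \<longrightarrow>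
         (\<exists>B. \<forall>w. u w * (1 + norm (w - y)) powr - \<sigma>' \<le> B) \<longrightarrow>
         epow (ennreal (u w * (1 + norm (w - y)) powr - \<sigma>')) s \<le>
            ennreal D' * (\<integral>\<^sup>+v. epow (ennreal (u v * (1 + norm (v - y)) powr - \<sigma>')) s \<partial>lborel)"
        by (rule peetre_core_finite[OF s \<sigma>'(1) N' C[of N']])
      note fin' = fin'0[THEN spec, THEN spec, THEN spec, THEN mp, THEN mp, THEN mp, THEN mp]
      \<comment> \<open>The coarse estimate is applied around the centre z and at z itself, where
        the weight is 1. The weight around z is then converted into the one around y, with the
        exponent \<sigma> that occurs in I.\<close>
      have bd: "epow (ennreal (u z * (1 + norm (z - y)) powr - \<sigma>)) s \<le> ennreal D' * I" for z
      proof -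
        have bz: "u w * (1 + norm (w - z)) powr - \<sigma>' \<le> G * (1 + norm z) ^ M" for w
        proof -
          have "(1 + norm w) \<le> (1 + norm z) * (1 + norm (w - z))"
          proof -
            have "norm w \<le> norm z + norm (w - z)" using norm_triangle_ineq[of z "w - z"] by simp
            moreover have "0 \<le> norm z * norm (w - z)" by simp
            ultimately show ?thesis by (simp only: distrib_left distrib_right mult_1_left mult_1_right)
          qed
          then have "(1 + norm w) ^ M \<le> ((1 + norm z) * (1 + norm (w - z))) ^ M" by (intro power_mono) auto
          then have "u w \<le> G * ((1 + norm z) * (1 + norm (w - z))) ^ M"
            using G by (meson mult_left_mono order_trans)
          then have "u w * (1 + norm (w - z)) powr - \<sigma>' \<le> (G * ((1 + norm z) * (1 + norm (w - z))) ^ M) * (1 + norm (w - z)) powr - real M"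
            using \<sigma>' G u0 by (intro mult_mono powr_mono) auto
          also have "\<dots> = G * (1 + norm z) ^ M"
          proof -
            have pos: "0 < 1 + norm (w - z)" by (intro add_pos_nonneg) auto
            have "X * (1 / X) = 1" if "0 < X" for X :: real using that by simp
            from this[OF zero_less_power[OF pos]] have "(1 + norm (w - z)) ^ M * (1 + norm (w - z)) powr - real M = 1"
              by (simp only: powr_minus_divide powr_realpow[OF pos])
            then show ?thesis by (simp add: power_mult_distrib mult.assoc)
          qed
          finally show ?thesis .
        qed
        have 1: "epow (ennreal (u z)) s \<le> ennreal D' * (\<integral>\<^sup>+v. epow (ennreal (u v * (1 + norm (v - z)) powr - \<sigma>')) s \<partial>lborel)"
        proof -
          have "\<exists>B. \<forall>w. u w * (1 + norm (w - z)) powr - \<sigma>' \<le> B" using bz by blast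
          from fin'[OF m u0 _ this, of z] show ?thesis using loc by simp
        qed
        have "epow (ennreal (u z * (1 + norm (z - y)) powr - \<sigma>)) s = epow (ennreal (u z)) s * epow (ennreal ((1 + norm (z - y)) powr - \<sigma>)) s"
          using u0 by (simp add: ennreal_mult epow_mult)
        also have "\<dots> \<le> (ennreal D' * (\<integral>\<^sup>+v. epow (ennreal (u v * (1 + norm (v - z)) powr - \<sigma>')) s \<partial>lborel)) * epow (ennreal ((1 + norm (z - y)) powr - \<sigma>)) s"
          by (intro mult_right_mono 1) auto
        also have "\<dots> = ennreal D' * (\<integral>\<^sup>+v. epow (ennreal (u v * (1 + norm (v - z)) powr - \<sigma>')) s * epow (ennreal ((1 + norm (z - y)) powr - \<sigma>)) s \<partial>lborel)"
          by (simp add: nn_integral_multc mult.assoc)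
        also have "\<dots> \<le> ennreal D' * I"
          unfolding I_def epow_mult[symmetric]
        proof (intro mult_left_mono nn_integral_mono epow_mono)
          fix v :: 'a
          have "(1 + norm (v - z)) powr - \<sigma>' * (1 + norm (z - y)) powr - \<sigma> \<le> (1 + norm (v - z)) powr - \<sigma> * ((1 + norm (v - y)) powr - \<sigma> * (1 + norm (z - v)) powr \<sigma>)"
            using \<sigma> \<sigma>' by (intro mult_mono powr_submult powr_mono) auto
          also have "\<dots> = (1 + norm (v - y)) powr - \<sigma>"
            by (simp add: powr_minus norm_minus_commute[of v z] add_nonneg_eq_0_iff field_simps)
          finally have "u v * ((1 + norm (v - z)) powr - \<sigma>' * (1 + norm (z - y)) powr - \<sigma>) \<le> u v * (1 + norm (v - y)) powr - \<sigma>"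
            using u0 by (intro mult_left_mono) auto
          then show "ennreal (u v * (1 + norm (v - z)) powr - \<sigma>') * ennreal ((1 + norm (z - y)) powr - \<sigma>) \<le> ennreal (u v * (1 + norm (v - y)) powr - \<sigma>)"
            using u0 by (simp add: mult.assoc flip: ennreal_mult)
        qed (use s in auto)
        finally show ?thesis .
      qed
      have "epow (ennreal D' * I) (1 / s) \<noteq> top"
        using I by (simp add: ennreal_mult_eq_top_iff)
      then obtain b where b: "0 \<le> b" "epow (ennreal D' * I) (1 / s) = ennreal b" by (cases "epow (ennreal D' * I) (1 / s)") auto
      have "u z * (1 + norm (z - y)) powr - \<sigma> \<le> b" for z
      proof -
        have "ennreal (u z * (1 + norm (z - y)) powr - \<sigma>) \<le> ennreal b"
          using bd[of z] s unfolding b(2)[symmetric] by (subst epow_le_swap[symmetric]) auto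
        then show ?thesis using b by simp
      qed
      then show ?thesis using loc by (intro fin[OF m u0]) blast+
    qed
  qed
qed

text \<open>The pointwise bound in units of the scale 2^-k. The substitution v \<mapsto> A (w - v)
  makes the constant independent of k; it depends on A, N and n only.\<close>

lemma class_E_local:
  assumes A: "0 < A"
  shows "\<exists>C>0. \<forall>k. \<forall>f\<in>(class_E (A * 2 powr real_of_int k) :: ('a::euclidean_space \<Rightarrow> complex) set). \<forall>x w.
     ennreal (cmod (f (x - (2 powr - real_of_int k) *\<^sub>R w))) \<le>
     ennreal C * (\<integral>\<^sup>+v. ennreal (cmod (f (x - (2 powr - real_of_int k) *\<^sub>R v)) * (1 + norm (w - v)) powr - real N) \<partial>lborel)"
proof -
  obtain C where C: "0 < C" and pt: "\<And>\<rho> f x. 0 < \<rho> \<Longrightarrow> f \<in> (class_E \<rho> :: ('a \<Rightarrow> complex) set) \<Longrightarrow>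
     ennreal (cmod (f x)) \<le> ennreal C * (\<integral>\<^sup>+v. ennreal (cmod (f (x + (1 / \<rho>) *\<^sub>R v)) * (1 + norm v) powr - real N) \<partial>lborel)"
    using class_E_pointwise[of N, where 'a='a] by blast
  \<comment> \<open>The minimum compares 1 + A |w| with 1 + |w| whether A is below or above
    1.\<close>
  define a where "a = min 1 A"
  have a: "0 < a" "a \<le> 1" "a \<le> A" using A by (auto simp: a_def)
  define C' where "C' = C * (A ^ DIM('a) * a powr - real N)"
  show ?thesis
  proof (intro exI[of _ C'] conjI allI ballI)
    show "0 < C'" using C A a by (simp add: C'_def)
    fix k :: int and f :: "'a \<Rightarrow> complex" and x w :: 'a
    assume f: "f \<in> class_E (A * 2 powr real_of_int k)"
    let ?q = "2 powr - real_of_int k"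
    have [measurable]: "f \<in> borel_measurable borel"
      using f by (auto simp: class_E_def intro: borel_measurable_continuous_onI)
    have "ennreal (cmod (f (x - ?q *\<^sub>R w))) \<le> ennreal C * (\<integral>\<^sup>+v. ennreal (cmod (f (x - ?q *\<^sub>R w + (1 / (A * 2 powr real_of_int k)) *\<^sub>R v)) * (1 + norm v) powr - real N) \<partial>lborel)"
      using A by (intro pt f) auto
    also have "(\<integral>\<^sup>+v. ennreal (cmod (f (x - ?q *\<^sub>R w + (1 / (A * 2 powr real_of_int k)) *\<^sub>R v)) * (1 + norm v) powr - real N) \<partial>lborel)
      = ennreal (\<bar>- A\<bar> ^ DIM('a)) * (\<integral>\<^sup>+v. ennreal (cmod (f (x - ?q *\<^sub>R w + (1 / (A * 2 powr real_of_int k)) *\<^sub>R (A *\<^sub>R w + (- A) *\<^sub>R v))) * (1 + norm (A *\<^sub>R w + (- A) *\<^sub>R v)) powr - real N) \<partial>lborel)"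
      using A by (intro nn_integral_lborel_affine) auto
    also have "\<dots> \<le> ennreal (\<bar>- A\<bar> ^ DIM('a)) * (\<integral>\<^sup>+v. ennreal (a powr - real N) * ennreal (cmod (f (x - ?q *\<^sub>R v)) * (1 + norm (w - v)) powr - real N) \<partial>lborel)"
    proof (intro mult_left_mono nn_integral_mono)
      fix v :: 'a
      have e1: "A *\<^sub>R w + (- A) *\<^sub>R v = A *\<^sub>R (w - v)" by (simp add: algebra_simps)
      have e2: "1 / (A * 2 powr real_of_int k) * A = ?q" using A by (simp add: powr_minus_divide)
      have arg: "x - ?q *\<^sub>R w + (1 / (A * 2 powr real_of_int k)) *\<^sub>R (A *\<^sub>R w + (- A) *\<^sub>R v) = x - ?q *\<^sub>R v"
        unfolding e1 scaleR_scaleR e2 by (simp add: scaleR_diff_right)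
      have nrm: "norm (A *\<^sub>R w + (- A) *\<^sub>R v) = A * norm (w - v)" unfolding e1 using A by simp
      have "a * (1 + norm (w - v)) \<le> 1 + A * norm (w - v)"
        using a mult_right_mono[of a A "norm (w - v)"] by (simp add: distrib_left)
      then have "(1 + A * norm (w - v)) powr - real N \<le> (a * (1 + norm (w - v))) powr - real N"
        using a by (intro powr_mono2') (auto intro!: mult_pos_pos add_pos_nonneg)
      also have "\<dots> = a powr - real N * (1 + norm (w - v)) powr - real N"
        by (rule powr_mult)
      finally have "cmod (f (x - ?q *\<^sub>R v)) * (1 + A * norm (w - v)) powr - real N \<le> cmod (f (x - ?q *\<^sub>R v)) * (a powr - real N * (1 + norm (w - v)) powr - real N)"
        by (intro mult_left_mono) auto
      then show "ennreal (cmod (f (x - ?q *\<^sub>R w + (1 / (A * 2 powr real_of_int k)) *\<^sub>R (A *\<^sub>R w + (- A) *\<^sub>R v))) * (1 + norm (A *\<^sub>R w + (- A) *\<^sub>R v)) powr - real N)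
        \<le> ennreal (a powr - real N) * ennreal (cmod (f (x - ?q *\<^sub>R v)) * (1 + norm (w - v)) powr - real N)"
        unfolding arg nrm by (simp add: mult_ac flip: ennreal_mult)
    qed auto
    also have "\<dots> = ennreal (A ^ DIM('a) * a powr - real N) * (\<integral>\<^sup>+v. ennreal (cmod (f (x - ?q *\<^sub>R v)) * (1 + norm (w - v)) powr - real N) \<partial>lborel)"
      using A by (subst nn_integral_cmult) (auto simp: ennreal_mult mult.assoc)
    finally show "ennreal (cmod (f (x - ?q *\<^sub>R w))) \<le> ennreal C' * (\<integral>\<^sup>+v. ennreal (cmod (f (x - ?q *\<^sub>R v)) * (1 + norm (w - v)) powr - real N) \<partial>lborel)"
      using C A a by (simp add: C'_def ennreal_mult mult.assoc mult_left_mono)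
  qed
qed

lemma shiftavg_rescale:
  fixes x y :: "'a::euclidean_space"
  assumes [measurable]: "g \<in> borel_measurable borel"
  shows "shiftavg L k y g x = (\<integral>\<^sup>+v. g (x - (2 powr - real_of_int k) *\<^sub>R v) * ennreal ((1 + norm (v - y)) powr - L) \<partial>lborel)"
proof -
  let ?q = "2 powr - real_of_int k"
  have "shiftavg L k y g x = ennreal (\<bar>- ?q\<bar> ^ DIM('a)) * (\<integral>\<^sup>+v. g (x + (- ?q) *\<^sub>R v) * ennreal (kern L k y (x - (x + (- ?q) *\<^sub>R v))) \<partial>lborel)"
    unfolding shiftavg_def by (rule nn_integral_lborel_affine) auto
  also have "\<dots> = (\<integral>\<^sup>+v. ennreal (\<bar>- ?q\<bar> ^ DIM('a)) * (g (x + (- ?q) *\<^sub>R v) * ennreal (kern L k y (x - (x + (- ?q) *\<^sub>R v)))) \<partial>lborel)"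
    by (rule nn_integral_cmult[symmetric]) measurable
  also have "\<dots> = (\<integral>\<^sup>+v. g (x - ?q *\<^sub>R v) * ennreal ((1 + norm (v - y)) powr - L) \<partial>lborel)"
  proof (rule nn_integral_cong)
    fix v :: 'a
    have "(2 powr real_of_int k) *\<^sub>R (x - (x + (- ?q) *\<^sub>R v)) - y = v - y"
      by (simp flip: powr_add)
    moreover have "?q ^ DIM('a) * 2 powr (real_of_int k * real DIM('a)) = 1"
      by (simp add: powr_realpow[symmetric] powr_powr flip: powr_add)
    ultimately have "ennreal (\<bar>- ?q\<bar> ^ DIM('a)) * ennreal (kern L k y (x - (x + (- ?q) *\<^sub>R v))) = ennreal ((1 + norm (v - y)) powr - L)"
      unfolding kern_def by (simp add: mult.assoc[symmetric] flip: ennreal_mult)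
    then show "ennreal (\<bar>- ?q\<bar> ^ DIM('a)) * (g (x + (- ?q) *\<^sub>R v) * ennreal (kern L k y (x - (x + (- ?q) *\<^sub>R v)))) = g (x - ?q *\<^sub>R v) * ennreal ((1 + norm (v - y)) powr - L)"
      by (subst mult.left_commute) (simp only: scaleR_minus_left, simp)
  qed
  finally show ?thesis .
qed

text \<open>For t = \<infinity> this is \<open>peetre_core\<close> in rescaled variables. For finite
  t > s the power F^t is split into F^(t - s), bounded by the supremum estimate just obtained, and
  F^s, whose integral is the shifted average; the change of variables cancels the factor 2^(k n /
  t).\<close>

lemma peetre_le_shiftavg:
  assumes A: "0 < A" and s: "0 < s" and \<sigma>: "0 < \<sigma>" and t: "ennreal s < t"
  shows "\<exists>D\<ge>1. \<forall>(y::'a::euclidean_space) k. \<forall>f\<in>class_E (A * 2 powr real_of_int k). \<forall>x.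
     peetre t \<sigma> k y f x \<le> epow (ennreal D * shiftavg (\<sigma> * s) k y (\<lambda>v. epow (ennreal (cmod (f v))) s) x) (1 / s)"
proof -
  let ?P = "\<lambda>N C. 0 < C \<and> (\<forall>k. \<forall>f\<in>(class_E (A * 2 powr real_of_int k) :: ('a \<Rightarrow> complex) set). \<forall>x w.
     ennreal (cmod (f (x - (2 powr - real_of_int k) *\<^sub>R w))) \<le>
     ennreal C * (\<integral>\<^sup>+v. ennreal (cmod (f (x - (2 powr - real_of_int k) *\<^sub>R v)) * (1 + norm (w - v)) powr - real N) \<partial>lborel))"
  have "\<forall>N. \<exists>C. ?P N C" by (intro allI class_E_local[OF A])
  from choice[OF this] obtain C where C_loc: "\<forall>N. ?P N (C N)" ..
  then have C: "0 < C N" for N by simp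
  obtain D where D: "1 \<le> D" and core0: "\<forall>(u::'a \<Rightarrow> real) y w. u \<in> borel_measurable borel \<longrightarrow> (\<forall>w. 0 \<le> u w) \<longrightarrow>
     (\<forall>N w. ennreal (u w) \<le> ennreal (C N) * (\<integral>\<^sup>+v. ennreal (u v * (1 + norm (w - v)) powr - real N) \<partial>lborel)) \<longrightarrow>
     (\<exists>G M. \<forall>w. u w \<le> G * (1 + norm w) ^ M) \<longrightarrow>
     epow (ennreal (u w * (1 + norm (w - y)) powr - \<sigma>)) s \<le>
        ennreal D * (\<integral>\<^sup>+v. epow (ennreal (u v * (1 + norm (v - y)) powr - \<sigma>)) s \<partial>lborel)"
    by (rule peetre_core[where C=C, OF s less_imp_le[OF \<sigma>] C])
  note core = core0[THEN spec, THEN spec, THEN spec, THEN mp, THEN mp, THEN mp, THEN mp]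
  show ?thesis
  proof (intro exI[of _ D] conjI D allI ballI)
    fix y :: 'a and k :: int and f :: "'a \<Rightarrow> complex" and x :: 'a
    assume f: "f \<in> class_E (A * 2 powr real_of_int k)"
    let ?q = "2 powr - real_of_int k" and ?p = "2 powr real_of_int k"
    have qp: "?q * ?p = 1" by (simp flip: powr_add)
    have [measurable]: "f \<in> borel_measurable borel"
      using f by (auto simp: class_E_def intro: borel_measurable_continuous_onI)
    define u where "u w = cmod (f (x - ?q *\<^sub>R w))" for w
    have [measurable]: "u \<in> borel_measurable borel" unfolding u_def by measurable
    define F where "F w = ennreal (u w * (1 + norm (w - y)) powr - \<sigma>)" for w
    have [measurable]: "F \<in> borel_measurable borel" unfolding F_def by measurable
    define I where "I = (\<integral>\<^sup>+v. epow (F v) s \<partial>lborel)"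
    have I_eq: "I = shiftavg (\<sigma> * s) k y (\<lambda>v. epow (ennreal (cmod (f v))) s) x"
      unfolding I_def F_def u_def
      by (subst shiftavg_rescale) (auto simp: ennreal_mult epow_mult epow_ennreal powr_powr intro!: nn_integral_cong)
    have growth: "\<exists>G M. \<forall>w. u w \<le> G * (1 + norm w) ^ M"
    proof -
      obtain G0 M where G0: "\<And>x. cmod (f x) \<le> G0 * (1 + norm x) ^ M" using f unfolding class_E_def by blast
      define c where "c = 1 + norm x + ?q"
      have "u w \<le> (\<bar>G0\<bar> * c ^ M) * (1 + norm w) ^ M" for w
      proof -
        have "norm (x - ?q *\<^sub>R w) \<le> norm x + ?q * norm w" using norm_triangle_ineq4[of x "?q *\<^sub>R w"] by simp
        moreover have "0 \<le> norm x * norm w" "0 < ?q" "0 \<le> norm w" by auto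
        moreover have "c * (1 + norm w) = 1 + norm x + ?q + norm w + norm x * norm w + ?q * norm w"
          by (simp add: c_def algebra_simps)
        ultimately have "1 + norm (x - ?q *\<^sub>R w) \<le> c * (1 + norm w)" by linarith
        then have "(1 + norm (x - ?q *\<^sub>R w)) ^ M \<le> (c * (1 + norm w)) ^ M" by (intro power_mono) auto
        then have "\<bar>G0\<bar> * (1 + norm (x - ?q *\<^sub>R w)) ^ M \<le> \<bar>G0\<bar> * (c * (1 + norm w)) ^ M" by (intro mult_left_mono) auto
        moreover have "u w \<le> \<bar>G0\<bar> * (1 + norm (x - ?q *\<^sub>R w)) ^ M"
          unfolding u_def by (rule order_trans[OF G0]) (intro mult_right_mono, auto)
        ultimately show ?thesis by (simp add: power_mult_distrib mult.assoc)
      qed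
      then show ?thesis by blast
    qed
    have FI: "epow (F w) s \<le> ennreal D * I" for w
      unfolding F_def I_def
    proof (rule core)
      show "\<forall>N w. ennreal (u w) \<le> ennreal (C N) * (\<integral>\<^sup>+v. ennreal (u v * (1 + norm (w - v)) powr - real N) \<partial>lborel)"
        unfolding u_def using C_loc f by simp
      show "\<exists>G M. \<forall>w. u w \<le> G * (1 + norm w) ^ M" by (rule growth)
    qed (auto simp: u_def)
    then have F_le: "F w \<le> epow (ennreal D * I) (1 / s)" for w
      using s by (subst epow_le_swap[symmetric]) auto
    have Fz: "F (?p *\<^sub>R z) = ennreal (cmod (f (x - z)) / (1 + norm (?p *\<^sub>R z - y)) powr \<sigma>)" for z
      by (simp add: F_def u_def powr_minus divide_inverse qp)
    have "peetre t \<sigma> k y f x \<le> epow (ennreal D * I) (1 / s)"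
    proof (cases "t = \<infinity>")
      case True
      then show ?thesis unfolding peetre_def using F_le by (auto simp: Fz[symmetric] intro!: SUP_least)
    next
      case False
      define \<tau> where "\<tau> = enn2real t"
      have t\<tau>: "t = ennreal \<tau>" "s < \<tau>"
      proof -
        show "t = ennreal \<tau>" using False by (simp add: \<tau>_def less_top)
        then show "s < \<tau>" using t s by (simp add: ennreal_less_iff)
      qed
      have \<tau>0: "0 < \<tau>" using t\<tau> s by linarith
      have "peetre t \<sigma> k y f x = ennreal (2 powr (real_of_int k * real DIM('a) / \<tau>)) * epow (\<integral>\<^sup>+z. epow (F (?p *\<^sub>R z)) \<tau> \<partial>lborel) (1 / \<tau>)"
      proof -
        have "epow (F (?p *\<^sub>R z)) \<tau> = ennreal (cmod (f (x - z)) powr \<tau> / (1 + norm (?p *\<^sub>R z - y)) powr (\<sigma> * \<tau>))" for z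
          unfolding Fz by (simp add: epow_ennreal powr_divide powr_powr)
        then show ?thesis unfolding peetre_def using False by (simp add: \<tau>_def)
      qed
      also have "ennreal (2 powr (real_of_int k * real DIM('a) / \<tau>)) = epow (ennreal (2 powr (real_of_int k * real DIM('a)))) (1 / \<tau>)"
        by (simp add: epow_ennreal powr_powr)
      also have "epow (ennreal (2 powr (real_of_int k * real DIM('a)))) (1 / \<tau>) * epow (\<integral>\<^sup>+z. epow (F (?p *\<^sub>R z)) \<tau> \<partial>lborel) (1 / \<tau>)
        = epow (ennreal (2 powr (real_of_int k * real DIM('a))) * (\<integral>\<^sup>+z. epow (F (?p *\<^sub>R z)) \<tau> \<partial>lborel)) (1 / \<tau>)"
        by (rule epow_mult[symmetric])
      also have "(\<integral>\<^sup>+z. epow (F (?p *\<^sub>R z)) \<tau> \<partial>lborel) = ennreal (\<bar>?q\<bar> ^ DIM('a)) * (\<integral>\<^sup>+w. epow (F (?p *\<^sub>R (0 + ?q *\<^sub>R w))) \<tau> \<partial>lborel)"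
        by (rule nn_integral_lborel_affine) auto
      also have "ennreal (2 powr (real_of_int k * real DIM('a))) * (ennreal (\<bar>?q\<bar> ^ DIM('a)) * (\<integral>\<^sup>+w. epow (F (?p *\<^sub>R (0 + ?q *\<^sub>R w))) \<tau> \<partial>lborel)) = (\<integral>\<^sup>+w. epow (F w) \<tau> \<partial>lborel)"
      proof -
        have "ennreal (2 powr (real_of_int k * real DIM('a))) * ennreal (\<bar>?q\<bar> ^ DIM('a)) = 1"
          by (simp add: powr_realpow[symmetric] powr_powr flip: ennreal_mult powr_add)
        then show ?thesis using qp by (simp add: mult.assoc[symmetric] mult.commute[of ?p])
      qed
      also have "epow (\<integral>\<^sup>+w. epow (F w) \<tau> \<partial>lborel) (1 / \<tau>) \<le> epow (epow (ennreal D * I) (\<tau> / s)) (1 / \<tau>)"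
      proof (rule epow_mono)
        have "(\<integral>\<^sup>+w. epow (F w) \<tau> \<partial>lborel) \<le> (\<integral>\<^sup>+w. epow (ennreal D * I) ((\<tau> - s) / s) * epow (F w) s \<partial>lborel)"
        proof (rule nn_integral_mono)
          fix w
          have "epow (F w) \<tau> = epow (epow (F w) s) ((\<tau> - s) / s) * epow (F w) s"
            using s by (simp add: epow_epow flip: epow_add)
          also have "\<dots> \<le> epow (ennreal D * I) ((\<tau> - s) / s) * epow (F w) s"
            using s t\<tau> by (intro mult_right_mono epow_mono FI) auto
          finally show "epow (F w) \<tau> \<le> epow (ennreal D * I) ((\<tau> - s) / s) * epow (F w) s" .
        qed
        also have "\<dots> = epow (ennreal D * I) ((\<tau> - s) / s) * I"
          unfolding I_def by (rule nn_integral_cmult) measurable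
        also have "\<dots> \<le> epow (ennreal D * I) ((\<tau> - s) / s) * epow (ennreal D * I) 1"
        proof (rule mult_left_mono)
          have "1 * I \<le> ennreal D * I" using D by (intro mult_right_mono) auto
          then show "I \<le> epow (ennreal D * I) 1" by simp
        qed simp
        also have "\<dots> = epow (ennreal D * I) ((\<tau> - s) / s + 1)" by (rule epow_add[symmetric])
        also have "(\<tau> - s) / s + 1 = \<tau> / s" using s by (simp add: field_simps)
        finally show "(\<integral>\<^sup>+w. epow (F w) \<tau> \<partial>lborel) \<le> epow (ennreal D * I) (\<tau> / s)" .
      qed (use \<tau>0 in auto)
      also have "\<dots> = epow (ennreal D * I) (1 / s)" using \<tau>0 by (simp add: epow_epow)
      finally show ?thesis .
    qed
    then show "peetre t \<sigma> k y f x \<le> epow (ennreal D * shiftavg (\<sigma> * s) k y (\<lambda>v. epow (ennreal (cmod (f v))) s) x) (1 / s)"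
      by (simp only: I_eq)
  qed
qed

section \<open>Sharpness\<close>

lemma recip_exp_real: "0 < a \<Longrightarrow> recip_exp (ennreal a) = 1 / a"
  by (simp add: recip_exp_def)

text \<open>On the ball of radius 2^-k \<delta> about 2^-k y the weight is at least 2^-\<sigma>, and
  the volume of that ball is balanced by the factor 2^(k n / t). Hence \<kappa> depends neither on k
  nor on y.\<close>

lemma peetre_lower:
  assumes t: "0 < t" and \<sigma>: "0 < \<sigma>" and \<delta>: "0 < \<delta>" "\<delta> \<le> 1"
  shows "\<exists>\<kappa>>0. \<forall>k (y::'a::euclidean_space) f x c. 0 \<le> c \<longrightarrow>
    (\<forall>z. norm ((2 powr real_of_int k) *\<^sub>R z - y) \<le> \<delta> \<longrightarrow> c \<le> cmod (f (x - z))) \<longrightarrow>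
    ennreal (c * \<kappa>) \<le> peetre t \<sigma> k y f x"
proof (cases "t = \<infinity>")
  case True
  show ?thesis
  proof (intro exI[of _ 1] conjI allI impI)
    fix k and y :: 'a and f :: "'a \<Rightarrow> complex" and x c
    assume c: "0 \<le> (c::real)" and le: "\<forall>z. norm ((2 powr real_of_int k) *\<^sub>R z - y) \<le> \<delta> \<longrightarrow> c \<le> cmod (f (x - z))"
    let ?z = "(2 powr - real_of_int k) *\<^sub>R y"
    have z: "(2 powr real_of_int k) *\<^sub>R ?z = y" by (simp flip: powr_add)
    have "c * 1 \<le> cmod (f (x - ?z)) / (1 + norm ((2 powr real_of_int k) *\<^sub>R ?z - y)) powr \<sigma>"
      using le[rule_format, of ?z] \<delta> unfolding z by simp
    then show "ennreal (c * 1) \<le> peetre t \<sigma> k y f x"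
      unfolding peetre_def using True by (auto intro!: SUP_upper2[of ?z] ennreal_leI)
  qed simp
next
  case False
  then obtain \<tau> where \<tau>: "0 < \<tau>" "t = ennreal \<tau>" using t epow_pos_real[of t] by auto
  let ?n = "real DIM('a)" and ?V = "unit_ball_vol (real DIM('a))"
  define \<kappa> where "\<kappa> = (2 powr - (\<sigma> * \<tau>) * ?V * \<delta> ^ DIM('a)) powr (1 / \<tau>)"
  have V: "0 < ?V" by simp
  have pos: "0 < 2 powr - (\<sigma> * \<tau>) * ?V * \<delta> ^ DIM('a)" using \<delta> V by (intro mult_pos_pos) auto
  have \<kappa>0: "0 < \<kappa>" unfolding \<kappa>_def powr_gt_zero using pos by linarith
  show ?thesis
  proof (intro exI[of _ \<kappa>] conjI \<kappa>0 allI impI)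
    fix k and y :: 'a and f :: "'a \<Rightarrow> complex" and x c
    assume c: "0 \<le> (c::real)" and le: "\<forall>z. norm ((2 powr real_of_int k) *\<^sub>R z - y) \<le> \<delta> \<longrightarrow> c \<le> cmod (f (x - z))"
    let ?q = "2 powr - real_of_int k" and ?p = "2 powr real_of_int k"
    let ?s = "2 powr (real_of_int k * ?n)"
    have qp: "?q * ?p = 1" by (simp flip: powr_add)
    define J where "J = (\<integral>\<^sup>+ z. ennreal (cmod (f (x - z)) powr \<tau> / (1 + norm (?p *\<^sub>R z - y)) powr (\<sigma> * \<tau>)) \<partial>lborel)"
    have "ennreal (c powr \<tau> * 2 powr - (\<sigma> * \<tau>)) * ennreal (?V * (?q * \<delta>) ^ DIM('a)) = (\<integral>\<^sup>+z. (if norm (?q *\<^sub>R y - z) \<le> ?q * \<delta> then ennreal (c powr \<tau> * 2 powr - (\<sigma> * \<tau>)) else 0) \<partial>lborel)"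
      using \<delta> by (subst nn_integral_cball_indicator) auto
    also have "\<dots> \<le> J"
      unfolding J_def
    proof (rule nn_integral_mono)
      fix z :: 'a
      show "(if norm (?q *\<^sub>R y - z) \<le> ?q * \<delta> then ennreal (c powr \<tau> * 2 powr - (\<sigma> * \<tau>)) else 0) \<le> ennreal (cmod (f (x - z)) powr \<tau> / (1 + norm (?p *\<^sub>R z - y)) powr (\<sigma> * \<tau>))"
      proof (cases "norm (?q *\<^sub>R y - z) \<le> ?q * \<delta>")
        case True
        have "?p *\<^sub>R z - y = - (?p *\<^sub>R (?q *\<^sub>R y - z))"
          by (simp add: algebra_simps flip: powr_add)
        then have "norm (?p *\<^sub>R z - y) = ?p * norm (?q *\<^sub>R y - z)" by (simp only: norm_minus_cancel norm_scaleR) simp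
        also have "\<dots> \<le> ?p * (?q * \<delta>)" using True by (intro mult_left_mono) auto
        also have "\<dots> = \<delta>" using qp by (simp add: mult.assoc[symmetric] mult.commute[of ?p])
        finally have nz: "norm (?p *\<^sub>R z - y) \<le> \<delta>" .
        then have "c powr \<tau> \<le> cmod (f (x - z)) powr \<tau>" using le c \<tau> by (intro powr_mono2) auto
        moreover have "2 powr - (\<sigma> * \<tau>) \<le> (1 + norm (?p *\<^sub>R z - y)) powr - (\<sigma> * \<tau>)"
          using nz \<delta> \<sigma> \<tau> by (intro powr_mono2') (auto intro: add_pos_nonneg)
        ultimately have "c powr \<tau> * 2 powr - (\<sigma> * \<tau>) \<le> cmod (f (x - z)) powr \<tau> * (1 + norm (?p *\<^sub>R z - y)) powr - (\<sigma> * \<tau>)"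
          by (intro mult_mono) auto
        also have "\<dots> = cmod (f (x - z)) powr \<tau> / (1 + norm (?p *\<^sub>R z - y)) powr (\<sigma> * \<tau>)"
          by (simp add: powr_minus divide_inverse)
        finally show ?thesis using True by (simp add: ennreal_leI)
      qed simp
    qed
    finally have J: "ennreal (c powr \<tau> * 2 powr - (\<sigma> * \<tau>)) * ennreal (?V * (?q * \<delta>) ^ DIM('a)) \<le> J" .
    have "ennreal (c * \<kappa>) = epow (ennreal ((c * \<kappa>) powr \<tau>)) (1 / \<tau>)"
      using c \<kappa>0 \<tau> by (simp add: epow_ennreal powr_powr)
    also have "(c * \<kappa>) powr \<tau> = ?s * (c powr \<tau> * 2 powr - (\<sigma> * \<tau>) * (?V * (?q * \<delta>) ^ DIM('a)))"
    proof -
      have "\<kappa> powr \<tau> = 2 powr - (\<sigma> * \<tau>) * ?V * \<delta> ^ DIM('a)" unfolding \<kappa>_def using \<tau> pos by (simp add: powr_powr)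
      moreover have "?s * ?q ^ DIM('a) = 1" by (simp add: powr_realpow[symmetric] powr_powr flip: powr_add)
      ultimately show ?thesis using c \<kappa>0 by (simp add: powr_mult power_mult_distrib)
    qed
    also have "ennreal \<dots> = ennreal ?s * (ennreal (c powr \<tau> * 2 powr - (\<sigma> * \<tau>)) * ennreal (?V * (?q * \<delta>) ^ DIM('a)))"
      using \<delta> V by (simp add: ennreal_mult)
    also have "epow \<dots> (1 / \<tau>) \<le> epow (ennreal ?s * J) (1 / \<tau>)"
      using \<tau> by (intro epow_mono mult_left_mono J) auto
    also have "\<dots> = peetre t \<sigma> k y f x"
      unfolding peetre_def J_def using False \<tau> by (simp add: epow_mult epow_ennreal powr_powr)
    finally show "ennreal (c * \<kappa>) \<le> peetre t \<sigma> k y f x" .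
  qed
qed

text \<open>The common building block of the counterexamples. U is bounded below on a ball of radius
  2 \<delta>, once \<delta> for the position of x and once for that of z, and \<delta> \<le> 1/4
  keeps balls of radius \<delta> apart when their centres are at distance 1 or more.\<close>

lemma test_bump:
  assumes A: "0 < A"
  obtains U :: "'a::euclidean_space \<Rightarrow> complex" and c \<delta> where
    "\<And>b. (\<lambda>x. U (x + b)) \<in> class_E A" "U \<in> borel_measurable borel"
    "0 < c" "0 < \<delta>" "\<delta> \<le> 1 / 4" "\<And>x. norm x \<le> 2 * \<delta> \<Longrightarrow> c \<le> cmod (U x)"
    "\<And>N::nat. \<exists>B>0. \<forall>x. cmod (U x) \<le> B * (1 + norm x) powr - real N"
proof -
  \<comment> \<open>Then 3 a n = A, safely below the 2 A that \<open>bump_in_class_E\<close>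
    allows.\<close>
  define a where "a = A / (3 * real DIM('a))"
  have a: "0 < a" "3 * a * real DIM('a) < 2 * A" using A by (auto simp: a_def)
  define U where "U x = bump (a *\<^sub>R x)" for x :: 'a
  have cont: "continuous_on UNIV U" unfolding U_def
    by (intro continuous_on_compose2[OF bump_continuous] continuous_intros) auto
  define c where "c = cmod (U 0) / 2"
  have c: "0 < c" using bump_0[where 'a='a] by (simp add: c_def U_def)
  have "isCont U 0" using cont by (simp add: continuous_on_eq_continuous_at)
  then obtain d where d: "0 < d" "\<And>x. dist x 0 < d \<Longrightarrow> dist (U x) (U 0) < c"
    using c unfolding continuous_at_eps_delta by blast
  define \<delta> where "\<delta> = min (1 / 4) (d / 4)"
  have \<delta>: "0 < \<delta>" "\<delta> \<le> 1 / 4" "2 * \<delta> < d" using d by (auto simp: \<delta>_def)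
  show thesis
  proof (rule that[of U c \<delta>])
    show "(\<lambda>x. U (x + b)) \<in> class_E A" for b unfolding U_def by (rule bump_in_class_E[OF a])
    show "U \<in> borel_measurable borel" by (intro borel_measurable_continuous_onI cont)
    show "c \<le> cmod (U x)" if "norm x \<le> 2 * \<delta>" for x
    proof -
      have "cmod (U x - U 0) < c" using d(2)[of x] that \<delta> by (simp add: dist_norm)
      then show ?thesis using norm_triangle_ineq2[of "U 0" "U 0 - U x"] by (simp add: c_def norm_minus_commute)
    qed
    show "\<exists>B>0. \<forall>x. cmod (U x) \<le> B * (1 + norm x) powr - real N" for N :: nat
    proof -
      obtain B where B: "0 < B" "\<And>u::'a. cmod (bump u) \<le> B * (1 + norm u) powr - real N"
        using pf_F1_decay[of "\<lambda>_. cut" N] smooth1_cut csupp_cut by blast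
      define m where "m = min 1 a"
      have m: "0 < m" "m \<le> 1" "m \<le> a" using a by (auto simp: m_def)
      have "cmod (U x) \<le> (B * m powr - real N) * (1 + norm x) powr - real N" for x
      proof -
        have "m * (1 + norm x) \<le> 1 + norm (a *\<^sub>R x)"
          using m a mult_right_mono[of m a "norm x"] by (simp add: distrib_left)
        then have "(1 + norm (a *\<^sub>R x)) powr - real N \<le> (m * (1 + norm x)) powr - real N"
          using m by (intro powr_mono2') (auto intro!: mult_pos_pos add_pos_nonneg)
        also have "\<dots> = m powr - real N * (1 + norm x) powr - real N" by (rule powr_mult)
        finally have "B * (1 + norm (a *\<^sub>R x)) powr - real N \<le> B * (m powr - real N * (1 + norm x) powr - real N)"
          using B by (intro mult_left_mono) auto
        with B(2)[of "a *\<^sub>R x"] show ?thesis by (simp add: U_def mult.assoc)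
      qed
      moreover have "0 < B * m powr - real N" using B m by simp
      ultimately show ?thesis by blast
    qed
  qed (use c \<delta> in auto)
qed

section \<open>Growth in the number of bumps\<close>

lemma powr_growth:
  assumes "0 < c" and le: "\<And>N::nat. 1 \<le> N \<Longrightarrow> c * real N powr a \<le> K * real N powr b"
  shows "a \<le> b"
proof (rule ccontr)
  assume "\<not> a \<le> b"
  then have ab: "0 < a - b" by simp
  define R where "R = \<bar>K / c\<bar> + 1"
  have R: "1 \<le> R" by (simp add: R_def)
  obtain N :: nat where N: "R powr (1 / (a - b)) \<le> real N" using real_arch_simple by blast
  have "1 powr (1 / (a - b)) \<le> R powr (1 / (a - b))" using R ab by (intro powr_mono2) auto
  then have N1: "1 \<le> N" using N by simp
  have "R = (R powr (1 / (a - b))) powr (a - b)" using R ab by (simp add: powr_powr)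
  also have "\<dots> \<le> real N powr (a - b)" using N ab by (intro powr_mono2) auto
  also have "\<dots> = real N powr a / real N powr b" by (rule powr_diff)
  also have "\<dots> \<le> K / c" using le[OF N1] assms(1) N1 by (simp add: field_simps)
  finally show False unfolding R_def by linarith
qed

lemma logfac_pow2:
  fixes e :: "'a::euclidean_space"
  assumes "e \<in> Basis"
  shows "logfac ((2 ^ N) *\<^sub>R e) \<le> real N + 2"
proof -
  have "exp 1 + (2::real) ^ N \<le> exp (real N + 2)"
  proof -
    have 1: "exp 1 \<le> exp (real N + 1)" by simp
    have e2: "2 \<le> exp (1::real)" using exp_ge_add_one_self[of 1] by simp
    have "(2::real) ^ N \<le> exp 1 ^ N" using e2 by (intro power_mono) auto
    also have "\<dots> = exp (real N)" by (simp flip: exp_of_nat_mult)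
    also have "\<dots> \<le> exp (real N + 1)" by simp
    finally have "exp 1 + (2::real) ^ N \<le> 2 * exp (real N + 1)" using 1 by linarith
    also have "\<dots> \<le> exp 1 * exp (real N + 1)" using e2 by (intro mult_right_mono) auto
    also have "\<dots> = exp (real N + 2)" by (simp flip: exp_add)
    finally show ?thesis .
  qed
  then have "ln (exp 1 + 2 ^ N) \<le> ln (exp (real N + 2))"
    by (subst ln_le_cancel_iff) (auto intro: add_pos_pos)
  then show ?thesis using assms by (simp add: logfac_def)
qed

lemma nn_integral_count_space_finite:
  assumes "finite J" "\<And>k. k \<notin> J \<Longrightarrow> g k = 0"
  shows "(\<integral>\<^sup>+k. g k \<partial>count_space UNIV) = (\<Sum>k\<in>J. g k :: ennreal)"
  using assms by (intro nn_integral_count_space') auto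

lemma lq_norm_ge_point:
  assumes "0 < q" shows "g k \<le> lq_norm q g"
proof (cases "q = \<infinity>")
  case True
  then show ?thesis by (auto simp: lq_norm_def intro: SUP_upper)
next
  case False
  then obtain b where b: "0 < b" "q = ennreal b" using assms epow_pos_real[of q] by auto
  then show ?thesis unfolding lq_norm_def using epow_ge_point[OF b(1), of g k] False by simp
qed

lemma lq_norm_ge:
  assumes q: "0 < q" and J: "finite J" "J \<noteq> {}" and g: "\<And>k. k \<in> J \<Longrightarrow> \<epsilon> \<le> g k"
  shows "ennreal (real (card J) powr recip_exp q) * \<epsilon> \<le> lq_norm q g"
proof (cases "q = \<infinity>")
  case True
  obtain k where "k \<in> J" using J by blast
  then have "\<epsilon> \<le> lq_norm q g" using g lq_norm_ge_point[OF q, of g k] by (meson order_trans)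
  moreover have "real (card J) powr recip_exp q = 1" using True J by (simp add: recip_exp_def card_gt_0_iff)
  ultimately show ?thesis by simp
next
  case False
  then obtain b where b: "0 < b" "q = ennreal b" using q epow_pos_real[of q] by auto
  have "ennreal (real (card J) powr (1 / b)) * \<epsilon> = epow (of_nat (card J) * epow \<epsilon> b) (1 / b)"
    using b by (simp add: epow_mult epow_epow ennreal_of_nat_eq_real_of_nat epow_ennreal)
  also have "of_nat (card J) * epow \<epsilon> b = (\<Sum>k\<in>J. epow \<epsilon> b)" by simp
  also have "\<dots> \<le> (\<Sum>k\<in>J. epow (g k) b)" using b by (intro sum_mono epow_mono g) auto
  also have "\<dots> = (\<integral>\<^sup>+k. (if k \<in> J then epow (g k) b else 0) \<partial>count_space UNIV)"
    using J by (subst nn_integral_count_space_finite[of J]) auto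
  also have "\<dots> \<le> (\<integral>\<^sup>+k. epow (g k) b \<partial>count_space UNIV)" by (intro nn_integral_mono) auto
  finally have "ennreal (real (card J) powr (1 / b)) * \<epsilon> \<le> epow (\<integral>\<^sup>+k. epow (g k) b \<partial>count_space UNIV) (1 / b)"
    using b by (simp add: epow_mono)
  then show ?thesis using b False by (simp add: lq_norm_def recip_exp_real)
qed

lemma lq_norm_const:
  assumes q: "0 < q" and J: "finite J" "J \<noteq> {}"
  shows "lq_norm q (\<lambda>k. if k \<in> J then w else 0) = ennreal (real (card J) powr recip_exp q) * w"
proof (cases "q = \<infinity>")
  case True
  have "(SUP k. if k \<in> J then w else 0) = w"
  proof (rule antisym)
    show "(SUP k. if k \<in> J then w else 0) \<le> w" by (intro SUP_least) auto
    obtain k where "k \<in> J" using J by blast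
    then show "w \<le> (SUP k. if k \<in> J then w else 0)" by (intro SUP_upper2[of k]) auto
  qed
  moreover have "real (card J) powr recip_exp q = 1" using True J by (simp add: recip_exp_def card_gt_0_iff)
  ultimately show ?thesis using True by (simp add: lq_norm_def)
next
  case False
  then obtain b where b: "0 < b" "q = ennreal b" using q epow_pos_real[of q] by auto
  have "(\<integral>\<^sup>+k. epow (if k \<in> J then w else 0) b \<partial>count_space UNIV) = (\<Sum>k\<in>J. epow (if k \<in> J then w else 0) b)"
    using J by (intro nn_integral_count_space_finite) auto
  also have "\<dots> = of_nat (card J) * epow w b" by simp
  finally show ?thesis using b False
    by (simp add: lq_norm_def recip_exp_real epow_mult epow_epow ennreal_of_nat_eq_real_of_nat epow_ennreal)
qed

text \<open>The points $-2^j e$ are so well spaced that at most one summand is not exponentially small.\<close>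
lemma lacunary_sum:
  fixes x e :: "'a::euclidean_space"
  assumes e: "e \<in> Basis"
  shows "(\<Sum>i<N. 1 / (1 + norm (x + (2 ^ (N - i)) *\<^sub>R e))) \<le> 5"
proof (cases "N = 0")
  case False
  let ?d = "\<lambda>i. norm (x + (2 ^ (N - i)) *\<^sub>R e)"
  \<comment> \<open>m is the index of the point nearest to x. Any other point has distance at least
    2^(N - i) / 2 from that one, hence at least 2^(N - i) / 4 from x. The nearest point contributes
    at most 1 to the sum and all others together at most 4.\<close>
  have "Min (?d ` {..<N}) \<in> ?d ` {..<N}" using False by (intro Min_in) auto
  then obtain m where m0: "m < N" "Min (?d ` {..<N}) = ?d m" by auto
  have m: "m < N" "\<And>i. i < N \<Longrightarrow> ?d m \<le> ?d i"
    unfolding m0(2)[symmetric] by (auto intro: m0 Min_le)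
  have far: "1 / (1 + ?d i) \<le> 4 / 2 ^ (N - i)" if i: "i < N" "i \<noteq> m" for i
  proof -
    have "(2::real) ^ (N - i) / 2 \<le> \<bar>2 ^ (N - i) - 2 ^ (N - m)\<bar>"
    proof (cases "i < m")
      case True
      then have "(2::real) ^ (N - m) * 2 \<le> 2 ^ (N - i)"
      proof -
        have "Suc (N - m) \<le> N - i" using \<open>i < m\<close> m(1) by arith
        from power_increasing[OF this, of "2::real"] show ?thesis by simp
      qed
      then show ?thesis by linarith
    next
      case F: False
      then have "(2::real) ^ (N - i) * 2 \<le> 2 ^ (N - m)"
      proof -
        have "Suc (N - i) \<le> N - m" using F i by arith
        from power_increasing[OF this, of "2::real"] show ?thesis by simp
      qed
      moreover have "(0::real) < 2 ^ (N - i)" by simp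
      ultimately show ?thesis by linarith
    qed
    also have "\<dots> = norm ((x + (2 ^ (N - i)) *\<^sub>R e) - (x + (2 ^ (N - m)) *\<^sub>R e))"
      using e by (simp add: scaleR_left_diff_distrib[symmetric])
    also have "\<dots> \<le> ?d i + ?d m" by (rule norm_triangle_ineq4)
    also have "\<dots> \<le> 2 * ?d i" using m(2)[OF i(1)] by simp
    finally have "2 ^ (N - i) / 4 \<le> 1 + ?d i" by simp
    then have "1 / (1 + ?d i) \<le> 1 / (2 ^ (N - i) / 4)" by (intro divide_left_mono) (auto intro!: mult_pos_pos add_pos_nonneg)
    then show ?thesis by simp
  qed
  have "(\<Sum>i<N. 1 / (1 + ?d i)) = 1 / (1 + ?d m) + (\<Sum>i\<in>{..<N} - {m}. 1 / (1 + ?d i))"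
    using m by (intro sum.remove) auto
  also have "\<dots> \<le> 1 + (\<Sum>i\<in>{..<N} - {m}. 4 / 2 ^ (N - i))"
    by (intro add_mono sum_mono far) (auto simp: divide_le_eq add_pos_nonneg)
  also have "\<dots> \<le> 1 + (\<Sum>i<N. 4 / 2 ^ (N - i))"
    by (intro add_left_mono sum_mono2) auto
  also have "(\<Sum>i<N. 4 / 2 ^ (N - i)) = (4 / 2 ^ N) * (\<Sum>i<N. (2::real) ^ i)"
    unfolding sum_distrib_left by (intro sum.cong refl) (simp add: power_diff)
  also have "(\<Sum>i<N. (2::real) ^ i) = 2 ^ N - 1" using geometric_sum[of "2::real" N] by simp
  also have "(4 / 2 ^ N) * ((2::real) ^ N - 1) \<le> 4" by (simp add: field_simps)
  finally show ?thesis by simp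
qed simp

lemma logfac_powr_le:
  fixes e :: "'a::euclidean_space"
  assumes "e \<in> Basis" "0 \<le> r" "1 \<le> N"
  shows "logfac ((2 ^ N) *\<^sub>R e) powr r \<le> 3 powr r * real N powr r"
proof -
  have "logfac ((2 ^ N) *\<^sub>R e) \<le> 3 * real N"
    using logfac_pow2[OF assms(1), of N] assms(3) by linarith
  then have "logfac ((2 ^ N) *\<^sub>R e) powr r \<le> (3 * real N) powr r"
    using assms logfac_ge_1[of "(2 ^ N) *\<^sub>R e"] by (intro powr_mono2) auto
  then show ?thesis by (simp add: powr_mult)
qed

lemma dyadic_shift:
  fixes e :: "'a::real_vector"
  assumes "i \<le> N"
  shows "(2 powr - real_of_int (int i)) *\<^sub>R (2 ^ N) *\<^sub>R e = (2 ^ (N - i)) *\<^sub>R e"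
  using assms by (simp add: powr_minus powr_realpow power_diff divide_inverse mult.commute)

lemma class_E_dyadic: "0 < A \<Longrightarrow> f \<in> class_E A \<Longrightarrow> f \<in> class_E (A * 2 powr real_of_int (int i))"
  using class_E_mono[of A "A * 2 powr real_of_int (int i)"] by (auto simp: powr_realpow mult_le_cancel_left1)

lemma Lp_norm_real:
  assumes "0 < a"
  shows "Lp_norm (ennreal a) F = epow (\<integral>\<^sup>+x. epow (F x) a \<partial>lborel) (1 / a)"
  using assms by (simp add: Lp_norm_def)

lemma lq_norm_real: "0 < b \<Longrightarrow> lq_norm (ennreal b) g = epow (\<integral>\<^sup>+k. epow (g k) b \<partial>count_space UNIV) (1 / b)"
  by (simp add: lq_norm_def)

section \<open>Necessity of the power of the logarithm\<close>

lemma powr_decay_integral_finite: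
  fixes U :: "'a::euclidean_space \<Rightarrow> complex"
  assumes a: "0 < a" and decay: "\<And>N::nat. \<exists>B>0. \<forall>x. cmod (U x) \<le> B * (1 + norm x) powr - real N"
  shows "(\<integral>\<^sup>+x. epow (ennreal (cmod (U x))) a \<partial>lborel) < \<infinity>"
proof -
  obtain N :: nat where N: "(real DIM('a) + 1) / a \<le> real N" using real_arch_simple by blast
  obtain B where B: "0 < B" "\<And>x. cmod (U x) \<le> B * (1 + norm x) powr - real N" using decay by blast
  have L: "real DIM('a) < real N * a" using N a by (simp add: field_simps)
  have "(\<integral>\<^sup>+x. epow (ennreal (cmod (U x))) a \<partial>lborel) \<le> (\<integral>\<^sup>+x. ennreal (B powr a) * ennreal ((1 + norm (x::'a)) powr - (real N * a)) \<partial>lborel)"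
  proof (rule nn_integral_mono)
    fix x :: 'a
    have "cmod (U x) powr a \<le> (B * (1 + norm x) powr - real N) powr a" using a B by (intro powr_mono2) auto
    also have "\<dots> = B powr a * (1 + norm x) powr - (real N * a)" by (simp add: powr_mult powr_powr)
    finally show "epow (ennreal (cmod (U x))) a \<le> ennreal (B powr a) * ennreal ((1 + norm x) powr - (real N * a))"
      by (simp add: epow_ennreal flip: ennreal_mult)
  qed
  also have "\<dots> = ennreal (B powr a) * kmass TYPE('a) (real N * a)"
    unfolding kmass_def by (rule nn_integral_cmult) measurable
  also have "\<dots> < \<infinity>" using kmass_finite[OF L] by (simp add: ennreal_mult_less_top)
  finally show ?thesis .
qed

text \<open>With the same bump at all N scales, the input norm is N^(1/q) times the L^p norm of U.
  The output is bounded below on N disjoint balls of equal size by a single term of the sequence on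
  each ball, so its norm is at least a multiple of N^(1/p). Comparing powers of N gives the
  claim.\<close>

lemma necessity_spread:
  fixes p q t :: ennreal
  assumes p: "0 < p" "p < \<infinity>" and q: "0 < q" and t: "0 < t" and \<sigma>: "0 < \<sigma>" and A: "0 < A" and r: "0 \<le> r"
    and bound: "\<And>(y::'a::euclidean_space) f. (\<forall>k. f k \<in> class_E (A * 2 powr real_of_int k)) \<Longrightarrow>
       Lp_lq_norm p q (\<lambda>k. peetre t \<sigma> k y (f k))
         \<le> ennreal (C * logfac y powr r) * Lp_lq_norm p q (\<lambda>k x. ennreal (cmod (f k x)))"
  shows "recip_exp p - recip_exp q \<le> r"
proof -
  obtain a where a: "0 < a" "p = ennreal a" using p epow_pos_real[of p] by auto
  obtain U :: "'a \<Rightarrow> complex" and c \<delta> where U: "\<And>b. (\<lambda>x. U (x + b)) \<in> class_E A" "U \<in> borel_measurable borel"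
    "0 < c" "0 < \<delta>" "\<delta> \<le> 1 / 4" "\<And>x. norm x \<le> 2 * \<delta> \<Longrightarrow> c \<le> cmod (U x)"
    "\<And>N::nat. \<exists>B>0. \<forall>x. cmod (U x) \<le> B * (1 + norm x) powr - real N"
    using test_bump[OF A] by blast
  obtain \<kappa> where \<kappa>: "0 < \<kappa>" "\<And>k (y::'a) f x c. 0 \<le> c \<Longrightarrow>
    (\<And>z. norm ((2 powr real_of_int k) *\<^sub>R z - y) \<le> \<delta> \<Longrightarrow> c \<le> cmod (f (x - z))) \<Longrightarrow>
    ennreal (c * \<kappa>) \<le> peetre t \<sigma> k y f x"
    using peetre_lower[OF t \<sigma>, of \<delta>] U by (auto simp: less_imp_le)
  have U0: "U \<in> class_E A" using U(1)[of 0] by simp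
  have [measurable]: "U \<in> borel_measurable borel" by (rule U)
  obtain e :: 'a where e: "e \<in> Basis" using nonempty_Basis by blast
  let ?V = "unit_ball_vol (real DIM('a)) * \<delta> ^ DIM('a)"
  have V: "0 < ?V" using U by simp
  obtain X where X: "0 \<le> X" "(\<integral>\<^sup>+x. epow (ennreal (cmod (U x))) a \<partial>lborel) = ennreal X"
    using powr_decay_integral_finite[OF a(1) U(7)] by (cases "\<integral>\<^sup>+x. epow (ennreal (cmod (U x))) a \<partial>lborel") auto
  have "1 / a \<le> r + recip_exp q"
  proof (rule powr_growth)
    have "0 < ?V powr (1 / a)" unfolding powr_gt_zero using V by linarith
    then show "0 < c * \<kappa> * ?V powr (1 / a)" using U(3) \<kappa>(1) by (intro mult_pos_pos)
    fix N :: nat assume N: "1 \<le> N"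
    define y where "y = (2 ^ N) *\<^sub>R e"
    define J where "J = int ` {..<N}"
    have J: "finite J" "J \<noteq> {}" "card J = N" using N by (auto simp: J_def card_image lessThan_empty_iff)
    define f where "f k = (if k \<in> J then U else (\<lambda>_. 0))" for k
    define B where "B i = cball ((2 ^ (N - i)) *\<^sub>R e) \<delta>" for i
    have fE: "f k \<in> class_E (A * 2 powr real_of_int k)" for k
      unfolding f_def J_def using class_E_dyadic[OF A U0] class_E_zero by auto
    have low: "ennreal (c * \<kappa>) \<le> lq_norm q (\<lambda>k. peetre t \<sigma> k y (f k) x)" if i: "i < N" "x \<in> B i" for i x
    proof -
      have "ennreal (c * \<kappa>) \<le> peetre t \<sigma> (int i) y (f (int i)) x"
      proof (rule \<kappa>(2))
        fix z assume z: "norm ((2 powr real_of_int (int i)) *\<^sub>R z - y) \<le> \<delta>"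
        have "z - (2 ^ (N - i)) *\<^sub>R e = (2 powr - real_of_int (int i)) *\<^sub>R ((2 powr real_of_int (int i)) *\<^sub>R z - y)"
          unfolding y_def scaleR_diff_right dyadic_shift[OF less_imp_le[OF i(1)]] by (simp flip: powr_add)
        then have "norm (z - (2 ^ (N - i)) *\<^sub>R e) = 2 powr - real_of_int (int i) * norm ((2 powr real_of_int (int i)) *\<^sub>R z - y)"
          by (simp only: norm_scaleR) simp
        also have "\<dots> \<le> 1 * \<delta>" using z by (intro mult_mono) (auto simp: powr_le_one_le powr_minus_divide powr_realpow)
        finally have 1: "norm (z - (2 ^ (N - i)) *\<^sub>R e) \<le> \<delta>" by simp
        have "norm (x - (2 ^ (N - i)) *\<^sub>R e) \<le> \<delta>" using i by (simp add: B_def dist_norm norm_minus_commute)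
        with 1 have "norm (x - z) \<le> 2 * \<delta>"
          using norm_triangle_ineq4[of "x - (2 ^ (N - i)) *\<^sub>R e" "z - (2 ^ (N - i)) *\<^sub>R e"] by simp
        then show "c \<le> cmod (f (int i) (x - z))" using U(6) i by (simp add: f_def J_def)
      qed (use U in auto)
      also have "\<dots> \<le> lq_norm q (\<lambda>k. peetre t \<sigma> k y (f k) x)" by (rule lq_norm_ge_point[OF q])
      finally show ?thesis .
    qed
    \<comment> \<open>Different powers of two that are integers are at distance at least 1, more
      than 2 \<delta> \<le> 1/2.\<close>
    have disj: "disjoint_family_on B {..<N}"
      unfolding disjoint_family_on_def
    proof (intro ballI impI)
      fix i j assume ij: "i \<in> {..<N}" "j \<in> {..<N}" "i \<noteq> j"
      have gap: "1 \<le> \<bar>(2::real) ^ m - 2 ^ n\<bar>" if "m \<noteq> n" for m n :: nat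
      proof -
        have "(2::real) ^ m = of_int (2 ^ m)" "(2::real) ^ n = of_int (2 ^ n)" by simp_all
        moreover have "(2::int) ^ m \<noteq> 2 ^ n" using that by simp
        then have "1 \<le> \<bar>(2::int) ^ m - 2 ^ n\<bar>" by linarith
        then have "1 \<le> real_of_int \<bar>(2::int) ^ m - 2 ^ n\<bar>" by linarith
        ultimately show ?thesis by simp
      qed
      have "1 \<le> norm ((2 ^ (N - i)) *\<^sub>R e - (2 ^ (N - j)) *\<^sub>R e)"
        using gap[of "N - i" "N - j"] ij e by (simp add: scaleR_left_diff_distrib[symmetric])
      then have "\<delta> + \<delta> < dist ((2 ^ (N - i)) *\<^sub>R e) ((2 ^ (N - j)) *\<^sub>R e)" using U(5) by (simp add: dist_norm)
      then show "B i \<inter> B j = {}" unfolding B_def by (rule disjoint_cballI)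
    qed
    have "emeasure lborel (\<Union>i<N. B i) = (\<Sum>i<N. emeasure lborel (B i))"
    proof (intro sum_emeasure[symmetric] disj)
      show "B ` {..<N} \<subseteq> sets lborel" by (auto simp: B_def)
    qed simp
    also have "\<dots> = ennreal (real N * ?V)"
      using U(4) by (simp add: B_def emeasure_cball ennreal_of_nat_eq_real_of_nat flip: ennreal_mult)
    finally have em: "emeasure lborel (\<Union>i<N. B i) = ennreal (real N * ?V)" .
    have "ennreal (c * \<kappa> * ?V powr (1 / a) * real N powr (1 / a)) = epow (epow (ennreal (c * \<kappa>)) a * ennreal (real N * ?V)) (1 / a)"
      using a U(3,4) \<kappa>(1) V by (simp add: epow_mult epow_epow epow_ennreal powr_mult powr_powr mult_ac flip: ennreal_mult)
    also have "epow (ennreal (c * \<kappa>)) a * ennreal (real N * ?V) = (\<integral>\<^sup>+x. epow (ennreal (c * \<kappa>)) a * indicator (\<Union>i<N. B i) x \<partial>lborel)"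
      unfolding em[symmetric] by (rule nn_integral_cmult_indicator[symmetric]) (auto simp: B_def)
    also have "epow \<dots> (1 / a) \<le> Lp_lq_norm p q (\<lambda>k. peetre t \<sigma> k y (f k))"
      unfolding Lp_lq_norm_def a(2) Lp_norm_real[OF a(1)]
      using a low by (intro epow_mono nn_integral_mono) (auto simp: indicator_def intro!: epow_mono)
    also have "\<dots> \<le> ennreal (C * logfac y powr r) * Lp_lq_norm p q (\<lambda>k x. ennreal (cmod (f k x)))"
      using fE by (intro bound) auto
    also have "Lp_lq_norm p q (\<lambda>k x. ennreal (cmod (f k x))) = ennreal (real N powr recip_exp q * X powr (1 / a))"
    proof -
      have "lq_norm q (\<lambda>k. ennreal (cmod (f k x))) = ennreal (real N powr recip_exp q) * ennreal (cmod (U x))" for x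
      proof -
        have "(\<lambda>k. ennreal (cmod (f k x))) = (\<lambda>k. if k \<in> J then ennreal (cmod (U x)) else 0)" by (auto simp: f_def)
        then show ?thesis using lq_norm_const[OF q J(1,2), of "ennreal (cmod (U x))"] J(3) by simp
      qed
      then have "Lp_lq_norm p q (\<lambda>k x. ennreal (cmod (f k x))) = epow (epow (ennreal (real N powr recip_exp q)) a * ennreal X) (1 / a)"
        unfolding Lp_lq_norm_def a(2) Lp_norm_real[OF a(1)] X(2)[symmetric]
        by (simp add: epow_mult nn_integral_cmult)
      also have "\<dots> = ennreal (real N powr recip_exp q * X powr (1 / a))"
        using X a by (simp add: epow_mult epow_epow epow_ennreal powr_powr ennreal_mult)
      finally show ?thesis .
    qed
    also have "ennreal (C * logfac y powr r) * ennreal (real N powr recip_exp q * X powr (1 / a)) \<le> ennreal (\<bar>C\<bar> * (3 powr r * real N powr r)) * ennreal (real N powr recip_exp q * X powr (1 / a))"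
      using logfac_powr_le[OF e r N] unfolding y_def by (intro mult_right_mono ennreal_leI mult_mono) auto
    also have "\<dots> = ennreal ((\<bar>C\<bar> * 3 powr r * X powr (1 / a)) * real N powr (r + recip_exp q))"
      by (simp add: powr_add mult_ac flip: ennreal_mult)
    finally show "c * \<kappa> * ?V powr (1 / a) * real N powr (1 / a) \<le> (\<bar>C\<bar> * 3 powr r * X powr (1 / a)) * real N powr (r + recip_exp q)"
      by (subst (asm) ennreal_le_iff) auto
  qed
  then show ?thesis using a by (simp add: recip_exp_real)
qed

text \<open>Translating the bumps to the points \<open>-2\<^sup>N\<^sup>-\<^sup>i e\<close> makes their maximal functions all large near the origin.\<close>
lemma aligned_family:
  fixes t :: ennreal and e :: "'a::euclidean_space"
  assumes b: "0 < b" and t: "0 < t" and \<sigma>: "0 < \<sigma>" and A: "0 < A" and e: "e \<in> Basis"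
  obtains c \<delta> B Y and f :: "nat \<Rightarrow> int \<Rightarrow> 'a \<Rightarrow> complex" where
    "0 < c" "0 < \<delta>" "0 \<le> B" "0 \<le> Y" "\<forall>N k. f N k \<in> class_E (A * 2 powr real_of_int k)"
    "\<forall>N i x. i < N \<longrightarrow> norm x \<le> \<delta> \<longrightarrow> ennreal c \<le> peetre t \<sigma> (int i) ((2 ^ N) *\<^sub>R e) (f N (int i)) x"
    "\<forall>N x. (\<integral>\<^sup>+k. epow (ennreal (cmod (f N k x))) b \<partial>count_space UNIV) \<le> ennreal B"
    "\<forall>N. (\<integral>\<^sup>+x. \<integral>\<^sup>+k. epow (ennreal (cmod (f N k x))) b \<partial>count_space UNIV \<partial>lborel) = ennreal (real N * Y)"
proof -
  obtain U :: "'a \<Rightarrow> complex" and c \<delta> where U: "\<And>b. (\<lambda>x. U (x + b)) \<in> class_E A" "U \<in> borel_measurable borel"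
    "0 < c" "0 < \<delta>" "\<delta> \<le> 1 / 4" "\<And>x. norm x \<le> 2 * \<delta> \<Longrightarrow> c \<le> cmod (U x)"
    "\<And>N::nat. \<exists>B>0. \<forall>x. cmod (U x) \<le> B * (1 + norm x) powr - real N"
    using test_bump[OF A] by blast
  obtain \<kappa> where \<kappa>: "0 < \<kappa>" "\<And>k (y::'a) f x c. 0 \<le> c \<Longrightarrow>
    (\<And>z. norm ((2 powr real_of_int k) *\<^sub>R z - y) \<le> \<delta> \<Longrightarrow> c \<le> cmod (f (x - z))) \<Longrightarrow>
    ennreal (c * \<kappa>) \<le> peetre t \<sigma> k y f x"
    using peetre_lower[OF t \<sigma>, of \<delta>] U by (auto simp: less_imp_le)
  have [measurable]: "U \<in> borel_measurable borel" by (rule U)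
  obtain Y where Y: "0 \<le> Y" "(\<integral>\<^sup>+x. epow (ennreal (cmod (U x))) b \<partial>lborel) = ennreal Y"
    using powr_decay_integral_finite[OF b U(7)] by (cases "\<integral>\<^sup>+x. epow (ennreal (cmod (U x))) b \<partial>lborel") auto
  \<comment> \<open>This much decay gives |U|^b \<le> D^b / (1 + norm z), the form to which
    \<open>lacunary_sum\<close> applies, even for small b.\<close>
  obtain M :: nat where M: "1 / b \<le> real M" using real_arch_simple by blast
  obtain D where D: "0 < D" "\<And>x. cmod (U x) \<le> D * (1 + norm x) powr - real M" using U(7) by blast
  define f where "f N k = (if k \<in> int ` {..<N} then (\<lambda>x. U (x + (2 ^ (N - nat k)) *\<^sub>R e)) else (\<lambda>_. 0))" for N k
  have sum: "(\<integral>\<^sup>+k. epow (ennreal (cmod (f N k x))) b \<partial>count_space UNIV) = (\<Sum>i<N. epow (ennreal (cmod (U (x + (2 ^ (N - i)) *\<^sub>R e)))) b)" for N x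
  proof -
    have "(\<integral>\<^sup>+k. epow (ennreal (cmod (f N k x))) b \<partial>count_space UNIV) = (\<Sum>k\<in>int ` {..<N}. epow (ennreal (cmod (f N k x))) b)"
      by (rule nn_integral_count_space_finite) (auto simp: f_def)
    also have "\<dots> = (\<Sum>i<N. epow (ennreal (cmod (U (x + (2 ^ (N - i)) *\<^sub>R e)))) b)"
      by (subst sum.reindex) (auto simp: f_def inj_on_def)
    finally show ?thesis .
  qed
  show thesis
  proof (rule that[of "c * \<kappa>" \<delta> "5 * D powr b" Y f]; (intro allI impI)?)
    show "0 < c * \<kappa>" using U \<kappa> by simp
    show "f N k \<in> class_E (A * 2 powr real_of_int k)" for N k
      unfolding f_def using class_E_dyadic[OF A U(1)] class_E_zero by auto
    show "ennreal (c * \<kappa>) \<le> peetre t \<sigma> (int i) ((2 ^ N) *\<^sub>R e) (f N (int i)) x" if i: "i < N" "norm x \<le> \<delta>" for N i x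
    proof (rule \<kappa>(2))
      fix z assume z: "norm ((2 powr real_of_int (int i)) *\<^sub>R z - (2 ^ N) *\<^sub>R e) \<le> \<delta>"
      have "z - (2 ^ (N - i)) *\<^sub>R e = (2 powr - real_of_int (int i)) *\<^sub>R ((2 powr real_of_int (int i)) *\<^sub>R z - (2 ^ N) *\<^sub>R e)"
        unfolding scaleR_diff_right dyadic_shift[OF less_imp_le[OF i(1)]] by (simp flip: powr_add)
      then have "norm (z - (2 ^ (N - i)) *\<^sub>R e) = 2 powr - real_of_int (int i) * norm ((2 powr real_of_int (int i)) *\<^sub>R z - (2 ^ N) *\<^sub>R e)"
        by (simp only: norm_scaleR) simp
      also have "\<dots> \<le> 1 * \<delta>" using z by (intro mult_mono) (auto simp: powr_le_one_le powr_minus_divide powr_realpow)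
      finally have 1: "norm (z - (2 ^ (N - i)) *\<^sub>R e) \<le> \<delta>" by simp
      have eq: "x - z + (2 ^ (N - i)) *\<^sub>R e = x - (z - (2 ^ (N - i)) *\<^sub>R e)" by simp
      have "norm (x - z + (2 ^ (N - i)) *\<^sub>R e) \<le> 2 * \<delta>"
        unfolding eq using norm_triangle_ineq4[of x "z - (2 ^ (N - i)) *\<^sub>R e"] 1 i by linarith
      then show "c \<le> cmod (f N (int i) (x - z))" using U(6) i by (simp add: f_def)
    qed (use U in auto)
    show "(\<integral>\<^sup>+k. epow (ennreal (cmod (f N k x))) b \<partial>count_space UNIV) \<le> ennreal (5 * D powr b)" for N x
    proof -
      have "cmod (U z) powr b \<le> D powr b * (1 / (1 + norm z))" for z
      proof -
        have "cmod (U z) powr b \<le> (D * (1 + norm z) powr - real M) powr b" using b D by (intro powr_mono2) auto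
        also have "\<dots> = D powr b * (1 + norm z) powr - (real M * b)" by (simp add: powr_mult powr_powr)
        also have "\<dots> \<le> D powr b * (1 + norm z) powr - 1"
          using M b by (intro mult_left_mono powr_mono) (auto simp: field_simps)
        finally show ?thesis by (simp add: powr_minus_divide)
      qed
      then have "(\<Sum>i<N. cmod (U (x + (2 ^ (N - i)) *\<^sub>R e)) powr b) \<le> (\<Sum>i<N. D powr b * (1 / (1 + norm (x + (2 ^ (N - i)) *\<^sub>R e))))"
        by (intro sum_mono)
      also have "\<dots> = D powr b * (\<Sum>i<N. 1 / (1 + norm (x + (2 ^ (N - i)) *\<^sub>R e)))" by (simp only: sum_distrib_left)
      also have "\<dots> \<le> D powr b * 5" by (intro mult_left_mono lacunary_sum e) auto
      finally show ?thesis unfolding sum by (simp add: epow_ennreal mult.commute sum_ennreal ennreal_leI)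
    qed
    show "(\<integral>\<^sup>+x. \<integral>\<^sup>+k. epow (ennreal (cmod (f N k x))) b \<partial>count_space UNIV \<partial>lborel) = ennreal (real N * Y)" for N
    proof -
      have "(\<integral>\<^sup>+x. epow (ennreal (cmod (U (x + v)))) b \<partial>lborel) = ennreal Y" for v
        using nn_integral_lborel_affine[of "\<lambda>x. epow (ennreal (cmod (U x))) b" 1 v] Y by (simp add: add.commute)
      then show ?thesis unfolding sum using Y by (subst nn_integral_sum) (auto simp: ennreal_of_nat_eq_real_of_nat ennreal_mult)
    qed
  qed (use U Y D in auto)
qed

text \<open>On a fixed ball at the origin all N maximal functions are bounded below, so the output
  norm is at least a multiple of N^(1/q). The sum of the |f_k|^q is bounded uniformly in N and has
  integral N Y, and for p \<ge> q this keeps the input norm below a multiple of N^(1/p).\<close>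

lemma necessity_align:
  fixes p q t :: ennreal
  assumes p: "0 < p" "p < \<infinity>" and q: "0 < q" "q < \<infinity>" and qp: "q \<le> p" and t: "0 < t" and \<sigma>: "0 < \<sigma>" and A: "0 < A" and r: "0 \<le> r"
    and bound: "\<And>(y::'a::euclidean_space) f. (\<forall>k. f k \<in> class_E (A * 2 powr real_of_int k)) \<Longrightarrow>
       Lp_lq_norm p q (\<lambda>k. peetre t \<sigma> k y (f k))
         \<le> ennreal (C * logfac y powr r) * Lp_lq_norm p q (\<lambda>k x. ennreal (cmod (f k x)))"
  shows "recip_exp q - recip_exp p \<le> r"
proof -
  obtain a where a: "0 < a" "p = ennreal a" using p epow_pos_real[of p] by auto
  obtain b where b: "0 < b" "q = ennreal b" using q epow_pos_real[of q] by auto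
  have ba: "b \<le> a" using qp a b by simp
  obtain e :: 'a where e: "e \<in> Basis" using nonempty_Basis by blast
  obtain c \<delta> B Y f where f0:
    "0 < c" "0 < \<delta>" "0 \<le> B" "0 \<le> Y" "\<forall>N k. f N k \<in> class_E (A * 2 powr real_of_int k)"
    "\<forall>N i x. i < N \<longrightarrow> norm x \<le> \<delta> \<longrightarrow> ennreal c \<le> peetre t \<sigma> (int i) ((2 ^ N) *\<^sub>R e) (f N (int i)) x"
    "\<forall>N x. (\<integral>\<^sup>+k. epow (ennreal (cmod (f N k x))) b \<partial>count_space UNIV) \<le> ennreal B"
    "\<forall>N. (\<integral>\<^sup>+x. \<integral>\<^sup>+k. epow (ennreal (cmod (f N k x))) b \<partial>count_space UNIV \<partial>lborel) = ennreal (real N * Y)"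
    by (rule aligned_family[OF b(1) t \<sigma> A e])
  note f = f0[rule_format]
  have [measurable]: "f N k \<in> borel_measurable borel" for N k
    using class_E_measurable[OF f(5)] .
  let ?V = "unit_ball_vol (real DIM('a)) * \<delta> ^ DIM('a)"
  have V: "0 < ?V" using f by simp
  have "1 / b \<le> r + 1 / a"
  proof (rule powr_growth)
    have "0 < ?V powr (1 / a)" unfolding powr_gt_zero using V by linarith
    then show "0 < c * ?V powr (1 / a)" using f(1) by (intro mult_pos_pos)
    fix N :: nat assume N: "1 \<le> N"
    define y where "y = (2 ^ N) *\<^sub>R e"
    define J where "J = int ` {..<N}"
    have J: "finite J" "J \<noteq> {}" "card J = N" using N by (auto simp: J_def card_image lessThan_empty_iff)
    have low: "ennreal (real N powr (1 / b)) * ennreal c \<le> lq_norm q (\<lambda>k. peetre t \<sigma> k y (f N k) x)" if "norm x \<le> \<delta>" for x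
      using lq_norm_ge[OF q(1) J(1,2), of "ennreal c" "\<lambda>k. peetre t \<sigma> k y (f N k) x"] f(6) that b J(3)
      by (auto simp: J_def y_def recip_exp_real)
    have "ennreal (c * ?V powr (1 / a) * real N powr (1 / b)) = epow (epow (ennreal (real N powr (1 / b)) * ennreal c) a * ennreal ?V) (1 / a)"
    proof -
      have "epow (epow Z a * ennreal ?V) (1 / a) = Z * ennreal (?V powr (1 / a))" for Z
        using a(1) V by (simp only: epow_mult epow_epow) (simp add: epow_ennreal)
      note eq = this
      show ?thesis unfolding eq using f(1) by (simp add: mult_ac flip: ennreal_mult)
    qed
    also have "epow (ennreal (real N powr (1 / b)) * ennreal c) a * ennreal ?V = (\<integral>\<^sup>+x. epow (ennreal (real N powr (1 / b)) * ennreal c) a * indicator (cball (0::'a) \<delta>) x \<partial>lborel)"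
      using f by (subst nn_integral_cmult_indicator) (auto simp: emeasure_cball)
    also have "epow \<dots> (1 / a) \<le> Lp_lq_norm p q (\<lambda>k. peetre t \<sigma> k y (f N k))"
      unfolding Lp_lq_norm_def a(2) Lp_norm_real[OF a(1)]
      using a low by (intro epow_mono nn_integral_mono) (auto simp: indicator_def intro!: epow_mono)
    also have "\<dots> \<le> ennreal (C * logfac y powr r) * Lp_lq_norm p q (\<lambda>k x. ennreal (cmod (f N k x)))"
      using f(5) by (intro bound) auto
    also have "\<dots> \<le> ennreal (\<bar>C\<bar> * (3 powr r * real N powr r)) * ennreal (B powr ((a / b - 1) / a) * (real N * Y) powr (1 / a))"
    proof (intro mult_mono)
      show "ennreal (C * logfac y powr r) \<le> ennreal (\<bar>C\<bar> * (3 powr r * real N powr r))"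
        using logfac_powr_le[OF e r N] unfolding y_def by (intro ennreal_leI mult_mono) auto
      let ?G = "\<lambda>x. \<integral>\<^sup>+k. epow (ennreal (cmod (f N k x))) b \<partial>count_space UNIV"
      have "Lp_lq_norm p q (\<lambda>k x. ennreal (cmod (f N k x))) = epow (\<integral>\<^sup>+x. epow (?G x) (a / b) \<partial>lborel) (1 / a)"
        using b unfolding Lp_lq_norm_def a(2) Lp_norm_real[OF a(1)] by (simp add: lq_norm_def epow_epow)
      \<comment> \<open>Because a/b - 1 \<ge> 0, this power of the sum may be bounded pointwise, and
        only the first power is integrated.\<close>
      also have "\<dots> \<le> epow (\<integral>\<^sup>+x. ennreal (B powr (a / b - 1)) * ?G x \<partial>lborel) (1 / a)"
      proof (intro epow_mono nn_integral_mono)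
        fix x
        have "epow (?G x) (a / b) = epow (?G x) (a / b - 1) * ?G x" using epow_add[of "?G x" "a / b - 1" 1] by simp
        also have "\<dots> \<le> epow (ennreal B) (a / b - 1) * ?G x"
          using ba b by (intro mult_right_mono epow_mono f) (auto simp: field_simps)
        finally show "epow (?G x) (a / b) \<le> ennreal (B powr (a / b - 1)) * ?G x" using f by (simp add: epow_ennreal)
      qed (use a in auto)
      also have "\<dots> = epow (ennreal (B powr (a / b - 1)) * ennreal (real N * Y)) (1 / a)"
        unfolding f(8)[symmetric] by (subst nn_integral_cmult) auto
      also have "\<dots> = ennreal (B powr ((a / b - 1) / a) * (real N * Y) powr (1 / a))"
        using f by (simp add: epow_mult epow_ennreal powr_powr powr_mult ennreal_mult)
      finally show "Lp_lq_norm p q (\<lambda>k x. ennreal (cmod (f N k x))) \<le> ennreal (B powr ((a / b - 1) / a) * (real N * Y) powr (1 / a))" .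
    qed auto
    also have "\<dots> = ennreal ((\<bar>C\<bar> * 3 powr r * B powr ((a / b - 1) / a) * Y powr (1 / a)) * real N powr (r + 1 / a))"
      by (simp add: powr_add powr_mult mult_ac flip: ennreal_mult)
    finally show "c * ?V powr (1 / a) * real N powr (1 / b) \<le> (\<bar>C\<bar> * 3 powr r * B powr ((a / b - 1) / a) * Y powr (1 / a)) * real N powr (r + 1 / a)"
      by (subst (asm) ennreal_le_iff) auto
  qed
  then show ?thesis using a b by (simp add: recip_exp_real)
qed

text \<open>The aligned family again. Its input norm is bounded because the sum over all scales is
  bounded pointwise. The unit cube counts all scales k \<ge> 0, and on the part of it near the
  origin the sum of the maximal functions is at least a multiple of N.\<close>

lemma necessity_dyadic:
  fixes q t :: ennreal
  assumes q: "0 < q" "q < \<infinity>" and t: "0 < t" and \<sigma>: "0 < \<sigma>" and A: "0 < A" and r: "0 \<le> r"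
    and bound: "\<And>(y::'a::euclidean_space) f. (\<forall>k. f k \<in> class_E (A * 2 powr real_of_int k)) \<Longrightarrow>
       dyadic_sup_norm q (\<lambda>k. peetre t \<sigma> k y (f k))
         \<le> ennreal (C * logfac y powr r) * dyadic_sup_norm q (\<lambda>k x. ennreal (cmod (f k x)))"
  shows "recip_exp q \<le> r"
proof -
  obtain b where b: "0 < b" "q = ennreal b" using q epow_pos_real[of q] by auto
  obtain e :: 'a where e: "e \<in> Basis" using nonempty_Basis by blast
  obtain c \<delta> B Y f where f0:
    "0 < c" "0 < \<delta>" "0 \<le> B" "0 \<le> Y" "\<forall>N k. f N k \<in> class_E (A * 2 powr real_of_int k)"
    "\<forall>N i x. i < N \<longrightarrow> norm x \<le> \<delta> \<longrightarrow> ennreal c \<le> peetre t \<sigma> (int i) ((2 ^ N) *\<^sub>R e) (f N (int i)) x"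
    "\<forall>N x. (\<integral>\<^sup>+k. epow (ennreal (cmod (f N k x))) b \<partial>count_space UNIV) \<le> ennreal B"
    "\<forall>N. (\<integral>\<^sup>+x. \<integral>\<^sup>+k. epow (ennreal (cmod (f N k x))) b \<partial>count_space UNIV \<partial>lborel) = ennreal (real N * Y)"
    by (rule aligned_family[OF b(1) t \<sigma> A e])
  note f = f0[rule_format]
  \<comment> \<open>The origin is a corner of the unit cube, so a subcube of side 2^-m at that
    corner, with n 2^-m < \<delta>, serves as the region where the lower bounds hold.\<close>
  obtain m :: nat where m: "real DIM('a) / \<delta> < 2 ^ m" using real_arch_pow[of 2 "real DIM('a) / \<delta>"] by auto
  define P0 :: "'a set" where "P0 = dyadic_cube 0 (\<lambda>_. 0)"
  define Q :: "'a set" where "Q = dyadic_cube (int m) (\<lambda>_. 0)"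
  have Q_coord: "0 \<le> x \<bullet> i \<and> x \<bullet> i < 1 / 2 ^ m" if "x \<in> Q" "i \<in> Basis" for x i
    using that by (auto simp: Q_def dyadic_cube_def powr_minus_divide powr_realpow)
  have Q_P0: "Q \<subseteq> P0"
  proof
    fix x assume x: "x \<in> Q"
    have "1 / 2 ^ m \<le> (1::real)" by simp
    then have "0 \<le> x \<bullet> i \<and> x \<bullet> i < 1" if "i \<in> Basis" for i
      using Q_coord[OF x that] by linarith
    then show "x \<in> P0" by (simp add: P0_def dyadic_cube_def)
  qed
  have Q_ball: "norm x \<le> \<delta>" if x: "x \<in> Q" for x
  proof -
    have "norm x \<le> (\<Sum>i\<in>Basis. \<bar>x \<bullet> i\<bar>)" by (rule norm_le_l1)
    also have "\<dots> \<le> (\<Sum>i\<in>(Basis::'a set). 1 / 2 ^ m)" using Q_coord[OF x] by (intro sum_mono) (auto simp: less_imp_le)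
    also have "\<dots> \<le> \<delta>" using m f(2) by (simp add: field_simps)
    finally show ?thesis .
  qed
  define w where "w = 2 powr - (real_of_int (int m) * real DIM('a))"
  have w: "0 < w" "emeasure lborel Q = ennreal w" by (simp_all add: w_def Q_def emeasure_dyadic_cube)
  have [measurable]: "Q \<in> sets borel" "P0 \<in> sets borel" by (simp_all add: Q_def P0_def)
  have "1 / b \<le> r"
  proof (rule powr_growth)
    show "0 < c * w powr (1 / b)" using f(1) w(1) by simp
    fix N :: nat assume N: "1 \<le> N"
    define y where "y = (2 ^ N) *\<^sub>R e"
    let ?S = "\<lambda>F s x. \<integral>\<^sup>+ k. indicator {k. 2 powr real_of_int k * s \<ge> 1} k * epow (F k x) b \<partial>count_space UNIV :: ennreal"
    have low: "ennreal (real N * c powr b) \<le> ?S (\<lambda>k. peetre t \<sigma> k y (f N k)) 1 x" if "norm x \<le> \<delta>" for x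
    proof -
      have "ennreal (real N * c powr b) = (\<Sum>k\<in>int ` {..<N}. ennreal (c powr b))"
        by (simp add: card_image ennreal_of_nat_eq_real_of_nat ennreal_mult)
      also have "\<dots> = (\<integral>\<^sup>+k. (if k \<in> int ` {..<N} then ennreal (c powr b) else 0) \<partial>count_space UNIV)"
        by (subst nn_integral_count_space_finite[of "int ` {..<N}"]) auto
      also have "\<dots> \<le> ?S (\<lambda>k. peetre t \<sigma> k y (f N k)) 1 x"
      proof (rule nn_integral_mono)
        fix k :: int
        show "(if k \<in> int ` {..<N} then ennreal (c powr b) else 0) \<le> indicator {k. 2 powr real_of_int k * 1 \<ge> 1} k * epow (peetre t \<sigma> k y (f N k) x) b"
        proof (cases "k \<in> int ` {..<N}")
          case True
          then obtain i where i: "k = int i" "i < N" by auto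
          have "epow (ennreal c) b \<le> epow (peetre t \<sigma> k y (f N k) x) b"
            using f(6)[OF i(2) that] b i by (intro epow_mono) (auto simp: y_def)
          moreover have "1 \<le> 2 powr real_of_int k" using i by (simp add: powr_realpow)
          ultimately show ?thesis using True f by (simp add: epow_ennreal)
        qed simp
      qed
      finally show ?thesis .
    qed
    have "ennreal (c * w powr (1 / b) * real N powr (1 / b)) = epow (ennreal (real N * c powr b) * ennreal w) (1 / b)"
      using b f w by (simp add: epow_mult epow_ennreal powr_mult powr_powr mult_ac flip: ennreal_mult)
    also have "ennreal (real N * c powr b) * ennreal w = (\<integral>\<^sup>+x. ennreal (real N * c powr b) * indicator Q x \<partial>lborel)"
      unfolding w(2)[symmetric] by (rule nn_integral_cmult_indicator[symmetric]) simp
    also have "epow \<dots> (1 / b) \<le> epow (ennreal (1 / measure lborel P0) * (\<integral>\<^sup>+x. indicator P0 x * ?S (\<lambda>k. peetre t \<sigma> k y (f N k)) (side_len P0) x \<partial>lborel)) (1 / b)"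
    proof (intro epow_mono)
      have "measure lborel P0 = 1" "side_len P0 = 1" by (simp_all add: P0_def measure_dyadic_cube side_len_dyadic_cube)
      then show "(\<integral>\<^sup>+x. ennreal (real N * c powr b) * indicator Q x \<partial>lborel) \<le> ennreal (1 / measure lborel P0) * (\<integral>\<^sup>+x. indicator P0 x * ?S (\<lambda>k. peetre t \<sigma> k y (f N k)) (side_len P0) x \<partial>lborel)"
        using low Q_ball Q_P0 by (auto simp: indicator_def intro!: nn_integral_mono)
    qed (use b in auto)
    also have "\<dots> \<le> dyadic_sup_norm q (\<lambda>k. peetre t \<sigma> k y (f N k))"
      unfolding dyadic_sup_norm_def using b
      by (intro SUP_upper2[of P0]) (auto simp: P0_def dyadic_cubes_def)
    also have "\<dots> \<le> ennreal (C * logfac y powr r) * dyadic_sup_norm q (\<lambda>k x. ennreal (cmod (f N k x)))"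
      using f(5) by (intro bound) auto
    also have "\<dots> \<le> ennreal (\<bar>C\<bar> * (3 powr r * real N powr r)) * ennreal (B powr (1 / b))"
    proof (intro mult_mono)
      show "ennreal (C * logfac y powr r) \<le> ennreal (\<bar>C\<bar> * (3 powr r * real N powr r))"
        using logfac_powr_le[OF e r N] unfolding y_def by (intro ennreal_leI mult_mono) auto
      show "dyadic_sup_norm q (\<lambda>k x. ennreal (cmod (f N k x))) \<le> ennreal (B powr (1 / b))"
        unfolding dyadic_sup_norm_def
      proof (rule SUP_least)
        fix P :: "'a set" assume "P \<in> dyadic_cubes"
        then obtain j l where P: "P = dyadic_cube j l" by (auto simp: dyadic_cubes_def)
        define v where "v = 2 powr - (real_of_int j * real DIM('a))"
        have v: "0 < v" "measure lborel P = v" "emeasure lborel P = ennreal v"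
          by (simp_all add: v_def P measure_dyadic_cube emeasure_dyadic_cube)
        have [measurable]: "P \<in> sets borel" by (simp add: P)
        have "(\<integral>\<^sup>+x. indicator P x * ?S (\<lambda>k x. ennreal (cmod (f N k x))) (side_len P) x \<partial>lborel) \<le> (\<integral>\<^sup>+x. ennreal B * indicator P x \<partial>lborel)"
        proof (rule nn_integral_mono)
          fix x
          have "?S (\<lambda>k x. ennreal (cmod (f N k x))) (side_len P) x \<le> (\<integral>\<^sup>+k. epow (ennreal (cmod (f N k x))) b \<partial>count_space UNIV)"
            by (intro nn_integral_mono) (auto simp: indicator_def)
          also have "\<dots> \<le> ennreal B" by (rule f)
          finally show "indicator P x * ?S (\<lambda>k x. ennreal (cmod (f N k x))) (side_len P) x \<le> ennreal B * indicator P x"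
            by (auto simp: indicator_def)
        qed
        also have "\<dots> = ennreal B * ennreal v" unfolding v(3)[symmetric] by (rule nn_integral_cmult_indicator) simp
        finally have "ennreal (1 / v) * (\<integral>\<^sup>+x. indicator P x * ?S (\<lambda>k x. ennreal (cmod (f N k x))) (side_len P) x \<partial>lborel) \<le> ennreal (1 / v) * (ennreal B * ennreal v)"
          by (intro mult_left_mono) auto
        also have "\<dots> = ennreal B" using v f by (simp flip: ennreal_mult)
        finally have "epow (ennreal (1 / measure lborel P) * (\<integral>\<^sup>+x. indicator P x * ?S (\<lambda>k x. ennreal (cmod (f N k x))) (side_len P) x \<partial>lborel)) (1 / b) \<le> epow (ennreal B) (1 / b)"
          unfolding v(2) using b by (intro epow_mono) auto
        then show "epow (ennreal (1 / measure lborel P) * (\<integral>\<^sup>+x. indicator P x * (\<integral>\<^sup>+ k. indicator {k. 2 powr real_of_int k * side_len P \<ge> 1} k *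
           epow (ennreal (cmod (f N k x))) (enn2real q) \<partial>count_space UNIV) \<partial>lborel)) (1 / enn2real q) \<le> ennreal (B powr (1 / b))"
          using b f by (simp add: epow_ennreal)
      qed
    qed auto
    also have "\<dots> = ennreal ((\<bar>C\<bar> * 3 powr r * B powr (1 / b)) * real N powr r)"
      by (simp add: mult_ac flip: ennreal_mult)
    finally show "c * w powr (1 / b) * real N powr (1 / b) \<le> (\<bar>C\<bar> * 3 powr r * B powr (1 / b)) * real N powr r"
      by (subst (asm) ennreal_le_iff) auto
  qed
  then show ?thesis using b by (simp add: recip_exp_real)
qed

section \<open>The upper bounds\<close>

lemma less_of_recip_exp:
  assumes "0 < p" "0 < s" "recip_exp p < 1 / s"
  shows "ennreal s < p"
proof (cases "p = \<infinity>")
  case False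
  then obtain a where a: "0 < a" "p = ennreal a" using assms(1) epow_pos_real[of p] by auto
  then have "1 / a < 1 / s" using assms(3) by (simp add: recip_exp_def)
  then have "s < a" using a assms(2) by (simp add: field_simps)
  then show ?thesis using a assms(2) by (simp add: ennreal_less_iff)
qed simp

lemma exponent_choice:
  assumes "real DIM('a::euclidean_space) * max (recip_exp p) (max (recip_exp q) (recip_exp t)) < \<sigma>" "0 < p" "0 < q" "0 < t"
  obtains s where "0 < s" "0 < \<sigma>" "real DIM('a) < \<sigma> * s" "ennreal s < p" "ennreal s < q" "ennreal s < t"
proof -
  let ?n = "real DIM('a)"
  define M where "M = max (recip_exp p) (max (recip_exp q) (recip_exp t))"
  have n: "0 < ?n" by simp
  have r0: "0 \<le> recip_exp x" for x by (simp add: recip_exp_def)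
  then have M: "0 \<le> M" by (simp add: M_def le_max_iff_disj)
  define w where "w = \<sigma> / ?n"
  have Mw: "M < w" using assms(1) n unfolding M_def[symmetric] w_def by (simp add: field_simps)
  then have w: "0 < w" using M by linarith
  then have \<sigma>: "0 < \<sigma>" using n by (simp add: w_def zero_less_divide_iff)
  \<comment> \<open>1/s is the midpoint between M and \<sigma> / n, so both strict inequalities
    hold.\<close>
  define s where "s = 2 / (M + w)"
  have s: "0 < s" using M w by (simp add: s_def)
  have inv: "1 / s = (M + w) / 2" by (simp add: s_def)
  have "1 / s < w" using Mw unfolding inv by (simp add: field_simps)
  then have "?n < \<sigma> * s" using s n by (simp add: w_def field_simps)
  moreover have "M < 1 / s" using Mw unfolding inv by (simp add: field_simps)
  then have "recip_exp p < 1 / s" "recip_exp q < 1 / s" "recip_exp t < 1 / s" by (auto simp: M_def)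
  ultimately show thesis using s \<sigma> assms by (intro that[of s] less_of_recip_exp) auto
qed

text \<open>For Q < P Jensen's inequality moves the power Q inside the averages, which leaves a
  plain sum of averages in the norm of exponent P/Q > 1, the case settled by duality. On the
  diagonal the scales decouple, and no logarithm appears.\<close>

lemma vector_shiftavg:
  assumes L: "real DIM('a::euclidean_space) < L" and P: "1 < P" and Q: "1 < Q"
  obtains K where "0 < K" "\<forall>(y::'a) g. (\<forall>k::int. g k \<in> borel_measurable borel) \<longrightarrow>
     (\<integral>\<^sup>+x. epow (\<integral>\<^sup>+k. epow (shiftavg L k y (g k) x) Q \<partial>count_space UNIV) (P / Q) \<partial>lborel)
       \<le> ennreal (K * logfac y powr (P * \<bar>1 / P - 1 / Q\<bar>)) * (\<integral>\<^sup>+x. epow (\<integral>\<^sup>+k. epow (g k x) Q \<partial>count_space UNIV) (P / Q) \<partial>lborel)"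
proof -
  consider "P < Q" | "P = Q" | "Q < P" by linarith
  then show thesis
  proof cases
    case 1
    then have "1 / Q < 1 / P" using P Q by (intro divide_strict_left_mono) auto
    then have "P * \<bar>1 / P - 1 / Q\<bar> = 1 - P / Q" using P Q by (simp add: field_simps)
    with vector_shiftavg_lt[OF L P 1] that show ?thesis by auto
  next
    case 2
    obtain C where C: "0 < C" and lp: "\<And>(y::'a) k g. g \<in> borel_measurable borel \<Longrightarrow>
       (\<integral>\<^sup>+x. epow (shiftavg L k y g x) P \<partial>lborel) \<le> ennreal C * (\<integral>\<^sup>+x. epow (g x) P \<partial>lborel)"
      using shiftavg_Lp[OF L, of P] P by auto
    show ?thesis
    proof (rule that[OF C], intro allI impI)
      fix y :: 'a and g :: "int \<Rightarrow> 'a \<Rightarrow> ennreal" assume "\<forall>k. g k \<in> borel_measurable borel"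
      then have [measurable]: "g k \<in> borel_measurable borel" for k by blast
      have "(\<integral>\<^sup>+x. (\<integral>\<^sup>+k. epow (shiftavg L k y (g k) x) P \<partial>count_space UNIV) \<partial>lborel) = (\<integral>\<^sup>+k. \<integral>\<^sup>+x. epow (shiftavg L k y (g k) x) P \<partial>lborel \<partial>count_space UNIV)"
        by (intro nn_integral_count_space_nn_integral) auto
      also have "\<dots> \<le> (\<integral>\<^sup>+k. ennreal C * (\<integral>\<^sup>+x. epow (g k x) P \<partial>lborel) \<partial>count_space UNIV)"
        by (rule nn_integral_mono) (rule lp, measurable)
      also have "\<dots> = ennreal C * (\<integral>\<^sup>+k. \<integral>\<^sup>+x. epow (g k x) P \<partial>lborel \<partial>count_space UNIV)"
        by (rule nn_integral_cmult) auto
      also have "(\<integral>\<^sup>+k. \<integral>\<^sup>+x. epow (g k x) P \<partial>lborel \<partial>count_space UNIV) = (\<integral>\<^sup>+x. \<integral>\<^sup>+k. epow (g k x) P \<partial>count_space UNIV \<partial>lborel)"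
        by (intro nn_integral_count_space_nn_integral[symmetric]) auto
      finally show "(\<integral>\<^sup>+x. epow (\<integral>\<^sup>+k. epow (shiftavg L k y (g k) x) Q \<partial>count_space UNIV) (P / Q) \<partial>lborel)
       \<le> ennreal (C * logfac y powr (P * \<bar>1 / P - 1 / Q\<bar>)) * (\<integral>\<^sup>+x. epow (\<integral>\<^sup>+k. epow (g k x) Q \<partial>count_space UNIV) (P / Q) \<partial>lborel)"
        using 2 P logfac_ge_1[of y] by simp
    qed
  next
    case 3
    define u where "u = P / Q"
    have u: "1 < u" using 3 Q by (simp add: u_def)
    obtain m where m: "0 < m" "kmass TYPE('a) L = ennreal m" using kmass_real[OF L] .
    define c where "c = 2 powr Q * m powr (Q - 1)"
    have c: "0 < c" using m by (simp add: c_def)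
    obtain C where C: "0 < C" and gt: "\<And>(y::'a) h. (\<forall>k::int. h k \<in> borel_measurable borel) \<Longrightarrow>
     (\<integral>\<^sup>+x. epow (\<integral>\<^sup>+k. shiftavg L k y (h k) x \<partial>count_space UNIV) u \<partial>lborel)
       \<le> ennreal (C * logfac y powr (u - 1)) * (\<integral>\<^sup>+x. epow (\<integral>\<^sup>+k. h k x \<partial>count_space UNIV) u \<partial>lborel)"
      using vector_shiftavg_gt[OF L u] by blast
    have "1 / P < 1 / Q" using 3 Q by (intro divide_strict_left_mono) auto
    then have ex: "P * \<bar>1 / P - 1 / Q\<bar> = u - 1" using P Q by (simp add: u_def field_simps)
    show ?thesis
    proof (rule that[of "c powr u * C"], goal_cases)
      case 1
      show ?case using c C by simp
    next
      case 2
      show ?case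
      proof (intro allI impI)
        fix y :: 'a and g :: "int \<Rightarrow> 'a \<Rightarrow> ennreal" assume "\<forall>k. g k \<in> borel_measurable borel"
        then have [measurable]: "g k \<in> borel_measurable borel" for k by blast
        have J: "epow (shiftavg L k y (g k) x) Q \<le> ennreal c * shiftavg L k y (\<lambda>v. epow (g k v) Q) x" for k x
          using shiftavg_Jensen[of "g k" Q L k y x] Q m epow_ennreal[of 2 Q]
          by (simp add: c_def epow_ennreal ennreal_mult mult.assoc)
        have "(\<integral>\<^sup>+x. epow (\<integral>\<^sup>+k. epow (shiftavg L k y (g k) x) Q \<partial>count_space UNIV) u \<partial>lborel)
          \<le> (\<integral>\<^sup>+x. epow (\<integral>\<^sup>+k. ennreal c * shiftavg L k y (\<lambda>v. epow (g k v) Q) x \<partial>count_space UNIV) u \<partial>lborel)"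
          using u by (intro nn_integral_mono epow_mono J) auto
        also have "\<dots> = ennreal (c powr u) * (\<integral>\<^sup>+x. epow (\<integral>\<^sup>+k. shiftavg L k y (\<lambda>v. epow (g k v) Q) x \<partial>count_space UNIV) u \<partial>lborel)"
          using c by (simp add: nn_integral_cmult epow_mult epow_ennreal)
        also have "\<dots> \<le> ennreal (c powr u) * (ennreal (C * logfac y powr (u - 1)) * (\<integral>\<^sup>+x. epow (\<integral>\<^sup>+k. epow (g k x) Q \<partial>count_space UNIV) u \<partial>lborel))"
          by (intro mult_left_mono gt) auto
        also have "\<dots> = ennreal (c powr u * C * logfac y powr (u - 1)) * (\<integral>\<^sup>+x. epow (\<integral>\<^sup>+k. epow (g k x) Q \<partial>count_space UNIV) u \<partial>lborel)"
          using c C by (simp add: ennreal_mult mult.assoc)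
        finally show "(\<integral>\<^sup>+x. epow (\<integral>\<^sup>+k. epow (shiftavg L k y (g k) x) Q \<partial>count_space UNIV) (P / Q) \<partial>lborel)
         \<le> ennreal (c powr u * C * logfac y powr (P * \<bar>1 / P - 1 / Q\<bar>)) * (\<integral>\<^sup>+x. epow (\<integral>\<^sup>+k. epow (g k x) Q \<partial>count_space UNIV) (P / Q) \<partial>lborel)"
          unfolding ex u_def .
      qed
    qed
  qed
qed

lemma logfac_powr_bound:
  assumes "0 \<le> C" "\<theta> \<le> r"
  shows "ennreal (C * logfac y powr \<theta>) \<le> ennreal (C * logfac y powr r)"
  using assms logfac_ge_1[of y] by (intro ennreal_leI mult_left_mono powr_mono) auto

text \<open>The vector-valued inequality is applied to |f_k|^s with exponents a/s and b/s. Since P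
  |1/P - 1/Q| = a |1/a - 1/b|, the power 1/a taken at the end leaves |1/a - 1/b| on the logarithm,
  whatever s was.\<close>

lemma sufficiency_finite:
  assumes A: "0 < A" and s: "0 < s" and \<sigma>: "0 < \<sigma>" and L: "real DIM('a::euclidean_space) < \<sigma> * s" and st: "ennreal s < t"
    and a: "s < a" and b: "s < b" and r: "\<bar>1 / a - 1 / b\<bar> \<le> r"
  shows "\<exists>C. \<forall>(y::'a) f. (\<forall>k. f k \<in> class_E (A * 2 powr real_of_int k)) \<longrightarrow>
     Lp_lq_norm (ennreal a) (ennreal b) (\<lambda>k. peetre t \<sigma> k y (f k))
       \<le> ennreal (C * logfac y powr r) * Lp_lq_norm (ennreal a) (ennreal b) (\<lambda>k x. ennreal (cmod (f k x)))"
proof -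
  obtain D where D: "1 \<le> D" and pe: "\<And>(y::'a) k f x. f \<in> class_E (A * 2 powr real_of_int k) \<Longrightarrow>
     peetre t \<sigma> k y f x \<le> epow (ennreal D * shiftavg (\<sigma> * s) k y (\<lambda>v. epow (ennreal (cmod (f v))) s) x) (1 / s)"
    using peetre_le_shiftavg[OF A s \<sigma> st, where 'a='a] by blast
  define P Q where "P = a / s" and "Q = b / s"
  have PQ: "1 < P" "1 < Q" "P / Q = a / b" using s a b by (auto simp: P_def Q_def)
  have a0: "0 < a" "0 < b" using s a b by auto
  obtain K where K: "0 < K" "\<forall>(y::'a) g. (\<forall>k::int. g k \<in> borel_measurable borel) \<longrightarrow>
     (\<integral>\<^sup>+x. epow (\<integral>\<^sup>+k. epow (shiftavg (\<sigma> * s) k y (g k) x) Q \<partial>count_space UNIV) (P / Q) \<partial>lborel)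
       \<le> ennreal (K * logfac y powr (P * \<bar>1 / P - 1 / Q\<bar>)) * (\<integral>\<^sup>+x. epow (\<integral>\<^sup>+k. epow (g k x) Q \<partial>count_space UNIV) (P / Q) \<partial>lborel)"
    by (rule vector_shiftavg[OF L PQ(1,2)])
  have "P * \<bar>1 / P - 1 / Q\<bar> = \<bar>P * (1 / P - 1 / Q)\<bar>" using PQ by (simp add: abs_mult)
  also have "P * (1 / P - 1 / Q) = a * (1 / a - 1 / b)" using s a0 by (simp add: P_def Q_def field_simps)
  also have "\<bar>a * (1 / a - 1 / b)\<bar> = a * \<bar>1 / a - 1 / b\<bar>" using a0 by (simp add: abs_mult)
  finally have ex: "P * \<bar>1 / P - 1 / Q\<bar> = a * \<bar>1 / a - 1 / b\<bar>" .
  define C where "C = D powr (1 / s) * K powr (1 / a)"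
  show ?thesis
  proof (intro exI[of _ C] allI impI)
    fix y :: 'a and f :: "int \<Rightarrow> 'a \<Rightarrow> complex" assume f: "\<forall>k. f k \<in> class_E (A * 2 powr real_of_int k)"
    then have [measurable]: "f k \<in> borel_measurable borel" for k using class_E_measurable by blast
    let ?T = "\<lambda>k x. shiftavg (\<sigma> * s) k y (\<lambda>v. epow (ennreal (cmod (f k v))) s) x"
    let ?X = "\<integral>\<^sup>+x. epow (\<integral>\<^sup>+k. epow (epow (ennreal (cmod (f k x))) s) Q \<partial>count_space UNIV) (P / Q) \<partial>lborel"
    have "Lp_lq_norm (ennreal a) (ennreal b) (\<lambda>k. peetre t \<sigma> k y (f k))
      = epow (\<integral>\<^sup>+x. epow (\<integral>\<^sup>+k. epow (peetre t \<sigma> k y (f k) x) b \<partial>count_space UNIV) (a / b) \<partial>lborel) (1 / a)"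
      unfolding Lp_lq_norm_def Lp_norm_real[OF a0(1)] lq_norm_real[OF a0(2)] by (simp add: epow_epow)
    also have "\<dots> \<le> epow (\<integral>\<^sup>+x. ennreal (D powr P) * epow (\<integral>\<^sup>+k. epow (?T k x) Q \<partial>count_space UNIV) (a / b) \<partial>lborel) (1 / a)"
    proof (intro epow_mono nn_integral_mono)
      fix x
      have "epow (\<integral>\<^sup>+k. epow (peetre t \<sigma> k y (f k) x) b \<partial>count_space UNIV) (a / b)
        \<le> epow (\<integral>\<^sup>+k. ennreal (D powr Q) * epow (?T k x) Q \<partial>count_space UNIV) (a / b)"
      proof (intro epow_mono nn_integral_mono)
        fix k
        have "epow (peetre t \<sigma> k y (f k) x) b \<le> epow (epow (ennreal D * ?T k x) (1 / s)) b"
          using a0 f by (intro epow_mono pe) auto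
        also have "\<dots> = ennreal (D powr Q) * epow (?T k x) Q"
          using D by (simp add: epow_epow epow_mult epow_ennreal powr_powr Q_def)
        finally show "epow (peetre t \<sigma> k y (f k) x) b \<le> ennreal (D powr Q) * epow (?T k x) Q" .
      qed (use a0 in auto)
      also have "\<dots> = ennreal (D powr P) * epow (\<integral>\<^sup>+k. epow (?T k x) Q \<partial>count_space UNIV) (a / b)"
        using a0 s by (simp add: nn_integral_cmult epow_mult epow_ennreal powr_powr P_def Q_def)
      finally show "epow (\<integral>\<^sup>+k. epow (peetre t \<sigma> k y (f k) x) b \<partial>count_space UNIV) (a / b)
        \<le> ennreal (D powr P) * epow (\<integral>\<^sup>+k. epow (?T k x) Q \<partial>count_space UNIV) (a / b)" .
    qed (use a0 in auto)
    also have "\<dots> = ennreal (D powr (1 / s)) * epow (\<integral>\<^sup>+x. epow (\<integral>\<^sup>+k. epow (?T k x) Q \<partial>count_space UNIV) (P / Q) \<partial>lborel) (1 / a)"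
      unfolding PQ(3) using a0 by (subst nn_integral_cmult) (auto simp: epow_mult epow_ennreal powr_powr P_def)
    also have "\<dots> \<le> ennreal (D powr (1 / s)) * epow (ennreal (K * logfac y powr (a * \<bar>1 / a - 1 / b\<bar>)) * ?X) (1 / a)"
      unfolding ex[symmetric] using a0 by (intro mult_left_mono epow_mono K(2)[rule_format]) auto
    also have "\<dots> = ennreal (C * logfac y powr \<bar>1 / a - 1 / b\<bar>) * epow ?X (1 / a)"
      using a0 K(1) by (simp add: epow_mult epow_ennreal powr_mult powr_powr C_def ennreal_mult mult.assoc)
    also have "\<dots> \<le> ennreal (C * logfac y powr r) * epow ?X (1 / a)"
      by (intro mult_right_mono logfac_powr_bound r) (auto simp: C_def)
    also have "epow ?X (1 / a) = Lp_lq_norm (ennreal a) (ennreal b) (\<lambda>k x. ennreal (cmod (f k x)))"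
      unfolding Lp_lq_norm_def Lp_norm_real[OF a0(1)] lq_norm_real[OF a0(2)] PQ(3)
      using s by (simp only: epow_epow) (simp add: Q_def)
    finally show "Lp_lq_norm (ennreal a) (ennreal b) (\<lambda>k. peetre t \<sigma> k y (f k))
       \<le> ennreal (C * logfac y powr r) * Lp_lq_norm (ennreal a) (ennreal b) (\<lambda>k x. ennreal (cmod (f k x)))" .
  qed
qed

lemma sufficiency_sup:
  assumes A: "0 < A" and s: "0 < s" and \<sigma>: "0 < \<sigma>" and L: "real DIM('a::euclidean_space) < \<sigma> * s" and st: "ennreal s < t"
    and a: "s < a" and r: "1 / a \<le> r"
  shows "\<exists>C. \<forall>(y::'a) f. (\<forall>k. f k \<in> class_E (A * 2 powr real_of_int k)) \<longrightarrow>
     Lp_lq_norm (ennreal a) \<infinity> (\<lambda>k. peetre t \<sigma> k y (f k))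
       \<le> ennreal (C * logfac y powr r) * Lp_lq_norm (ennreal a) \<infinity> (\<lambda>k x. ennreal (cmod (f k x)))"
proof -
  obtain D where D: "1 \<le> D" and pe: "\<And>(y::'a) k f x. f \<in> class_E (A * 2 powr real_of_int k) \<Longrightarrow>
     peetre t \<sigma> k y f x \<le> epow (ennreal D * shiftavg (\<sigma> * s) k y (\<lambda>v. epow (ennreal (cmod (f v))) s) x) (1 / s)"
    using peetre_le_shiftavg[OF A s \<sigma> st, where 'a='a] by blast
  define P where "P = a / s"
  have P: "1 < P" using s a by (auto simp: P_def)
  have a0: "0 < a" using s a by auto
  obtain K where K: "0 < K" and sup: "\<And>(y::'a) g. (\<forall>k::int. g k \<in> borel_measurable borel) \<Longrightarrow>
     (\<integral>\<^sup>+x. epow (SUP k. shiftavg (\<sigma> * s) k y (g k) x) P \<partial>lborel)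
       \<le> ennreal (K * logfac y) * (\<integral>\<^sup>+x. epow (SUP k. g k x) P \<partial>lborel)"
    using vector_shiftavg_sup[OF L P] by blast
  define C where "C = D powr (1 / s) * K powr (1 / a)"
  show ?thesis
  proof (intro exI[of _ C] allI impI)
    fix y :: 'a and f :: "int \<Rightarrow> 'a \<Rightarrow> complex" assume f: "\<forall>k. f k \<in> class_E (A * 2 powr real_of_int k)"
    then have [measurable]: "f k \<in> borel_measurable borel" for k using class_E_measurable by blast
    let ?T = "\<lambda>k x. shiftavg (\<sigma> * s) k y (\<lambda>v. epow (ennreal (cmod (f k v))) s) x"
    let ?X = "\<integral>\<^sup>+x. epow (SUP k. epow (ennreal (cmod (f k x))) s) P \<partial>lborel"
    have "Lp_lq_norm (ennreal a) \<infinity> (\<lambda>k. peetre t \<sigma> k y (f k)) = epow (\<integral>\<^sup>+x. epow (SUP k. peetre t \<sigma> k y (f k) x) a \<partial>lborel) (1 / a)"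
      unfolding Lp_lq_norm_def Lp_norm_real[OF a0] by (simp add: lq_norm_def)
    also have "\<dots> \<le> epow (\<integral>\<^sup>+x. ennreal (D powr P) * epow (SUP k. ?T k x) P \<partial>lborel) (1 / a)"
    proof (intro epow_mono nn_integral_mono)
      fix x
      have "(SUP k. peetre t \<sigma> k y (f k) x) \<le> epow (ennreal D * (SUP k. ?T k x)) (1 / s)"
      proof (rule SUP_least)
        fix k
        have "peetre t \<sigma> k y (f k) x \<le> epow (ennreal D * ?T k x) (1 / s)" using f by (intro pe) auto
        also have "\<dots> \<le> epow (ennreal D * (SUP k. ?T k x)) (1 / s)"
          using s by (intro epow_mono mult_left_mono SUP_upper) auto
        finally show "peetre t \<sigma> k y (f k) x \<le> \<dots>" .
      qed
      then have "epow (SUP k. peetre t \<sigma> k y (f k) x) a \<le> epow (epow (ennreal D * (SUP k. ?T k x)) (1 / s)) a"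
        using a0 by (intro epow_mono) auto
      then show "epow (SUP k. peetre t \<sigma> k y (f k) x) a \<le> ennreal (D powr P) * epow (SUP k. ?T k x) P"
        using D by (simp add: epow_epow epow_mult epow_ennreal powr_powr P_def)
    qed (use a0 in auto)
    also have "\<dots> = ennreal (D powr (1 / s)) * epow (\<integral>\<^sup>+x. epow (SUP k. ?T k x) P \<partial>lborel) (1 / a)"
      using a0 by (subst nn_integral_cmult) (auto simp: epow_mult epow_ennreal powr_powr P_def)
    also have "\<dots> \<le> ennreal (D powr (1 / s)) * epow (ennreal (K * logfac y) * ?X) (1 / a)"
      using a0 by (intro mult_left_mono epow_mono sup) auto
    also have "\<dots> = ennreal (C * logfac y powr (1 / a)) * epow ?X (1 / a)"
    proof -
      have "0 \<le> logfac y" using logfac_ge_1[of y] by linarith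
      then show ?thesis
        using a0 K by (simp add: epow_mult epow_ennreal powr_mult C_def ennreal_mult mult.assoc)
    qed
    also have "\<dots> \<le> ennreal (C * logfac y powr r) * epow ?X (1 / a)"
      by (intro mult_right_mono logfac_powr_bound r) (auto simp: C_def)
    also have "epow ?X (1 / a) = Lp_lq_norm (ennreal a) \<infinity> (\<lambda>k x. ennreal (cmod (f k x)))"
      unfolding Lp_lq_norm_def Lp_norm_real[OF a0] epow_SUP[OF s, symmetric]
      using s by (simp add: lq_norm_def epow_epow P_def)
    finally show "Lp_lq_norm (ennreal a) \<infinity> (\<lambda>k. peetre t \<sigma> k y (f k))
       \<le> ennreal (C * logfac y powr r) * Lp_lq_norm (ennreal a) \<infinity> (\<lambda>k x. ennreal (cmod (f k x)))" .
  qed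
qed

text \<open>Here only the mass of the kernel matters, and it is independent of the shift; the
  logarithm enters merely through \<open>1 \<le> logfac y\<close>.\<close>

lemma sufficiency_top:
  assumes A: "0 < A" and s: "0 < s" and \<sigma>: "0 < \<sigma>" and L: "real DIM('a::euclidean_space) < \<sigma> * s" and st: "ennreal s < t"
    and r: "0 \<le> r"
  shows "\<exists>C. \<forall>(y::'a) f. (\<forall>k. f k \<in> class_E (A * 2 powr real_of_int k)) \<longrightarrow>
     Lp_lq_norm \<infinity> \<infinity> (\<lambda>k. peetre t \<sigma> k y (f k))
       \<le> ennreal (C * logfac y powr r) * Lp_lq_norm \<infinity> \<infinity> (\<lambda>k x. ennreal (cmod (f k x)))"
proof -
  obtain D where D: "1 \<le> D" and pe: "\<And>(y::'a) k f x. f \<in> class_E (A * 2 powr real_of_int k) \<Longrightarrow>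
     peetre t \<sigma> k y f x \<le> epow (ennreal D * shiftavg (\<sigma> * s) k y (\<lambda>v. epow (ennreal (cmod (f v))) s) x) (1 / s)"
    using peetre_le_shiftavg[OF A s \<sigma> st, where 'a='a] by blast
  obtain m where m: "0 < m" "kmass TYPE('a) (\<sigma> * s) = ennreal m" using kmass_real[OF L] .
  define C where "C = (D * m) powr (1 / s)"
  have C: "0 < C" unfolding C_def powr_gt_zero using D m by simp
  show ?thesis
  proof (intro exI[of _ C] allI impI)
    fix y :: 'a and f :: "int \<Rightarrow> 'a \<Rightarrow> complex" assume f: "\<forall>k. f k \<in> class_E (A * 2 powr real_of_int k)"
    then have [measurable]: "f k \<in> borel_measurable borel" for k using class_E_measurable by blast
    let ?T = "\<lambda>k x. shiftavg (\<sigma> * s) k y (\<lambda>v. epow (ennreal (cmod (f k v))) s) x"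
    let ?S = "{c. AE x in lborel. (SUP k. ennreal (cmod (f k x))) \<le> c}"
    let ?l = "Lp_lq_norm \<infinity> \<infinity> (\<lambda>k. peetre t \<sigma> k y (f k))"
    have le: "?l \<le> ennreal C * c" if c: "c \<in> ?S" for c
    proof -
      have pk: "peetre t \<sigma> k y (f k) x \<le> ennreal C * c" for k x
      proof -
        have ae: "AE v in lborel. ennreal (cmod (f k v)) \<le> c"
          using c by (auto simp: SUP_le_iff)
        have "?T k x \<le> (\<integral>\<^sup>+v. epow c s * ennreal (kern (\<sigma> * s) k y (x - v)) \<partial>lborel)"
          unfolding shiftavg_def using s
          by (intro nn_integral_mono_AE eventually_mono[OF ae] mult_right_mono epow_mono) auto
        also have "\<dots> = epow c s * ennreal m"
          by (subst nn_integral_cmult) (auto simp: nn_integral_kern m)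
        finally have "ennreal D * ?T k x \<le> ennreal D * (epow c s * ennreal m)" by (rule mult_left_mono) simp
        also have "\<dots> = ennreal (D * m) * epow c s" using D m by (simp add: ennreal_mult ac_simps)
        finally have "epow (ennreal D * ?T k x) (1 / s) \<le> epow (ennreal (D * m) * epow c s) (1 / s)"
          using s by (intro epow_mono) auto
        also have "\<dots> = ennreal C * c"
          using s D m by (simp add: epow_mult epow_epow epow_ennreal C_def)
        finally show ?thesis using pe[of "f k" k y x] f by (meson order_trans)
      qed
      then have "AE x in lborel. (SUP k. peetre t \<sigma> k y (f k) x) \<le> ennreal C * c"
        by (intro AE_I2 SUP_least)
      then show ?thesis unfolding Lp_lq_norm_def Lp_norm_def lq_norm_def by (auto intro!: Inf_lower)
    qed
    \<comment> \<open>The constant is carried across the infimum that defines the essential supremum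
      by dividing: \<open>ennreal (1 / C) * ?l\<close> is a lower bound of the set.\<close>
    have "ennreal (1 / C) * ?l \<le> Inf ?S"
    proof (rule Inf_greatest)
      fix c assume "c \<in> ?S"
      then have "ennreal (1 / C) * ?l \<le> ennreal (1 / C) * (ennreal C * c)" by (intro mult_left_mono le) auto
      also have "\<dots> = c" using C by (simp add: mult.assoc[symmetric] flip: ennreal_mult)
      finally show "ennreal (1 / C) * ?l \<le> c" .
    qed
    then have "ennreal C * (ennreal (1 / C) * ?l) \<le> ennreal C * Inf ?S" by (intro mult_left_mono) auto
    also have "ennreal C * (ennreal (1 / C) * ?l) = ?l" using C by (simp add: mult.assoc[symmetric] flip: ennreal_mult)
    also have "Inf ?S = Lp_lq_norm \<infinity> \<infinity> (\<lambda>k x. ennreal (cmod (f k x)))"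
      by (simp add: Lp_lq_norm_def Lp_norm_def lq_norm_def)
    also have "ennreal C \<le> ennreal (C * logfac y powr r)"
      using logfac_powr_bound[of C 0 r y] C r logfac_ge_1[of y] by simp
    finally show "?l \<le> ennreal (C * logfac y powr r) * Lp_lq_norm \<infinity> \<infinity> (\<lambda>k x. ennreal (cmod (f k x)))"
      by (simp add: mult_right_mono)
  qed
qed

lemma dyadic_sup_norm_cells:
  assumes b: "0 < b"
  shows "dyadic_sup_norm (ennreal b) F = (SUP P\<in>dyadic_cubes.
     epow (ennreal (1 / measure lborel P) * (\<integral>\<^sup>+x. indicator P x *
       (\<integral>\<^sup>+k. indicator {k. 2 powr real_of_int k * side_len P \<ge> 1} k * epow (F k x) b \<partial>count_space UNIV) \<partial>lborel)) (1 / b))"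
  using b by (simp add: dyadic_sup_norm_def)

text \<open>For a cube of side 2^-j the condition 2^k 2^-j \<ge> 1 says k \<ge> j; this puts the
  terms of the norm into the shape used by \<open>dyadic_shiftavg_sum\<close>.\<close>

lemma dyadic_cube_term:
  fixes F :: "int \<Rightarrow> 'a::euclidean_space \<Rightarrow> ennreal"
  shows "ennreal (1 / measure lborel (dyadic_cube j l :: 'a set)) * (\<integral>\<^sup>+x. indicator (dyadic_cube j l) x *
       (\<integral>\<^sup>+k. indicator {k. 2 powr real_of_int k * side_len (dyadic_cube j l :: 'a set) \<ge> 1} k * F k x \<partial>count_space UNIV) \<partial>lborel)
     = ennreal (2 powr (real_of_int j * real DIM('a))) * (\<integral>\<^sup>+x. (\<integral>\<^sup>+k. indicator {j..} k * F k x \<partial>count_space UNIV) * indicator (dyadic_cube j l) x \<partial>lborel)"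
proof -
  have "{k. 2 powr real_of_int k * 2 powr - real_of_int j \<ge> 1} = {j..}"
  proof -
    have "(1::real) \<le> 2 powr real_of_int k * 2 powr - real_of_int j \<longleftrightarrow> j \<le> k" for k
    proof -
      have "2 powr real_of_int k * 2 powr - real_of_int j = (2::real) powr real_of_int (k - j)" by (simp flip: powr_add)
      moreover have "(1::real) = 2 powr 0" by simp
      ultimately show ?thesis by (metis powr_le_cancel_iff one_less_numeral_iff semiring_norm(76) of_int_0_le_iff diff_ge_0_iff_ge)
    qed
    then show ?thesis by auto
  qed
  moreover have "1 / 2 powr - (real_of_int j * real DIM('a)) = 2 powr (real_of_int j * real DIM('a))"
    by (simp add: powr_minus divide_inverse)
  ultimately show ?thesis
    unfolding measure_dyadic_cube side_len_dyadic_cube by (simp add: mult.commute)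
qed

text \<open>Jensen with b/s > 1 moves the power inside the averages, so that b-th powers of the
  maximal functions are dominated by shifted averages of |f_k|^b. The estimate over cells is linear
  in the logarithm, and the power 1/b taken at the end gives the exponent.\<close>

lemma sufficiency_dyadic:
  assumes A: "0 < A" and s: "0 < s" and \<sigma>: "0 < \<sigma>" and L: "real DIM('a::euclidean_space) < \<sigma> * s" and st: "ennreal s < t"
    and b: "s < b" and r: "1 / b \<le> r"
  shows "\<exists>C. \<forall>(y::'a) f. (\<forall>k. f k \<in> class_E (A * 2 powr real_of_int k)) \<longrightarrow>
     dyadic_sup_norm (ennreal b) (\<lambda>k. peetre t \<sigma> k y (f k))
       \<le> ennreal (C * logfac y powr r) * dyadic_sup_norm (ennreal b) (\<lambda>k x. ennreal (cmod (f k x)))"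
proof -
  obtain D where D: "1 \<le> D" and pe: "\<And>(y::'a) k f x. f \<in> class_E (A * 2 powr real_of_int k) \<Longrightarrow>
     peetre t \<sigma> k y f x \<le> epow (ennreal D * shiftavg (\<sigma> * s) k y (\<lambda>v. epow (ennreal (cmod (f v))) s) x) (1 / s)"
    using peetre_le_shiftavg[OF A s \<sigma> st, where 'a='a] by blast
  obtain m where m: "0 < m" "kmass TYPE('a) (\<sigma> * s) = ennreal m" using kmass_real[OF L] .
  obtain K where "0 < K \<and> (\<forall>(y::'a) (h::int \<Rightarrow> 'a \<Rightarrow> ennreal) j N x0. (\<forall>k. h k \<in> borel_measurable borel) \<longrightarrow>
     (\<forall>x. ennreal (2 powr (real_of_int j * real DIM('a))) *
        (\<integral>\<^sup>+v. (\<integral>\<^sup>+k. indicator {j..} k * h k v \<partial>count_space UNIV) * indicator (cell j x) v \<partial>lborel) \<le> N) \<longrightarrow>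
     ennreal (2 powr (real_of_int j * real DIM('a))) *
        (\<integral>\<^sup>+x. (\<integral>\<^sup>+k. indicator {j..} k * shiftavg (\<sigma> * s) k y (h k) x \<partial>count_space UNIV) * indicator (cell j x0) x \<partial>lborel)
       \<le> ennreal (K * logfac y) * N)"
    using dyadic_shiftavg_sum[OF L] by (rule exE)
  note K = this[THEN conjunct1] and dy = this[THEN conjunct2, rule_format]
  define Q where "Q = b / s"
  have Q: "1 < Q" using s b by (auto simp: Q_def)
  have b0: "0 < b" using s b by auto
  define c where "c = D powr Q * (2 powr Q * m powr (Q - 1))"
  have c: "0 < c" using D m by (simp add: c_def)
  define C where "C = (c * K) powr (1 / b)"
  show ?thesis
  proof (intro exI[of _ C] allI impI)
    fix y :: 'a and f :: "int \<Rightarrow> 'a \<Rightarrow> complex" assume f: "\<forall>k. f k \<in> class_E (A * 2 powr real_of_int k)"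
    then have [measurable]: "f k \<in> borel_measurable borel" for k using class_E_measurable by blast
    define h where "h k v = epow (ennreal (cmod (f k v))) b" for k v
    have [measurable]: "h k \<in> borel_measurable borel" for k unfolding h_def by measurable
    define \<nu> where "\<nu> = dyadic_sup_norm (ennreal b) (\<lambda>k x. ennreal (cmod (f k x)))"
    have pk: "epow (peetre t \<sigma> k y (f k) x) b \<le> ennreal c * shiftavg (\<sigma> * s) k y (h k) x" for k x
    proof -
      let ?T = "shiftavg (\<sigma> * s) k y (\<lambda>v. epow (ennreal (cmod (f k v))) s) x"
      have "epow (peetre t \<sigma> k y (f k) x) b \<le> epow (epow (ennreal D * ?T) (1 / s)) b"
        using b0 f by (intro epow_mono pe) auto
      also have "\<dots> = ennreal (D powr Q) * epow ?T Q" using D by (simp add: epow_epow epow_mult epow_ennreal powr_powr Q_def)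
      also have "\<dots> \<le> ennreal (D powr Q) * (epow 2 Q * (epow (kmass TYPE('a) (\<sigma> * s)) (Q - 1) * shiftavg (\<sigma> * s) k y (\<lambda>v. epow (epow (ennreal (cmod (f k v))) s) Q) x))"
        using Q by (intro mult_left_mono shiftavg_Jensen) auto
      also have "(\<lambda>v. epow (epow (ennreal (cmod (f k v))) s) Q) = h k"
        using s by (auto simp only: epow_epow h_def fun_eq_iff) (simp add: Q_def)
      also have "ennreal (D powr Q) * (epow 2 Q * (epow (kmass TYPE('a) (\<sigma> * s)) (Q - 1) * shiftavg (\<sigma> * s) k y (h k) x)) = ennreal c * shiftavg (\<sigma> * s) k y (h k) x"
        using m epow_ennreal[of 2 Q] by (simp add: epow_ennreal c_def ennreal_mult mult.assoc)
      finally show ?thesis .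
    qed
    have N: "\<forall>x. ennreal (2 powr (real_of_int j * real DIM('a))) *
        (\<integral>\<^sup>+v. (\<integral>\<^sup>+k. indicator {j..} k * h k v \<partial>count_space UNIV) * indicator (cell j x) v \<partial>lborel) \<le> epow \<nu> b" for j
    proof
      fix x :: 'a
      let ?l = "\<lambda>i. \<lfloor>2 powr real_of_int j * (x \<bullet> i)\<rfloor>"
      have "epow (ennreal (2 powr (real_of_int j * real DIM('a))) *
        (\<integral>\<^sup>+v. (\<integral>\<^sup>+k. indicator {j..} k * h k v \<partial>count_space UNIV) * indicator (cell j x) v \<partial>lborel)) (1 / b) \<le> \<nu>"
        unfolding \<nu>_def dyadic_sup_norm_cells[OF b0] h_def cell_eq_dyadic_cube
        by (rule SUP_upper2[of "dyadic_cube j ?l"]) (auto simp: dyadic_cubes_def dyadic_cube_term)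
      then show "ennreal (2 powr (real_of_int j * real DIM('a))) *
        (\<integral>\<^sup>+v. (\<integral>\<^sup>+k. indicator {j..} k * h k v \<partial>count_space UNIV) * indicator (cell j x) v \<partial>lborel) \<le> epow \<nu> b"
        using b0 epow_le_swap[of "1 / b" _ \<nu>] by simp
    qed
    have "dyadic_sup_norm (ennreal b) (\<lambda>k. peetre t \<sigma> k y (f k)) \<le> ennreal (C * logfac y powr (1 / b)) * \<nu>"
      unfolding dyadic_sup_norm_cells[OF b0]
    proof (rule SUP_least)
      fix P :: "'a set" assume "P \<in> dyadic_cubes"
      then obtain j l where P: "P = dyadic_cube j l" by (auto simp: dyadic_cubes_def)
      have "P \<noteq> {}"
      proof
        assume "P = {}"
        then have "emeasure lborel P = 0" by simp
        then show False unfolding P emeasure_dyadic_cube by (simp add: ennreal_eq_0_iff)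
      qed
      then obtain x0 where "x0 \<in> P" by blast
      then have Pc: "dyadic_cube j l = cell j x0" using dyadic_cube_eq_cell P by blast
      let ?s = "ennreal (2 powr (real_of_int j * real DIM('a)))"
      have "?s * (\<integral>\<^sup>+x. (\<integral>\<^sup>+k. indicator {j..} k * epow (peetre t \<sigma> k y (f k) x) b \<partial>count_space UNIV) * indicator (cell j x0) x \<partial>lborel)
        \<le> ?s * (\<integral>\<^sup>+x. (\<integral>\<^sup>+k. indicator {j..} k * (ennreal c * shiftavg (\<sigma> * s) k y (h k) x) \<partial>count_space UNIV) * indicator (cell j x0) x \<partial>lborel)"
        by (intro mult_left_mono nn_integral_mono mult_right_mono pk) auto
      also have "\<dots> = ennreal c * (?s * (\<integral>\<^sup>+x. (\<integral>\<^sup>+k. indicator {j..} k * shiftavg (\<sigma> * s) k y (h k) x \<partial>count_space UNIV) * indicator (cell j x0) x \<partial>lborel))"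
        by (simp add: mult.left_commute[of _ "ennreal c"] nn_integral_cmult mult.assoc)
      also have "\<dots> \<le> ennreal c * (ennreal (K * logfac y) * epow \<nu> b)"
        using N by (intro mult_left_mono dy) auto
      finally have "epow (?s * (\<integral>\<^sup>+x. (\<integral>\<^sup>+k. indicator {j..} k * epow (peetre t \<sigma> k y (f k) x) b \<partial>count_space UNIV) * indicator (cell j x0) x \<partial>lborel)) (1 / b)
        \<le> epow (ennreal c * (ennreal (K * logfac y) * epow \<nu> b)) (1 / b)"
        using b0 by (intro epow_mono) auto
      also have "\<dots> = ennreal (C * logfac y powr (1 / b)) * \<nu>"
      proof -
        have "0 \<le> logfac y" using logfac_ge_1[of y] by linarith
        then show ?thesis
          using b0 c K by (simp add: epow_mult epow_epow epow_ennreal powr_mult C_def ennreal_mult mult.assoc)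
      qed
      finally show "epow (ennreal (1 / measure lborel P) * (\<integral>\<^sup>+x. indicator P x *
         (\<integral>\<^sup>+k. indicator {k. 2 powr real_of_int k * side_len P \<ge> 1} k * epow (peetre t \<sigma> k y (f k) x) b \<partial>count_space UNIV) \<partial>lborel)) (1 / b)
         \<le> ennreal (C * logfac y powr (1 / b)) * \<nu>"
        unfolding P dyadic_cube_term unfolding Pc .
    qed
    also have "\<dots> \<le> ennreal (C * logfac y powr r) * \<nu>"
      by (intro mult_right_mono logfac_powr_bound r) (auto simp: C_def)
    finally show "dyadic_sup_norm (ennreal b) (\<lambda>k. peetre t \<sigma> k y (f k))
       \<le> ennreal (C * logfac y powr r) * dyadic_sup_norm (ennreal b) (\<lambda>k x. ennreal (cmod (f k x)))"
      by (simp only: \<nu>_def)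
  qed
qed

theorem theorem1p1:
  fixes p q t :: ennreal and A r \<sigma> :: real
  assumes "0 < p" and "0 < q" and "0 < t" and "A > 0" and "r \<ge> 0"
    and "\<sigma> > real DIM('a::euclidean_space) * max (recip_exp p) (max (recip_exp q) (recip_exp t))"
  shows
   "(p < \<infinity> \<or> (p = \<infinity> \<and> q = \<infinity>) \<longrightarrow>
      (r \<ge> \<bar>recip_exp p - recip_exp q\<bar> \<longleftrightarrow>
       (\<exists>C::real. \<forall>(y::'a) (f :: int \<Rightarrow> 'a \<Rightarrow> complex).
          (\<forall>k. f k \<in> class_E (A * 2 powr real_of_int k)) \<longrightarrow>
          Lp_lq_norm p q (\<lambda>k. peetre t \<sigma> k y (f k))
            \<le> ennreal (C * ln (exp 1 + norm y) powr r) *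
              Lp_lq_norm p q (\<lambda>k x. ennreal (cmod (f k x))))))
    \<and>
    (p = \<infinity> \<and> q < \<infinity> \<longrightarrow>
      (r \<ge> recip_exp q \<longleftrightarrow>
       (\<exists>C::real. \<forall>(y::'a) (f :: int \<Rightarrow> 'a \<Rightarrow> complex).
          (\<forall>k. f k \<in> class_E (A * 2 powr real_of_int k)) \<longrightarrow>
          dyadic_sup_norm q (\<lambda>k. peetre t \<sigma> k y (f k))
            \<le> ennreal (C * ln (exp 1 + norm y) powr r) *
              dyadic_sup_norm q (\<lambda>k x. ennreal (cmod (f k x))))))"
proof -
  have logs: "ln (exp 1 + norm y) = logfac y" for y :: 'a by (simp add: logfac_def)
  obtain s where s: "0 < s" "0 < \<sigma>" "real DIM('a) < \<sigma> * s" "ennreal s < p" "ennreal s < q" "ennreal s < t"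
    using exponent_choice[OF assms(6,1,2,3)] by blast
  have real: "\<exists>a. 0 < a \<and> s < a \<and> x = ennreal a \<and> recip_exp x = 1 / a" if "ennreal s < x" "x < \<infinity>" for x
  proof -
    have "x \<noteq> 0" "x \<noteq> top" using that by auto
    then obtain a where "0 < a" "x = ennreal a" by (rule epow_pos_real)
    with that s(1) show ?thesis by (auto simp: ennreal_less_iff recip_exp_def)
  qed
  have nonneg: "0 \<le> recip_exp x" for x by (simp add: recip_exp_def)
  have top: "recip_exp \<infinity> = 0" by (simp add: recip_exp_def)
  note suff = \<open>0 < A\<close> s(1-3,6)
  note nec = \<open>0 < t\<close> s(2) \<open>0 < A\<close> \<open>0 \<le> r\<close>
  show ?thesis
    unfolding logs
  proof (intro conjI impI iffI)
    assume fin: "p < \<infinity> \<or> p = \<infinity> \<and> q = \<infinity>" and r: "\<bar>recip_exp p - recip_exp q\<bar> \<le> r"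
    consider "p < \<infinity>" "q < \<infinity>" | "p < \<infinity>" "q = \<infinity>" | "p = \<infinity>" "q = \<infinity>"
      using fin by (cases "q = \<infinity>") (auto simp: less_top[symmetric])
    then show "\<exists>C. \<forall>(y::'a) f. (\<forall>k. f k \<in> class_E (A * 2 powr real_of_int k)) \<longrightarrow>
       Lp_lq_norm p q (\<lambda>k. peetre t \<sigma> k y (f k)) \<le> ennreal (C * logfac y powr r) * Lp_lq_norm p q (\<lambda>k x. ennreal (cmod (f k x)))"
    proof cases
      case 1
      obtain a where a: "s < a" "p = ennreal a" "recip_exp p = 1 / a" using real[OF s(4) 1(1)] by auto
      obtain b where b: "s < b" "q = ennreal b" "recip_exp q = 1 / b" using real[OF s(5) 1(2)] by auto
      show ?thesis using sufficiency_finite[OF suff a(1) b(1) r[unfolded a(3) b(3)]] unfolding a(2) b(2) .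
    next
      case 2
      obtain a where a: "s < a" "p = ennreal a" "recip_exp p = 1 / a" "0 < a" using real[OF s(4) 2(1)] by auto
      have "1 / a \<le> r" using r a(4) unfolding a(3) 2(2) top by simp
      then show ?thesis using sufficiency_sup[OF suff a(1)] unfolding a(2) 2(2) by blast
    next
      case 3
      show ?thesis using sufficiency_top[OF suff \<open>0 \<le> r\<close>] unfolding 3 .
    qed
  next
    assume fin: "p < \<infinity> \<or> p = \<infinity> \<and> q = \<infinity>"
      and "\<exists>C. \<forall>(y::'a) f. (\<forall>k. f k \<in> class_E (A * 2 powr real_of_int k)) \<longrightarrow>
       Lp_lq_norm p q (\<lambda>k. peetre t \<sigma> k y (f k)) \<le> ennreal (C * logfac y powr r) * Lp_lq_norm p q (\<lambda>k x. ennreal (cmod (f k x)))"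
    then obtain C where bound: "\<And>(y::'a) f. (\<forall>k. f k \<in> class_E (A * 2 powr real_of_int k)) \<Longrightarrow>
       Lp_lq_norm p q (\<lambda>k. peetre t \<sigma> k y (f k)) \<le> ennreal (C * logfac y powr r) * Lp_lq_norm p q (\<lambda>k x. ennreal (cmod (f k x)))"
      by auto
    show "\<bar>recip_exp p - recip_exp q\<bar> \<le> r"
    proof (cases "p = \<infinity>")
      case True
      then show ?thesis using fin \<open>0 \<le> r\<close> by (simp add: top)
    next
      case False
      then have p: "p < \<infinity>" by (simp add: less_top)
      have "recip_exp p - recip_exp q \<le> r"
        by (rule necessity_spread[OF \<open>0 < p\<close> p \<open>0 < q\<close> nec bound])
      moreover have "recip_exp q - recip_exp p \<le> r"
      proof (cases "q \<le> p")
        case True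
        then have "q < \<infinity>" using p by (rule le_less_trans)
        then show ?thesis by (rule necessity_align[OF \<open>0 < p\<close> p \<open>0 < q\<close> _ True nec bound])
      next
        \<comment> \<open>For p < q the difference 1/q - 1/p is at most 0, so this half of the
          absolute value is settled by r \<ge> 0 alone.\<close>
        case False
        have "recip_exp q \<le> recip_exp p"
        proof (cases "q = \<infinity>")
          case True
          show ?thesis unfolding True top by (rule nonneg)
        next
          case q: False
          then have "q < \<infinity>" by (simp add: less_top)
          with p obtain a b where "0 < a" "p = ennreal a" "recip_exp p = 1 / a" "0 < b" "q = ennreal b" "recip_exp q = 1 / b"
            using real[OF s(4)] real[OF s(5)] by auto
          then show ?thesis using False by (simp add: frac_le)
        qed
        then show ?thesis using \<open>0 \<le> r\<close> by linarith
      qed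
      ultimately show ?thesis by linarith
    qed
  next
    assume "p = \<infinity> \<and> q < \<infinity>" and r: "recip_exp q \<le> r"
    then obtain b where b: "s < b" "q = ennreal b" "recip_exp q = 1 / b" using real[OF s(5)] by auto
    show "\<exists>C. \<forall>(y::'a) f. (\<forall>k. f k \<in> class_E (A * 2 powr real_of_int k)) \<longrightarrow>
       dyadic_sup_norm q (\<lambda>k. peetre t \<sigma> k y (f k)) \<le> ennreal (C * logfac y powr r) * dyadic_sup_norm q (\<lambda>k x. ennreal (cmod (f k x)))"
      using sufficiency_dyadic[OF suff b(1) r[unfolded b(3)]] unfolding b(2) .
  next
    assume fin: "p = \<infinity> \<and> q < \<infinity>"
      and "\<exists>C. \<forall>(y::'a) f. (\<forall>k. f k \<in> class_E (A * 2 powr real_of_int k)) \<longrightarrow>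
       dyadic_sup_norm q (\<lambda>k. peetre t \<sigma> k y (f k)) \<le> ennreal (C * logfac y powr r) * dyadic_sup_norm q (\<lambda>k x. ennreal (cmod (f k x)))"
    then obtain C where bound: "\<And>(y::'a) f. (\<forall>k. f k \<in> class_E (A * 2 powr real_of_int k)) \<Longrightarrow>
       dyadic_sup_norm q (\<lambda>k. peetre t \<sigma> k y (f k)) \<le> ennreal (C * logfac y powr r) * dyadic_sup_norm q (\<lambda>k x. ennreal (cmod (f k x)))"
      by auto
    show "recip_exp q \<le> r" using fin by (intro necessity_dyadic[OF \<open>0 < q\<close> _ nec bound]) auto
  qed
qed

end
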